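(* Let $(M,D)$ be a compact flat affine manifold that admits a $D$-flat Riemannian metric. Then for any Hessian metric $g$ on $M$ there exist a $D$-flat Riemannian metric $g_{\mathrm{flat}}$ on $M$ and a closed $1$-form $\alpha$ on $M$ such that $$ g=g_{\mathrm{flat}}+D\alpha . $$
   Context: A flat affine manifold $(M,D)$ is a smooth manifold $M$ with a flat affine (i.e. flat and torsion-free) connection $D$. A tensor $T$ is $D$-flat if $DT=0$. A Hessian metric on $(M,D)$ is a Riemannian metric $g$ such that $Dg$ is a totally symmetric tensor; equivalently, $g$ is locally of the form $D^2f=D(df)$ for a smooth function $f$. For a $1$-form $\alpha$, $D\alpha$ is its covariant derivative, a symmetric bilinear form when $\alpha$ is closed. *)

theory Defs
  imports "HOL-Analysis.Analysis"
begin

section \<open>Smooth maps between Euclidean spaces\<close>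

text \<open>
  Meant for open \<open>S\<close> only: the derivatives are taken at \<open>x\<close>, not within \<open>S\<close>.
\<close>

primrec Ck_on :: "nat \<Rightarrow> ('b::euclidean_space \<Rightarrow> 'c::real_normed_vector) \<Rightarrow> 'b set \<Rightarrow> bool" where
  "Ck_on 0 f S \<longleftrightarrow> continuous_on S f"
| "Ck_on (Suc k) f S \<longleftrightarrow>
     (\<forall>x\<in>S. f differentiable (at x)) \<and>
     (\<forall>v. Ck_on k (\<lambda>x. frechet_derivative f (at x) v) S)"

definition smooth_on :: "'b::euclidean_space set \<Rightarrow> ('b \<Rightarrow> 'c::real_normed_vector) \<Rightarrow> bool" where
  "smooth_on S f \<longleftrightarrow> (\<forall>k. Ck_on k f S)"


section \<open>Smooth manifolds\<close>

text \<open>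
  The underlying space is a whole type \<open>'a\<close>; the classes \<open>t2_space\<close> and
  \<open>second_countable_topology\<close> supply the usual global topological conditions.
  A chart is a pair of a domain \<open>U\<close> and a map \<open>\<phi>\<close> that only matters on \<open>U\<close>.
  Atlases need not be maximal.
\<close>

type_synonym ('a, 'b) atlas = "('a set \<times> ('a \<Rightarrow> 'b)) set"

definition is_chart :: "'a::topological_space set \<Rightarrow> ('a \<Rightarrow> 'b::euclidean_space) \<Rightarrow> bool" where
  "is_chart U \<phi> \<longleftrightarrow> open U \<and> open (\<phi> ` U) \<and> (\<exists>\<psi>. homeomorphism U (\<phi> ` U) \<phi> \<psi>)"

definition smooth_atlas ::
    "('a::{t2_space,second_countable_topology}, 'b::euclidean_space) atlas \<Rightarrow> bool" where
  "smooth_atlas A \<longleftrightarrow>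
     (\<forall>(U, \<phi>)\<in>A. is_chart U \<phi>) \<and>
     (\<Union>(U, \<phi>)\<in>A. U) = UNIV \<and>
     (\<forall>(U, \<phi>)\<in>A. \<forall>(V, \<psi>)\<in>A. smooth_on (\<phi> ` (U \<inter> V)) (\<psi> \<circ> inv_into U \<phi>))"

definition smooth_fun ::
    "('a::{t2_space,second_countable_topology}, 'b::euclidean_space) atlas \<Rightarrow> ('a \<Rightarrow> real) \<Rightarrow> bool" where
  "smooth_fun A f \<longleftrightarrow> (\<forall>(U, \<phi>)\<in>A. smooth_on (\<phi> ` U) (f \<circ> inv_into U \<phi>))"


section \<open>Tangent vectors and vector fields\<close>

text \<open>
  Tangent vectors at \<open>p\<close> are derivations at \<open>p\<close> of the algebra of smooth functions. Because HOL
  functions are total, they are set to zero on functions that are not smooth; this makes the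
  representation of a derivation unique.
\<close>

type_synonym 'a tvec = "('a \<Rightarrow> real) \<Rightarrow> real"
type_synonym 'a vfield = "'a \<Rightarrow> 'a tvec"

definition tangent_space ::
    "('a::{t2_space,second_countable_topology}, 'b::euclidean_space) atlas \<Rightarrow> 'a \<Rightarrow> 'a tvec set" where
  "tangent_space A p = {v.
     (\<forall>f h a b. smooth_fun A f \<longrightarrow> smooth_fun A h \<longrightarrow>
        v (\<lambda>q. a * f q + b * h q) = a * v f + b * v h) \<and>
     (\<forall>f h. smooth_fun A f \<longrightarrow> smooth_fun A h \<longrightarrow>
        v (\<lambda>q. f q * h q) = f p * v h + h p * v f) \<and>
     (\<forall>f. \<not> smooth_fun A f \<longrightarrow> v f = 0)}"

definition tv_comb :: "real \<Rightarrow> 'a tvec \<Rightarrow> real \<Rightarrow> 'a tvec \<Rightarrow> 'a tvec" where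
  "tv_comb a v b w = (\<lambda>f. a * v f + b * w f)"

definition vector_fields ::
    "('a::{t2_space,second_countable_topology}, 'b::euclidean_space) atlas \<Rightarrow> 'a vfield set" where
  "vector_fields A = {X.
     (\<forall>p. X p \<in> tangent_space A p) \<and>
     (\<forall>f. smooth_fun A f \<longrightarrow> smooth_fun A (\<lambda>p. X p f))}"

definition vf_add :: "'a vfield \<Rightarrow> 'a vfield \<Rightarrow> 'a vfield" where
  "vf_add X Y = (\<lambda>p f. X p f + Y p f)"

definition vf_mult :: "('a \<Rightarrow> real) \<Rightarrow> 'a vfield \<Rightarrow> 'a vfield" where
  "vf_mult u X = (\<lambda>p f. u p * X p f)"

definition lie_bracket :: "'a vfield \<Rightarrow> 'a vfield \<Rightarrow> 'a vfield" where
  "lie_bracket X Y = (\<lambda>p f. X p (\<lambda>q. Y q f) - Y p (\<lambda>q. X q f))"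


section \<open>Covariant tensor fields\<close>

text \<open>
  Tensor fields of type (0,1) and (0,2) are families of (bi)linear forms on the tangent spaces;
  their values outside the tangent spaces are irrelevant.
\<close>

type_synonym 'a form1 = "'a \<Rightarrow> 'a tvec \<Rightarrow> real"
type_synonym 'a form2 = "'a \<Rightarrow> 'a tvec \<Rightarrow> 'a tvec \<Rightarrow> real"

definition one_form ::
    "('a::{t2_space,second_countable_topology}, 'b::euclidean_space) atlas \<Rightarrow> 'a form1 \<Rightarrow> bool" where
  "one_form A \<alpha> \<longleftrightarrow>
     (\<forall>p. \<forall>v\<in>tangent_space A p. \<forall>w\<in>tangent_space A p. \<forall>a b.
        \<alpha> p (tv_comb a v b w) = a * \<alpha> p v + b * \<alpha> p w) \<and>
     (\<forall>X\<in>vector_fields A. smooth_fun A (\<lambda>p. \<alpha> p (X p)))"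

definition tensor2 ::
    "('a::{t2_space,second_countable_topology}, 'b::euclidean_space) atlas \<Rightarrow> 'a form2 \<Rightarrow> bool" where
  "tensor2 A T \<longleftrightarrow>
     (\<forall>p. \<forall>u\<in>tangent_space A p. \<forall>v\<in>tangent_space A p. \<forall>w\<in>tangent_space A p. \<forall>a b.
        T p (tv_comb a u b v) w = a * T p u w + b * T p v w \<and>
        T p w (tv_comb a u b v) = a * T p w u + b * T p w v) \<and>
     (\<forall>X\<in>vector_fields A. \<forall>Y\<in>vector_fields A. smooth_fun A (\<lambda>p. T p (X p) (Y p)))"

definition riemannian_metric ::
    "('a::{t2_space,second_countable_topology}, 'b::euclidean_space) atlas \<Rightarrow> 'a form2 \<Rightarrow> bool" where
  "riemannian_metric A g \<longleftrightarrow>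
     tensor2 A g \<and>
     (\<forall>p. \<forall>v\<in>tangent_space A p. \<forall>w\<in>tangent_space A p. g p v w = g p w v) \<and>
     (\<forall>p. \<forall>v\<in>tangent_space A p. v \<noteq> (\<lambda>f. 0) \<longrightarrow> g p v v > 0)"

definition closed_one_form ::
    "('a::{t2_space,second_countable_topology}, 'b::euclidean_space) atlas \<Rightarrow> 'a form1 \<Rightarrow> bool" where
  "closed_one_form A \<alpha> \<longleftrightarrow>
     one_form A \<alpha> \<and>
     (\<forall>X\<in>vector_fields A. \<forall>Y\<in>vector_fields A. \<forall>p.
        X p (\<lambda>q. \<alpha> q (Y q)) - Y p (\<lambda>q. \<alpha> q (X q)) - \<alpha> p (lie_bracket X Y p) = 0)"


section \<open>Flat affine connections\<close>

text \<open>\<open>D X Y\<close> is the covariant derivative of \<open>Y\<close> along \<open>X\<close>.\<close>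

type_synonym 'a conn = "'a vfield \<Rightarrow> 'a vfield \<Rightarrow> 'a vfield"

definition affine_connection ::
    "('a::{t2_space,second_countable_topology}, 'b::euclidean_space) atlas \<Rightarrow> 'a conn \<Rightarrow> bool" where
  "affine_connection A D \<longleftrightarrow>
     (\<forall>X\<in>vector_fields A. \<forall>Y\<in>vector_fields A. D X Y \<in> vector_fields A) \<and>
     (\<forall>X\<in>vector_fields A. \<forall>Y\<in>vector_fields A. \<forall>Z\<in>vector_fields A.
        D (vf_add X Y) Z = vf_add (D X Z) (D Y Z) \<and>
        D X (vf_add Y Z) = vf_add (D X Y) (D X Z)) \<and>
     (\<forall>X\<in>vector_fields A. \<forall>Y\<in>vector_fields A. \<forall>u. smooth_fun A u \<longrightarrow>
        D (vf_mult u X) Y = vf_mult u (D X Y) \<and>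
        D X (vf_mult u Y) = vf_add (vf_mult (\<lambda>p. X p u) Y) (vf_mult u (D X Y)))"

definition torsion_free ::
    "('a::{t2_space,second_countable_topology}, 'b::euclidean_space) atlas \<Rightarrow> 'a conn \<Rightarrow> bool" where
  "torsion_free A D \<longleftrightarrow>
     (\<forall>X\<in>vector_fields A. \<forall>Y\<in>vector_fields A. \<forall>p f.
        D X Y p f - D Y X p f - lie_bracket X Y p f = 0)"

definition flat_connection ::
    "('a::{t2_space,second_countable_topology}, 'b::euclidean_space) atlas \<Rightarrow> 'a conn \<Rightarrow> bool" where
  "flat_connection A D \<longleftrightarrow>
     (\<forall>X\<in>vector_fields A. \<forall>Y\<in>vector_fields A. \<forall>Z\<in>vector_fields A. \<forall>p f.
        D X (D Y Z) p f - D Y (D X Z) p f - D (lie_bracket X Y) Z p f = 0)"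

definition flat_affine_manifold ::
    "('a::{t2_space,second_countable_topology}, 'b::euclidean_space) atlas \<Rightarrow> 'a conn \<Rightarrow> bool" where
  "flat_affine_manifold A D \<longleftrightarrow>
     smooth_atlas A \<and> affine_connection A D \<and> torsion_free A D \<and> flat_connection A D"


section \<open>Covariant derivatives, flat tensors and Hessian metrics\<close>

text \<open>The first vector field argument is the direction of differentiation.\<close>

definition cov_deriv1 :: "'a conn \<Rightarrow> 'a form1 \<Rightarrow> 'a vfield \<Rightarrow> 'a vfield \<Rightarrow> 'a \<Rightarrow> real" where
  "cov_deriv1 D \<alpha> X Y p = X p (\<lambda>q. \<alpha> q (Y q)) - \<alpha> p (D X Y p)"

definition cov_deriv2 ::
    "'a conn \<Rightarrow> 'a form2 \<Rightarrow> 'a vfield \<Rightarrow> 'a vfield \<Rightarrow> 'a vfield \<Rightarrow> 'a \<Rightarrow> real" where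
  "cov_deriv2 D T X Y Z p =
     X p (\<lambda>q. T q (Y q) (Z q)) - T p (D X Y p) (Z p) - T p (Y p) (D X Z p)"

definition D_flat ::
    "('a::{t2_space,second_countable_topology}, 'b::euclidean_space) atlas \<Rightarrow> 'a conn \<Rightarrow> 'a form2 \<Rightarrow> bool" where
  "D_flat A D T \<longleftrightarrow>
     (\<forall>X\<in>vector_fields A. \<forall>Y\<in>vector_fields A. \<forall>Z\<in>vector_fields A. \<forall>p.
        cov_deriv2 D T X Y Z p = 0)"

definition hessian_metric ::
    "('a::{t2_space,second_countable_topology}, 'b::euclidean_space) atlas \<Rightarrow> 'a conn \<Rightarrow> 'a form2 \<Rightarrow> bool" where
  "hessian_metric A D g \<longleftrightarrow>
     riemannian_metric A g \<and>
     (\<forall>X\<in>vector_fields A. \<forall>Y\<in>vector_fields A. \<forall>Z\<in>vector_fields A. \<forall>p.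
        cov_deriv2 D g X Y Z p = cov_deriv2 D g Y X Z p \<and>
        cov_deriv2 D g X Y Z p = cov_deriv2 D g X Z Y p)"

end

theory Submission
  imports Defs
begin

text \<open>
  A compact flat affine manifold with a parallel Riemannian metric \<open>h\<close> is a flat
  Riemannian manifold. Let \<open>P\<close> be the operation of averaging over small balls of
  \<open>h\<close>. It commutes with covariant derivatives, because it is a convolution in
  flat coordinates. If a function \<open>w\<close> can be found for which the tensor \<open>T = g + D dw\<close> satisfies \<open>P T = T\<close>, the maximum principle for the norm of
  \<open>T\<close> shows that \<open>T\<close> is parallel, and \<open>\<alpha> = - dw\<close>
  gives the decomposition \<open>g = T + D \<alpha>\<close>. At a minimum of \<open>w\<close>
  the Hessian \<open>D dw\<close> is nonnegative, so \<open>T\<close> is positive definite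
  there; being parallel, it is positive definite everywhere on the component.

  Such a \<open>w\<close> comes from the local potentials \<open>\<phi>\<close> of
  \<open>g\<close>. These are determined up to affine functions, and affine functions equal
  their averages. Hence \<open>u = P \<phi> - \<phi>\<close> is a well defined function on the
  whole manifold (\<open>source\<close>) with \<open>D du = P g - g\<close>. The equation to
  be solved is \<open>w - P w = u - c\<close> with \<open>c\<close> constant on components,
  since then \<open>\<phi> + w\<close> equals its average up to the constant \<open>c\<close>.
  Iterated averages of a continuous function converge geometrically to constants: after a
  fixed number of steps the average at every point retains a fixed share of one and the same
  local mean, which reduces the oscillation by a fixed factor (\<open>doeblin\<close>,
  \<open>contraction\<close>). So the Neumann series \<open>w = \<Sum>n. P\<^sup>n u - c\<close> converges uniformly (\<open>poisson\<close>). Its sum is continuous, and the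
  equation itself makes it smooth because \<open>P w\<close> is a convolution with a smooth
  kernel. This takes the place of Hodge theory and of elliptic regularity.

  The geometric input is the existence of flat coordinates (\<open>flat_param_exists\<close>).
  Parallel frames are obtained by Picard iteration along rays, where vanishing curvature makes
  the solution parallel in all directions (\<open>solution_exists\<close>); vanishing torsion
  makes the dual coframe closed, and Poincare's lemma integrates it to coordinates. Two
  systems of flat coordinates differ by an affine isometry (\<open>flat_transition\<close>),
  and by compactness all coordinate balls can be given the same radius. That is all the
  averaging needs. Total symmetry of \<open>D g\<close> and Poincare's lemma, applied twice,
  give the local potentials (\<open>hessian_potential\<close>).
\<close>

section \<open>Calculus of smooth maps on open sets\<close>

abbreviation dir_deriv :: "'b::euclidean_space \<Rightarrow> ('b \<Rightarrow> 'c::real_normed_vector) \<Rightarrow> 'b \<Rightarrow> 'c" where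
  "dir_deriv v f \<equiv> (\<lambda>x. frechet_derivative f (at x) v)"

lemma dir_deriv_eq: "(f has_derivative f') (at x) \<Longrightarrow> dir_deriv v f x = f' v"
  by (metis frechet_derivative_at)

text \<open>The premise that \<open>C\<^sup>k\<close> regularity only depends on the values on
  \<open>S\<close> breaks a circularity: that invariance is itself proved by induction on
  \<open>k\<close>, with this rule as the step.\<close>

lemma Ck_on_SucI:
  fixes f :: "'b::euclidean_space \<Rightarrow> 'c::real_normed_vector"
  assumes "\<And>x. x \<in> S \<Longrightarrow> (f has_derivative f' x) (at x)"
    and "\<And>v. Ck_on k (\<lambda>x. f' x v) S" and "open S"
    and cong: "\<And>f g :: 'b \<Rightarrow> 'c. (\<And>x. x \<in> S \<Longrightarrow> f x = g x) \<Longrightarrow> Ck_on k f S \<Longrightarrow> Ck_on k g S"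
  shows "Ck_on (Suc k) f S"
proof -
  have "f' x v = dir_deriv v f x" if "x \<in> S" for x v
    using dir_deriv_eq[OF assms(1)[OF that]] by metis
  then have "Ck_on k (dir_deriv v f) S" for v
    using cong[of "\<lambda>x. f' x v" "dir_deriv v f"] assms(2) by blast
  then show ?thesis using assms(1) by (auto simp: differentiable_def)
qed

lemma Ck_on_cong_imp:
  assumes "open S" "\<And>x. x \<in> S \<Longrightarrow> f x = g x" "Ck_on k f S"
  shows "Ck_on k g S"
  using assms(2,3)
proof (induction k arbitrary: f g)
  case 0
  then show ?case by (simp cong: continuous_on_cong)
next
  case (Suc k)
  have d: "(g has_derivative (\<lambda>v. dir_deriv v f x)) (at x)" if "x \<in> S" for x
  proof -
    have "(f has_derivative frechet_derivative f (at x)) (at x)"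
      using Suc.prems(2) that by (auto simp: frechet_derivative_works)
    then show ?thesis
      using has_derivative_transform_within_open[OF _ \<open>open S\<close> that, of f _ UNIV g] Suc.prems(1)
      by auto
  qed
  show ?case
  proof (rule Ck_on_SucI[OF d])
    show "\<And>v. Ck_on k (dir_deriv v f) S" using Suc.prems(2) by simp
    show "\<And>f g::'a \<Rightarrow> 'b. (\<And>x. x \<in> S \<Longrightarrow> f x = g x) \<Longrightarrow> Ck_on k f S \<Longrightarrow> Ck_on k g S"
      using Suc.IH by blast
  qed (use \<open>open S\<close> in auto)
qed

lemma Ck_on_Suc_has_derivative:
  assumes "Ck_on (Suc k) f S" "x \<in> S"
  shows "(f has_derivative (\<lambda>v. dir_deriv v f x)) (at x)"
  using assms by (simp add: frechet_derivative_works)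

lemma Ck_on_SucI':
  assumes "open S" "\<And>x. x \<in> S \<Longrightarrow> (f has_derivative f' x) (at x)"
    and "\<And>v. Ck_on k (\<lambda>x. f' x v) S"
  shows "Ck_on (Suc k) f S"
  using Ck_on_SucI[OF assms(2,3,1)] Ck_on_cong_imp[OF assms(1)] by metis

lemma Ck_on_SucD: "Ck_on (Suc k) f S \<Longrightarrow> Ck_on k f S"
proof (induction k arbitrary: f)
  case 0
  then show ?case
    by (simp add: differentiable_imp_continuous_within continuous_at_imp_continuous_on)
next
  case (Suc k)
  then show ?case by simp
qed

lemma Ck_on_imp_continuous_on: "Ck_on k f S \<Longrightarrow> continuous_on S f"
  by (induction k) (use Ck_on_SucD in \<open>auto simp del: Ck_on.simps(2)\<close>)

lemma Ck_on_subset: "Ck_on k f S \<Longrightarrow> T \<subseteq> S \<Longrightarrow> Ck_on k f T"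
  by (induction k arbitrary: f) (auto intro: continuous_on_subset)

lemma Ck_on_local:
  assumes "\<And>x. x \<in> S \<Longrightarrow> \<exists>U. open U \<and> x \<in> U \<and> Ck_on k f U"
  shows "Ck_on k f S"
  using assms
proof (induction k arbitrary: f)
  case 0
  then show ?case
    by (meson Ck_on.simps(1) continuous_at_imp_continuous_on continuous_on_eq_continuous_at)
next
  case (Suc k)
  then show ?case by (fastforce)
qed

lemma Ck_on_const: "open S \<Longrightarrow> Ck_on k (\<lambda>x. c) S"
proof (induction k arbitrary: c)
  case (Suc k)
  then show ?case
    by (intro Ck_on_SucI'[where f' = "\<lambda>x v. 0"]) auto
qed simp

lemma Ck_on_linear_comp:
  assumes "bounded_linear L" "open S" "Ck_on k f S"
  shows "Ck_on k (\<lambda>x. L (f x)) S"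
  using assms(3)
proof (induction k arbitrary: f)
  case 0
  then show ?case using assms(1) by (simp add: bounded_linear.continuous_on)
next
  case (Suc k)
  show ?case
  proof (rule Ck_on_SucI'[OF \<open>open S\<close>])
    show "((\<lambda>x. L (f x)) has_derivative (\<lambda>v. L (dir_deriv v f x))) (at x)" if "x \<in> S" for x
      by (rule bounded_linear.has_derivative[OF assms(1) Ck_on_Suc_has_derivative[OF Suc.prems that]])
    show "Ck_on k (\<lambda>x. L (dir_deriv v f x)) S" for v
      using Suc by simp
  qed
qed

lemma Ck_on_linear: "bounded_linear L \<Longrightarrow> open S \<Longrightarrow> Ck_on k L S"
proof (induction k)
  case 0 then show ?case by (simp add: linear_continuous_on)
next
  case (Suc k)
  then show ?case
    by (intro Ck_on_SucI'[where f' = "\<lambda>x. L"])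
      (auto intro: bounded_linear.has_derivative has_derivative_ident Ck_on_const bounded_linear_imp_has_derivative)
qed

lemma Ck_on_add:
  assumes "open S" "Ck_on k f S" "Ck_on k g S"
  shows "Ck_on k (\<lambda>x. f x + g x) S"
  using assms(2,3)
proof (induction k arbitrary: f g)
  case 0
  then show ?case by (simp add: continuous_on_add)
next
  case (Suc k)
  show ?case
  proof (rule Ck_on_SucI'[OF \<open>open S\<close>])
    show "((\<lambda>x. f x + g x) has_derivative (\<lambda>v. dir_deriv v f x + dir_deriv v g x)) (at x)"
      if "x \<in> S" for x
      using Suc.prems that by (intro has_derivative_add) (auto intro: Ck_on_Suc_has_derivative)
    show "Ck_on k (\<lambda>x. dir_deriv v f x + dir_deriv v g x) S" for v
      using Suc by simp
  qed
qed

lemma Ck_on_sum: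
  assumes "open S" "\<And>i. i \<in> I \<Longrightarrow> Ck_on k (f i) S"
  shows "Ck_on k (\<lambda>x. \<Sum>i\<in>I. f i x) S"
  using assms(2)
  by (induction I rule: infinite_finite_induct) (auto intro: Ck_on_add Ck_on_const assms(1))

lemma Ck_on_bilinear:
  assumes "bounded_bilinear B" "open S" "Ck_on k f S" "Ck_on k g S"
  shows "Ck_on k (\<lambda>x. B (f x) (g x)) S"
  using assms(3,4)
proof (induction k arbitrary: f g)
  case 0
  then show ?case using bounded_bilinear.continuous_on[OF assms(1)] by simp
next
  case (Suc k)
  show ?case
  proof (rule Ck_on_SucI'[OF \<open>open S\<close>])
    show "((\<lambda>x. B (f x) (g x)) has_derivative
        (\<lambda>v. B (f x) (dir_deriv v g x) + B (dir_deriv v f x) (g x))) (at x)"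
      if "x \<in> S" for x
      using Suc.prems that
      by (intro bounded_bilinear.FDERIV[OF assms(1)]) (auto intro: Ck_on_Suc_has_derivative)
    show "Ck_on k (\<lambda>x. B (f x) (dir_deriv v g x) + B (dir_deriv v f x) (g x)) S" for v
      using Suc.prems Ck_on_SucD[OF Suc.prems(1)] Ck_on_SucD[OF Suc.prems(2)]
      by (intro Ck_on_add Suc.IH \<open>open S\<close>) auto
  qed
qed

text \<open>The chain rule is expanded in the basis, so that the derivative is a sum of products
  of a derivative of the inner map with a composition of lower order.\<close>

lemma Ck_on_compose:
  fixes g :: "'b::euclidean_space \<Rightarrow> 'c::euclidean_space"
  assumes "open S" "open T" "Ck_on k g S" "Ck_on k f T" "g ` S \<subseteq> T"
  shows "Ck_on k (\<lambda>x. f (g x)) S"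
  using assms(3,4)
proof (induction k arbitrary: f)
  case 0
  then show ?case
    using assms(5) continuous_on_compose2 by (metis Ck_on.simps(1))
next
  case (Suc k)
  note g = Ck_on_SucD[OF Suc.prems(1)]
  show ?case
  proof (rule Ck_on_SucI'[OF \<open>open S\<close>])
    fix x assume x: "x \<in> S"
    then have gx: "g x \<in> T" using assms(5) by blast
    have "((\<lambda>x. f (g x)) has_derivative (\<lambda>v. dir_deriv (dir_deriv v g x) f (g x))) (at x)"
      using has_derivative_compose[OF Ck_on_Suc_has_derivative[OF Suc.prems(1) x]
          Ck_on_Suc_has_derivative[OF Suc.prems(2) gx]] by simp
    moreover have "dir_deriv (dir_deriv v g x) f (g x)
        = (\<Sum>b\<in>Basis. (dir_deriv v g x \<bullet> b) *\<^sub>R dir_deriv b f (g x))" for v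
    proof -
      interpret linear "frechet_derivative f (at (g x))"
        using Suc.prems(2) gx by (intro linear_frechet_derivative) auto
      show ?thesis
        by (subst euclidean_representation[of "dir_deriv v g x", symmetric]) (simp add: sum scale)
    qed
    ultimately show "((\<lambda>x. f (g x)) has_derivative (\<lambda>v. \<Sum>b\<in>Basis.
        (dir_deriv v g x \<bullet> b) *\<^sub>R dir_deriv b f (g x))) (at x)" by simp
  next
    fix v
    show "Ck_on k (\<lambda>x. \<Sum>b\<in>Basis. (dir_deriv v g x \<bullet> b) *\<^sub>R dir_deriv b f (g x)) S"
      using Suc.prems g
      by (intro Ck_on_sum \<open>open S\<close> Ck_on_bilinear[OF bounded_bilinear_scaleR] Suc.IH
          Ck_on_linear_comp[OF bounded_linear_inner_left]) auto
  qed
qed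

lemma smooth_onI: "(\<And>k. Ck_on k f S) \<Longrightarrow> smooth_on S f"
  by (simp add: smooth_on_def)

lemma smooth_on_has_derivative:
  "smooth_on S f \<Longrightarrow> x \<in> S \<Longrightarrow> (f has_derivative (\<lambda>v. dir_deriv v f x)) (at x)"
  using Ck_on_Suc_has_derivative unfolding smooth_on_def by blast

lemma smooth_on_linear_dir_deriv:
  "smooth_on S f \<Longrightarrow> x \<in> S \<Longrightarrow> linear (\<lambda>v. dir_deriv v f x)"
  using has_derivative_linear smooth_on_has_derivative by blast

lemma smooth_on_continuous_on: "smooth_on S f \<Longrightarrow> continuous_on S f"
  using Ck_on_imp_continuous_on unfolding smooth_on_def by blast

lemma smooth_on_dir_deriv: "smooth_on S f \<Longrightarrow> smooth_on S (dir_deriv v f)"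
  unfolding smooth_on_def by (metis Ck_on.simps(2))

lemma smooth_on_cong:
  "open S \<Longrightarrow> smooth_on S f \<Longrightarrow> (\<And>x. x \<in> S \<Longrightarrow> f x = g x) \<Longrightarrow> smooth_on S g"
  unfolding smooth_on_def by (metis Ck_on_cong_imp)

lemma smooth_on_subset: "smooth_on S f \<Longrightarrow> T \<subseteq> S \<Longrightarrow> smooth_on T f"
  unfolding smooth_on_def by (metis Ck_on_subset)

lemma smooth_on_local:
  "(\<And>x. x \<in> S \<Longrightarrow> \<exists>U. open U \<and> x \<in> U \<and> smooth_on U f) \<Longrightarrow> smooth_on S f"
  unfolding smooth_on_def by (metis Ck_on_local)

lemma smooth_on_const: "open S \<Longrightarrow> smooth_on S (\<lambda>x. c)"
  by (simp add: smooth_on_def Ck_on_const)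

lemma smooth_on_linear: "bounded_linear L \<Longrightarrow> open S \<Longrightarrow> smooth_on S L"
  by (simp add: smooth_on_def Ck_on_linear)

lemma smooth_on_linear_comp: "bounded_linear L \<Longrightarrow> open S \<Longrightarrow> smooth_on S f \<Longrightarrow> smooth_on S (\<lambda>x. L (f x))"
  by (simp add: smooth_on_def Ck_on_linear_comp)

lemma smooth_on_inner_const:
  "open S \<Longrightarrow> smooth_on S f \<Longrightarrow> smooth_on S (\<lambda>x. f x \<bullet> c)"
  by (rule smooth_on_linear_comp[OF bounded_linear_inner_left])

lemma smooth_on_add: "open S \<Longrightarrow> smooth_on S f \<Longrightarrow> smooth_on S g \<Longrightarrow> smooth_on S (\<lambda>x. f x + g x)"
  by (simp add: smooth_on_def Ck_on_add)

lemma smooth_on_sum: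
  "open S \<Longrightarrow> (\<And>i. i \<in> I \<Longrightarrow> smooth_on S (f i)) \<Longrightarrow> smooth_on S (\<lambda>x. \<Sum>i\<in>I. f i x)"
  by (simp add: smooth_on_def Ck_on_sum)

lemma smooth_on_bilinear:
  "bounded_bilinear B \<Longrightarrow> open S \<Longrightarrow> smooth_on S f \<Longrightarrow> smooth_on S g \<Longrightarrow> smooth_on S (\<lambda>x. B (f x) (g x))"
  by (simp add: smooth_on_def Ck_on_bilinear)

lemma smooth_on_scaleR:
  "open S \<Longrightarrow> smooth_on S f \<Longrightarrow> smooth_on S g \<Longrightarrow> smooth_on S (\<lambda>x. f x *\<^sub>R g x)"
  by (rule smooth_on_bilinear[OF bounded_bilinear_scaleR])

lemma smooth_on_mult:
  fixes f g :: "'b::euclidean_space \<Rightarrow> real"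
  shows "open S \<Longrightarrow> smooth_on S f \<Longrightarrow> smooth_on S g \<Longrightarrow> smooth_on S (\<lambda>x. f x * g x)"
  by (rule smooth_on_bilinear[OF bounded_bilinear_mult])

lemma smooth_on_inner:
  "open S \<Longrightarrow> smooth_on S f \<Longrightarrow> smooth_on S g \<Longrightarrow> smooth_on S (\<lambda>x. f x \<bullet> g x)"
  by (rule smooth_on_bilinear[OF bounded_bilinear_inner])

lemma smooth_on_diff:
  fixes f g :: "'b::euclidean_space \<Rightarrow> 'c::real_normed_vector"
  shows "open S \<Longrightarrow> smooth_on S f \<Longrightarrow> smooth_on S g \<Longrightarrow> smooth_on S (\<lambda>x. f x - g x)"
  using smooth_on_add[of S f "\<lambda>x. - g x"]
    smooth_on_linear_comp[OF bounded_linear_minus[OF bounded_linear_ident], of S g]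
  by simp

lemma smooth_on_compose:
  fixes g :: "'b::euclidean_space \<Rightarrow> 'c::euclidean_space"
  shows "open S \<Longrightarrow> open T \<Longrightarrow> smooth_on S g \<Longrightarrow> smooth_on T f \<Longrightarrow> g ` S \<subseteq> T \<Longrightarrow>
    smooth_on S (\<lambda>x. f (g x))"
  by (simp add: smooth_on_def Ck_on_compose)

lemma smooth_on_componentwise:
  fixes f :: "'b::euclidean_space \<Rightarrow> 'c::euclidean_space"
  assumes "open S" "\<And>b. b \<in> Basis \<Longrightarrow> smooth_on S (\<lambda>x. f x \<bullet> b)"
  shows "smooth_on S f"
proof -
  have "smooth_on S (\<lambda>x. \<Sum>b\<in>Basis. (f x \<bullet> b) *\<^sub>R b)"
    by (intro smooth_on_sum smooth_on_scaleR smooth_on_const assms)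
  then show ?thesis by (simp add: euclidean_representation)
qed

text \<open>If the derivative of \<open>f\<close> is as regular as \<open>f\<close> itself, each
  order of regularity yields the next. Solutions of differential equations are of this kind, and
  so are inverse maps, whose derivative is expressed through the map.\<close>

lemma smooth_on_bootstrap:
  assumes "open S" "continuous_on S f"
    and "\<And>x. x \<in> S \<Longrightarrow> (f has_derivative f' x) (at x)"
    and "\<And>k v. Ck_on k f S \<Longrightarrow> Ck_on k (\<lambda>x. f' x v) S"
  shows "smooth_on S f"
proof (rule smooth_onI)
  show "Ck_on k f S" for k
    by (induction k) (auto simp del: Ck_on.simps(2) intro!: Ck_on_SucI' assms simp: assms(2))
qed

lemma smooth_on_inverse: "smooth_on {x::real. x \<noteq> 0} inverse"
proof (rule smooth_on_bootstrap[where f' = "\<lambda>x v. - (inverse x * v * inverse x)"])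
  show "open {x::real. x \<noteq> 0}" by (simp add: open_Collect_neq)
  then show "Ck_on k (\<lambda>x. - (inverse x * v * inverse x)) {x::real. x \<noteq> 0}"
    if "Ck_on k inverse {x::real. x \<noteq> 0}" for k and v :: real
    using Ck_on_linear_comp[OF bounded_linear_mult_right[of "- v"], of _ k "\<lambda>x. inverse x * inverse x",
        OF _ Ck_on_bilinear[OF bounded_bilinear_mult _ that that]]
    by (simp add: algebra_simps)
  show "(inverse has_derivative (\<lambda>v. - (inverse x * v * inverse x))) (at x)"
    if "x \<in> {x::real. x \<noteq> 0}" for x
    using that by (intro has_derivative_inverse') auto
qed (auto intro!: continuous_intros)

text \<open>Schwarz's theorem: both iterated derivatives are limits of the same second difference
  quotient, by two applications of the mean value theorem in either order.\<close>

lemma second_difference_mean_value: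
  fixes f :: "'b::euclidean_space \<Rightarrow> real"
  assumes "smooth_on (ball x e) f" "t > 0" "t * (norm u + norm v) < e"
  obtains y where "norm (y - x) \<le> t * (norm u + norm v)"
    "f (x + t *\<^sub>R u + t *\<^sub>R v) - f (x + t *\<^sub>R u) - f (x + t *\<^sub>R v) + f x
       = t * t * dir_deriv v (dir_deriv u f) y"
proof -
  have near: "norm (s *\<^sub>R u + r *\<^sub>R v) \<le> t * (norm u + norm v)"
    if "0 \<le> s" "s \<le> t" "0 \<le> r" "r \<le> t" for s r
  proof -
    have "norm (s *\<^sub>R u + r *\<^sub>R v) \<le> s * norm u + r * norm v"
      using norm_triangle_ineq[of "s *\<^sub>R u" "r *\<^sub>R v"] that by simp
    also have "\<dots> \<le> t * norm u + t * norm v"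
      using that by (intro add_mono mult_right_mono) auto
    finally show ?thesis by (simp add: algebra_simps)
  qed
  have inb: "x + s *\<^sub>R u + r *\<^sub>R v \<in> ball x e" if "0 \<le> s" "s \<le> t" "0 \<le> r" "r \<le> t" for s r
    using near[OF that] assms(3) by (simp add: dist_norm norm_minus_commute add.assoc)
      (smt (verit) add.commute norm_minus_cancel minus_add_distrib)
  define \<phi> where "\<phi> s = f (x + s *\<^sub>R u + t *\<^sub>R v) - f (x + s *\<^sub>R u + 0 *\<^sub>R v)" for s
  have d1: "((\<lambda>s. f (x + s *\<^sub>R u + r *\<^sub>R v)) has_derivative
      (\<lambda>h. h * dir_deriv u f (x + s *\<^sub>R u + r *\<^sub>R v))) (at s)"
    if "0 \<le> s" "s \<le> t" "0 \<le> r" "r \<le> t" for s r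
  proof -
    let ?y = "x + s *\<^sub>R u + r *\<^sub>R v"
    have "((\<lambda>s. x + s *\<^sub>R u + r *\<^sub>R v) has_derivative (\<lambda>h. h *\<^sub>R u)) (at s)"
      by (auto intro!: derivative_eq_intros)
    from has_derivative_compose[OF this smooth_on_has_derivative[OF assms(1) inb[OF that]]]
    show ?thesis
      using linear_scale[OF smooth_on_linear_dir_deriv[OF assms(1) inb[OF that]]] by simp
  qed
  have "\<exists>s. 0 < s \<and> s < t \<and> \<phi> t - \<phi> 0 = (t - 0) *
      (dir_deriv u f (x + s *\<^sub>R u + t *\<^sub>R v) - dir_deriv u f (x + s *\<^sub>R u + 0 *\<^sub>R v))"
  proof (rule MVT2[OF \<open>t > 0\<close>])
    fix s assume "0 \<le> s" "s \<le> t"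
    then show "(\<phi> has_real_derivative dir_deriv u f (x + s *\<^sub>R u + t *\<^sub>R v)
        - dir_deriv u f (x + s *\<^sub>R u + 0 *\<^sub>R v)) (at s)"
      unfolding \<phi>_def has_field_derivative_def
      by (rule has_derivative_eq_rhs[OF has_derivative_diff[OF d1 d1]])
        (use \<open>t > 0\<close> \<open>0 \<le> s\<close> \<open>s \<le> t\<close> in \<open>auto simp: algebra_simps fun_eq_iff\<close>)
  qed
  then obtain s where s: "0 < s" "s < t" and e1: "\<phi> t - \<phi> 0 = t *
      (dir_deriv u f (x + s *\<^sub>R u + t *\<^sub>R v) - dir_deriv u f (x + s *\<^sub>R u + 0 *\<^sub>R v))" by auto
  have d2: "((\<lambda>r. dir_deriv u f (x + s *\<^sub>R u + r *\<^sub>R v)) has_derivative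
      (\<lambda>h. h * dir_deriv v (dir_deriv u f) (x + s *\<^sub>R u + r *\<^sub>R v))) (at r)"
    if "0 \<le> r" "r \<le> t" for r
  proof -
    note sm = smooth_on_dir_deriv[OF assms(1), of u]
    have i: "x + s *\<^sub>R u + r *\<^sub>R v \<in> ball x e" using inb s that by simp
    have "((\<lambda>r. x + s *\<^sub>R u + r *\<^sub>R v) has_derivative (\<lambda>h. h *\<^sub>R v)) (at r)"
      by (auto intro!: derivative_eq_intros)
    from has_derivative_compose[OF this smooth_on_has_derivative[OF sm i]]
    show ?thesis using linear_scale[OF smooth_on_linear_dir_deriv[OF sm i]] by simp
  qed
  have "\<exists>r. 0 < r \<and> r < t \<and> dir_deriv u f (x + s *\<^sub>R u + t *\<^sub>R v) - dir_deriv u f (x + s *\<^sub>R u + 0 *\<^sub>R v)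
     = (t - 0) * dir_deriv v (dir_deriv u f) (x + s *\<^sub>R u + r *\<^sub>R v)"
    by (rule MVT2[OF \<open>t > 0\<close>], unfold has_field_derivative_def, rule has_derivative_eq_rhs[OF d2])
      (auto simp: fun_eq_iff)
  then obtain r where r: "0 < r" "r < t" and
    e2: "dir_deriv u f (x + s *\<^sub>R u + t *\<^sub>R v) - dir_deriv u f (x + s *\<^sub>R u + 0 *\<^sub>R v)
     = t * dir_deriv v (dir_deriv u f) (x + s *\<^sub>R u + r *\<^sub>R v)" by auto
  show thesis
  proof (rule that[of "x + s *\<^sub>R u + r *\<^sub>R v"])
    show "norm (x + s *\<^sub>R u + r *\<^sub>R v - x) \<le> t * (norm u + norm v)"
      using near[of s r] s r by (simp add: add.assoc)
    show "f (x + t *\<^sub>R u + t *\<^sub>R v) - f (x + t *\<^sub>R u) - f (x + t *\<^sub>R v) + f x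
       = t * t * dir_deriv v (dir_deriv u f) (x + s *\<^sub>R u + r *\<^sub>R v)"
      using e1 e2 by (simp add: \<phi>_def)
  qed
qed

lemma dir_deriv_commute:
  fixes f :: "'b::euclidean_space \<Rightarrow> real"
  assumes "open S" "smooth_on S f" "x \<in> S"
  shows "dir_deriv u (dir_deriv v f) x = dir_deriv v (dir_deriv u f) x"
proof (rule ccontr)
  let ?g = "dir_deriv u (dir_deriv v f)" and ?h = "dir_deriv v (dir_deriv u f)"
  assume ne: "?g x \<noteq> ?h x"
  define \<epsilon> where "\<epsilon> = \<bar>?g x - ?h x\<bar> / 2"
  have "\<epsilon> > 0" using ne by (simp add: \<epsilon>_def)
  obtain e where e: "e > 0" "ball x e \<subseteq> S" using assms by (meson openE)
  have "continuous (at x) ?g" "continuous (at x) ?h"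
    using assms smooth_on_continuous_on[OF smooth_on_dir_deriv[OF smooth_on_dir_deriv[OF assms(2)]]]
    by (auto simp: continuous_on_eq_continuous_at)
  then obtain d1 d2 where d12: "d1 > 0" "\<And>y. dist y x < d1 \<Longrightarrow> dist (?g y) (?g x) < \<epsilon>"
      "d2 > 0" "\<And>y. dist y x < d2 \<Longrightarrow> dist (?h y) (?h x) < \<epsilon>"
    unfolding continuous_at_eps_delta using \<open>\<epsilon> > 0\<close> that by (elim allE[of _ \<epsilon>] impE exE conjE) auto
  define d where "d = min d1 d2"
  have d: "d > 0" "\<And>y. dist y x < d \<Longrightarrow> dist (?g y) (?g x) < \<epsilon>"
      "\<And>y. dist y x < d \<Longrightarrow> dist (?h y) (?h x) < \<epsilon>"
    using d12 by (auto simp: d_def)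
  define t where "t = min e d / (2 * (norm u + norm v + 1))"
  have t: "t > 0" "t * (norm u + norm v) < min e d"
  proof -
    have pos: "norm u + norm v + 1 > 0" by (simp add: add_nonneg_pos)
    show "t > 0" using e d pos by (simp add: t_def)
    then have "t * (norm u + norm v) \<le> t * (norm u + norm v + 1)" by (intro mult_left_mono) auto
    also have "\<dots> = min e d / 2" using pos by (simp add: t_def field_simps)
    also have "\<dots> < min e d" using e d by auto
    finally show "t * (norm u + norm v) < min e d" .
  qed
  have sm: "smooth_on (ball x e) f" using assms(2) e smooth_on_subset by blast
  obtain y where y: "norm (y - x) \<le> t * (norm u + norm v)"
    "f (x + t *\<^sub>R u + t *\<^sub>R v) - f (x + t *\<^sub>R u) - f (x + t *\<^sub>R v) + f x = t * t * ?h y"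
    using second_difference_mean_value[OF sm t(1), of u v] t by (metis min_less_iff_conj)
  obtain z where z: "norm (z - x) \<le> t * (norm v + norm u)"
    "f (x + t *\<^sub>R v + t *\<^sub>R u) - f (x + t *\<^sub>R v) - f (x + t *\<^sub>R u) + f x = t * t * ?g z"
    using second_difference_mean_value[OF sm t(1), of v u] t by (metis add.commute min_less_iff_conj)
  have "t * t * ?h y = t * t * ?g z"
    using y(2) z(2) by (simp add: algebra_simps)
  then have "?h y = ?g z" using t by simp
  moreover have "dist (?h y) (?h x) < \<epsilon>" "dist (?g z) (?g x) < \<epsilon>"
    using d y(1) z(1) t by (auto simp: dist_norm add.commute)
  ultimately show False unfolding \<epsilon>_def dist_real_def by (simp add: abs_if split: if_splits)
qed

section \<open>Integrals depending smoothly on parameters\<close>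

text \<open>The three integrals used below have this form: the radial primitive \<open>\<integral> f (s x) ds\<close>,
  the convolution \<open>\<integral> k (y - x) w y dy\<close> with a smooth kernel and a merely continuous \<open>w\<close>,
  and the average \<open>\<integral> k z f (x + z) dz\<close> of a smooth \<open>f\<close>. Differentiating once reproduces the
  form, so one induction settles all of them.\<close>

lemma affine_integral_continuous_on:
  fixes f :: "'b::euclidean_space \<Rightarrow> 'c::euclidean_space" and c l :: "'d::euclidean_space \<Rightarrow> real"
  assumes "continuous_on (cbox p q) c" "continuous_on (cbox p q) l" "continuous_on (cbox p q) d"
    and "\<And>x t. x \<in> U \<Longrightarrow> t \<in> cbox p q \<Longrightarrow> l t *\<^sub>R x + d t \<in> S" "continuous_on S f"
  shows "continuous_on U (\<lambda>x. integral (cbox p q) (\<lambda>t. c t *\<^sub>R f (l t *\<^sub>R x + d t)))"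
proof (rule integral_continuous_on_param)
  have 1: "continuous_on (U \<times> cbox p q) (\<lambda>z. c (snd z))" "continuous_on (U \<times> cbox p q) (\<lambda>z. l (snd z))"
     "continuous_on (U \<times> cbox p q) (\<lambda>z. d (snd z))"
    by (rule continuous_on_compose2[OF assms(1)], auto intro!: continuous_intros,
      rule continuous_on_compose2[OF assms(2)], auto intro!: continuous_intros,
      rule continuous_on_compose2[OF assms(3)], auto intro!: continuous_intros)
  show "continuous_on (U \<times> cbox p q) (\<lambda>(x, t). c t *\<^sub>R f (l t *\<^sub>R x + d t))"
    unfolding split_beta
    by (intro continuous_on_scaleR 1 continuous_on_compose2[OF assms(5), of _ "\<lambda>z. l (snd z) *\<^sub>R fst z + d (snd z)"]
        continuous_on_add continuous_on_fst) (use assms(4) in \<open>auto intro: continuous_on_id\<close>)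
qed

lemma affine_integral_has_derivative:
  fixes f :: "'b::euclidean_space \<Rightarrow> 'c::euclidean_space" and c l :: "'d::euclidean_space \<Rightarrow> real"
  assumes c: "continuous_on (cbox p q) c" and l: "continuous_on (cbox p q) l"
    and d: "continuous_on (cbox p q) d"
    and U: "open U" "convex U"
    and inS: "\<And>x t. x \<in> U \<Longrightarrow> t \<in> cbox p q \<Longrightarrow> l t *\<^sub>R x + d t \<in> S" and "open S"
    and f: "Ck_on (Suc 0) f S" and x: "x \<in> U"
  shows "((\<lambda>x. integral (cbox p q) (\<lambda>t. c t *\<^sub>R f (l t *\<^sub>R x + d t))) has_derivative
     (\<lambda>v. integral (cbox p q) (\<lambda>t. (c t * l t) *\<^sub>R dir_deriv v f (l t *\<^sub>R x + d t)))) (at x)"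
proof -
  define fx where "fx x t = Blinfun (\<lambda>v. (c t * l t) *\<^sub>R dir_deriv v f (l t *\<^sub>R x + d t))" for x t
  have D: "(f has_derivative (\<lambda>v. dir_deriv v f y)) (at y)" if "y \<in> S" for y
    using Ck_on_Suc_has_derivative[OF f that] .
  have app: "blinfun_apply (fx x t) = (\<lambda>v. (c t * l t) *\<^sub>R dir_deriv v f (l t *\<^sub>R x + d t))"
    if "x \<in> U" "t \<in> cbox p q" for x t
    unfolding fx_def
    by (rule bounded_linear_Blinfun_apply)
      (intro bounded_linear_const_scaleR has_derivative_bounded_linear[OF D] inS that)
  have cont1: "continuous_on (U \<times> cbox p q) (\<lambda>z. c (snd z))" "continuous_on (U \<times> cbox p q) (\<lambda>z. l (snd z))"
     "continuous_on (U \<times> cbox p q) (\<lambda>z. d (snd z))"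
    by (rule continuous_on_compose2[OF c], auto intro!: continuous_intros,
      rule continuous_on_compose2[OF l], auto intro!: continuous_intros,
      rule continuous_on_compose2[OF d], auto intro!: continuous_intros)
  have cont: "continuous_on (U \<times> cbox p q) (\<lambda>(x, t). fx x t)"
  proof (rule continuous_on_blinfun_componentwise)
    fix v :: 'b
    have "continuous_on S (dir_deriv v f)" using f by simp
    then have "continuous_on (U \<times> cbox p q)
       (\<lambda>z. (c (snd z) * l (snd z)) *\<^sub>R dir_deriv v f (l (snd z) *\<^sub>R fst z + d (snd z)))"
      by (intro continuous_on_scaleR continuous_on_mult cont1
          continuous_on_compose2[of S "dir_deriv v f" _ "\<lambda>z. l (snd z) *\<^sub>R fst z + d (snd z)"]
          continuous_on_add continuous_on_fst) (use inS in \<open>auto intro: continuous_on_id\<close>)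
    then show "continuous_on (U \<times> cbox p q) (\<lambda>z. blinfun_apply (case z of (x, t) \<Rightarrow> fx x t) v)"
      by (rule continuous_on_eq) (auto simp: app)
  qed
  have "((\<lambda>x. integral (cbox p q) (\<lambda>t. c t *\<^sub>R f (l t *\<^sub>R x + d t))) has_derivative
      integral (cbox p q) (fx x)) (at x within U)"
  proof (rule leibniz_rule[OF _ _ cont x U(2)])
    fix x t assume xt: "x \<in> U" "t \<in> cbox p q"
    have "((\<lambda>x. l t *\<^sub>R x + d t) has_derivative (\<lambda>v. l t *\<^sub>R v)) (at x within U)"
      by (auto intro!: derivative_eq_intros)
    from has_derivative_scaleR_right[OF has_derivative_compose[OF this D[OF inS[OF xt]]], of "c t"]
    show "((\<lambda>x. c t *\<^sub>R f (l t *\<^sub>R x + d t)) has_derivative blinfun_apply (fx x t)) (at x within U)"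
      using linear_scale[OF has_derivative_linear[OF D[OF inS[OF xt]]]] app[OF xt] by simp
  next
    fix x assume "x \<in> U"
    then show "(\<lambda>t. c t *\<^sub>R f (l t *\<^sub>R x + d t)) integrable_on cbox p q"
      using Ck_on_imp_continuous_on[OF f]
      by (intro integrable_continuous continuous_on_scaleR c
          continuous_on_compose2[of S f _ "\<lambda>t. l t *\<^sub>R x + d t"] continuous_on_add l d continuous_on_const) (use inS in auto)
  qed
  moreover have "blinfun_apply (integral (cbox p q) (fx x)) =
     (\<lambda>v. integral (cbox p q) (\<lambda>t. (c t * l t) *\<^sub>R dir_deriv v f (l t *\<^sub>R x + d t)))"
  proof
    fix v
    have "continuous_on (cbox p q) (\<lambda>t. (\<lambda>(x, t). fx x t) (x, t))"
      by (rule continuous_on_compose2[OF cont]) (use x in \<open>auto intro!: continuous_intros\<close>)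
    then have "fx x integrable_on cbox p q"
      by (intro integrable_continuous) simp
    then have "blinfun_apply (integral (cbox p q) (fx x)) v = integral (cbox p q) (\<lambda>t. fx x t v)"
      by (rule blinfun_apply_integral)
    also have "\<dots> = integral (cbox p q) (\<lambda>t. (c t * l t) *\<^sub>R dir_deriv v f (l t *\<^sub>R x + d t))"
      by (rule integral_cong) (use x app in auto)
    finally show "blinfun_apply (integral (cbox p q) (fx x)) v = \<dots>" .
  qed
  ultimately show ?thesis
    by (simp add: at_within_open[OF x U(1)])
qed

lemma affine_integral_Ck_on:
  fixes f :: "'b::euclidean_space \<Rightarrow> 'c::euclidean_space" and c l :: "'d::euclidean_space \<Rightarrow> real"
  assumes c: "continuous_on (cbox p q) c" and l: "continuous_on (cbox p q) l"
    and d: "continuous_on (cbox p q) d"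
    and U: "open U" "convex U"
    and inS: "\<And>x t. x \<in> U \<Longrightarrow> t \<in> cbox p q \<Longrightarrow> l t *\<^sub>R x + d t \<in> S" and "open S"
    and f: "Ck_on k f S"
  shows "Ck_on k (\<lambda>x. integral (cbox p q) (\<lambda>t. c t *\<^sub>R f (l t *\<^sub>R x + d t))) U"
  using c f
proof (induction k arbitrary: c f)
  case 0
  then show ?case
    using affine_integral_continuous_on[OF _ l d inS] by simp
next
  case (Suc k)
  have "Ck_on (Suc 0) f S"
    using Suc.prems(2) Ck_on_imp_continuous_on by (metis Ck_on.simps)
  then show ?case
    using Suc.prems by (intro Ck_on_SucI'[OF U(1) affine_integral_has_derivative[OF _ l d U inS \<open>open S\<close>]]
      Suc.IH continuous_on_mult l) auto
qed

lemma affine_integral_smooth_on: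
  fixes f :: "'b::euclidean_space \<Rightarrow> 'c::euclidean_space" and c l :: "'d::euclidean_space \<Rightarrow> real"
  assumes "continuous_on (cbox p q) c" "continuous_on (cbox p q) l" "continuous_on (cbox p q) d"
    and "open U" "convex U" "\<And>x t. x \<in> U \<Longrightarrow> t \<in> cbox p q \<Longrightarrow> l t *\<^sub>R x + d t \<in> S" "open S"
    and "smooth_on S f"
  shows "smooth_on U (\<lambda>x. integral (cbox p q) (\<lambda>t. c t *\<^sub>R f (l t *\<^sub>R x + d t)))"
  using assms affine_integral_Ck_on[OF assms(1-7)] unfolding smooth_on_def by blast

text \<open>The mean over the segment from the origin to \<open>x\<close>. Multiplied by the
  coordinates of \<open>x\<close> it becomes the integral along the ray that occurs in
  Poincare's and Hadamard's lemmas and in the Picard iteration.\<close>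

definition ray_mean :: "('b::euclidean_space \<Rightarrow> 'c::euclidean_space) \<Rightarrow> 'b \<Rightarrow> 'c" where
  "ray_mean f x = integral (cbox 0 (1::real)) (\<lambda>s. f (s *\<^sub>R x))"

lemma scaleR_in_ball_0: "x \<in> ball 0 \<rho> \<Longrightarrow> s \<in> cbox 0 (1::real) \<Longrightarrow> s *\<^sub>R x \<in> ball 0 \<rho>"
  for x :: "'b::euclidean_space"
  by (simp add: mult_le_one order.strict_trans1[OF mult_left_le_one_le])

lemma ray_mean_smooth_on:
  "smooth_on (ball 0 \<rho>) f \<Longrightarrow> smooth_on (ball 0 \<rho>) (ray_mean f)"
  unfolding ray_mean_def
  using affine_integral_smooth_on[of 0 "1::real" "\<lambda>_. 1" "\<lambda>s. s" "\<lambda>_. 0" "ball 0 \<rho>" "ball 0 \<rho>" f]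
    scaleR_in_ball_0
  by (auto intro: continuous_on_id)

lemma ray_mean_has_derivative:
  assumes "smooth_on (ball 0 \<rho>) f" "x \<in> ball 0 \<rho>"
  shows "(ray_mean f has_derivative
    (\<lambda>v. integral (cbox 0 (1::real)) (\<lambda>s. s *\<^sub>R dir_deriv v f (s *\<^sub>R x)))) (at x)"
  unfolding ray_mean_def
  using affine_integral_has_derivative[of 0 "1::real" "\<lambda>_. 1" "\<lambda>s. s" "\<lambda>_. 0" "ball 0 \<rho>" "ball 0 \<rho>" f x]
    scaleR_in_ball_0[of _ \<rho>] assms
  by (auto intro: continuous_on_id simp: smooth_on_def simp del: Ck_on.simps)

lemma ray_integrable:
  fixes f :: "'b::euclidean_space \<Rightarrow> 'c::euclidean_space"
  assumes "continuous_on (ball 0 \<rho>) f" "x \<in> ball 0 \<rho>" "continuous_on (cbox 0 1) c"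
  shows "(\<lambda>s::real. c s *\<^sub>R f (s *\<^sub>R x)) integrable_on cbox 0 1"
  using scaleR_in_ball_0[OF assms(2)]
  by (intro integrable_continuous continuous_on_scaleR assms(3)
      continuous_on_compose2[OF assms(1), of _ "\<lambda>s. s *\<^sub>R x"] continuous_on_id continuous_on_const) auto

lemma ray_mean_fundamental_theorem:
  fixes f :: "'b::euclidean_space \<Rightarrow> 'c::euclidean_space"
  assumes "smooth_on (ball 0 \<rho>) f" "x \<in> ball 0 \<rho>"
  shows "((\<lambda>s. f (s *\<^sub>R x) + s *\<^sub>R dir_deriv x f (s *\<^sub>R x)) has_integral f x) (cbox 0 (1::real))"
proof -
  have "((\<lambda>s. s *\<^sub>R f (s *\<^sub>R x)) has_vector_derivative
      (f (s *\<^sub>R x) + s *\<^sub>R dir_deriv x f (s *\<^sub>R x))) (at s within {0..1})" if "0 \<le> s" "s \<le> 1" for s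
  proof -
    have i: "s *\<^sub>R x \<in> ball 0 \<rho>" using scaleR_in_ball_0[OF assms(2)] that by simp
    have "((\<lambda>s. s *\<^sub>R x) has_derivative (\<lambda>h. h *\<^sub>R x)) (at s within {0..1})"
      by (auto intro!: derivative_eq_intros)
    from has_derivative_compose[OF this smooth_on_has_derivative[OF assms(1) i]]
    have "((\<lambda>s. f (s *\<^sub>R x)) has_derivative (\<lambda>h. h *\<^sub>R dir_deriv x f (s *\<^sub>R x))) (at s within {0..1})"
      using linear_scale[OF smooth_on_linear_dir_deriv[OF assms(1) i]] by simp
    from has_derivative_scaleR[OF has_derivative_ident this] show ?thesis
      unfolding has_vector_derivative_def by (simp add: algebra_simps)
  qed
  then have "((\<lambda>s. f (s *\<^sub>R x) + s *\<^sub>R dir_deriv x f (s *\<^sub>R x)) has_integral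
      (1 *\<^sub>R f (1 *\<^sub>R x) - 0 *\<^sub>R f (0 *\<^sub>R x))) {0..1}"
    using fundamental_theorem_of_calculus[of 0 1 "\<lambda>s. s *\<^sub>R f (s *\<^sub>R x)"] by auto
  then show ?thesis by simp
qed

text \<open>Poincare's lemma for one-forms on a ball; the one-form is identified with the vector
  field \<open>\<theta>\<close> by the inner product. Closedness turns the derivative of the radial integral into
  the derivative of \<open>s \<theta>(s x) \<bullet> v\<close>.\<close>

lemma poincare_lemma:
  fixes \<theta> :: "'b::euclidean_space \<Rightarrow> 'b"
  assumes sm: "smooth_on (ball 0 \<rho>) \<theta>"
    and closed: "\<And>x u v. x \<in> ball 0 \<rho> \<Longrightarrow> dir_deriv u \<theta> x \<bullet> v = dir_deriv v \<theta> x \<bullet> u"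
  obtains f :: "'b \<Rightarrow> real" where "smooth_on (ball 0 \<rho>) f" "f 0 = 0"
    "\<And>x. x \<in> ball 0 \<rho> \<Longrightarrow> (f has_derivative (\<lambda>v. \<theta> x \<bullet> v)) (at x)"
proof -
  define f where "f x = x \<bullet> ray_mean \<theta> x" for x
  have smr: "smooth_on (ball 0 \<rho>) (ray_mean \<theta>)" by (rule ray_mean_smooth_on[OF sm])
  have der: "(f has_derivative (\<lambda>v. \<theta> x \<bullet> v)) (at x)" if x: "x \<in> ball 0 \<rho>" for x
  proof -
    let ?I = "\<lambda>v. integral (cbox 0 (1::real)) (\<lambda>s. s *\<^sub>R dir_deriv v \<theta> (s *\<^sub>R x))"
    have "x \<bullet> ?I v + v \<bullet> ray_mean \<theta> x = \<theta> x \<bullet> v" for v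
    proof -
      have i1: "(\<lambda>s. \<theta> (s *\<^sub>R x)) integrable_on cbox 0 (1::real)"
        using ray_integrable[OF smooth_on_continuous_on[OF sm] x, of "\<lambda>_. 1"] by simp
      have i2: "(\<lambda>s. s *\<^sub>R dir_deriv v \<theta> (s *\<^sub>R x)) integrable_on cbox 0 (1::real)" for v
        by (rule ray_integrable[OF smooth_on_continuous_on[OF smooth_on_dir_deriv[OF sm]] x])
          (auto intro: continuous_on_id)
      have "((\<lambda>s. s *\<^sub>R dir_deriv v \<theta> (s *\<^sub>R x) \<bullet> x) has_integral (?I v \<bullet> x)) (cbox 0 1)"
        using has_integral_linear[OF integrable_integral[OF i2[of v]] bounded_linear_inner_left[of x]]
        by (simp add: o_def)
      moreover have "((\<lambda>s. \<theta> (s *\<^sub>R x) \<bullet> v) has_integral (ray_mean \<theta> x \<bullet> v)) (cbox 0 (1::real))"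
        using has_integral_linear[OF integrable_integral[OF i1] bounded_linear_inner_left, of v]
        by (simp add: o_def ray_mean_def)
      ultimately have "((\<lambda>s. s *\<^sub>R dir_deriv v \<theta> (s *\<^sub>R x) \<bullet> x + \<theta> (s *\<^sub>R x) \<bullet> v) has_integral
         (?I v \<bullet> x + ray_mean \<theta> x \<bullet> v)) (cbox 0 (1::real))"
        by (rule has_integral_add)
      moreover have "((\<lambda>s. (\<theta> (s *\<^sub>R x) + s *\<^sub>R dir_deriv x \<theta> (s *\<^sub>R x)) \<bullet> v) has_integral (\<theta> x \<bullet> v))
          (cbox 0 (1::real))"
        using has_integral_linear[OF ray_mean_fundamental_theorem[OF sm x] bounded_linear_inner_left, of v]
        by (simp add: o_def)
      moreover have "(\<theta> (s *\<^sub>R x) + s *\<^sub>R dir_deriv x \<theta> (s *\<^sub>R x)) \<bullet> v =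
          s *\<^sub>R dir_deriv v \<theta> (s *\<^sub>R x) \<bullet> x + \<theta> (s *\<^sub>R x) \<bullet> v" if "s \<in> cbox 0 1" for s :: real
        using closed[OF scaleR_in_ball_0[OF x that], of v x] by (simp add: inner_add_left)
      ultimately show ?thesis
        using has_integral_unique has_integral_eq by (smt (verit) inner_commute)
    qed
    moreover have "(f has_derivative (\<lambda>v. x \<bullet> ?I v + v \<bullet> ray_mean \<theta> x)) (at x)"
      unfolding f_def by (rule has_derivative_inner[OF has_derivative_ident ray_mean_has_derivative[OF sm x]])
    ultimately show ?thesis by simp
  qed
  show thesis
  proof (rule that[OF _ _ der])
    show "smooth_on (ball 0 \<rho>) f"
      unfolding f_def by (intro smooth_on_inner smr smooth_on_linear bounded_linear_ident open_ball)
  qed (simp add: f_def)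
qed

text \<open>Hadamard's lemma. Since the remainder is a combination of the coordinates with
  smooth coefficients, a derivation at the centre is determined by its values on the
  coordinates.\<close>

lemma hadamard_lemma:
  fixes f :: "'b::euclidean_space \<Rightarrow> real"
  assumes sm: "smooth_on (ball 0 \<rho>) f" and x: "x \<in> ball 0 \<rho>"
  shows "f x = f 0 + (\<Sum>b\<in>Basis. (x \<bullet> b) * ray_mean (dir_deriv b f) x)"
proof -
  have i: "(\<lambda>s. dir_deriv b f (s *\<^sub>R x)) integrable_on cbox 0 (1::real)" for b
    using ray_integrable[OF smooth_on_continuous_on[OF smooth_on_dir_deriv[OF sm]] x, of "\<lambda>_. 1"] by simp
  have "((\<lambda>s. f (s *\<^sub>R x)) has_vector_derivative (\<Sum>b\<in>Basis. (x \<bullet> b) * dir_deriv b f (s *\<^sub>R x)))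
     (at s within {0..1})" if "0 \<le> s" "s \<le> 1" for s
  proof -
    have i: "s *\<^sub>R x \<in> ball 0 \<rho>" using scaleR_in_ball_0[OF x] that by simp
    interpret linear "\<lambda>v. dir_deriv v f (s *\<^sub>R x)" by (rule smooth_on_linear_dir_deriv[OF sm i])
    have "((\<lambda>s. s *\<^sub>R x) has_derivative (\<lambda>h. h *\<^sub>R x)) (at s within {0..1})"
      by (auto intro!: derivative_eq_intros)
    from has_derivative_compose[OF this smooth_on_has_derivative[OF sm i]]
    have "((\<lambda>s. f (s *\<^sub>R x)) has_derivative (\<lambda>h. h *\<^sub>R dir_deriv x f (s *\<^sub>R x))) (at s within {0..1})"
      by (simp add: scale)
    moreover have "dir_deriv x f (s *\<^sub>R x) = (\<Sum>b\<in>Basis. (x \<bullet> b) * dir_deriv b f (s *\<^sub>R x))"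
      by (subst (1) euclidean_representation[of x, symmetric]) (simp add: sum scale)
    ultimately show ?thesis by (simp add: has_vector_derivative_def)
  qed
  then have "((\<lambda>s. \<Sum>b\<in>Basis. (x \<bullet> b) * dir_deriv b f (s *\<^sub>R x)) has_integral (f (1 *\<^sub>R x) - f (0 *\<^sub>R x))) {0..1}"
    by (intro fundamental_theorem_of_calculus) auto
  moreover have "((\<lambda>s::real. \<Sum>b\<in>Basis. (x \<bullet> b) * dir_deriv b f (s *\<^sub>R x)) has_integral
     (\<Sum>b\<in>Basis. (x \<bullet> b) * ray_mean (dir_deriv b f) x)) (cbox 0 1)"
    unfolding ray_mean_def
    by (intro has_integral_sum has_integral_mult_right integrable_integral i) auto
  ultimately have "f (1 *\<^sub>R x) - f (0 *\<^sub>R x) = (\<Sum>b\<in>Basis. (x \<bullet> b) * ray_mean (dir_deriv b f) x)"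
    unfolding cbox_interval by (rule has_integral_unique)
  then show ?thesis by simp
qed

section \<open>Bump functions\<close>

text \<open>The powers of \<open>1/t\<close> make the derivatives of the family combinations of
  its members, so that one induction shows the smoothness of all of them.\<close>

definition flat_exp :: "nat \<Rightarrow> real \<Rightarrow> real" where
  "flat_exp m t = (if t > 0 then inverse t ^ m * exp (- inverse t) else 0)"

lemma flat_exp_tendsto_0: "(flat_exp m \<longlongrightarrow> 0) (at 0)"
proof -
  have "((\<lambda>t::real. inverse t ^ m * exp (- inverse t)) \<longlongrightarrow> 0) (at_right 0)"
  proof -
    have "((\<lambda>y::real. y ^ m * exp (- y)) \<longlongrightarrow> 0) at_top"
      using tendsto_power_div_exp_0[of m] by (simp add: exp_minus divide_inverse)
    then show ?thesis
      by (rule filterlim_compose) (rule filterlim_inverse_at_top_right)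
  qed
  then have "(flat_exp m \<longlongrightarrow> 0) (at_right 0)"
    by (rule Lim_transform_eventually) (auto simp: flat_exp_def intro!: eventually_at_rightI[of 0 1])
  moreover have "(flat_exp m \<longlongrightarrow> 0) (at_left 0)"
    by (rule Lim_transform_eventually[of "\<lambda>_. 0"]) (auto simp: flat_exp_def intro!: eventually_at_leftI[of "-1"])
  ultimately show ?thesis by (simp add: filterlim_at_split)
qed

lemma flat_exp_has_derivative:
  "(flat_exp m has_real_derivative (flat_exp (m + 2) t - m * flat_exp (Suc m) t)) (at t)"
proof -
  consider "t > 0" | "t < 0" | "t = 0" by linarith
  then show ?thesis
  proof cases
    case 1
    have "((\<lambda>t. inverse t ^ m) has_real_derivative - (m * inverse t ^ Suc m)) (at t)"
      using 1 DERIV_power[OF DERIV_inverse[of t UNIV], of m] by (cases m) (auto simp: algebra_simps power2_eq_square)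
    moreover have "((\<lambda>t. exp (- inverse t)) has_real_derivative exp (- inverse t) * (inverse t ^ 2)) (at t)"
      using 1 by (auto intro!: derivative_eq_intros simp: power2_eq_square)
    ultimately have "((\<lambda>t. inverse t ^ m * exp (- inverse t)) has_real_derivative
       (flat_exp (m + 2) t - m * flat_exp (Suc m) t)) (at t)"
      by (rule DERIV_cong[OF DERIV_mult]) (use 1 in \<open>simp add: flat_exp_def algebra_simps power2_eq_square\<close>)
    then show ?thesis
      by (rule DERIV_cong_ev[THEN iffD1, OF refl _ refl, rotated])
        (use 1 in \<open>auto simp: flat_exp_def eventually_nhds intro!: exI[of _ "{0<..}"]\<close>)
  next
    case 2
    have "((\<lambda>t. 0) has_real_derivative (flat_exp (m + 2) t - m * flat_exp (Suc m) t)) (at t)"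
      using 2 by (simp add: flat_exp_def)
    then show ?thesis
      by (rule DERIV_cong_ev[THEN iffD1, OF refl _ refl, rotated])
        (use 2 in \<open>auto simp: flat_exp_def eventually_nhds intro!: exI[of _ "{..<0}"]\<close>)
  next
    case 3
    have "(\<lambda>h. (flat_exp m (0 + h) - flat_exp m 0) / h) = flat_exp (Suc m)"
      by (auto simp: flat_exp_def fun_eq_iff divide_inverse)
    then show ?thesis
      using flat_exp_tendsto_0[of "Suc m"] 3 by (simp add: DERIV_def flat_exp_def)
  qed
qed

lemma flat_exp_smooth_on: "smooth_on UNIV (flat_exp m)"
proof (rule smooth_onI)
  show "Ck_on k (flat_exp m) UNIV" for k
  proof (induction k arbitrary: m)
    case 0
    then show ?case
      using DERIV_continuous_on[OF flat_exp_has_derivative[THEN has_field_derivative_at_within]] by auto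
  next
    case (Suc k)
    show ?case
    proof (rule Ck_on_SucI'[OF open_UNIV,
          where f' = "\<lambda>x v. v * flat_exp (m + 2) x + (- real m * v) * flat_exp (Suc m) x"])
      fix x :: real
      show "(flat_exp m has_derivative (\<lambda>v. v * flat_exp (m + 2) x + (- real m * v) * flat_exp (Suc m) x)) (at x)"
        using flat_exp_has_derivative[of m x] unfolding has_field_derivative_def
        by (rule has_derivative_eq_rhs) (auto simp: algebra_simps)
      show "Ck_on k (\<lambda>x. v * flat_exp (m + 2) x + (- real m * v) * flat_exp (Suc m) x) UNIV" for v
        by (intro Ck_on_add Ck_on_linear_comp[OF bounded_linear_mult_right] Suc.IH open_UNIV)
    qed
  qed
qed

definition radial_bump :: "real \<Rightarrow> 'b::euclidean_space \<Rightarrow> real" where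
  "radial_bump r x = flat_exp 0 (r\<^sup>2 - x \<bullet> x)"

lemma norm_sq_smooth_on: "smooth_on UNIV (\<lambda>x::'b::euclidean_space. x \<bullet> x)"
  by (intro smooth_on_inner smooth_on_linear bounded_linear_ident open_UNIV)

lemma radial_bump_smooth_on: "smooth_on UNIV (radial_bump r :: 'b::euclidean_space \<Rightarrow> real)"
  unfolding radial_bump_def
  by (rule smooth_on_compose[OF open_UNIV open_UNIV _ flat_exp_smooth_on])
    (auto intro!: smooth_on_diff smooth_on_const norm_sq_smooth_on)

lemma radial_bump_nonneg: "radial_bump r x \<ge> 0"
  by (simp add: radial_bump_def flat_exp_def)

lemma radial_bump_pos_iff: "r > 0 \<Longrightarrow> radial_bump r x > 0 \<longleftrightarrow> norm x < r"
  using power2_less_imp_less[of "norm x" r] power_strict_mono[of "norm x" r 2]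
  by (auto simp: radial_bump_def flat_exp_def dot_square_norm not_less)

lemma radial_bump_eq_0_iff: "r > 0 \<Longrightarrow> radial_bump r x = 0 \<longleftrightarrow> norm x \<ge> r"
  using radial_bump_pos_iff[of r x] radial_bump_nonneg[of r x] by linarith

text \<open>The quotient \<open>a / (a + b)\<close>, where \<open>a\<close> vanishes outside the
  larger ball and \<open>b\<close> on the smaller one.\<close>

lemma cutoff_exists:
  fixes x0 :: "'b::euclidean_space"
  assumes "0 < r1" "r1 < r2"
  obtains \<eta> :: "'b \<Rightarrow> real" where "smooth_on UNIV \<eta>"
    "\<And>x. norm (x - x0) \<le> r1 \<Longrightarrow> \<eta> x = 1" "\<And>x. norm (x - x0) \<ge> r2 \<Longrightarrow> \<eta> x = 0"
proof -
  define a where "a x = flat_exp 0 (r2\<^sup>2 - (x - x0) \<bullet> (x - x0))" for x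
  define b where "b x = flat_exp 0 ((x - x0) \<bullet> (x - x0) - r1\<^sup>2)" for x
  have le: "norm y \<ge> r \<longleftrightarrow> r\<^sup>2 \<le> y \<bullet> y" if "r > 0" for r and y :: 'b
    using abs_le_square_iff[of r "norm y"] that by (simp add: dot_square_norm)
  have sq: "r1\<^sup>2 < r2\<^sup>2" using assms by (simp add: power_strict_mono)
  have nn: "a x \<ge> 0" "b x \<ge> 0" for x by (auto simp: a_def b_def flat_exp_def)
  have pos: "a x + b x \<noteq> 0" for x
  proof -
    have "(x - x0) \<bullet> (x - x0) < r2\<^sup>2 \<or> r1\<^sup>2 < (x - x0) \<bullet> (x - x0)" using sq by linarith
    then have "a x > 0 \<or> b x > 0" by (auto simp: a_def b_def flat_exp_def)
    with nn[of x] show ?thesis by linarith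
  qed
  have q: "smooth_on UNIV (\<lambda>x. (x - x0) \<bullet> (x - x0))"
    by (intro smooth_on_inner smooth_on_diff smooth_on_const smooth_on_linear bounded_linear_ident open_UNIV)
  have sa: "smooth_on UNIV a" "smooth_on UNIV b"
    unfolding a_def b_def
    by (rule smooth_on_compose[OF open_UNIV open_UNIV _ flat_exp_smooth_on];
      auto intro!: smooth_on_diff smooth_on_const q)+
  have "smooth_on UNIV (\<lambda>x. inverse (a x + b x))"
    by (rule smooth_on_compose[OF open_UNIV _ _ smooth_on_inverse])
      (use pos in \<open>auto intro!: smooth_on_add sa simp: open_Collect_neq\<close>)
  then have "smooth_on UNIV (\<lambda>x. a x * inverse (a x + b x))"
    by (intro smooth_on_mult sa open_UNIV)
  moreover have "a x * inverse (a x + b x) = 1" if "norm (x - x0) \<le> r1" for x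
  proof -
    have "(x - x0) \<bullet> (x - x0) \<le> r1\<^sup>2" using that by (metis dot_square_norm norm_ge_zero power_mono)
    then have "b x = 0" by (simp add: b_def flat_exp_def)
    then show ?thesis using pos[of x] by simp
  qed
  moreover have "a x * inverse (a x + b x) = 0" if "norm (x - x0) \<ge> r2" for x
    using that le[of r2 "x - x0"] assms by (simp add: a_def flat_exp_def)
  ultimately show thesis by (rule that)
qed

section \<open>Linear total differential systems\<close>

lemma linear_basis_expansion:
  fixes L :: "'b::euclidean_space \<Rightarrow> 'c::real_vector"
  assumes "linear L"
  shows "L v = (\<Sum>b\<in>Basis. (v \<bullet> b) *\<^sub>R L b)"
  using linear_sum[OF assms, of "\<lambda>b. (v \<bullet> b) *\<^sub>R b" Basis]
  by (simp add: euclidean_representation linear_scale[OF assms])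

text \<open>The systems \<open>d\<theta> v = M x v \<theta>\<close> whose coefficients satisfy the zero curvature condition.
  Parallel transport along rays is obtained by Picard iteration; the condition makes the defect
  \<open>d\<theta> v - M x v \<theta>\<close> of the iterates contract together with the iterates themselves, so that
  the limit is parallel in all directions and not only along rays.\<close>

locale integrable_system =
  fixes M :: "'b::euclidean_space \<Rightarrow> 'b \<Rightarrow> 'c::euclidean_space \<Rightarrow> 'c" and \<rho> :: real
  assumes \<rho>: "\<rho> > 0"
    and lin1: "x \<in> ball 0 \<rho> \<Longrightarrow> linear (\<lambda>v. M x v c)"
    and lin2: "x \<in> ball 0 \<rho> \<Longrightarrow> linear (M x v)"
    and smooth: "smooth_on (ball 0 \<rho>) (\<lambda>x. M x v c)"
    and integrability: "x \<in> ball 0 \<rho> \<Longrightarrow>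
      dir_deriv u (\<lambda>y. M y v c) x + M x v (M x u c) = dir_deriv v (\<lambda>y. M y u c) x + M x u (M x v c)"
begin

lemma coefficient_bound:
  obtains C where "C > 0"
    "\<And>x v c. x \<in> ball 0 (\<rho>/2) \<Longrightarrow> norm (M x v c) \<le> C * norm v * norm c"
proof -
  have "\<exists>B. \<forall>x\<in>cball 0 (\<rho>/2). norm (M x a b) \<le> B" for a b
  proof -
    have "continuous_on (cball 0 (\<rho>/2)) (\<lambda>x. M x a b)"
      by (rule continuous_on_subset[OF smooth_on_continuous_on[OF smooth]]) (use \<rho> in auto)
    then have "bounded ((\<lambda>x. M x a b) ` cball 0 (\<rho>/2))"
      by (intro compact_imp_bounded compact_continuous_image) auto
    then show ?thesis by (auto simp: bounded_iff)
  qed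
  then obtain B where B: "\<And>a b x. x \<in> cball 0 (\<rho>/2) \<Longrightarrow> norm (M x a b) \<le> B a b" by metis
  define C where "C = (\<Sum>a\<in>Basis. \<Sum>b\<in>Basis. \<bar>B a b\<bar>) + 1"
  have "norm (M x v c) \<le> C * norm v * norm c" if x: "x \<in> ball 0 (\<rho>/2)" for x v c
  proof -
    have x': "x \<in> ball 0 \<rho>" "x \<in> cball 0 (\<rho>/2)" using x \<rho> by auto
    have "M x v c = (\<Sum>a\<in>Basis. \<Sum>b\<in>Basis. (v \<bullet> a) *\<^sub>R (c \<bullet> b) *\<^sub>R M x a b)"
    proof -
      have "M x v c = (\<Sum>a\<in>Basis. (v \<bullet> a) *\<^sub>R M x a c)"
        by (rule linear_basis_expansion[OF lin1[OF x'(1)]])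
      also have "\<dots> = (\<Sum>a\<in>Basis. (v \<bullet> a) *\<^sub>R (\<Sum>b\<in>Basis. (c \<bullet> b) *\<^sub>R M x a b))"
        by (subst linear_basis_expansion[OF lin2[OF x'(1)]]) (rule refl)
      finally show ?thesis by (simp add: scaleR_sum_right)
    qed
    also have "norm \<dots> \<le> (\<Sum>a\<in>Basis. \<Sum>b\<in>Basis. \<bar>B a b\<bar> * (norm v * norm c))"
    proof (rule order_trans[OF norm_sum] sum_mono)+
      fix a :: 'b and b :: 'c assume "a \<in> Basis" "b \<in> Basis"
      then have 1: "\<bar>v \<bullet> a\<bar> * \<bar>c \<bullet> b\<bar> \<le> norm v * norm c"
        by (intro mult_mono Basis_le_norm) auto
      have 2: "norm (M x a b) \<le> \<bar>B a b\<bar>" using B[OF x'(2), of a b] by linarith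
      show "norm ((v \<bullet> a) *\<^sub>R (c \<bullet> b) *\<^sub>R M x a b) \<le> \<bar>B a b\<bar> * (norm v * norm c)"
        using mult_mono[OF 1 2] by (simp add: abs_mult mult_ac)
    qed
    also have "\<dots> = (C - 1) * (norm v * norm c)" by (simp add: C_def sum_distrib_right)
    also have "\<dots> \<le> C * (norm v * norm c)" by (intro mult_right_mono) auto
    finally show ?thesis by (simp add: mult_ac)
  qed
  moreover have "C > 0" by (simp add: C_def add_nonneg_pos sum_nonneg)
  ultimately show thesis using that by blast
qed

lemma along_Ck_on:
  assumes "Ck_on k \<theta> (ball 0 r)" "r \<le> \<rho>"
  shows "Ck_on k (\<lambda>x. M x v (\<theta> x)) (ball 0 r)"
proof (rule Ck_on_cong_imp[OF open_ball])
  have "Ck_on k (\<lambda>x. M x v b) (ball 0 r)" for b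
    using smooth[of v b] \<open>r \<le> \<rho>\<close> by (auto simp: smooth_on_def intro: Ck_on_subset)
  then show "Ck_on k (\<lambda>x. \<Sum>b\<in>Basis. (\<theta> x \<bullet> b) *\<^sub>R M x v b) (ball 0 r)"
    by (intro Ck_on_sum Ck_on_bilinear[OF bounded_bilinear_scaleR]
        Ck_on_linear_comp[OF bounded_linear_inner_left] assms(1)) auto
  show "(\<Sum>b\<in>Basis. (\<theta> x \<bullet> b) *\<^sub>R M x v b) = M x v (\<theta> x)" if "x \<in> ball 0 r" for x
  proof -
    have x: "x \<in> ball 0 \<rho>" using that \<open>r \<le> \<rho>\<close> by auto
    show ?thesis
      by (rule linear_basis_expansion[OF lin2[OF x], symmetric])
  qed
qed

lemma along_smooth_on:
  "smooth_on (ball 0 r) \<theta> \<Longrightarrow> r \<le> \<rho> \<Longrightarrow> smooth_on (ball 0 r) (\<lambda>x. M x v (\<theta> x))"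
  by (simp add: smooth_on_def along_Ck_on)

lemma dir_deriv_along:
  assumes "smooth_on (ball 0 r) \<theta>" "r \<le> \<rho>" "x \<in> ball 0 r"
  shows "dir_deriv u (\<lambda>y. M y v (\<theta> y)) x = dir_deriv u (\<lambda>y. M y v (\<theta> x)) x + M x v (dir_deriv u \<theta> x)"
proof -
  have x: "x \<in> ball 0 \<rho>" using assms by auto
  have rep: "M y v c = (\<Sum>b\<in>Basis. (c \<bullet> b) *\<^sub>R M y v b)" if "y \<in> ball 0 \<rho>" for y c
      by (rule linear_basis_expansion[OF lin2[OF that]])
  note D\<theta> = smooth_on_has_derivative[OF assms(1,3)]
  note DM = smooth_on_has_derivative[OF smooth x]
  have "((\<lambda>y. \<Sum>b\<in>Basis. (\<theta> y \<bullet> b) *\<^sub>R M y v b) has_derivative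
     (\<lambda>u. \<Sum>b\<in>Basis. (\<theta> x \<bullet> b) *\<^sub>R dir_deriv u (\<lambda>y. M y v b) x + (dir_deriv u \<theta> x \<bullet> b) *\<^sub>R M x v b)) (at x)"
    by (intro has_derivative_sum has_derivative_scaleR DM has_derivative_inner_left D\<theta>)
  then have "((\<lambda>y. M y v (\<theta> y)) has_derivative
     (\<lambda>u. \<Sum>b\<in>Basis. (\<theta> x \<bullet> b) *\<^sub>R dir_deriv u (\<lambda>y. M y v b) x + (dir_deriv u \<theta> x \<bullet> b) *\<^sub>R M x v b)) (at x)"
    by (rule has_derivative_transform_within_open[OF _ open_ball x]) (simp flip: rep)
  from dir_deriv_eq[OF this]
  have 1: "dir_deriv u (\<lambda>y. M y v (\<theta> y)) x = (\<Sum>b\<in>Basis. (\<theta> x \<bullet> b) *\<^sub>R dir_deriv u (\<lambda>y. M y v b) x)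
     + M x v (dir_deriv u \<theta> x)"
    by (simp add: sum.distrib flip: rep[OF x])
  have "((\<lambda>y. \<Sum>b\<in>Basis. (\<theta> x \<bullet> b) *\<^sub>R M y v b) has_derivative
     (\<lambda>u. \<Sum>b\<in>Basis. (\<theta> x \<bullet> b) *\<^sub>R dir_deriv u (\<lambda>y. M y v b) x)) (at x)"
    by (intro has_derivative_sum has_derivative_scaleR_right DM)
  then have "((\<lambda>y. M y v (\<theta> x)) has_derivative
     (\<lambda>u. \<Sum>b\<in>Basis. (\<theta> x \<bullet> b) *\<^sub>R dir_deriv u (\<lambda>y. M y v b) x)) (at x)"
    by (rule has_derivative_transform_within_open[OF _ open_ball x]) (simp flip: rep)
  from dir_deriv_eq[OF this] 1 show ?thesis by simp
qed

text \<open>The integral of \<open>M (s x) x (\<theta> (s x))\<close> over \<open>0 \<le> s \<le> 1\<close>, expanded in the basis so that it is a combination of ray means.\<close>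

definition picard :: "'c \<Rightarrow> ('b \<Rightarrow> 'c) \<Rightarrow> 'b \<Rightarrow> 'c" where
  "picard c \<theta> x = c + (\<Sum>b\<in>Basis. (x \<bullet> b) *\<^sub>R ray_mean (\<lambda>y. M y b (\<theta> y)) x)"

lemma picard_smooth_on:
  assumes "smooth_on (ball 0 r) \<theta>" "r \<le> \<rho>"
  shows "smooth_on (ball 0 r) (picard c \<theta>)"
  unfolding picard_def
  by (intro smooth_on_add smooth_on_const smooth_on_sum smooth_on_scaleR smooth_on_inner_const
      smooth_on_linear bounded_linear_ident ray_mean_smooth_on along_smooth_on assms open_ball)

lemma picard_has_integral:
  assumes "smooth_on (ball 0 r) \<theta>" "r \<le> \<rho>" "x \<in> ball 0 r"
  shows "((\<lambda>s. M (s *\<^sub>R x) x (\<theta> (s *\<^sub>R x))) has_integral picard c \<theta> x - c) (cbox 0 (1::real))"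
proof -
  have "(\<lambda>s. M (s *\<^sub>R x) b (\<theta> (s *\<^sub>R x))) integrable_on cbox 0 (1::real)" for b
    using ray_integrable[OF smooth_on_continuous_on[OF along_smooth_on[OF assms(1,2)]] assms(3), of "\<lambda>_. 1"]
    by simp
  then have "((\<lambda>s. \<Sum>b\<in>Basis. (x \<bullet> b) *\<^sub>R M (s *\<^sub>R x) b (\<theta> (s *\<^sub>R x))) has_integral picard c \<theta> x - c) (cbox 0 (1::real))"
    unfolding picard_def ray_mean_def
    by (simp only: add_diff_cancel_left') (intro has_integral_sum has_integral_cmul integrable_integral, auto)
  then show ?thesis
  proof (rule has_integral_eq[rotated])
    fix s :: real assume "s \<in> cbox 0 1"
    then have sx: "s *\<^sub>R x \<in> ball 0 \<rho>" using scaleR_in_ball_0[OF assms(3)] assms(2) by fastforce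
    show "(\<Sum>b\<in>Basis. (x \<bullet> b) *\<^sub>R M (s *\<^sub>R x) b (\<theta> (s *\<^sub>R x))) = M (s *\<^sub>R x) x (\<theta> (s *\<^sub>R x))"
      by (rule linear_basis_expansion[OF lin1[OF sx], symmetric])
  qed
qed

text \<open>Differentiation under the integral and integration by parts along the ray leave the
  antisymmetrised derivative of \<open>M x v (\<theta> x)\<close>. The zero curvature condition
  cancels all of it except terms that are linear in the defect \<open>E\<close> of
  \<open>\<theta>\<close>: the defect of an iterate is an integral of the preceding one.\<close>

lemma picard_defect:
  assumes sm: "smooth_on (ball 0 r) \<theta>" and r: "r \<le> \<rho>" and x: "x \<in> ball 0 r"
  defines "E \<equiv> \<lambda>y v. dir_deriv v \<theta> y - M y v (\<theta> y)"
  shows "((\<lambda>s. s *\<^sub>R (M (s *\<^sub>R x) x (E (s *\<^sub>R x) v) - M (s *\<^sub>R x) v (E (s *\<^sub>R x) x))) has_integral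
      dir_deriv v (picard c \<theta>) x - M x v (\<theta> x)) (cbox 0 (1::real))"
proof -
  define W where "W v y = M y v (\<theta> y)" for v y
  have smW: "smooth_on (ball 0 r) (W v)" for v unfolding W_def by (rule along_smooth_on[OF sm r])
  have linW: "W v y = (\<Sum>b\<in>Basis. (v \<bullet> b) *\<^sub>R W b y)" if "y \<in> ball 0 r" for v y
  proof -
    have y: "y \<in> ball 0 \<rho>" using that r by auto
    show ?thesis unfolding W_def
      by (rule linear_basis_expansion[OF lin1[OF y]])
  qed
  have dW: "dir_deriv u (W v) y = (\<Sum>b\<in>Basis. (v \<bullet> b) *\<^sub>R dir_deriv u (W b) y)" if y: "y \<in> ball 0 r" for u v y
  proof -
    have "((\<lambda>y. \<Sum>b\<in>Basis. (v \<bullet> b) *\<^sub>R W b y) has_derivative (\<lambda>u. \<Sum>b\<in>Basis. (v \<bullet> b) *\<^sub>R dir_deriv u (W b) y)) (at y)"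
      by (intro has_derivative_sum has_derivative_scaleR_right smooth_on_has_derivative[OF smW y])
    then have "(W v has_derivative (\<lambda>u. \<Sum>b\<in>Basis. (v \<bullet> b) *\<^sub>R dir_deriv u (W b) y)) (at y)"
      by (rule has_derivative_transform_within_open[OF _ open_ball y]) (simp flip: linW)
    from dir_deriv_eq[OF this] show ?thesis .
  qed
  have int: "(\<lambda>s. W b (s *\<^sub>R x)) integrable_on cbox 0 (1::real)" for b
    using ray_integrable[OF smooth_on_continuous_on[OF smW] x, of "\<lambda>_. 1"] by simp
  have int': "(\<lambda>s. s *\<^sub>R dir_deriv v (W b) (s *\<^sub>R x)) integrable_on cbox 0 (1::real)" for b
    by (rule ray_integrable[OF smooth_on_continuous_on[OF smooth_on_dir_deriv[OF smW]] x]) (auto intro: continuous_on_id)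
  have sx: "s *\<^sub>R x \<in> ball 0 r" if "s \<in> cbox 0 1" for s :: real using scaleR_in_ball_0[OF x that] .
  have "(picard c \<theta> has_derivative (\<lambda>v. 0 + (\<Sum>b\<in>Basis. (x \<bullet> b) *\<^sub>R
       integral (cbox 0 (1::real)) (\<lambda>s. s *\<^sub>R dir_deriv v (W b) (s *\<^sub>R x)) + (v \<bullet> b) *\<^sub>R ray_mean (W b) x))) (at x)"
    unfolding picard_def W_def[symmetric]
    by (intro has_derivative_add has_derivative_const has_derivative_sum has_derivative_scaleR
        has_derivative_inner_left has_derivative_ident ray_mean_has_derivative[OF smW x])
  from dir_deriv_eq[OF this]
  have d: "dir_deriv v (picard c \<theta>) x = (\<Sum>b\<in>Basis. (x \<bullet> b) *\<^sub>R
       integral (cbox 0 (1::real)) (\<lambda>s. s *\<^sub>R dir_deriv v (W b) (s *\<^sub>R x)) + (v \<bullet> b) *\<^sub>R ray_mean (W b) x)"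
    by simp
  have "((\<lambda>s. \<Sum>b\<in>Basis. (x \<bullet> b) *\<^sub>R (s *\<^sub>R dir_deriv v (W b) (s *\<^sub>R x)) + (v \<bullet> b) *\<^sub>R W b (s *\<^sub>R x))
      has_integral dir_deriv v (picard c \<theta>) x) (cbox 0 (1::real))"
    unfolding d ray_mean_def
    by (intro has_integral_sum has_integral_add has_integral_cmul integrable_integral int int') auto
  from has_integral_diff[OF this ray_mean_fundamental_theorem[OF smW x, of v]]
  have "((\<lambda>s. (\<Sum>b\<in>Basis. (x \<bullet> b) *\<^sub>R (s *\<^sub>R dir_deriv v (W b) (s *\<^sub>R x)) + (v \<bullet> b) *\<^sub>R W b (s *\<^sub>R x))
       - (W v (s *\<^sub>R x) + s *\<^sub>R dir_deriv x (W v) (s *\<^sub>R x)))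
      has_integral dir_deriv v (picard c \<theta>) x - M x v (\<theta> x)) (cbox 0 (1::real))"
    by (simp add: W_def)
  then show ?thesis
  proof (rule has_integral_eq[rotated])
    fix s :: real assume s: "s \<in> cbox 0 1"
    let ?y = "s *\<^sub>R x"
    note y = sx[OF s]
    have y': "?y \<in> ball 0 \<rho>" using y r by auto
    have "(\<Sum>b\<in>Basis. (x \<bullet> b) *\<^sub>R (s *\<^sub>R dir_deriv v (W b) ?y) + (v \<bullet> b) *\<^sub>R W b ?y)
        = s *\<^sub>R dir_deriv v (W x) ?y + W v ?y"
      unfolding dW[OF y, where u = v and v = x] linW[OF y, where v = v]
      by (simp add: sum.distrib scaleR_sum_right mult.commute)
    then have "(\<Sum>b\<in>Basis. (x \<bullet> b) *\<^sub>R (s *\<^sub>R dir_deriv v (W b) ?y) + (v \<bullet> b) *\<^sub>R W b ?y)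
        - (W v ?y + s *\<^sub>R dir_deriv x (W v) ?y)
      = s *\<^sub>R (dir_deriv v (W x) ?y - dir_deriv x (W v) ?y)"
      by (simp add: algebra_simps)
    also have "dir_deriv v (W x) ?y - dir_deriv x (W v) ?y = M ?y x (E ?y v) - M ?y v (E ?y x)"
    proof -
      have "dir_deriv v (W x) ?y - dir_deriv x (W v) ?y =
         (dir_deriv v (\<lambda>y. M y x (\<theta> ?y)) ?y - dir_deriv x (\<lambda>y. M y v (\<theta> ?y)) ?y)
         + M ?y x (dir_deriv v \<theta> ?y) - M ?y v (dir_deriv x \<theta> ?y)"
        unfolding W_def dir_deriv_along[OF sm r y] by simp
      also have "dir_deriv v (\<lambda>y. M y x (\<theta> ?y)) ?y - dir_deriv x (\<lambda>y. M y v (\<theta> ?y)) ?y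
         = M ?y v (M ?y x (\<theta> ?y)) - M ?y x (M ?y v (\<theta> ?y))"
        using integrability[OF y', where u = v and v = x and c = "\<theta> ?y"] by (simp add: algebra_simps)
      finally show ?thesis
        unfolding E_def by (simp add: linear_diff[OF lin2[OF y']])
    qed
    finally show "(\<Sum>b\<in>Basis. (x \<bullet> b) *\<^sub>R (s *\<^sub>R dir_deriv v (W b) ?y) + (v \<bullet> b) *\<^sub>R W b ?y)
        - (W v ?y + s *\<^sub>R dir_deriv x (W v) ?y) = s *\<^sub>R (M ?y x (E ?y v) - M ?y v (E ?y x))" .
  qed
qed

lemma unit_integral_bound:
  fixes f :: "real \<Rightarrow> 'c"
  assumes "(f has_integral I) (cbox 0 1)" "\<And>s. s \<in> cbox 0 1 \<Longrightarrow> norm (f s) \<le> B"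
  shows "norm I \<le> B"
  using has_integral_bound[of B f I 0 1] assms norm_ge_zero order_trans[OF norm_ge_zero assms(2)[of 0]]
  by (auto)

text \<open>On a ball so small that \<open>C r \<le> 1/4\<close> consecutive iterates differ by
  a multiple of \<open>4\<^sup>-\<^sup>n\<close> and their defects are bounded by a multiple of
  \<open>(n + 1) 2\<^sup>-\<^sup>n\<close>. Hence the derivatives converge uniformly, and the
  limit satisfies the equation in every direction.\<close>

theorem solution_exists:
  obtains r where "0 < r" "r \<le> \<rho>"
    "\<And>c. \<exists>\<theta>. smooth_on (ball 0 r) \<theta> \<and> \<theta> 0 = c \<and>
       (\<forall>x\<in>ball 0 r. (\<theta> has_derivative (\<lambda>v. M x v (\<theta> x))) (at x))"
proof -
  obtain C where C: "C > 0" "\<And>x v c. x \<in> ball 0 (\<rho>/2) \<Longrightarrow> norm (M x v c) \<le> C * norm v * norm c"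
    using coefficient_bound by blast
  define r where "r = min (\<rho>/2) (1 / (4 * C))"
  have r: "0 < r" "r \<le> \<rho>" "r \<le> \<rho>/2" "C * r \<le> 1/4"
    using C \<rho> by (auto simp: r_def min_def field_simps)
  have Mb: "norm (M (s *\<^sub>R x) v c) \<le> C * norm v * norm c" if "x \<in> ball 0 r" "s \<in> cbox 0 1" for s :: real and x v c
    by (rule C(2)) (use scaleR_in_ball_0[OF that] r in auto)
  have Mb1: "norm (M (s *\<^sub>R x) x c) \<le> 1/4 * norm c" if "x \<in> ball 0 r" "s \<in> cbox 0 1" for s :: real and x c
  proof -
    have "C * norm x \<le> C * r" using that C by (intro mult_left_mono) auto
    then have "C * norm x * norm c \<le> 1/4 * norm c" using r by (intro mult_right_mono) auto
    then show ?thesis using Mb[OF that, of x c] by linarith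
  qed
  have "\<exists>\<theta>. smooth_on (ball 0 r) \<theta> \<and> \<theta> 0 = c \<and>
       (\<forall>x\<in>ball 0 r. (\<theta> has_derivative (\<lambda>v. M x v (\<theta> x))) (at x))" for c
  proof -
    define \<Theta> where "\<Theta> n = (picard c ^^ n) (\<lambda>_. c)" for n
    have \<Theta>_Suc: "\<Theta> (Suc n) = picard c (\<Theta> n)" and \<Theta>_0: "\<Theta> 0 = (\<lambda>_. c)" for n by (auto simp: \<Theta>_def)
    have sm: "smooth_on (ball 0 r) (\<Theta> n)" for n
      by (induction n) (auto simp: \<Theta>_Suc \<Theta>_0 intro: smooth_on_const picard_smooth_on r)
    have at0: "\<Theta> n 0 = c" for n by (cases n) (auto simp: \<Theta>_Suc \<Theta>_0 picard_def)
    have inr: "s *\<^sub>R x \<in> ball 0 \<rho>" if "x \<in> ball 0 r" "s \<in> cbox 0 1" for s :: real and x :: 'b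
      using scaleR_in_ball_0[OF that] r by auto
    have step: "norm (\<Theta> (Suc n) x - \<Theta> n x) \<le> norm c * (1/4) ^ Suc n" if "x \<in> ball 0 r" for n x
      using that
    proof (induction n arbitrary: x)
      case 0
      have "norm (picard c (\<Theta> 0) x - c) \<le> 1/4 * norm c"
        by (rule unit_integral_bound[OF picard_has_integral[OF sm r(2) "0.prems", of 0 c]])
          (use Mb1[OF "0.prems"] in \<open>simp add: \<Theta>_0\<close>)
      then show ?case by (simp add: \<Theta>_Suc \<Theta>_0)
    next
      case (Suc n)
      have "((\<lambda>s. M (s *\<^sub>R x) x (\<Theta> (Suc n) (s *\<^sub>R x) - \<Theta> n (s *\<^sub>R x))) has_integral \<Theta> (Suc (Suc n)) x - \<Theta> (Suc n) x) (cbox 0 (1::real))"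
      proof (rule has_integral_eq)
        show "((\<lambda>s. M (s *\<^sub>R x) x (\<Theta> (Suc n) (s *\<^sub>R x)) - M (s *\<^sub>R x) x (\<Theta> n (s *\<^sub>R x))) has_integral \<Theta> (Suc (Suc n)) x - \<Theta> (Suc n) x) (cbox 0 (1::real))"
          using has_integral_diff[OF picard_has_integral[OF sm[of "Suc n"] r(2) Suc.prems, of c]
              picard_has_integral[OF sm[of n] r(2) Suc.prems, of c]] by (simp add: \<Theta>_Suc)
      qed (use inr[OF Suc.prems] in \<open>simp add: linear_diff[OF lin2]\<close>)
      moreover have "norm (M (s *\<^sub>R x) x (\<Theta> (Suc n) (s *\<^sub>R x) - \<Theta> n (s *\<^sub>R x))) \<le> norm c * (1/4) ^ Suc (Suc n)"
        if s: "s \<in> cbox 0 1" for s :: real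
        using order_trans[OF Mb1[OF Suc.prems s] mult_left_mono[OF Suc.IH[OF scaleR_in_ball_0[OF Suc.prems s]]]]
        by simp
      ultimately show ?case by (rule unit_integral_bound)
    qed
    define K where "K = C * norm c"
    have K: "K \<ge> 0" using C by (simp add: K_def)
    have defect: "norm (dir_deriv v (\<Theta> n) x - M x v (\<Theta> n x)) \<le> K * (real n + 1) * (1/2) ^ n * norm v"
      if "x \<in> ball 0 r" for n x v
      using that
    proof (induction n arbitrary: x v)
      case 0
      then show ?case
        using Mb[OF 0, of 1 v c] by (simp add: \<Theta>_0 K_def mult_ac)
    next
      case (Suc n)
      note x = Suc.prems
      let ?e = "K * (real n + 1) * (1/2) ^ n"
      have e0: "?e \<ge> 0" using K by simp
      define E where "E y v = dir_deriv v (\<Theta> n) y - M y v (\<Theta> n y)" for y v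
      have Eb: "norm (E (s *\<^sub>R x) v) \<le> ?e * norm v" if "s \<in> cbox 0 1" for s :: real and v
        unfolding E_def by (rule Suc.IH[OF scaleR_in_ball_0[OF x that]])
      have "norm (dir_deriv v (\<Theta> (Suc n)) x - M x v (\<Theta> n x)) \<le> 1/2 * ?e * norm v"
        unfolding \<Theta>_Suc
      proof (rule unit_integral_bound[OF picard_defect[OF sm r(2) x]])
        fix s :: real assume s: "s \<in> cbox 0 1"
        have 1: "norm (M (s *\<^sub>R x) x (E (s *\<^sub>R x) v)) \<le> 1/4 * (?e * norm v)"
          using Mb1[OF x s, of "E (s *\<^sub>R x) v"] Eb[OF s, of v] by linarith
        have "norm (M (s *\<^sub>R x) v (E (s *\<^sub>R x) x)) \<le> C * norm v * (?e * norm x)"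
          by (rule order_trans[OF Mb[OF x s]], rule mult_left_mono[OF Eb[OF s]]) (use C in simp)
        also have "\<dots> = (C * norm x) * (?e * norm v)" by simp
        also have "\<dots> \<le> 1/4 * (?e * norm v)"
        proof (rule mult_right_mono)
          have "C * norm x \<le> C * r" using C x by (intro mult_left_mono) auto
          then show "C * norm x \<le> 1/4" using r by linarith
        qed (use e0 in auto)
        finally have 2: "norm (M (s *\<^sub>R x) v (E (s *\<^sub>R x) x)) \<le> 1/4 * (?e * norm v)" .
        have "norm (M (s *\<^sub>R x) x (E (s *\<^sub>R x) v) - M (s *\<^sub>R x) v (E (s *\<^sub>R x) x)) \<le> 1/2 * ?e * norm v"
          using norm_triangle_ineq4[of "M (s *\<^sub>R x) x (E (s *\<^sub>R x) v)" "M (s *\<^sub>R x) v (E (s *\<^sub>R x) x)"] 1 2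
          by linarith
        moreover have "s * norm (M (s *\<^sub>R x) x (E (s *\<^sub>R x) v) - M (s *\<^sub>R x) v (E (s *\<^sub>R x) x)) \<le>
            1 * norm (M (s *\<^sub>R x) x (E (s *\<^sub>R x) v) - M (s *\<^sub>R x) v (E (s *\<^sub>R x) x))"
          using s by (intro mult_right_mono) auto
        ultimately show "norm (s *\<^sub>R (M (s *\<^sub>R x) x (dir_deriv v (\<Theta> n) (s *\<^sub>R x) - M (s *\<^sub>R x) v (\<Theta> n (s *\<^sub>R x)))
            - M (s *\<^sub>R x) v (dir_deriv x (\<Theta> n) (s *\<^sub>R x) - M (s *\<^sub>R x) x (\<Theta> n (s *\<^sub>R x))))) \<le> 1/2 * ?e * norm v"
          using s by (simp add: E_def)
      qed
      moreover have "norm (M x v (\<Theta> n x) - M x v (\<Theta> (Suc n) x)) \<le> K * (1/2) ^ Suc n * norm v"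
      proof -
        have "norm (M x v (\<Theta> n x) - M x v (\<Theta> (Suc n) x)) = norm (M (1 *\<^sub>R x) v (\<Theta> n x - \<Theta> (Suc n) x))"
          using inr[OF x, of 1] by (simp add: linear_diff[OF lin2])
        also have "\<dots> \<le> C * norm v * norm (\<Theta> n x - \<Theta> (Suc n) x)" by (rule Mb[OF x]) simp
        also have "\<dots> \<le> C * norm v * (norm c * (1/4) ^ Suc n)"
          using step[OF x, of n] C by (intro mult_left_mono) (auto simp: norm_minus_commute)
        also have "\<dots> \<le> C * norm v * (norm c * (1/2) ^ Suc n)"
          using C by (intro mult_left_mono power_mono) auto
        finally show ?thesis by (simp add: K_def mult_ac)
      qed
      ultimately have "norm (dir_deriv v (\<Theta> (Suc n)) x - M x v (\<Theta> (Suc n) x)) \<le>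
          1/2 * ?e * norm v + K * (1/2) ^ Suc n * norm v"
        using norm_triangle_ineq[of "dir_deriv v (\<Theta> (Suc n)) x - M x v (\<Theta> n x)" "M x v (\<Theta> n x) - M x v (\<Theta> (Suc n) x)"]
        by simp
      also have "\<dots> = K * (real (Suc n) + 1) * (1/2) ^ Suc n * norm v" by (simp add: algebra_simps)
      finally show ?case .
    qed
    have tel: "c + (\<Sum>i<n. \<Theta> (Suc i) x - \<Theta> i x) = \<Theta> n x" for n x
      using sum_lessThan_telescope[of "\<lambda>i. \<Theta> i x" n] by (simp add: \<Theta>_0)
    define \<theta> where "\<theta> x = c + (\<Sum>n. \<Theta> (Suc n) x - \<Theta> n x)" for x
    have "uniform_limit (ball 0 r) (\<lambda>n x. \<Sum>i<n. \<Theta> (Suc i) x - \<Theta> i x) (\<lambda>x. \<Sum>n. \<Theta> (Suc n) x - \<Theta> n x) sequentially"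
    proof (rule Weierstrass_m_test[OF step])
      show "summable (\<lambda>n. norm c * (1/4::real) ^ Suc n)"
        by (intro summable_mult) (simp add: summable_geometric)
    qed
    from uniform_limit_add[OF uniform_limit_const this]
    have lim: "uniform_limit (ball 0 r) \<Theta> \<theta> sequentially"
      unfolding \<theta>_def by (rule uniform_limit_cong'[THEN iffD1, rotated 2])
        (auto simp: tel)
    have conv: "(\<lambda>n. \<Theta> n x) \<longlonglongrightarrow> \<theta> x" if "x \<in> ball 0 r" for x
      using tendsto_uniform_limitI[OF lim that] .
    have dlim: "\<forall>\<^sub>F n in sequentially. \<forall>x\<in>ball 0 r. \<forall>h. norm (dir_deriv h (\<Theta> n) x - M x h (\<theta> x)) \<le> e * norm h"
      if "e > 0" for e
    proof -
      have "(\<lambda>n. K * (real n + 1) * (1/2) ^ n) \<longlonglongrightarrow> K * 0"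
      proof -
        have "(\<lambda>n. real n * (1/2) ^ n) \<longlonglongrightarrow> 0" by (rule powser_times_n_limit_0) simp
        moreover have "(\<lambda>n. (1/2::real) ^ n) \<longlonglongrightarrow> 0" by (rule LIMSEQ_power_zero) simp
        ultimately have "(\<lambda>n. real n * (1/2) ^ n + (1/2) ^ n) \<longlonglongrightarrow> 0 + 0" by (rule tendsto_add)
        from tendsto_mult_left[OF this, of K] show ?thesis by (simp add: algebra_simps)
      qed
      then have "\<forall>\<^sub>F n in sequentially. K * (real n + 1) * (1/2) ^ n < e/2"
        using \<open>e > 0\<close> by (intro order_tendstoD) auto
      moreover have "\<forall>\<^sub>F n in sequentially. \<forall>x\<in>ball 0 r. dist (\<Theta> n x) (\<theta> x) < e / (2 * C)"
        using lim \<open>e > 0\<close> C by (auto simp: uniform_limit_iff)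
      ultimately show ?thesis
      proof eventually_elim
        case (elim n)
        show ?case
        proof (intro ballI allI)
          fix x h :: 'b assume x: "x \<in> ball 0 r"
          have "norm (M x h (\<Theta> n x) - M x h (\<theta> x)) = norm (M (1 *\<^sub>R x) h (\<Theta> n x - \<theta> x))"
            using inr[OF x, of 1] by (simp add: linear_diff[OF lin2])
          also have "\<dots> \<le> C * norm h * norm (\<Theta> n x - \<theta> x)" by (rule Mb[OF x]) simp
          also have "\<dots> \<le> C * norm h * (e / (2 * C))"
            using elim(2) x C by (intro mult_left_mono) (auto simp: dist_norm less_imp_le)
          also have "\<dots> = e/2 * norm h" using C by (simp add: field_simps)
          finally have "norm (M x h (\<Theta> n x) - M x h (\<theta> x)) \<le> e/2 * norm h" .
          moreover have "norm (dir_deriv h (\<Theta> n) x - M x h (\<Theta> n x)) \<le> e/2 * norm h"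
            using defect[OF x, of n h] mult_right_mono[OF less_imp_le[OF elim(1)], of "norm h"] by simp
          ultimately show "norm (dir_deriv h (\<Theta> n) x - M x h (\<theta> x)) \<le> e * norm h"
            using norm_triangle_ineq[of "dir_deriv h (\<Theta> n) x - M x h (\<Theta> n x)" "M x h (\<Theta> n x) - M x h (\<theta> x)"]
            by simp
        qed
      qed
    qed
    have "\<exists>g. \<forall>x\<in>ball 0 r. (\<lambda>n. \<Theta> n x) \<longlonglongrightarrow> g x \<and> (g has_derivative (\<lambda>h. M x h (\<theta> x))) (at x within ball 0 r)"
    proof (rule has_derivative_sequence[OF convex_ball _ dlim])
      show "(\<Theta> n has_derivative (\<lambda>v. dir_deriv v (\<Theta> n) x)) (at x within ball 0 r)" if "x \<in> ball 0 r" for n x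
        using smooth_on_has_derivative[OF sm that] has_derivative_at_withinI by blast
      show "(0::'b) \<in> ball 0 r" using r by simp
      show "(\<lambda>n. \<Theta> n 0) \<longlonglongrightarrow> c" by (simp add: at0)
    qed
    then obtain g where g: "\<And>x. x \<in> ball 0 r \<Longrightarrow> (\<lambda>n. \<Theta> n x) \<longlonglongrightarrow> g x"
      "\<And>x. x \<in> ball 0 r \<Longrightarrow> (g has_derivative (\<lambda>h. M x h (\<theta> x))) (at x within ball 0 r)" by blast
    have gt: "g x = \<theta> x" if "x \<in> ball 0 r" for x
      using LIMSEQ_unique[OF g(1)[OF that] conv[OF that]] .
    have der: "(\<theta> has_derivative (\<lambda>v. M x v (\<theta> x))) (at x)" if x: "x \<in> ball 0 r" for x
    proof -
      have "(g has_derivative (\<lambda>h. M x h (\<theta> x))) (at x)"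
        using g(2)[OF x] at_within_open[OF x open_ball] by simp
      then show ?thesis
        by (rule has_derivative_transform_within_open[OF _ open_ball x]) (rule gt)
    qed
    have "smooth_on (ball 0 r) \<theta>"
    proof (rule smooth_on_bootstrap[OF open_ball _ der])
      show "continuous_on (ball 0 r) \<theta>"
        using der by (meson continuous_at_imp_continuous_on has_derivative_continuous)
    qed (use along_Ck_on r in auto)
    moreover have "\<theta> 0 = c"
      using LIMSEQ_unique[OF conv[of 0]] r by (simp add: at0)
    ultimately show ?thesis using der by blast
  qed
  with r show thesis using that by blast
qed

end

section \<open>Local parametrisations\<close>

text \<open>Tangent vectors, vector fields and connections depend on the atlas only through the smooth
  functions. It is therefore convenient to work with parametrisations of open sets by balls that
  are compatible with the smooth functions in two directions: smooth functions are smooth in the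
  parameters, and a function supported well inside the image is smooth if it is so in the
  parameters. The charts of the atlas and the flat coordinates constructed later are both of this
  kind.\<close>

definition local_param ::
    "('a::{t2_space,second_countable_topology}, 'b::euclidean_space) atlas \<Rightarrow> real \<Rightarrow> ('b \<Rightarrow> 'a) \<Rightarrow> bool" where
  "local_param A \<rho> \<xi> \<longleftrightarrow> \<rho> > 0 \<and> inj_on \<xi> (ball 0 \<rho>) \<and> continuous_on (ball 0 \<rho>) \<xi> \<and>
     (\<forall>S. open S \<longrightarrow> S \<subseteq> ball 0 \<rho> \<longrightarrow> open (\<xi> ` S)) \<and>
     (\<forall>f. smooth_fun A f \<longrightarrow> smooth_on (ball 0 \<rho>) (\<lambda>x. f (\<xi> x))) \<and>
     (\<forall>f r. r < \<rho> \<longrightarrow> (\<forall>q. q \<notin> \<xi> ` cball 0 r \<longrightarrow> f q = 0) \<longrightarrow>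
        smooth_on (ball 0 \<rho>) (\<lambda>x. f (\<xi> x)) \<longrightarrow> smooth_fun A f)"

lemma local_paramD:
  assumes "local_param A \<rho> \<xi>"
  shows "\<rho> > 0" "inj_on \<xi> (ball 0 \<rho>)" "continuous_on (ball 0 \<rho>) \<xi>"
    "open S \<Longrightarrow> S \<subseteq> ball 0 \<rho> \<Longrightarrow> open (\<xi> ` S)"
    "smooth_fun A f \<Longrightarrow> smooth_on (ball 0 \<rho>) (\<lambda>x. f (\<xi> x))"
    "r < \<rho> \<Longrightarrow> (\<And>q. q \<notin> \<xi> ` cball 0 r \<Longrightarrow> f q = 0) \<Longrightarrow>
        smooth_on (ball 0 \<rho>) (\<lambda>x. f (\<xi> x)) \<Longrightarrow> smooth_fun A f"
  using assms unfolding local_param_def by blast+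

lemma homeomorphism_image_open:
  assumes "homeomorphism U V \<phi> \<psi>" "open V" "open S" "S \<subseteq> U"
  shows "open (\<phi> ` S)"
proof -
  have "openin (top_of_set U) S" using assms by (metis inf.absorb_iff2 openin_open)
  then have "openin (top_of_set V) (\<phi> ` S)" using homeomorphism_imp_open_map[OF assms(1)] by blast
  then show ?thesis using assms(2) openin_open_eq by blast
qed

lemma chart_facts:
  assumes "is_chart U \<phi>"
  shows "open U" "open (\<phi> ` U)" "inj_on \<phi> U" "continuous_on U \<phi>"
    "continuous_on (\<phi> ` U) (inv_into U \<phi>)"
    "open S \<Longrightarrow> S \<subseteq> U \<Longrightarrow> open (\<phi> ` S)"
    "open T \<Longrightarrow> T \<subseteq> \<phi> ` U \<Longrightarrow> open (inv_into U \<phi> ` T)"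
proof -
  obtain \<psi> where U: "open U" "open (\<phi> ` U)" and h: "homeomorphism U (\<phi> ` U) \<phi> \<psi>"
    using assms by (auto simp: is_chart_def)
  show "open U" "open (\<phi> ` U)" by (fact U)+
  show i: "inj_on \<phi> U" using h by (metis homeomorphism_apply1 inj_on_inverseI)
  show "continuous_on U \<phi>" using h by (simp add: homeomorphism_def)
  have eq: "inv_into U \<phi> y = \<psi> y" if "y \<in> \<phi> ` U" for y
    using that i h by (auto simp: homeomorphism_apply1)
  then show "continuous_on (\<phi> ` U) (inv_into U \<phi>)"
    using h by (simp add: homeomorphism_def cong: continuous_on_cong)
  show "open S \<Longrightarrow> S \<subseteq> U \<Longrightarrow> open (\<phi> ` S)" by (rule homeomorphism_image_open[OF h U(2)])
  assume T: "open T" "T \<subseteq> \<phi> ` U"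
  then have "inv_into U \<phi> ` T = \<psi> ` T" using eq by (intro image_cong) auto
  then show "open (inv_into U \<phi> ` T)"
    using homeomorphism_image_open[OF homeomorphism_symD[OF h] U(1) T] by simp
qed

lemma ball_shift: "c + x \<in> ball c \<rho> \<longleftrightarrow> x \<in> ball (0::'b::euclidean_space) \<rho>"
  by (simp add: dist_norm)

lemma smooth_on_shift:
  fixes c :: "'b::euclidean_space"
  assumes "smooth_on S f" "open S" "open T" "\<And>x. x \<in> T \<Longrightarrow> c + x \<in> S"
  shows "smooth_on T (\<lambda>x. f (c + x))"
  by (rule smooth_on_compose[OF assms(3,2) _ assms(1)])
    (use assms in \<open>auto intro!: smooth_on_add[OF _ smooth_on_const smooth_on_linear[OF bounded_linear_ident]]\<close>)

locale manifold =
  fixes A :: "('a::{t2_space,second_countable_topology}, 'b::euclidean_space) atlas"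
  assumes atlas: "smooth_atlas A"
begin

lemma chart: "(U, \<phi>) \<in> A \<Longrightarrow> is_chart U \<phi>"
  using atlas by (auto simp: smooth_atlas_def)

lemma transition: "(U, \<phi>) \<in> A \<Longrightarrow> (V, \<psi>) \<in> A \<Longrightarrow> smooth_on (\<phi> ` (U \<inter> V)) (\<lambda>y. \<psi> (inv_into U \<phi> y))"
  using atlas by (fastforce simp: smooth_atlas_def o_def)

lemma smooth_funI:
  assumes "\<And>U \<phi>. (U, \<phi>) \<in> A \<Longrightarrow> smooth_on (\<phi> ` U) (\<lambda>y. f (inv_into U \<phi> y))"
  shows "smooth_fun A f"
  using assms by (auto simp: smooth_fun_def o_def)

lemma smooth_funD:
  "smooth_fun A f \<Longrightarrow> (U, \<phi>) \<in> A \<Longrightarrow> smooth_on (\<phi> ` U) (\<lambda>y. f (inv_into U \<phi> y))"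
  by (fastforce simp: smooth_fun_def o_def)

lemma smooth_fun_const: "smooth_fun A (\<lambda>q. c)"
  by (rule smooth_funI, intro smooth_on_const chart_facts(2)[OF chart])

lemma smooth_fun_add: "smooth_fun A f \<Longrightarrow> smooth_fun A g \<Longrightarrow> smooth_fun A (\<lambda>q. f q + g q)"
  by (rule smooth_funI, intro smooth_on_add smooth_funD chart_facts(2)[OF chart])

lemma smooth_fun_mult: "smooth_fun A f \<Longrightarrow> smooth_fun A g \<Longrightarrow> smooth_fun A (\<lambda>q. f q * g q)"
  by (rule smooth_funI, intro smooth_on_mult smooth_funD chart_facts(2)[OF chart])

lemma smooth_fun_diff: "smooth_fun A f \<Longrightarrow> smooth_fun A g \<Longrightarrow> smooth_fun A (\<lambda>q. f q - g q)"
  by (rule smooth_funI, intro smooth_on_diff smooth_funD chart_facts(2)[OF chart])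

lemma smooth_fun_sum: "(\<And>i. i \<in> I \<Longrightarrow> smooth_fun A (f i)) \<Longrightarrow> smooth_fun A (\<lambda>q. \<Sum>i\<in>I. f i q)"
  by (induction I rule: infinite_finite_induct) (auto intro: smooth_fun_const smooth_fun_add)

lemma smooth_fun_local:
  assumes "\<And>p. \<exists>W h. open W \<and> p \<in> W \<and> smooth_fun A h \<and> (\<forall>q\<in>W. f q = h q)"
  shows "smooth_fun A f"
proof (rule smooth_funI, rule smooth_on_local)
  fix U \<phi> y assume U: "(U, \<phi>) \<in> A" and y: "y \<in> \<phi> ` U"
  note c = chart_facts[OF chart[OF U]]
  obtain p where p: "p \<in> U" "y = \<phi> p" using y by blast
  obtain W h where W: "open W" "p \<in> W" "smooth_fun A h" "\<forall>q\<in>W. f q = h q" using assms[of p] by blast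
  have o: "open (\<phi> ` (U \<inter> W))" using c W by (intro c(6)) auto
  have "smooth_on (\<phi> ` (U \<inter> W)) (\<lambda>y. h (inv_into U \<phi> y))"
    by (rule smooth_on_subset[OF smooth_funD[OF W(3) U]]) auto
  then have "smooth_on (\<phi> ` (U \<inter> W)) (\<lambda>y. f (inv_into U \<phi> y))"
    by (rule smooth_on_cong[OF o]) (use W c(3) in auto)
  then show "\<exists>S. open S \<and> y \<in> S \<and> smooth_on S (\<lambda>y. f (inv_into U \<phi> y))"
    using o p W by (intro exI[of _ "\<phi> ` (U \<inter> W)"]) auto
qed

lemma local_param_exists:
  obtains \<rho> \<xi> where "local_param A \<rho> \<xi>" "\<xi> 0 = p"
proof -
  have "p \<in> (\<Union>(U, \<phi>)\<in>A. U)" using atlas by (simp add: smooth_atlas_def)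
  then obtain U \<phi> where U: "(U, \<phi>) \<in> A" and p: "p \<in> U" by auto
  note c = chart_facts[OF chart[OF U]]
  obtain \<rho> where \<rho>: "\<rho> > 0" "ball (\<phi> p) \<rho> \<subseteq> \<phi> ` U" using c(2) p openE by blast
  define \<xi> where "\<xi> x = inv_into U \<phi> (\<phi> p + x)" for x
  have inU: "\<phi> p + x \<in> \<phi> ` U" if "x \<in> ball 0 \<rho>" for x
    using \<rho>(2) that ball_shift[of "\<phi> p" x \<rho>] by blast
  have \<phi>\<xi>: "\<phi> (\<xi> x) = \<phi> p + x" "\<xi> x \<in> U" if "x \<in> ball 0 \<rho>" for x
    using inU[OF that] by (auto simp: \<xi>_def f_inv_into_f inv_into_into)
  have im: "\<xi> ` S = inv_into U \<phi> ` ((+) (\<phi> p) ` S)" for S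
    by (auto simp: \<xi>_def image_image)
  have op: "open (\<xi> ` S)" if "open S" "S \<subseteq> ball 0 \<rho>" for S
    unfolding im using that inU by (intro c(7) open_translation) auto
  have cont: "continuous_on (ball 0 \<rho>) \<xi>"
    unfolding \<xi>_def by (rule continuous_on_compose2[OF c(5)]) (use \<rho>(2) in \<open>auto intro!: continuous_intros\<close>)
  have ext: "smooth_fun A f" if r: "r < \<rho>" and z: "\<And>q. q \<notin> \<xi> ` cball 0 r \<Longrightarrow> f q = 0"
    and sm: "smooth_on (ball 0 \<rho>) (\<lambda>x. f (\<xi> x))" for f r
    \<comment> \<open>Smoothness is checked in each chart, near points of the image and away from the support.\<close>
      proof (rule smooth_funI, rule smooth_on_local)
        fix V \<psi> y assume V: "(V, \<psi>) \<in> A" and y: "y \<in> \<psi> ` V"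
        note d = chart_facts[OF chart[OF V]]
        obtain v where v: "v \<in> V" "y = \<psi> v" using y by blast
        show "\<exists>S. open S \<and> y \<in> S \<and> smooth_on S (\<lambda>y. f (inv_into V \<psi> y))"
        proof (cases "v \<in> \<xi> ` ball 0 \<rho>")
          case True
          define W where "W = V \<inter> \<xi> ` ball 0 \<rho>"
          have W: "open W" "W \<subseteq> V" "W \<subseteq> V \<inter> U" using op[of "ball 0 \<rho>"] d(1) \<phi>\<xi>(2) by (auto simp: W_def)
          have oW: "open (\<psi> ` W)" using W by (intro d(6))
          have "smooth_on (\<psi> ` W) (\<lambda>y. f (\<xi> (- \<phi> p + \<phi> (inv_into V \<psi> y))))"
          proof (rule smooth_on_compose[OF oW open_ball _ sm])
            show "smooth_on (\<psi> ` W) (\<lambda>y. - \<phi> p + \<phi> (inv_into V \<psi> y))"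
              by (intro smooth_on_add smooth_on_const oW smooth_on_subset[OF transition[OF V U]]) (use W in auto)
            show "(\<lambda>y. - \<phi> p + \<phi> (inv_into V \<psi> y)) ` \<psi> ` W \<subseteq> ball 0 \<rho>"
              using d(3) \<phi>\<xi>(1) by (fastforce simp: W_def)
          qed
          then have "smooth_on (\<psi> ` W) (\<lambda>y. f (inv_into V \<psi> y))"
            by (rule smooth_on_cong[OF oW]) (use d(3) \<phi>\<xi>(1) in \<open>auto simp: W_def\<close>)
          then show ?thesis using oW v True by (intro exI[of _ "\<psi> ` W"]) (auto simp: W_def)
        next
          case False
          have "compact (\<xi> ` cball 0 r)"
            by (rule compact_continuous_image[OF continuous_on_subset[OF cont]]) (use r in auto)
          then have "open (V - \<xi> ` cball 0 r)" by (intro open_Diff d(1) compact_imp_closed)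
          then have oW: "open (\<psi> ` (V - \<xi> ` cball 0 r))" by (intro d(6)) auto
          have "smooth_on (\<psi> ` (V - \<xi> ` cball 0 r)) (\<lambda>y. f (inv_into V \<psi> y))"
            by (rule smooth_on_cong[OF oW smooth_on_const[OF oW, of 0]]) (use d(3) z in auto)
          moreover have "v \<notin> \<xi> ` cball 0 r" using False r by force
          ultimately show ?thesis using oW v by (intro exI[of _ "\<psi> ` (V - \<xi> ` cball 0 r)"]) auto
        qed
      qed
  have "local_param A \<rho> \<xi>"
    unfolding local_param_def
  proof (intro conjI allI impI)
    show "inj_on \<xi> (ball 0 \<rho>)" using \<phi>\<xi>(1) by (metis add_left_cancel inj_onI)
    show "smooth_on (ball 0 \<rho>) (\<lambda>x. f (\<xi> x))" if "smooth_fun A f" for f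
      unfolding \<xi>_def by (rule smooth_on_shift[OF smooth_funD[OF that U] c(2) open_ball inU])
  qed (use \<rho> cont op ext in auto)
  moreover have "\<xi> 0 = p" using p c(3) by (simp add: \<xi>_def)
  ultimately show thesis using that by blast
qed

lemma local_param_recentre:
  assumes \<xi>: "local_param A \<rho> \<xi>" and x: "norm x + \<epsilon> \<le> \<rho>" "\<epsilon> > 0"
  shows "local_param A \<epsilon> (\<lambda>z. \<xi> (x + z))"
proof -
  have sub: "x + z \<in> ball 0 \<rho>" if "z \<in> ball 0 \<epsilon>" for z
    using that x norm_triangle_ineq[of x z] by simp
  note L = local_paramD[OF \<xi>]
  have im: "(\<lambda>z. \<xi> (x + z)) ` S = \<xi> ` ((+) x ` S)" for S by auto
  show ?thesis
    unfolding local_param_def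
  proof (intro conjI allI impI)
    show "inj_on (\<lambda>z. \<xi> (x + z)) (ball 0 \<epsilon>)"
    proof (rule inj_onI)
      fix z w assume "z \<in> ball 0 \<epsilon>" "w \<in> ball 0 \<epsilon>" "\<xi> (x + z) = \<xi> (x + w)"
      from inj_onD[OF L(2) this(3) sub[OF this(1)] sub[OF this(2)]] show "z = w" by simp
    qed
    show "continuous_on (ball 0 \<epsilon>) (\<lambda>z. \<xi> (x + z))"
    proof (rule continuous_on_compose2[OF L(3)])
      show "(+) x ` ball 0 \<epsilon> \<subseteq> ball 0 \<rho>" using sub by blast
    qed (auto intro!: continuous_intros)
    show "open ((\<lambda>z. \<xi> (x + z)) ` S)" if "open S" "S \<subseteq> ball 0 \<epsilon>" for S
      unfolding im using that sub by (intro L(4) open_translation) auto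
    show "smooth_on (ball 0 \<epsilon>) (\<lambda>z. f (\<xi> (x + z)))" if "smooth_fun A f" for f
      by (rule smooth_on_shift[OF L(5)[OF that] open_ball open_ball sub])
    fix f :: "'a \<Rightarrow> real" and r assume r: "r < \<epsilon>" and z: "\<forall>q. q \<notin> (\<lambda>z. \<xi> (x + z)) ` cball 0 r \<longrightarrow> f q = 0"
      and sm: "smooth_on (ball 0 \<epsilon>) (\<lambda>z. f (\<xi> (x + z)))"
    show "smooth_fun A f"
    proof (rule L(6)[of "norm x + r"])
      show "norm x + r < \<rho>" using r x by simp
      show "f q = 0" if "q \<notin> \<xi> ` cball 0 (norm x + r)" for q
      proof -
        have "q \<noteq> \<xi> (x + z)" if "z \<in> cball 0 r" for z
          using \<open>q \<notin> _\<close> that norm_triangle_ineq[of x z] by force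
        then show ?thesis using z by blast
      qed
      show "smooth_on (ball 0 \<rho>) (\<lambda>y. f (\<xi> y))"
      proof (rule smooth_on_local)
        fix y :: 'b assume y: "y \<in> ball 0 \<rho>"
        show "\<exists>S. open S \<and> y \<in> S \<and> smooth_on S (\<lambda>y. f (\<xi> y))"
        proof (cases "y \<in> ball x \<epsilon>")
          case True
          have "smooth_on (ball x \<epsilon>) (\<lambda>y. f (\<xi> (x + (- x + y))))"
            by (rule smooth_on_shift[OF sm open_ball open_ball]) (simp add: dist_norm norm_minus_commute)
          then show ?thesis using True by (intro exI[of _ "ball x \<epsilon>"]) simp
        next
          case False
          have o: "open (ball 0 \<rho> - cball x r)" by (simp add: open_Diff)
          have "smooth_on (ball 0 \<rho> - cball x r) (\<lambda>y. f (\<xi> y))"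
          proof (rule smooth_on_cong[OF o smooth_on_const[OF o, of 0]])
            fix y assume y: "y \<in> ball 0 \<rho> - cball x r"
            have "\<xi> y \<noteq> \<xi> (x + z)" if "z \<in> cball 0 r" for z
            proof
              assume "\<xi> y = \<xi> (x + z)"
              then have "y = x + z" using L(2) y sub[of z] that r by (auto simp: inj_on_def)
              then show False using y that by (simp add: dist_norm)
            qed
            then show "0 = f (\<xi> y)" using z by (metis imageE)
          qed
          moreover have "y \<notin> cball x r" using False r by auto
          ultimately show ?thesis using o y by (intro exI[of _ "ball 0 \<rho> - cball x r"]) auto
        qed
      qed
    qed
  qed (use x in auto)
qed

definition extend_by_zero :: "real \<Rightarrow> ('b \<Rightarrow> 'a) \<Rightarrow> ('b \<Rightarrow> real) \<Rightarrow> 'a \<Rightarrow> real" where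
  "extend_by_zero \<rho> \<xi> u q = (if q \<in> \<xi> ` ball 0 \<rho> then u (inv_into (ball 0 \<rho>) \<xi> q) else 0)"

lemma extend_by_zero_apply: "local_param A \<rho> \<xi> \<Longrightarrow> x \<in> ball 0 \<rho> \<Longrightarrow> extend_by_zero \<rho> \<xi> u (\<xi> x) = u x"
  by (simp add: extend_by_zero_def inv_into_f_f[OF local_paramD(2)])

lemma extend_by_zero_smooth:
  assumes \<xi>: "local_param A \<rho> \<xi>" and sm: "smooth_on (ball 0 \<rho>) u" and r: "r < \<rho>"
    and z: "\<And>x. x \<in> ball 0 \<rho> \<Longrightarrow> norm x > r \<Longrightarrow> u x = 0"
  shows "smooth_fun A (extend_by_zero \<rho> \<xi> u)"
proof (rule local_paramD(6)[OF \<xi> r])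
  show "smooth_on (ball 0 \<rho>) (\<lambda>x. extend_by_zero \<rho> \<xi> u (\<xi> x))"
    by (rule smooth_on_cong[OF open_ball sm]) (simp add: extend_by_zero_apply[OF \<xi>])
  show "extend_by_zero \<rho> \<xi> u q = 0" if "q \<notin> \<xi> ` cball 0 r" for q
  proof (cases "q \<in> \<xi> ` ball 0 \<rho>")
    case True
    then obtain x where x: "x \<in> ball 0 \<rho>" "q = \<xi> x" by blast
    then show ?thesis using that z[of x] extend_by_zero_apply[OF \<xi> x(1)] by force
  qed (simp add: extend_by_zero_def)
qed

text \<open>Tangent vectors and connections act on globally defined objects only. A cutoff
  brings functions of the parameters, in particular coordinates, within their reach.\<close>

lemma extend_function:
  assumes \<xi>: "local_param A \<rho> \<xi>" and r: "0 < r" "r < \<rho>" and sm: "smooth_on (ball 0 \<rho>) u"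
  obtains f where "smooth_fun A f" "\<And>x. x \<in> cball 0 r \<Longrightarrow> f (\<xi> x) = u x"
proof -
  obtain \<eta> :: "'b \<Rightarrow> real" where \<eta>: "smooth_on UNIV \<eta>" "\<And>x. norm x \<le> r \<Longrightarrow> \<eta> x = 1"
     "\<And>x. norm x \<ge> (r + \<rho>) / 2 \<Longrightarrow> \<eta> x = 0"
    using cutoff_exists[of r "(r + \<rho>) / 2" 0] r by (auto simp: field_simps)
  show thesis
  proof
    show "smooth_fun A (extend_by_zero \<rho> \<xi> (\<lambda>x. \<eta> x * u x))"
      by (rule extend_by_zero_smooth[OF \<xi> smooth_on_mult, of _ _ "(r + \<rho>) / 2"])
        (use r \<eta>(3) smooth_on_subset[OF \<eta>(1)] sm in \<open>auto\<close>)
    show "extend_by_zero \<rho> \<xi> (\<lambda>x. \<eta> x * u x) (\<xi> x) = u x" if "x \<in> cball 0 r" for x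
      using that extend_by_zero_apply[OF \<xi>, of x] r \<eta>(2) by auto
  qed
qed

lemma bump_function:
  assumes "open W" "p \<in> W"
  obtains f where "smooth_fun A f" "f p = 1" "\<And>q. q \<notin> W \<Longrightarrow> f q = 0"
proof -
  obtain \<rho> \<xi> where \<xi>: "local_param A \<rho> \<xi>" "\<xi> 0 = p" using local_param_exists by blast
  note L = local_paramD[OF \<xi>(1)]
  have "open (ball 0 \<rho> \<inter> \<xi> -` W)" using continuous_open_preimage[OF L(3) open_ball assms(1)] .
  moreover have "0 \<in> ball 0 \<rho> \<inter> \<xi> -` W" using L(1) \<xi>(2) assms(2) by simp
  ultimately obtain \<epsilon> where \<epsilon>: "\<epsilon> > 0" "ball 0 \<epsilon> \<subseteq> ball 0 \<rho> \<inter> \<xi> -` W" by (metis openE)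
  define s where "s = min \<epsilon> \<rho> / 2"
  have s: "0 < s" "s < \<epsilon>" "s < \<rho>" using \<epsilon> L(1) by (auto simp: s_def min_def)
  obtain \<eta> :: "'b \<Rightarrow> real" where \<eta>: "smooth_on UNIV \<eta>" "\<And>x. norm x \<le> s / 2 \<Longrightarrow> \<eta> x = 1"
     "\<And>x. norm x \<ge> s \<Longrightarrow> \<eta> x = 0"
    using cutoff_exists[of "s / 2" s 0] s by auto
  show thesis
  proof
    show "smooth_fun A (extend_by_zero \<rho> \<xi> \<eta>)"
      by (rule extend_by_zero_smooth[OF \<xi>(1) smooth_on_subset[OF \<eta>(1)] s(3)]) (auto simp: \<eta>(3))
    show "extend_by_zero \<rho> \<xi> \<eta> p = 1"
      using extend_by_zero_apply[OF \<xi>(1), of 0 \<eta>] L(1) \<xi>(2) \<eta>(2)[of 0] s by simp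
    fix q assume q: "q \<notin> W"
    show "extend_by_zero \<rho> \<xi> \<eta> q = 0"
    proof (cases "q \<in> \<xi> ` ball 0 \<rho>")
      case True
      then obtain x where x: "x \<in> ball 0 \<rho>" "q = \<xi> x" by blast
      then have "x \<notin> ball 0 \<epsilon>" using q \<epsilon>(2) by auto
      then have "norm x \<ge> s" using s by auto
      then show ?thesis using extend_by_zero_apply[OF \<xi>(1) x(1)] x \<eta>(3) by simp
    qed (simp add: extend_by_zero_def)
  qed
qed

section \<open>Tangent vectors and vector fields in parameters\<close>

lemma tangentD:
  assumes "v \<in> tangent_space A p"
  shows "smooth_fun A f \<Longrightarrow> smooth_fun A h \<Longrightarrow> v (\<lambda>q. a * f q + b * h q) = a * v f + b * v h"
    "smooth_fun A f \<Longrightarrow> smooth_fun A h \<Longrightarrow> v (\<lambda>q. f q * h q) = f p * v h + h p * v f"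
    "\<not> smooth_fun A f \<Longrightarrow> v f = 0"
  using assms unfolding tangent_space_def by blast+

lemma tangentI:
  assumes "\<And>f h a b. smooth_fun A f \<Longrightarrow> smooth_fun A h \<Longrightarrow> v (\<lambda>q. a * f q + b * h q) = a * v f + b * v h"
    "\<And>f h. smooth_fun A f \<Longrightarrow> smooth_fun A h \<Longrightarrow> v (\<lambda>q. f q * h q) = f p * v h + h p * v f"
    "\<And>f. \<not> smooth_fun A f \<Longrightarrow> v f = 0"
  shows "v \<in> tangent_space A p"
  using assms by (auto simp: tangent_space_def)

lemma tangent_const:
  assumes "v \<in> tangent_space A p"
  shows "v (\<lambda>q. c) = 0"
proof -
  have "v (\<lambda>q. 1 * 1) = 0"
    using tangentD(2)[OF assms smooth_fun_const[of 1] smooth_fun_const[of 1]] by simp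
  then show ?thesis
    using tangentD(1)[OF assms smooth_fun_const[of 1] smooth_fun_const[of 1], of c 0] by simp
qed

text \<open>For a bump function \<open>\<eta>\<close> at \<open>p\<close> with support in
  \<open>W\<close> the difference of the two functions is its own product with \<open>1 - \<eta>\<close>; both factors vanish at \<open>p\<close>, so the product rule gives
  zero.\<close>

lemma tangent_germ:
  assumes v: "v \<in> tangent_space A p" and f: "smooth_fun A f" and h: "smooth_fun A h"
    and W: "open W" "p \<in> W" "\<And>q. q \<in> W \<Longrightarrow> f q = h q"
  shows "v f = v h"
proof -
  obtain \<eta> where \<eta>: "smooth_fun A \<eta>" "\<eta> p = 1" "\<And>q. q \<notin> W \<Longrightarrow> \<eta> q = 0"
    using bump_function[OF W(1,2)] by blast
  have fh: "smooth_fun A (\<lambda>q. f q - h q)" "smooth_fun A (\<lambda>q. 1 - \<eta> q)"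
    by (intro smooth_fun_diff smooth_fun_const f h \<eta>)+
  have "(\<lambda>q. 1 * f q + (-1) * h q) = (\<lambda>q. (f q - h q) * (1 - \<eta> q))"
    using \<eta>(3) W(3) by (auto simp: fun_eq_iff)
  then have "v f - v h = v (\<lambda>q. (f q - h q) * (1 - \<eta> q))"
    using tangentD(1)[OF v f h, of 1 "-1"] by simp
  also have "\<dots> = 0" using tangentD(2)[OF v fh] W \<eta>(2) by simp
  finally show ?thesis by simp
qed

lemma tangent_sum:
  assumes v: "v \<in> tangent_space A p" and f: "\<And>i. i \<in> I \<Longrightarrow> smooth_fun A (f i)"
  shows "v (\<lambda>q. \<Sum>i\<in>I. f i q) = (\<Sum>i\<in>I. v (f i))"
  using f
proof (induction I rule: infinite_finite_induct)
  case (insert i I)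
  have "smooth_fun A (\<lambda>q. \<Sum>i\<in>I. f i q)" by (intro smooth_fun_sum) (use insert in auto)
  from tangentD(1)[OF v insert.prems[of i] this, of 1 1] insert show ?case by simp
qed (auto simp: tangent_const[OF v])

text \<open>The derivation \<open>\<partial>\<^sub>u\<close> at the point with parameter
  \<open>x\<close>. On functions that are not smooth it takes the value that membership in the
  tangent space prescribes.\<close>

definition dvec :: "('b \<Rightarrow> 'a) \<Rightarrow> 'b \<Rightarrow> 'b \<Rightarrow> 'a tvec" where
  "dvec \<xi> x u = (\<lambda>f. if smooth_fun A f then dir_deriv u (\<lambda>z. f (\<xi> z)) x else 0)"

definition vec :: "('b \<Rightarrow> 'a) \<Rightarrow> 'b \<Rightarrow> 'a tvec \<Rightarrow> 'b" where
  "vec \<xi> x v = (THE u. v = dvec \<xi> x u)"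

lemma dvec_tangent:
  assumes \<xi>: "local_param A \<rho> \<xi>" and x: "x \<in> ball 0 \<rho>"
  shows "dvec \<xi> x u \<in> tangent_space A (\<xi> x)"
proof (rule tangentI)
  fix f h a b assume f: "smooth_fun A f" and h: "smooth_fun A h"
  note d = smooth_on_has_derivative[OF local_paramD(5)[OF \<xi> f] x] smooth_on_has_derivative[OF local_paramD(5)[OF \<xi> h] x]
  have "smooth_fun A (\<lambda>q. a * f q + b * h q)" "smooth_fun A (\<lambda>q. f q * h q)"
    by (rule smooth_fun_add[OF smooth_fun_mult[OF smooth_fun_const f] smooth_fun_mult[OF smooth_fun_const h]],
        rule smooth_fun_mult[OF f h])
  moreover have "dir_deriv u (\<lambda>z. a * f (\<xi> z) + b * h (\<xi> z)) x
      = a * dir_deriv u (\<lambda>z. f (\<xi> z)) x + b * dir_deriv u (\<lambda>z. h (\<xi> z)) x"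
    by (rule dir_deriv_eq) (intro has_derivative_add has_derivative_mult_right d)
  moreover have "dir_deriv u (\<lambda>z. f (\<xi> z) * h (\<xi> z)) x
      = f (\<xi> x) * dir_deriv u (\<lambda>z. h (\<xi> z)) x + dir_deriv u (\<lambda>z. f (\<xi> z)) x * h (\<xi> x)"
    by (rule dir_deriv_eq) (rule has_derivative_mult[OF d])
  ultimately show "dvec \<xi> x u (\<lambda>q. a * f q + b * h q) = a * dvec \<xi> x u f + b * dvec \<xi> x u h"
     "dvec \<xi> x u (\<lambda>q. f q * h q) = f (\<xi> x) * dvec \<xi> x u h + h (\<xi> x) * dvec \<xi> x u f"
    using f h by (simp_all add: dvec_def)
qed (simp add: dvec_def)

lemma dvec_linear:
  assumes \<xi>: "local_param A \<rho> \<xi>" and x: "x \<in> ball 0 \<rho>"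
  shows "dvec \<xi> x (a *\<^sub>R u + b *\<^sub>R v) = tv_comb a (dvec \<xi> x u) b (dvec \<xi> x v)"
proof
  fix f
  show "dvec \<xi> x (a *\<^sub>R u + b *\<^sub>R v) f = tv_comb a (dvec \<xi> x u) b (dvec \<xi> x v) f"
  proof (cases "smooth_fun A f")
    case True
    interpret linear "\<lambda>v. dir_deriv v (\<lambda>z. f (\<xi> z)) x"
      using smooth_on_linear_dir_deriv[OF local_paramD(5)[OF \<xi> True] x] .
    show ?thesis using True by (simp add: dvec_def tv_comb_def add scale)
  qed (simp add: dvec_def tv_comb_def)
qed

lemma dvec_zero: "local_param A \<rho> \<xi> \<Longrightarrow> x \<in> ball 0 \<rho> \<Longrightarrow> dvec \<xi> x 0 = (\<lambda>f. 0)"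
  using dvec_linear[of \<rho> \<xi> x 0 0 0 0] by (simp add: tv_comb_def fun_eq_iff)

lemma coordinate_function:
  assumes \<xi>: "local_param A \<rho> \<xi>" and x: "x \<in> ball 0 \<rho>"
  obtains y r where "smooth_fun A y" "norm x < r" "r < \<rho>" "\<And>z. z \<in> cball 0 r \<Longrightarrow> y (\<xi> z) = z \<bullet> b"
proof -
  have r: "norm x < (norm x + \<rho>) / 2" "(norm x + \<rho>) / 2 < \<rho>" "0 < (norm x + \<rho>) / 2"
    using x by (auto intro: add_nonneg_pos simp: local_paramD(1)[OF \<xi>])
  obtain y where "smooth_fun A y" "\<And>z. z \<in> cball 0 ((norm x + \<rho>) / 2) \<Longrightarrow> y (\<xi> z) = z \<bullet> b"
    by (rule extend_function[OF \<xi> r(3,2) smooth_on_linear[OF bounded_linear_inner_left[of b] open_ball]])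
      (rule that, auto)
  then show thesis using that r by blast
qed

lemma dir_deriv_cong_open:
  assumes "open S" "x \<in> S" "\<And>z. z \<in> S \<Longrightarrow> f z = g z" "f differentiable (at x)"
  shows "dir_deriv u f x = dir_deriv u g x"
proof -
  have "(f has_derivative frechet_derivative f (at x)) (at x)" using assms(4) frechet_derivative_works by blast
  from has_derivative_transform_within_open[OF this assms(1,2,3)] show ?thesis
    by (metis frechet_derivative_at)
qed

lemma dvec_coordinate:
  assumes \<xi>: "local_param A \<rho> \<xi>" and x: "x \<in> ball 0 \<rho>"
    and y: "smooth_fun A y" "open S" "x \<in> S" "\<And>z. z \<in> S \<Longrightarrow> y (\<xi> z) = z \<bullet> b"
  shows "dvec \<xi> x u y = u \<bullet> b"
proof -
  have "((\<lambda>z. z \<bullet> b) has_derivative (\<lambda>u. u \<bullet> b)) (at x)"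
    by (auto intro!: derivative_eq_intros)
  from has_derivative_transform_within_open[OF this y(2,3), of "\<lambda>z. y (\<xi> z)"] y(4)
  have "((\<lambda>z. y (\<xi> z)) has_derivative (\<lambda>u. u \<bullet> b)) (at x)" by simp
  from dir_deriv_eq[OF this] show ?thesis using y(1) by (simp add: dvec_def)
qed

lemma dvec_inj:
  assumes \<xi>: "local_param A \<rho> \<xi>" and x: "x \<in> ball 0 \<rho>" and eq: "dvec \<xi> x u = dvec \<xi> x v"
  shows "u = v"
proof (rule euclidean_eqI)
  fix b :: 'b
  obtain y r where y: "smooth_fun A y" "norm x < r" "r < \<rho>" "\<And>z. z \<in> cball 0 r \<Longrightarrow> y (\<xi> z) = z \<bullet> b"
    using coordinate_function[OF \<xi> x] by blast
  show "u \<bullet> b = v \<bullet> b"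
    using dvec_coordinate[OF \<xi> x y(1) open_ball[of 0 r], of b u]
      dvec_coordinate[OF \<xi> x y(1) open_ball[of 0 r], of b v] y eq by auto
qed

text \<open>Hadamard's lemma writes a smooth function as its value at the centre plus a sum of
  products \<open>y\<^sub>b g\<^sub>b\<close> of coordinates, which vanish at the centre, with
  smooth functions. The product rule leaves \<open>\<Sum> v(y\<^sub>b) g\<^sub>b(0)\<close>, and
  \<open>g\<^sub>b(0)\<close> is the partial derivative.\<close>

lemma tangent_is_dvec_centre:
  assumes \<xi>: "local_param A \<rho> \<xi>" and v: "v \<in> tangent_space A (\<xi> 0)"
  shows "\<exists>u. v = dvec \<xi> 0 u"
proof -
  note L = local_paramD[OF \<xi>]
  have r: "0 < \<rho> / 2" "\<rho> / 2 < \<rho>" using L(1) by auto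
  have "\<exists>f. smooth_fun A f \<and> (\<forall>z\<in>cball 0 (\<rho>/2). f (\<xi> z) = z \<bullet> b)" for b
    using extend_function[OF \<xi> r, of "\<lambda>z. z \<bullet> b"] smooth_on_linear[OF bounded_linear_inner_left open_ball] by metis
  then obtain y where y: "\<And>b. smooth_fun A (y b)" "\<And>b z. z \<in> cball 0 (\<rho>/2) \<Longrightarrow> y b (\<xi> z) = z \<bullet> b" by metis
  define u where "u = (\<Sum>b\<in>Basis. v (y b) *\<^sub>R b)"
  have "v f = dvec \<xi> 0 u f" for f
  proof (cases "smooth_fun A f")
    case True
    let ?F = "\<lambda>z. f (\<xi> z)"
    note smF = L(5)[OF True]
    have "\<exists>g. smooth_fun A g \<and> (\<forall>z\<in>cball 0 (\<rho>/2). g (\<xi> z) = ray_mean (dir_deriv b ?F) z)" for b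
      using extend_function[OF \<xi> r ray_mean_smooth_on[OF smooth_on_dir_deriv[OF smF]]] by metis
    then obtain g where g: "\<And>b. smooth_fun A (g b)"
        "\<And>b z. z \<in> cball 0 (\<rho>/2) \<Longrightarrow> g b (\<xi> z) = ray_mean (dir_deriv b ?F) z" by metis
    have sm1: "smooth_fun A (\<lambda>q. y b q * g b q)" for b by (intro smooth_fun_mult y g)
    have sm2: "smooth_fun A (\<lambda>q. \<Sum>b\<in>Basis. y b q * g b q)" by (intro smooth_fun_sum sm1)
    have "v f = v (\<lambda>q. f (\<xi> 0) + (\<Sum>b\<in>Basis. y b q * g b q))"
    proof (rule tangent_germ[OF v True smooth_fun_add[OF smooth_fun_const sm2] L(4)[OF open_ball[of 0 "\<rho>/2"]]])
      fix q assume "q \<in> \<xi> ` ball 0 (\<rho>/2)"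
      then obtain z where z: "z \<in> ball 0 (\<rho>/2)" "q = \<xi> z" by blast
      then show "f q = f (\<xi> 0) + (\<Sum>b\<in>Basis. y b q * g b q)"
        using hadamard_lemma[OF smF, of z] y(2)[of z] g(2)[of z] L(1) by auto
    qed (use L(1) in auto)
    also have "\<dots> = (\<Sum>b\<in>Basis. v (\<lambda>q. y b q * g b q))"
      using tangentD(1)[OF v smooth_fun_const[of "f (\<xi> 0)"] sm2, of 1 1] tangent_const[OF v]
        tangent_sum[OF v, of Basis "\<lambda>b q. y b q * g b q"] sm1 by simp
    also have "\<dots> = (\<Sum>b\<in>Basis. v (y b) * dir_deriv b ?F 0)"
    proof (rule sum.cong[OF refl])
      fix b :: 'b
      have "y b (\<xi> 0) = 0" using y(2)[of 0 b] r by simp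
      moreover have "g b (\<xi> 0) = dir_deriv b ?F 0"
        using g(2)[of 0 b] r by (simp add: ray_mean_def)
      ultimately show "v (\<lambda>q. y b q * g b q) = v (y b) * dir_deriv b ?F 0"
        using tangentD(2)[OF v y(1) g(1)] by simp
    qed
    also have "\<dots> = dir_deriv u ?F 0"
    proof -
      interpret linear "\<lambda>v. dir_deriv v ?F 0" using smooth_on_linear_dir_deriv[OF smF] L(1) by simp
      show ?thesis by (simp add: u_def sum scale)
    qed
    finally show ?thesis using True by (simp add: dvec_def)
  qed (simp add: dvec_def tangentD(3)[OF v])
  then show ?thesis by blast
qed

lemma dvec_recentre:
  assumes \<xi>: "local_param A \<rho> \<xi>" and x: "x + z \<in> ball 0 \<rho>"
  shows "dvec (\<lambda>z. \<xi> (x + z)) z u = dvec \<xi> (x + z) u"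
proof
  fix f
  show "dvec (\<lambda>z. \<xi> (x + z)) z u f = dvec \<xi> (x + z) u f"
  proof (cases "smooth_fun A f")
    case True
    have "((+) x has_derivative (\<lambda>v. v)) (at z)" by (auto intro!: derivative_eq_intros)
    from has_derivative_compose[OF this smooth_on_has_derivative[OF local_paramD(5)[OF \<xi> True] x]]
    show ?thesis using True dir_deriv_eq by (fastforce simp: dvec_def)
  qed (simp add: dvec_def)
qed

lemma tangent_is_dvec:
  assumes \<xi>: "local_param A \<rho> \<xi>" and x: "x \<in> ball 0 \<rho>" and v: "v \<in> tangent_space A (\<xi> x)"
  shows "\<exists>u. v = dvec \<xi> x u"
  using tangent_is_dvec_centre[OF local_param_recentre[OF \<xi>, of x "\<rho> - norm x"], of v]
    dvec_recentre[OF \<xi>, of x 0] x v by auto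

lemma dvec_vec:
  assumes "local_param A \<rho> \<xi>" "x \<in> ball 0 \<rho>" "v \<in> tangent_space A (\<xi> x)"
  shows "dvec \<xi> x (vec \<xi> x v) = v"
  unfolding vec_def using theI'[of "\<lambda>u. v = dvec \<xi> x u"] tangent_is_dvec[OF assms] dvec_inj[OF assms(1,2)] by metis

lemma vec_dvec: "local_param A \<rho> \<xi> \<Longrightarrow> x \<in> ball 0 \<rho> \<Longrightarrow> vec \<xi> x (dvec \<xi> x u) = u"
  using dvec_inj[of \<rho> \<xi> x] dvec_vec dvec_tangent by blast

lemma vector_fieldD:
  "X \<in> vector_fields A \<Longrightarrow> X p \<in> tangent_space A p"
  "X \<in> vector_fields A \<Longrightarrow> smooth_fun A f \<Longrightarrow> smooth_fun A (\<lambda>p. X p f)"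
  by (auto simp: vector_fields_def)

text \<open>The components of a vector field in the parameters.\<close>

definition rep :: "('b \<Rightarrow> 'a) \<Rightarrow> 'a vfield \<Rightarrow> 'b \<Rightarrow> 'b" where
  "rep \<xi> X x = vec \<xi> x (X (\<xi> x))"

lemma field_eq_dvec:
  "local_param A \<rho> \<xi> \<Longrightarrow> X \<in> vector_fields A \<Longrightarrow> x \<in> ball 0 \<rho> \<Longrightarrow> X (\<xi> x) = dvec \<xi> x (rep \<xi> X x)"
  by (simp add: rep_def dvec_vec vector_fieldD)

lemma rep_eqI: "local_param A \<rho> \<xi> \<Longrightarrow> x \<in> ball 0 \<rho> \<Longrightarrow> X (\<xi> x) = dvec \<xi> x u \<Longrightarrow> rep \<xi> X x = u"
  by (simp add: rep_def vec_dvec)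

lemma field_apply:
  "local_param A \<rho> \<xi> \<Longrightarrow> X \<in> vector_fields A \<Longrightarrow> x \<in> ball 0 \<rho> \<Longrightarrow> smooth_fun A f \<Longrightarrow>
    X (\<xi> x) f = dir_deriv (rep \<xi> X x) (\<lambda>z. f (\<xi> z)) x"
  using field_eq_dvec[of \<rho> \<xi> X x] by (simp add: dvec_def)

lemma rep_smooth:
  assumes \<xi>: "local_param A \<rho> \<xi>" and X: "X \<in> vector_fields A"
  shows "smooth_on (ball 0 \<rho>) (rep \<xi> X)"
proof (rule smooth_on_componentwise[OF open_ball], rule smooth_on_local)
  fix b x :: 'b assume x: "x \<in> ball 0 \<rho>"
  obtain y r where y: "smooth_fun A y" "norm x < r" "r < \<rho>" "\<And>z. z \<in> cball 0 r \<Longrightarrow> y (\<xi> z) = z \<bullet> b"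
    using coordinate_function[OF \<xi> x] by blast
  have "smooth_on (ball 0 r) (\<lambda>z. X (\<xi> z) y)"
    by (rule smooth_on_subset[OF local_paramD(5)[OF \<xi> vector_fieldD(2)[OF X y(1)]]]) (use y in auto)
  then have "smooth_on (ball 0 r) (\<lambda>z. rep \<xi> X z \<bullet> b)"
  proof (rule smooth_on_cong[OF open_ball])
    fix z :: 'b assume z: "z \<in> ball 0 r"
    then have z': "z \<in> ball 0 \<rho>" using y by auto
    show "X (\<xi> z) y = rep \<xi> X z \<bullet> b"
      using field_eq_dvec[OF \<xi> X z'] dvec_coordinate[OF \<xi> z' y(1) open_ball z, of b] y(4) by simp
  qed
  then show "\<exists>S. open S \<and> x \<in> S \<and> smooth_on S (\<lambda>z. rep \<xi> X z \<bullet> b)"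
    using y(2) by (intro exI[of _ "ball 0 r"]) auto
qed

lemma zero_tangent: "(\<lambda>f. 0) \<in> tangent_space A p"
  by (rule tangentI) auto

lemma dir_deriv_field_smooth:
  fixes f :: "'b \<Rightarrow> real"
  assumes "open S" "smooth_on S f" "smooth_on S u"
  shows "smooth_on S (\<lambda>x. dir_deriv (u x) f x)"
proof (rule smooth_on_cong[OF assms(1)])
  show "smooth_on S (\<lambda>x. \<Sum>b\<in>Basis. (u x \<bullet> b) * dir_deriv b f x)"
    by (intro smooth_on_sum smooth_on_mult smooth_on_inner_const smooth_on_dir_deriv assms)
  show "(\<Sum>b\<in>Basis. (u x \<bullet> b) * dir_deriv b f x) = dir_deriv (u x) f x" if "x \<in> S" for x
    using linear_basis_expansion[OF smooth_on_linear_dir_deriv[OF assms(2) that], of "u x"] by simp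
qed

lemma extend_field:
  assumes \<xi>: "local_param A \<rho> \<xi>" and r: "0 < r" "r < \<rho>" and sm: "smooth_on (ball 0 \<rho>) u"
  obtains X where "X \<in> vector_fields A" "\<And>x. x \<in> cball 0 r \<Longrightarrow> X (\<xi> x) = dvec \<xi> x (u x)"
proof -
  obtain \<eta> :: "'b \<Rightarrow> real" where \<eta>: "smooth_on UNIV \<eta>" "\<And>x. norm x \<le> r \<Longrightarrow> \<eta> x = 1"
     "\<And>x. norm x \<ge> (r + \<rho>) / 2 \<Longrightarrow> \<eta> x = 0"
    using cutoff_exists[of r "(r + \<rho>) / 2" 0] r by (auto simp: field_simps)
  define X where "X q = (if q \<in> \<xi> ` ball 0 \<rho>
      then dvec \<xi> (inv_into (ball 0 \<rho>) \<xi> q) (\<eta> (inv_into (ball 0 \<rho>) \<xi> q) *\<^sub>R u (inv_into (ball 0 \<rho>) \<xi> q))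
      else (\<lambda>f. 0))" for q
  have X: "X (\<xi> x) = dvec \<xi> x (\<eta> x *\<^sub>R u x)" if "x \<in> ball 0 \<rho>" for x
    using that local_paramD(2)[OF \<xi>] by (simp add: X_def)
  have smu: "smooth_on (ball 0 \<rho>) (\<lambda>x. \<eta> x *\<^sub>R u x)"
    by (intro smooth_on_scaleR smooth_on_subset[OF \<eta>(1)] sm) auto
  have "X \<in> vector_fields A"
    unfolding vector_fields_def
  proof (intro CollectI conjI allI impI)
    show "X p \<in> tangent_space A p" for p
    proof (cases "p \<in> \<xi> ` ball 0 \<rho>")
      case True
      then show ?thesis using X dvec_tangent[OF \<xi>] by auto
    qed (simp add: X_def zero_tangent)
    fix f assume f: "smooth_fun A f"
    let ?u = "\<lambda>x. dir_deriv (\<eta> x *\<^sub>R u x) (\<lambda>z. f (\<xi> z)) x"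
    have "(\<lambda>p. X p f) = extend_by_zero \<rho> \<xi> ?u"
      using f by (auto simp: fun_eq_iff X_def extend_by_zero_def dvec_def)
    moreover have "smooth_fun A (extend_by_zero \<rho> \<xi> ?u)"
    proof (rule extend_by_zero_smooth[OF \<xi> dir_deriv_field_smooth[OF open_ball local_paramD(5)[OF \<xi> f] smu]])
      show "(r + \<rho>) / 2 < \<rho>" using r by simp
      show "?u x = 0" if "x \<in> ball 0 \<rho>" "(r + \<rho>) / 2 < norm x" for x
        using \<eta>(3)[of x] that linear_0[OF smooth_on_linear_dir_deriv[OF local_paramD(5)[OF \<xi> f] that(1)]] by simp
    qed
    ultimately show "smooth_fun A (\<lambda>p. X p f)" by simp
  qed
  moreover have "X (\<xi> x) = dvec \<xi> x (u x)" if "x \<in> cball 0 r" for x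
    using X[of x] \<eta>(2)[of x] that r by auto
  ultimately show thesis using that by blast
qed

lemma extend_tangent:
  assumes v: "v \<in> tangent_space A p"
  obtains X where "X \<in> vector_fields A" "X p = v"
proof -
  obtain \<rho> \<xi> where \<xi>: "local_param A \<rho> \<xi>" "\<xi> 0 = p" using local_param_exists by blast
  have r: "0 < \<rho>/2" "\<rho>/2 < \<rho>" and 0: "0 \<in> ball 0 \<rho>" using local_paramD(1)[OF \<xi>(1)] by auto
  obtain X where X: "X \<in> vector_fields A" "\<And>x. x \<in> cball 0 (\<rho>/2) \<Longrightarrow> X (\<xi> x) = dvec \<xi> x (vec \<xi> 0 v)"
    using extend_field[OF \<xi>(1) r smooth_on_const[OF open_ball]] by metis
  show thesis
    by (rule that[OF X(1)]) (use X(2)[of 0] r \<xi> dvec_vec[OF \<xi>(1) 0] v in auto)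
qed

lemma vector_field_add:
  assumes X: "X \<in> vector_fields A" and Y: "Y \<in> vector_fields A"
  shows "vf_add X Y \<in> vector_fields A"
proof -
  note t = tangentD[OF vector_fieldD(1)[OF X]] tangentD[OF vector_fieldD(1)[OF Y]]
  have "vf_add X Y p \<in> tangent_space A p" for p
    by (rule tangentI) (simp_all add: vf_add_def t algebra_simps)
  moreover have "smooth_fun A (\<lambda>p. vf_add X Y p f)" if "smooth_fun A f" for f
    unfolding vf_add_def by (rule smooth_fun_add[OF vector_fieldD(2)[OF X that] vector_fieldD(2)[OF Y that]])
  ultimately show ?thesis by (simp add: vector_fields_def)
qed

lemma vector_field_mult:
  assumes u: "smooth_fun A u" and X: "X \<in> vector_fields A"
  shows "vf_mult u X \<in> vector_fields A"
proof -
  note t = tangentD[OF vector_fieldD(1)[OF X]]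
  have "vf_mult u X p \<in> tangent_space A p" for p
    by (rule tangentI) (simp_all add: vf_mult_def t algebra_simps)
  moreover have "smooth_fun A (\<lambda>p. vf_mult u X p f)" if "smooth_fun A f" for f
    unfolding vf_mult_def by (rule smooth_fun_mult[OF u vector_fieldD(2)[OF X that]])
  ultimately show ?thesis by (simp add: vector_fields_def)
qed

lemma vector_field_bracket:
  assumes X: "X \<in> vector_fields A" and Y: "Y \<in> vector_fields A"
  shows "lie_bracket X Y \<in> vector_fields A"
proof -
  have "lie_bracket X Y p \<in> tangent_space A p" for p
  proof (rule tangentI)
    note t = tangentD[OF vector_fieldD(1)[OF X, of p]] tangentD[OF vector_fieldD(1)[OF Y, of p]]
    note tX = tangentD[OF vector_fieldD(1)[OF X]] and tY = tangentD[OF vector_fieldD(1)[OF Y]]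
    show "lie_bracket X Y p f = 0" if "\<not> smooth_fun A f" for f
      using that tangent_const[OF vector_fieldD(1)[OF X, of p], of 0] tangent_const[OF vector_fieldD(1)[OF Y, of p], of 0]
      by (simp add: lie_bracket_def tX(3) tY(3))
    fix f h a b assume f: "smooth_fun A f" and h: "smooth_fun A h"
    note s = vector_fieldD(2)[OF X f] vector_fieldD(2)[OF X h] vector_fieldD(2)[OF Y f] vector_fieldD(2)[OF Y h]
    show "lie_bracket X Y p (\<lambda>q. a * f q + b * h q) = a * lie_bracket X Y p f + b * lie_bracket X Y p h"
      unfolding lie_bracket_def using f h s by (simp add: tX(1) tY(1) algebra_simps)
    have e: "X p (\<lambda>q. u q * v q + u' q * v' q) = X p (\<lambda>q. u q * v q) + X p (\<lambda>q. u' q * v' q)"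
      "Y p (\<lambda>q. u q * v q + u' q * v' q) = Y p (\<lambda>q. u q * v q) + Y p (\<lambda>q. u' q * v' q)"
      if "smooth_fun A u" "smooth_fun A v" "smooth_fun A u'" "smooth_fun A v'" for u v u' v'
      using t(1)[of "\<lambda>q. u q * v q" "\<lambda>q. u' q * v' q" 1 1] t(4)[of "\<lambda>q. u q * v q" "\<lambda>q. u' q * v' q" 1 1]
        smooth_fun_mult that by auto
    show "lie_bracket X Y p (\<lambda>q. f q * h q) = f p * lie_bracket X Y p h + h p * lie_bracket X Y p f"
      unfolding lie_bracket_def using f h s by (simp add: tX(2) tY(2) e algebra_simps)
  qed
  moreover have "smooth_fun A (\<lambda>p. lie_bracket X Y p f)" if "smooth_fun A f" for f
    unfolding lie_bracket_def
    by (rule smooth_fun_diff[OF vector_fieldD(2)[OF X vector_fieldD(2)[OF Y that]]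
          vector_fieldD(2)[OF Y vector_fieldD(2)[OF X that]]])
  ultimately show ?thesis by (simp add: vector_fields_def)
qed

end

section \<open>Connections in parameters\<close>

context manifold
begin

lemma dvec_apply_linear:
  assumes \<xi>: "local_param A \<rho> \<xi>" and x: "x \<in> ball 0 \<rho>"
  shows "linear (\<lambda>u. dvec \<xi> x u f)"
  using dvec_linear[OF assms, of 1 _ 1] dvec_linear[OF assms, of _ _ 0 0]
  by (intro linearI) (simp_all add: tv_comb_def)

lemma constant_field:
  assumes \<xi>: "local_param A \<rho> \<xi>" and r: "0 < r" "r < \<rho>"
  obtains E where "E \<in> vector_fields A" "\<And>z. z \<in> ball 0 r \<Longrightarrow> E (\<xi> z) = dvec \<xi> z a"
    "\<And>z. z \<in> ball 0 r \<Longrightarrow> rep \<xi> E z = a" "\<And>z v. z \<in> ball 0 r \<Longrightarrow> dir_deriv v (rep \<xi> E) z = 0"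
proof -
  obtain E where E: "E \<in> vector_fields A" "\<And>z. z \<in> cball 0 r \<Longrightarrow> E (\<xi> z) = dvec \<xi> z a"
    by (rule extend_field[OF \<xi> r smooth_on_const[OF open_ball, where c = a]]) (rule that, auto)
  have 1: "rep \<xi> E z = a" if "z \<in> ball 0 r" for z
    by (rule rep_eqI[OF \<xi>]) (use that r E(2)[of z] in auto)
  have 2: "dir_deriv v (rep \<xi> E) z = 0" if "z \<in> ball 0 r" for z v
    by (rule dir_deriv_eq, rule has_derivative_transform_within_open[OF has_derivative_const[of a] open_ball that])
      (simp add: 1)
  show thesis by (rule that[OF E(1) _ 1 2]) (use E(2) in auto)
qed

text \<open>Schwarz's theorem, for fields with constant components in the parameters.\<close>

lemma constant_fields_commute:
  assumes \<xi>: "local_param A \<rho> \<xi>" and r: "r \<le> \<rho>" and x: "x \<in> ball 0 r"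
    and E: "E \<in> vector_fields A" "\<And>z. z \<in> ball 0 r \<Longrightarrow> E (\<xi> z) = dvec \<xi> z a"
    and F: "F \<in> vector_fields A" "\<And>z. z \<in> ball 0 r \<Longrightarrow> F (\<xi> z) = dvec \<xi> z b"
  shows "lie_bracket E F (\<xi> x) = (\<lambda>f. 0)"
proof
  fix f
  show "lie_bracket E F (\<xi> x) f = 0"
  proof (cases "smooth_fun A f")
    case True
    let ?f = "\<lambda>z. f (\<xi> z)"
    have x': "x \<in> ball 0 \<rho>" using x r by auto
    note smf = local_paramD(5)[OF \<xi> True]
    have *: "G (\<xi> x) (\<lambda>q. H q f) = dir_deriv u (dir_deriv v ?f) x"
      if G: "G \<in> vector_fields A" "\<And>z. z \<in> ball 0 r \<Longrightarrow> G (\<xi> z) = dvec \<xi> z u"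
      and H: "H \<in> vector_fields A" "\<And>z. z \<in> ball 0 r \<Longrightarrow> H (\<xi> z) = dvec \<xi> z v" for G H u v
    proof -
      have "G (\<xi> x) (\<lambda>q. H q f) = dir_deriv u (\<lambda>z. H (\<xi> z) f) x"
        using G(2)[OF x] vector_fieldD(2)[OF H(1) True] by (simp add: dvec_def)
      also have "\<dots> = dir_deriv u (dir_deriv v ?f) x"
      proof (rule dir_deriv_cong_open[OF open_ball x])
        show "H (\<xi> z) f = dir_deriv v ?f z" if "z \<in> ball 0 r" for z
          using H(2)[OF that] True by (simp add: dvec_def)
        show "(\<lambda>z. H (\<xi> z) f) differentiable at x"
          using smooth_on_has_derivative[OF local_paramD(5)[OF \<xi> vector_fieldD(2)[OF H(1) True]] x']
          by (auto simp: differentiable_def)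
      qed
      finally show ?thesis .
    qed
    show ?thesis
      using *[OF E F] *[OF F E] dir_deriv_commute[OF open_ball smf x', of a b] by (simp add: lie_bracket_def)
  qed (use tangentD(3)[OF vector_fieldD(1)[OF vector_field_bracket[OF E(1) F(1)]]] in simp)
qed

end

locale affine_manifold = manifold A
  for A :: "('a::{t2_space,second_countable_topology}, 'b::euclidean_space) atlas" +
  fixes D :: "'a conn"
  assumes connection: "affine_connection A D"
begin

lemma connD:
  assumes "X \<in> vector_fields A" "Y \<in> vector_fields A"
  shows "D X Y \<in> vector_fields A"
    "Z \<in> vector_fields A \<Longrightarrow> D (vf_add X Y) Z = vf_add (D X Z) (D Y Z)"
    "Z \<in> vector_fields A \<Longrightarrow> D X (vf_add Y Z) = vf_add (D X Y) (D X Z)"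
    "smooth_fun A u \<Longrightarrow> D (vf_mult u X) Y = vf_mult u (D X Y)"
    "smooth_fun A u \<Longrightarrow> D X (vf_mult u Y) = vf_add (vf_mult (\<lambda>p. X p u) Y) (vf_mult u (D X Y))"
  using assms connection unfolding affine_connection_def by blast+

text \<open>A connection is given on global fields; that it acts locally follows, as for tangent
  vectors, by multiplication with a bump function.\<close>

lemma conn_local1:
  assumes X: "X \<in> vector_fields A" "X' \<in> vector_fields A" and Y: "Y \<in> vector_fields A"
    and W: "open W" "p \<in> W" "\<And>q. q \<in> W \<Longrightarrow> X q = X' q"
  shows "D X Y p = D X' Y p"
proof -
  obtain \<eta> where \<eta>: "smooth_fun A \<eta>" "\<eta> p = 1" "\<And>q. q \<notin> W \<Longrightarrow> \<eta> q = 0"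
    using bump_function[OF W(1,2)] by blast
  have "vf_mult \<eta> X q = vf_mult \<eta> X' q" for q
    using W(3)[of q] \<eta>(3)[of q] by (cases "q \<in> W") (simp_all add: vf_mult_def)
  then have "vf_mult \<eta> X = vf_mult \<eta> X'" by blast
  then have "vf_mult \<eta> (D X Y) p = vf_mult \<eta> (D X' Y) p"
    using connD(4)[OF X(1) Y \<eta>(1)] connD(4)[OF X(2) Y \<eta>(1)] by simp
  then show ?thesis using \<eta>(2) by (simp add: vf_mult_def)
qed

lemma conn_local2:
  assumes X: "X \<in> vector_fields A" and Y: "Y \<in> vector_fields A" "Y' \<in> vector_fields A"
    and W: "open W" "p \<in> W" "\<And>q. q \<in> W \<Longrightarrow> Y q = Y' q"
  shows "D X Y p = D X Y' p"
proof -
  obtain \<eta> where \<eta>: "smooth_fun A \<eta>" "\<eta> p = 1" "\<And>q. q \<notin> W \<Longrightarrow> \<eta> q = 0"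
    using bump_function[OF W(1,2)] by blast
  have "vf_mult \<eta> Y q = vf_mult \<eta> Y' q" for q
    using W(3)[of q] \<eta>(3)[of q] by (cases "q \<in> W") (simp_all add: vf_mult_def)
  then have "vf_mult \<eta> Y = vf_mult \<eta> Y'" by blast
  then have "vf_add (vf_mult (\<lambda>p. X p \<eta>) Y) (vf_mult \<eta> (D X Y)) p
      = vf_add (vf_mult (\<lambda>p. X p \<eta>) Y') (vf_mult \<eta> (D X Y')) p"
    using connD(5)[OF X Y(1) \<eta>(1)] connD(5)[OF X Y(2) \<eta>(1)] by simp
  then have "X p \<eta> * Y p f + D X Y p f = X p \<eta> * Y' p f + D X Y' p f" for f
    using \<eta>(2) by (simp add: vf_mult_def vf_add_def fun_eq_iff)
  then show ?thesis using W(3)[OF W(2)] by (simp add: fun_eq_iff)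
qed

text \<open>Near a point every field is a combination of fields with constant components. These
  rules reduce the connection to its values on such fields.\<close>

lemma conn_combination:
  assumes B: "finite B" and E: "\<And>b. E b \<in> vector_fields A" and s: "\<And>b. smooth_fun A (s b)"
    and X: "X \<in> vector_fields A"
  shows "(\<lambda>p f. \<Sum>b\<in>B. s b p * E b p f) \<in> vector_fields A"
    "D X (\<lambda>p f. \<Sum>b\<in>B. s b p * E b p f) = (\<lambda>p f. \<Sum>b\<in>B. X p (s b) * E b p f + s b p * D X (E b) p f)"
    "D (\<lambda>p f. \<Sum>b\<in>B. s b p * E b p f) X = (\<lambda>p f. \<Sum>b\<in>B. s b p * D (E b) X p f)"
  using B
proof (induction B)
  case empty
  have 0: "(\<lambda>p f. \<Sum>b\<in>{}. s b p * E b p f) = vf_mult (\<lambda>_. 0) X"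
    by (simp add: vf_mult_def)
  { case 1 show ?case unfolding 0 by (rule vector_field_mult[OF smooth_fun_const X]) }
  { case 2 show ?case unfolding 0 connD(5)[OF X X smooth_fun_const]
      using tangent_const[OF vector_fieldD(1)[OF X]] by (simp add: vf_mult_def vf_add_def) }
  { case 3 show ?case unfolding 0 connD(4)[OF X X smooth_fun_const] by (simp add: vf_mult_def) }
next
  case (insert a B)
  let ?S = "\<lambda>p f. \<Sum>b\<in>B. s b p * E b p f"
  have a: "(\<lambda>p f. \<Sum>b\<in>insert a B. s b p * E b p f) = vf_add (vf_mult (s a) (E a)) ?S"
    using insert.hyps by (simp add: vf_mult_def vf_add_def)
  note m = vector_field_mult[OF s[of a] E[of a]]
  { case 1 show ?case unfolding a by (rule vector_field_add[OF m insert.IH(1)]) }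
  { case 2 show ?case unfolding a connD(3)[OF X m insert.IH(1)] connD(5)[OF X E s] insert.IH(2)
      using insert.hyps by (simp add: vf_mult_def vf_add_def) }
  { case 3 show ?case unfolding a connD(2)[OF m insert.IH(1) X] connD(4)[OF E X s] insert.IH(3)
      using insert.hyps by (simp add: vf_mult_def vf_add_def) }
qed

definition christoffel :: "real \<Rightarrow> ('b \<Rightarrow> 'a) \<Rightarrow> ('b \<Rightarrow> 'b \<Rightarrow> 'b \<Rightarrow> 'b) \<Rightarrow> bool" where
  "christoffel \<rho> \<xi> \<Gamma> \<longleftrightarrow>
     (\<forall>a b. smooth_on (ball 0 \<rho>) (\<lambda>x. \<Gamma> x a b)) \<and>
     (\<forall>x\<in>ball 0 \<rho>. (\<forall>b. linear (\<lambda>a. \<Gamma> x a b)) \<and> (\<forall>a. linear (\<Gamma> x a))) \<and>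
     (\<forall>X\<in>vector_fields A. \<forall>Y\<in>vector_fields A. \<forall>x\<in>ball 0 \<rho>.
        D X Y (\<xi> x) = dvec \<xi> x (dir_deriv (rep \<xi> X x) (rep \<xi> Y) x + \<Gamma> x (rep \<xi> X x) (rep \<xi> Y x)))"

lemma christoffelD:
  assumes "christoffel \<rho> \<xi> \<Gamma>"
  shows "smooth_on (ball 0 \<rho>) (\<lambda>x. \<Gamma> x a b)"
    "x \<in> ball 0 \<rho> \<Longrightarrow> linear (\<lambda>a. \<Gamma> x a b)" "x \<in> ball 0 \<rho> \<Longrightarrow> linear (\<Gamma> x a)"
    "X \<in> vector_fields A \<Longrightarrow> Y \<in> vector_fields A \<Longrightarrow> x \<in> ball 0 \<rho> \<Longrightarrow>
      D X Y (\<xi> x) = dvec \<xi> x (dir_deriv (rep \<xi> X x) (rep \<xi> Y) x + \<Gamma> x (rep \<xi> X x) (rep \<xi> Y x))"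
  using assms by (auto simp: christoffel_def)

lemma local_param_shrink: "local_param A \<rho> \<xi> \<Longrightarrow> 0 < r \<Longrightarrow> r \<le> \<rho> \<Longrightarrow> local_param A r \<xi>"
  using local_param_recentre[of \<rho> \<xi> 0 r] by simp

text \<open>The symbols are the components of the covariant derivatives of the fields that are
  constant in the parameters. By locality the general formula follows from the expansion of both
  arguments in these fields.\<close>

lemma christoffel_exists:
  obtains \<rho> \<xi> \<Gamma> where "local_param A \<rho> \<xi>" "\<xi> 0 = p" "christoffel \<rho> \<xi> \<Gamma>"
proof -
  obtain \<rho> \<xi> where \<xi>: "local_param A \<rho> \<xi>" "\<xi> 0 = p" using local_param_exists by blast
  define r where "r = \<rho> / 2"
  have r: "0 < r" "r < \<rho>" using local_paramD(1)[OF \<xi>(1)] by (auto simp: r_def)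
  have "\<exists>E. E \<in> vector_fields A \<and> (\<forall>z\<in>ball 0 r. E (\<xi> z) = dvec \<xi> z b)" for b
    by (rule constant_field[OF \<xi>(1) r, of b]) blast
  then obtain E where E: "\<And>b. E b \<in> vector_fields A" "\<And>b z. z \<in> ball 0 r \<Longrightarrow> E b (\<xi> z) = dvec \<xi> z b" by metis
  have "\<exists>f. smooth_fun A f \<and> (\<forall>z\<in>ball 0 r. f (\<xi> z) = z \<bullet> b)" for b
    by (rule extend_function[OF \<xi>(1) r smooth_on_linear[OF bounded_linear_inner_left[of b] open_ball]]) auto
  then obtain y where y: "\<And>b. smooth_fun A (y b)" "\<And>b z. z \<in> ball 0 r \<Longrightarrow> y b (\<xi> z) = z \<bullet> b" by metis
  define \<Gamma> where "\<Gamma> x a b = (\<Sum>i\<in>Basis. \<Sum>j\<in>Basis. ((a \<bullet> i) * (b \<bullet> j)) *\<^sub>R rep \<xi> (D (E i) (E j)) x)" for x a b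
  have W: "open (\<xi> ` ball 0 r)" by (rule local_paramD(4)[OF \<xi>(1) open_ball]) (use r in auto)
  have comp: "X (\<xi> z) (y b) = rep \<xi> X z \<bullet> b" if "X \<in> vector_fields A" "z \<in> ball 0 r" for X z b
  proof -
    have z: "z \<in> ball 0 \<rho>" using that r by auto
    show ?thesis
      using dvec_coordinate[OF \<xi>(1) z y(1) open_ball that(2) y(2)] field_eq_dvec[OF \<xi>(1) that(1) z] by simp
  qed
  have expand: "X q = (\<lambda>f. \<Sum>b\<in>Basis. X q (y b) * E b q f)"
    if X: "X \<in> vector_fields A" and q: "q \<in> \<xi> ` ball 0 r" for X q
  proof
    fix f
    obtain z where z: "z \<in> ball 0 r" "q = \<xi> z" using q by blast
    have z': "z \<in> ball 0 \<rho>" using z r by auto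
    show "X q f = (\<Sum>b\<in>Basis. X q (y b) * E b q f)"
      using linear_basis_expansion[OF dvec_apply_linear[OF \<xi>(1) z', of f], of "rep \<xi> X z"]
        field_eq_dvec[OF \<xi>(1) X z'] comp[OF X z(1)] E(2)[OF z(1)] z(2) by simp
  qed
  have "christoffel r \<xi> \<Gamma>"
    unfolding christoffel_def
  proof (intro conjI ballI allI)
    fix a b
    have "smooth_on (ball 0 r) (rep \<xi> (D (E i) (E j)))" for i j
      by (rule smooth_on_subset[OF rep_smooth[OF \<xi>(1) connD(1)[OF E(1) E(1)]]]) (use r in auto)
    then show "smooth_on (ball 0 r) (\<lambda>x. \<Gamma> x a b)"
      unfolding \<Gamma>_def by (intro smooth_on_sum smooth_on_linear_comp[OF bounded_linear_scaleR_right] open_ball)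
  next
    fix x a b
    show "linear (\<lambda>a. \<Gamma> x a b)"
      unfolding \<Gamma>_def by (intro linear_compose_sum ballI linearI) (simp_all add: inner_add_left algebra_simps)
    show "linear (\<Gamma> x a)"
      unfolding \<Gamma>_def by (intro linear_compose_sum ballI linearI) (simp_all add: inner_add_left algebra_simps)
  next
    fix X Y and x :: 'b assume X: "X \<in> vector_fields A" and Y: "Y \<in> vector_fields A" and x: "x \<in> ball 0 r"
    have x': "x \<in> ball 0 \<rho>" using x r by auto
    let ?p = "\<xi> x" and ?X = "rep \<xi> X x" and ?Y = "rep \<xi> Y x"
    note s = vector_fieldD(2)[OF X y(1)] and t = vector_fieldD(2)[OF Y y(1)]
    note dY = smooth_on_has_derivative[OF rep_smooth[OF \<xi>(1) Y] x']
    have pW: "?p \<in> \<xi> ` ball 0 r" using x by blast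
    show "D X Y ?p = dvec \<xi> x (dir_deriv ?X (rep \<xi> Y) x + \<Gamma> x ?X ?Y)"
    proof
      fix f
      interpret L: linear "\<lambda>u. dvec \<xi> x u f" by (rule dvec_apply_linear[OF \<xi>(1) x'])
      have X': "D (\<lambda>p f. \<Sum>b\<in>Basis. X p (y b) * E b p f) Y = (\<lambda>p f. \<Sum>b\<in>Basis. X p (y b) * D (E b) Y p f)"
        and VX': "(\<lambda>p f. \<Sum>b\<in>Basis. X p (y b) * E b p f) \<in> vector_fields A"
        by (rule conn_combination(3)[OF finite_Basis E(1) s Y], rule conn_combination(1)[OF finite_Basis E(1) s X])
      have 1: "D X Y ?p f = (\<Sum>b\<in>Basis. (?X \<bullet> b) * D (E b) Y ?p f)"
        using conn_local1[OF X VX' Y W pW expand[OF X]] X' comp[OF X x] by simp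
      have "D (E b) Y ?p f = (\<Sum>c\<in>Basis. E b ?p (\<lambda>q. Y q (y c)) * E c ?p f + (?Y \<bullet> c) * D (E b) (E c) ?p f)" for b
      proof -
        have Y': "D (E b) (\<lambda>p f. \<Sum>c\<in>Basis. Y p (y c) * E c p f)
            = (\<lambda>p f. \<Sum>c\<in>Basis. E b p (\<lambda>q. Y q (y c)) * E c p f + Y p (y c) * D (E b) (E c) p f)"
          and VY': "(\<lambda>p f. \<Sum>c\<in>Basis. Y p (y c) * E c p f) \<in> vector_fields A"
          by (rule conn_combination(2)[OF finite_Basis E(1) t E(1)], rule conn_combination(1)[OF finite_Basis E(1) t X])
        show ?thesis
          using conn_local2[OF E(1)[of b] Y VY' W pW expand[OF Y]] Y' comp[OF Y x] by simp
      qed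
      moreover have "E b ?p (\<lambda>q. Y q (y c)) = dir_deriv b (rep \<xi> Y) x \<bullet> c" for b c
      proof -
        have "((\<lambda>z. rep \<xi> Y z \<bullet> c) has_derivative (\<lambda>v. dir_deriv v (rep \<xi> Y) x \<bullet> c)) (at x)"
          by (rule has_derivative_inner_left[OF dY])
        then have "((\<lambda>z. Y (\<xi> z) (y c)) has_derivative (\<lambda>v. dir_deriv v (rep \<xi> Y) x \<bullet> c)) (at x)"
          by (rule has_derivative_transform_within_open[OF _ open_ball x]) (simp add: comp[OF Y])
        from dir_deriv_eq[OF this] show ?thesis
          using E(2)[OF x] t by (simp add: dvec_def)
      qed
      moreover have "D (E b) (E c) ?p f = dvec \<xi> x (rep \<xi> (D (E b) (E c)) x) f" for b c
        using field_eq_dvec[OF \<xi>(1) connD(1)[OF E(1) E(1)] x'] by simp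
      ultimately have 2: "D (E b) Y ?p f = dvec \<xi> x (\<Sum>c\<in>Basis. (dir_deriv b (rep \<xi> Y) x \<bullet> c) *\<^sub>R c
          + (?Y \<bullet> c) *\<^sub>R rep \<xi> (D (E b) (E c)) x) f" for b
        using E(2)[OF x] by (simp add: L.sum L.add L.scale)
      have "D X Y ?p f = dvec \<xi> x (\<Sum>b\<in>Basis. (?X \<bullet> b) *\<^sub>R (\<Sum>c\<in>Basis. (dir_deriv b (rep \<xi> Y) x \<bullet> c) *\<^sub>R c
          + (?Y \<bullet> c) *\<^sub>R rep \<xi> (D (E b) (E c)) x)) f"
        unfolding 1 2 by (simp add: L.sum L.scale)
      also have "(\<Sum>b\<in>Basis. (?X \<bullet> b) *\<^sub>R (\<Sum>c\<in>Basis. (dir_deriv b (rep \<xi> Y) x \<bullet> c) *\<^sub>R c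
          + (?Y \<bullet> c) *\<^sub>R rep \<xi> (D (E b) (E c)) x)) = dir_deriv ?X (rep \<xi> Y) x + \<Gamma> x ?X ?Y"
        using linear_basis_expansion[OF has_derivative_linear[OF dY], of ?X]
        by (simp add: \<Gamma>_def sum.distrib scaleR_add_right scaleR_sum_right euclidean_representation)
      finally show "D X Y ?p f = dvec \<xi> x (dir_deriv ?X (rep \<xi> Y) x + \<Gamma> x ?X ?Y) f" .
    qed
  qed
  then show thesis using that[OF local_param_shrink[OF \<xi>(1) r(1)] \<xi>(2)] r by simp
qed

text \<open>Torsion and curvature are evaluated on fields with constant components; as these
  commute, the bracket terms disappear.\<close>

lemma christoffel_symmetric:
  assumes "torsion_free A D" and \<xi>: "local_param A \<rho> \<xi>" and \<Gamma>: "christoffel \<rho> \<xi> \<Gamma>" and x: "x \<in> ball 0 \<rho>"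
  shows "\<Gamma> x a b = \<Gamma> x b a"
proof (rule dvec_inj[OF \<xi> x], rule ext)
  fix f
  define r where "r = (norm x + \<rho>) / 2"
  have r: "0 < r" "r < \<rho>" "x \<in> ball 0 r"
    using x by (auto simp: r_def intro: add_nonneg_pos local_paramD(1)[OF \<xi>])
  obtain E where E: "E \<in> vector_fields A" "\<And>z. z \<in> ball 0 r \<Longrightarrow> E (\<xi> z) = dvec \<xi> z a"
    "\<And>z. z \<in> ball 0 r \<Longrightarrow> rep \<xi> E z = a" "\<And>z v. z \<in> ball 0 r \<Longrightarrow> dir_deriv v (rep \<xi> E) z = 0"
    using constant_field[OF \<xi> r(1,2)] by metis
  obtain F where F: "F \<in> vector_fields A" "\<And>z. z \<in> ball 0 r \<Longrightarrow> F (\<xi> z) = dvec \<xi> z b"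
    "\<And>z. z \<in> ball 0 r \<Longrightarrow> rep \<xi> F z = b" "\<And>z v. z \<in> ball 0 r \<Longrightarrow> dir_deriv v (rep \<xi> F) z = 0"
    using constant_field[OF \<xi> r(1,2)] by metis
  have "D E F (\<xi> x) f - D F E (\<xi> x) f - lie_bracket E F (\<xi> x) f = 0"
    using assms(1) E F unfolding torsion_free_def by blast
  moreover have "lie_bracket E F (\<xi> x) = (\<lambda>f. 0)"
    by (rule constant_fields_commute[OF \<xi> less_imp_le[OF r(2)] r(3) E(1,2) F(1,2)])
  ultimately show "dvec \<xi> x (\<Gamma> x a b) f = dvec \<xi> x (\<Gamma> x b a) f"
    using christoffelD(4)[OF \<Gamma> E(1) F(1) x] christoffelD(4)[OF \<Gamma> F(1) E(1) x] E(3,4)[OF r(3)] F(3,4)[OF r(3)]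
    by simp
qed

lemma christoffel_flat:
  assumes "flat_connection A D" and \<xi>: "local_param A \<rho> \<xi>" and \<Gamma>: "christoffel \<rho> \<xi> \<Gamma>" and x: "x \<in> ball 0 \<rho>"
  shows "dir_deriv a (\<lambda>y. \<Gamma> y b c) x + \<Gamma> x a (\<Gamma> x b c) = dir_deriv b (\<lambda>y. \<Gamma> y a c) x + \<Gamma> x b (\<Gamma> x a c)"
proof (rule dvec_inj[OF \<xi> x], rule ext)
  fix f
  define r where "r = (norm x + \<rho>) / 2"
  have r: "0 < r" "r < \<rho>" "x \<in> ball 0 r"
    using x by (auto simp: r_def intro: add_nonneg_pos local_paramD(1)[OF \<xi>])
  have "\<exists>E. E \<in> vector_fields A \<and> (\<forall>z\<in>ball 0 r. E (\<xi> z) = dvec \<xi> z a \<and> rep \<xi> E z = a \<and> (\<forall>v. dir_deriv v (rep \<xi> E) z = 0))" for a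
    by (rule constant_field[OF \<xi> r(1,2), of a]) blast
  then obtain E where E: "\<And>a. E a \<in> vector_fields A"
     "\<And>a z. z \<in> ball 0 r \<Longrightarrow> E a (\<xi> z) = dvec \<xi> z a" "\<And>a z. z \<in> ball 0 r \<Longrightarrow> rep \<xi> (E a) z = a"
     "\<And>a z v. z \<in> ball 0 r \<Longrightarrow> dir_deriv v (rep \<xi> (E a)) z = 0" by metis
  have second: "D (E u) (D (E v) (E w)) (\<xi> x) = dvec \<xi> x (dir_deriv u (\<lambda>y. \<Gamma> y v w) x + \<Gamma> x u (\<Gamma> x v w))" for u v w
  proof -
    have Y: "D (E v) (E w) \<in> vector_fields A" by (rule connD(1)[OF E(1) E(1)])
    have rY: "rep \<xi> (D (E v) (E w)) z = \<Gamma> z v w" if "z \<in> ball 0 r" for z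
    proof -
      have z: "z \<in> ball 0 \<rho>" using that r by auto
      show ?thesis
        using rep_eqI[OF \<xi> z, of "D (E v) (E w)", OF christoffelD(4)[OF \<Gamma> E(1) E(1) z]] E(3,4)[OF that] by simp
    qed
    have "dir_deriv u (rep \<xi> (D (E v) (E w))) x = dir_deriv u (\<lambda>y. \<Gamma> y v w) x"
      by (rule dir_deriv_cong_open[OF open_ball r(3) rY])
        (use smooth_on_has_derivative[OF rep_smooth[OF \<xi> Y] x] in \<open>auto simp: differentiable_def\<close>)
    then show ?thesis
      using christoffelD(4)[OF \<Gamma> E(1) Y x] E(3)[OF r(3)] rY[OF r(3)] by simp
  qed
  let ?B = "lie_bracket (E a) (E b)"
  have B: "?B \<in> vector_fields A" by (rule vector_field_bracket[OF E(1) E(1)])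
  have "?B (\<xi> x) = dvec \<xi> x 0"
    unfolding dvec_zero[OF \<xi> x]
    by (rule constant_fields_commute[OF \<xi> less_imp_le[OF r(2)] r(3) E(1,2) E(1,2)])
  then have "rep \<xi> ?B x = 0" by (rule rep_eqI[OF \<xi> x])
  then have "D ?B (E c) (\<xi> x) = dvec \<xi> x 0"
    using christoffelD(4)[OF \<Gamma> B E(1) x] E(4)[OF r(3)] linear_0[OF christoffelD(2)[OF \<Gamma> x]] by simp
  moreover have "D (E a) (D (E b) (E c)) (\<xi> x) f - D (E b) (D (E a) (E c)) (\<xi> x) f - D ?B (E c) (\<xi> x) f = 0"
    using assms(1) E(1) unfolding flat_connection_def by blast
  ultimately show "dvec \<xi> x (dir_deriv a (\<lambda>y. \<Gamma> y b c) x + \<Gamma> x a (\<Gamma> x b c)) f =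
     dvec \<xi> x (dir_deriv b (\<lambda>y. \<Gamma> y a c) x + \<Gamma> x b (\<Gamma> x a c)) f"
    by (simp add: second dvec_zero[OF \<xi> x])
qed

end

section \<open>Flat coordinates\<close>

text \<open>Gram-Schmidt orthonormalisation of the standard basis for an arbitrary positive
  definite form.\<close>

lemma orthonormal_frame_exists:
  fixes H :: "'b::euclidean_space \<Rightarrow> 'b \<Rightarrow> real"
  assumes lin: "\<And>u. linear (H u)" and sym: "\<And>u v. H u v = H v u" and pos: "\<And>u. u \<noteq> 0 \<Longrightarrow> H u u > 0"
  obtains J J' :: "'b \<Rightarrow> 'b" where "linear J" "linear J'" "\<And>u. J (J' u) = u" "\<And>u. J' (J u) = u"
    "\<And>u v. H (J u) (J v) = u \<bullet> v"
proof -
  have lin': "linear (\<lambda>u. H u v)" for v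
  proof -
    have "(\<lambda>u. H u v) = H v" using sym by blast
    then show ?thesis using lin by simp
  qed
  have "\<exists>f. (\<forall>b\<in>B. f b \<in> span B) \<and> (\<forall>b\<in>B. \<forall>c\<in>B. H (f b) (f c) = (if b = c then 1 else 0))"
    if "finite B" "B \<subseteq> Basis" for B :: "'b set"
    using that
  proof (induction B)
    case (insert b B)
    then obtain f where f': "\<forall>b\<in>B. f b \<in> span B"
       "\<forall>b\<in>B. \<forall>c\<in>B. H (f b) (f c) = (if b = c then 1 else 0)" by auto
    then have f: "\<And>b. b \<in> B \<Longrightarrow> f b \<in> span B"
       "\<And>b c. b \<in> B \<Longrightarrow> c \<in> B \<Longrightarrow> H (f b) (f c) = (if b = c then 1 else 0)" by auto
    define v where "v = b - (\<Sum>c\<in>B. H b (f c) *\<^sub>R f c)"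
    have s: "(\<Sum>c\<in>B. H b (f c) *\<^sub>R f c) \<in> span B"
      by (intro span_sum span_scale f)
    have "b \<notin> span B"
    proof -
      have "B \<subseteq> Basis - {b}" using insert by auto
      then have "span B \<subseteq> span (Basis - {b})" by (rule span_mono)
      moreover have "b \<notin> span (Basis - {b})"
        using independent_Basis insert.prems unfolding dependent_def by auto
      ultimately show ?thesis by blast
    qed
    then have "v \<noteq> 0" using s by (auto simp: v_def)
    then have Hv: "H v v > 0" by (rule pos)
    have vf: "H v (f d) = 0" if "d \<in> B" for d
    proof -
      have "H v (f d) = H b (f d) - (\<Sum>c\<in>B. H b (f c) * H (f c) (f d))"
        unfolding v_def by (simp add: linear_diff[OF lin'] linear_sum[OF lin'] linear_scale[OF lin'])
      also have "(\<Sum>c\<in>B. H b (f c) * H (f c) (f d)) = (\<Sum>c\<in>B. if c = d then H b (f c) else 0)"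
        by (rule sum.cong) (use f(2) that in auto)
      also have "\<dots> = H b (f d)" using that insert.hyps by simp
      finally show ?thesis by simp
    qed
    define g where "g = f(b := (1 / sqrt (H v v)) *\<^sub>R v)"
    have "v \<in> span (insert b B)"
      unfolding v_def using subsetD[OF span_mono[of B "insert b B"] s] by (intro span_diff) (auto intro: span_base)
    then have 1: "\<forall>c\<in>insert b B. g c \<in> span (insert b B)"
      using f(1) span_mono[of B "insert b B"] insert.hyps by (auto simp: g_def intro!: span_scale)
    have gb: "g c = f c" if "c \<in> B" for c using that insert.hyps by (auto simp: g_def)
    have "H (g b) (g b) = 1"
      using Hv by (simp add: g_def linear_scale[OF lin] linear_scale[OF lin'])
    moreover have "H (g b) (g c) = 0" "H (g c) (g b) = 0" if "c \<in> B" for c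
      using vf[OF that] sym[of "f c" v] gb[OF that]
      by (simp_all add: g_def linear_scale[OF lin] linear_scale[OF lin'])
    ultimately have "\<forall>c\<in>insert b B. \<forall>d\<in>insert b B. H (g c) (g d) = (if c = d then 1 else 0)"
      using f(2) gb insert.hyps by auto
    with 1 show ?case by blast
  qed simp
  from this[OF finite_Basis subset_refl] obtain f :: "'b \<Rightarrow> 'b" where
    f: "\<forall>b\<in>Basis. \<forall>c\<in>Basis. H (f b) (f c) = (if b = c then 1 else 0)" by blast
  define J where "J u = (\<Sum>b\<in>Basis. (u \<bullet> b) *\<^sub>R f b)" for u
  have J: "linear J"
    unfolding J_def by (intro linear_compose_sum ballI linearI) (simp_all add: inner_add_left algebra_simps)
  have iso: "H (J u) (J v) = u \<bullet> v" for u v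
  proof -
    have "H (J u) (J v) = (\<Sum>b\<in>Basis. (u \<bullet> b) * H (f b) (J v))"
      unfolding J_def[of u] by (simp add: linear_sum[OF lin'] linear_scale[OF lin'])
    also have "\<dots> = (\<Sum>b\<in>Basis. \<Sum>c\<in>Basis. (u \<bullet> b) * (v \<bullet> c) * H (f b) (f c))"
      unfolding J_def by (simp add: linear_sum[OF lin] linear_scale[OF lin] sum_distrib_left mult_ac)
    also have "\<dots> = (\<Sum>b\<in>Basis. \<Sum>c\<in>Basis. if b = c then (u \<bullet> b) * (v \<bullet> c) else 0)"
      by (intro sum.cong refl) (simp add: f)
    also have "\<dots> = u \<bullet> v" by (simp add: euclidean_inner[of u v])
    finally show ?thesis .
  qed
  have "inj J"
    unfolding linear_injective_0[OF J] using iso by (metis inner_eq_zero_iff linear_0[OF lin])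
  then obtain J' where J': "linear J'" "\<forall>x. J' (J x) = x" "\<forall>x. J (J' x) = x"
    using linear_injective_isomorphism[OF J] by blast
  show thesis by (rule that[of J J']) (use J J' iso in auto)
qed

context manifold
begin

lemma tensor2D:
  assumes "tensor2 A T" "u \<in> tangent_space A p" "v \<in> tangent_space A p" "w \<in> tangent_space A p"
  shows "T p (tv_comb a u b v) w = a * T p u w + b * T p v w"
    "T p w (tv_comb a u b v) = a * T p w u + b * T p w v"
  using assms unfolding tensor2_def by blast+

lemma tensor2_component_linear:
  assumes T: "tensor2 A T" and \<xi>: "local_param A \<rho> \<xi>" and x: "x \<in> ball 0 \<rho>"
  shows "linear (\<lambda>a. T (\<xi> x) (dvec \<xi> x a) (dvec \<xi> x b))" "linear (\<lambda>b. T (\<xi> x) (dvec \<xi> x a) (dvec \<xi> x b))"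
proof -
  note t = dvec_tangent[OF \<xi> x] and l = dvec_linear[OF \<xi> x]
  note * = tensor2D[OF T t t t]
  show "linear (\<lambda>a. T (\<xi> x) (dvec \<xi> x a) (dvec \<xi> x b))"
    using *(1)[of 1 _ 1] l[of 1 _ 1] *(1)[of _ _ 0 0] l[of _ _ 0 0] by (intro linearI) simp_all
  show "linear (\<lambda>b. T (\<xi> x) (dvec \<xi> x a) (dvec \<xi> x b))"
    using *(2)[of _ 1 _ 1] l[of 1 _ 1] *(2)[of _ _ _ 0 0] l[of _ _ 0 0] by (intro linearI) simp_all
qed

lemma tensor2_component_smooth:
  assumes T: "tensor2 A T" and \<xi>: "local_param A \<rho> \<xi>"
  shows "smooth_on (ball 0 \<rho>) (\<lambda>x. T (\<xi> x) (dvec \<xi> x a) (dvec \<xi> x b))"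
proof (rule smooth_on_local)
  fix x :: 'b assume x: "x \<in> ball 0 \<rho>"
  define r where "r = (norm x + \<rho>) / 2"
  have r: "0 < r" "r < \<rho>" "x \<in> ball 0 r"
    using x by (auto simp: r_def intro: add_nonneg_pos local_paramD(1)[OF \<xi>])
  obtain E where E: "E \<in> vector_fields A" "\<And>z. z \<in> ball 0 r \<Longrightarrow> E (\<xi> z) = dvec \<xi> z a"
    using constant_field[OF \<xi> r(1,2)] by metis
  obtain F where F: "F \<in> vector_fields A" "\<And>z. z \<in> ball 0 r \<Longrightarrow> F (\<xi> z) = dvec \<xi> z b"
    using constant_field[OF \<xi> r(1,2)] by metis
  have "smooth_fun A (\<lambda>p. T p (E p) (F p))" using T E(1) F(1) by (simp add: tensor2_def)
  then have "smooth_on (ball 0 r) (\<lambda>z. T (\<xi> z) (E (\<xi> z)) (F (\<xi> z)))"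
    by (rule smooth_on_subset[OF local_paramD(5)[OF \<xi>]]) (use r in auto)
  then have "smooth_on (ball 0 r) (\<lambda>z. T (\<xi> z) (dvec \<xi> z a) (dvec \<xi> z b))"
    by (rule smooth_on_cong[OF open_ball]) (simp add: E F)
  then show "\<exists>S. open S \<and> x \<in> S \<and> smooth_on S (\<lambda>z. T (\<xi> z) (dvec \<xi> z a) (dvec \<xi> z b))"
    using r(3) by blast
qed

text \<open>A reparametrisation \<open>g\<close> with smooth left inverse \<open>Y\<close>:
  composition with \<open>g\<close> and with \<open>Y\<close> carries smoothness in the old
  parameters to smoothness in the new ones and back.\<close>

lemma local_param_compose:
  assumes \<xi>: "local_param A \<rho> \<xi>" and \<rho>': "\<rho>' > 0" and g: "smooth_on (ball 0 \<rho>') g"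
    and im: "open (g ` ball 0 \<rho>')" "g ` ball 0 \<rho>' \<subseteq> ball 0 \<rho>"
    and Y: "smooth_on (g ` ball 0 \<rho>') Y" "\<And>y. y \<in> ball 0 \<rho>' \<Longrightarrow> Y (g y) = y"
  shows "local_param A \<rho>' (\<lambda>y. \<xi> (g y))"
proof -
  note L = local_paramD[OF \<xi>]
  have cg: "continuous_on (ball 0 \<rho>') g" by (rule smooth_on_continuous_on[OF g])
  show ?thesis
    unfolding local_param_def
  proof (intro conjI allI impI)
    show "inj_on (\<lambda>y. \<xi> (g y)) (ball 0 \<rho>')"
    proof (rule inj_onI)
      fix y z assume yz: "y \<in> ball 0 \<rho>'" "z \<in> ball 0 \<rho>'" "\<xi> (g y) = \<xi> (g z)"
      have "g y \<in> ball 0 \<rho>" "g z \<in> ball 0 \<rho>" using im(2) yz by blast+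
      then have "g y = g z" by (rule inj_onD[OF L(2) yz(3)])
      then show "y = z" using Y(2) yz by metis
    qed
    show "continuous_on (ball 0 \<rho>') (\<lambda>y. \<xi> (g y))"
      by (rule continuous_on_compose2[OF L(3) cg im(2)])
    show "open ((\<lambda>y. \<xi> (g y)) ` S)" if S: "open S" "S \<subseteq> ball 0 \<rho>'" for S
    proof -
      have "g ` S = g ` ball 0 \<rho>' \<inter> Y -` S" using S(2) Y(2) by force
      then have "open (g ` S)"
        using continuous_open_preimage[OF smooth_on_continuous_on[OF Y(1)] im(1) S(1)] by simp
      moreover have "(\<lambda>y. \<xi> (g y)) ` S = \<xi> ` (g ` S)" by auto
      ultimately show ?thesis using L(4)[of "g ` S"] S(2) im(2) by (metis image_mono order_trans)
    qed
    show "smooth_on (ball 0 \<rho>') (\<lambda>y. f (\<xi> (g y)))" if "smooth_fun A f" for f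
      by (rule smooth_on_compose[OF open_ball open_ball g L(5)[OF that] im(2)])
    fix f :: "'a \<Rightarrow> real" and r assume r: "r < \<rho>'" and z: "\<forall>q. q \<notin> (\<lambda>y. \<xi> (g y)) ` cball 0 r \<longrightarrow> f q = 0"
      and sm: "smooth_on (ball 0 \<rho>') (\<lambda>y. f (\<xi> (g y)))"
    have sub: "cball 0 r \<subseteq> ball (0::'b) \<rho>'" using r by auto
    have cpt: "compact (g ` cball 0 r)"
      by (rule compact_continuous_image[OF continuous_on_subset[OF cg sub]]) simp
    have "\<exists>s. s < \<rho> \<and> g ` cball 0 r \<subseteq> cball 0 s"
    proof (cases "r < 0")
      case True then show ?thesis using L(1) by (intro exI[of _ 0]) auto
    next
      case False
      have "continuous_on (g ` cball 0 r) norm" by (intro continuous_intros)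
      then obtain m where m: "m \<in> g ` cball 0 r" "\<And>y. y \<in> g ` cball 0 r \<Longrightarrow> norm y \<le> norm m"
        using continuous_attains_sup[OF cpt, of norm] False by auto
      have "m \<in> ball 0 \<rho>" using m(1) sub im(2) by blast
      then show ?thesis using m(2) by (intro exI[of _ "norm m"]) auto
    qed
    then obtain s where s: "s < \<rho>" "g ` cball 0 r \<subseteq> cball 0 s" by blast
    show "smooth_fun A f"
    proof (rule L(6)[OF s(1)])
      show "f q = 0" if "q \<notin> \<xi> ` cball 0 s" for q
        using z that s(2) by blast
      show "smooth_on (ball 0 \<rho>) (\<lambda>x. f (\<xi> x))"
      proof (rule smooth_on_local)
        fix x :: 'b assume x: "x \<in> ball 0 \<rho>"
        show "\<exists>S. open S \<and> x \<in> S \<and> smooth_on S (\<lambda>x. f (\<xi> x))"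
        proof (cases "x \<in> g ` ball 0 \<rho>'")
          case True
          have "smooth_on (g ` ball 0 \<rho>') (\<lambda>x. f (\<xi> (g (Y x))))"
            by (rule smooth_on_compose[OF im(1) open_ball Y(1) sm]) (use Y(2) in auto)
          then have "smooth_on (g ` ball 0 \<rho>') (\<lambda>x. f (\<xi> x))"
            by (rule smooth_on_cong[OF im(1)]) (use Y(2) in auto)
          then show ?thesis using im(1) True by (intro exI[of _ "g ` ball 0 \<rho>'"]) simp
        next
          case False
          have o: "open (ball 0 \<rho> - g ` cball 0 r)" by (intro open_Diff open_ball compact_imp_closed cpt)
          have "smooth_on (ball 0 \<rho> - g ` cball 0 r) (\<lambda>x. f (\<xi> x))"
          proof (rule smooth_on_cong[OF o smooth_on_const[OF o, of 0]])
            fix w assume w: "w \<in> ball 0 \<rho> - g ` cball 0 r"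
            have "\<xi> w \<noteq> \<xi> (g y)" if "y \<in> cball 0 r" for y
              using inj_onD[OF L(2), of w "g y"] w that im(2) sub by blast
            then show "0 = f (\<xi> w)" using z by (metis imageE)
          qed
          moreover have "x \<in> ball 0 \<rho> - g ` cball 0 r" using x False sub by blast
          ultimately show ?thesis using o by (intro exI[of _ "ball 0 \<rho> - g ` cball 0 r"]) simp
        qed
      qed
    qed
  qed (rule \<rho>')
qed

end

context affine_manifold
begin

text \<open>Fields with constant components are parallel where the Christoffel symbols vanish,
  so the correction terms in the covariant derivative of a tensor drop out.\<close>

lemma flat_cov_deriv2:
  assumes T: "tensor2 A T" and e: "local_param A \<rho> e" and flat: "christoffel \<rho> e (\<lambda>x a b. 0)"
    and x: "x \<in> ball 0 \<rho>"
  obtains E where "\<And>a. E a \<in> vector_fields A"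
    "\<And>v a b. cov_deriv2 D T (E v) (E a) (E b) (e x) = dir_deriv v (\<lambda>z. T (e z) (dvec e z a) (dvec e z b)) x"
proof -
  define r where "r = (norm x + \<rho>) / 2"
  have r: "0 < r" "r < \<rho>" "x \<in> ball 0 r"
    using x by (auto simp: r_def intro: add_nonneg_pos local_paramD(1)[OF e])
  have "\<exists>E. E \<in> vector_fields A \<and> (\<forall>z\<in>ball 0 r. E (e z) = dvec e z a \<and> rep e E z = a \<and> (\<forall>v. dir_deriv v (rep e E) z = 0))" for a
    by (rule constant_field[OF e r(1,2), of a]) blast
  then obtain E where E: "\<And>a. E a \<in> vector_fields A"
     "\<And>a z. z \<in> ball 0 r \<Longrightarrow> E a (e z) = dvec e z a" "\<And>a z. z \<in> ball 0 r \<Longrightarrow> rep e (E a) z = a"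
     "\<And>a z v. z \<in> ball 0 r \<Longrightarrow> dir_deriv v (rep e (E a)) z = 0" by metis
  have "cov_deriv2 D T (E v) (E a) (E b) (e x) = dir_deriv v (\<lambda>z. T (e z) (dvec e z a) (dvec e z b)) x" for v a b
  proof -
    have 0: "D (E v) (E c) (e x) = dvec e x 0" for c
      using christoffelD(4)[OF flat E(1) E(1) x] E(4)[OF r(3)] by simp
    have sm: "smooth_fun A (\<lambda>q. T q (E a q) (E b q))" using T E(1) by (simp add: tensor2_def)
    have "E v (e x) (\<lambda>q. T q (E a q) (E b q)) = dir_deriv v (\<lambda>z. T (e z) (E a (e z)) (E b (e z))) x"
      using E(2)[OF r(3)] sm by (simp add: dvec_def)
    also have "\<dots> = dir_deriv v (\<lambda>z. T (e z) (dvec e z a) (dvec e z b)) x"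
      by (rule dir_deriv_cong_open[OF open_ball r(3)])
        (use smooth_on_has_derivative[OF local_paramD(5)[OF e sm] x] E(2) in \<open>auto simp: differentiable_def\<close>)
    finally show ?thesis
      unfolding cov_deriv2_def 0 E(2)[OF r(3)]
      using linear_0[OF tensor2_component_linear(1)[OF T e x]] linear_0[OF tensor2_component_linear(2)[OF T e x]] by simp
  qed
  with E(1) show thesis by (rule that)
qed

end

locale flat_riemannian = affine_manifold A D
  for A :: "('a::{t2_space,second_countable_topology}, 'b::euclidean_space) atlas" and D :: "'a conn" +
  fixes h :: "'a form2"
  assumes torsion: "torsion_free A D" and flat: "flat_connection A D"
    and metric: "riemannian_metric A h" and parallel: "D_flat A D h"
begin

text \<open>Affine coordinates of the connection that are orthonormal for the parallel
  metric.\<close>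

definition flat_param :: "real \<Rightarrow> ('b \<Rightarrow> 'a) \<Rightarrow> bool" where
  "flat_param \<rho> e \<longleftrightarrow> local_param A \<rho> e \<and> christoffel \<rho> e (\<lambda>x a b. 0) \<and>
     (\<forall>x\<in>ball 0 \<rho>. \<forall>a b. h (e x) (dvec e x a) (dvec e x b) = a \<bullet> b)"

lemma metric_tensor: "tensor2 A h"
  using metric by (simp add: riemannian_metric_def)

lemma flat_metric_constant:
  assumes e: "local_param A \<rho> e" and ch: "christoffel \<rho> e (\<lambda>x a b. 0)" and x: "x \<in> ball 0 \<rho>"
  shows "h (e x) (dvec e x a) (dvec e x b) = h (e 0) (dvec e 0 a) (dvec e 0 b)"
proof -
  let ?H = "\<lambda>z. h (e z) (dvec e z a) (dvec e z b)"
  have "(?H has_derivative (\<lambda>v. 0)) (at y within ball 0 \<rho>)" if y: "y \<in> ball 0 \<rho>" for y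
  proof -
    obtain E where E: "\<And>a. E a \<in> vector_fields A"
      "\<And>v a b. cov_deriv2 D h (E v) (E a) (E b) (e y) = dir_deriv v (\<lambda>z. h (e z) (dvec e z a) (dvec e z b)) y"
      by (rule flat_cov_deriv2[OF metric_tensor e ch y]) (rule that, auto)
    have "dir_deriv v ?H y = 0" for v
      using parallel E unfolding D_flat_def by metis
    then show ?thesis
      using smooth_on_has_derivative[OF tensor2_component_smooth[OF metric_tensor e, of a b] y]
      by (simp add: has_derivative_at_withinI)
  qed
  then obtain c where "\<And>y. y \<in> ball 0 \<rho> \<Longrightarrow> ?H y = c"
    using has_derivative_zero_constant[OF convex_ball, of 0 \<rho> ?H] by blast
  then show ?thesis using x local_paramD(1)[OF e] by simp
qed

text \<open>Zero curvature makes the equations of parallel one-forms and of parallel vector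
  fields integrable. Without torsion the parallel one-forms are closed, so Poincare's lemma
  integrates a parallel coframe \<open>\<theta>\<close> to coordinates \<open>Y\<close>. The
  dual parallel frame \<open>X\<close> supplies the derivative of the inverse map, which is
  therefore smooth by bootstrapping. In these coordinates the Christoffel symbols vanish and the
  parallel metric has constant components; the frame at \<open>p\<close> is chosen
  orthonormal.\<close>

theorem flat_param_exists:
  obtains \<rho> e where "flat_param \<rho> e" "e 0 = p"
proof -
  obtain \<rho> \<xi> \<Gamma> where \<xi>: "local_param A \<rho> \<xi>" "\<xi> 0 = p" and \<Gamma>: "christoffel \<rho> \<xi> \<Gamma>"
    using christoffel_exists by blast
  note sym = christoffel_symmetric[OF torsion \<xi>(1) \<Gamma>]
  note curv = christoffel_flat[OF flat \<xi>(1) \<Gamma>]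
  have \<rho>: "\<rho> > 0" and 0: "0 \<in> ball (0::'b) \<rho>" using local_paramD(1)[OF \<xi>(1)] by auto
  define M where "M x v \<theta> = (\<Sum>u\<in>Basis. (\<theta> \<bullet> \<Gamma> x v u) *\<^sub>R u)" for x v \<theta>
  have M: "M x v \<theta> \<bullet> w = \<theta> \<bullet> \<Gamma> x v w" if "x \<in> ball 0 \<rho>" for x v \<theta> w
  proof -
    have "M x v \<theta> \<bullet> w = \<theta> \<bullet> (\<Sum>u\<in>Basis. (w \<bullet> u) *\<^sub>R \<Gamma> x v u)"
      by (simp add: M_def inner_sum_left inner_sum_right inner_commute mult.commute)
    then show ?thesis using linear_basis_expansion[OF christoffelD(3)[OF \<Gamma> that], of v w] by simp
  qed
  have dG: "((\<lambda>y. \<Gamma> y v w) has_derivative (\<lambda>u. dir_deriv u (\<lambda>y. \<Gamma> y v w) x)) (at x)" if "x \<in> ball 0 \<rho>" for x v w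
    by (rule smooth_on_has_derivative[OF christoffelD(1)[OF \<Gamma>] that])
  have dM: "dir_deriv u (\<lambda>y. M y v c) x \<bullet> w = c \<bullet> dir_deriv u (\<lambda>y. \<Gamma> y v w) x"
    if x: "x \<in> ball 0 \<rho>" and w: "w \<in> Basis" for x u v c w
  proof -
    have "((\<lambda>y. M y v c) has_derivative (\<lambda>u. \<Sum>w\<in>Basis. (c \<bullet> dir_deriv u (\<lambda>y. \<Gamma> y v w) x) *\<^sub>R w)) (at x)"
      unfolding M_def by (intro has_derivative_sum has_derivative_scaleR_left has_derivative_inner_right dG x)
    from dir_deriv_eq[OF this] show ?thesis using w by (simp add: inner_sum_left_Basis)
  qed
  \<comment> \<open>\<open>M\<close> is the coefficient of the equation of parallel one-forms, the transpose of \<open>\<Gamma>\<close>.\<close>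
  interpret I1: integrable_system M \<rho>
  proof (rule integrable_system.intro)
    show "linear (\<lambda>v. M x v c)" if "x \<in> ball 0 \<rho>" for x c
      unfolding M_def
      by (intro linear_compose_sum ballI linearI)
        (simp_all add: linear_add[OF christoffelD(2)[OF \<Gamma> that]] linear_scale[OF christoffelD(2)[OF \<Gamma> that]]
          inner_add_right algebra_simps)
    show "linear (M x v)" for x v
      unfolding M_def by (intro linear_compose_sum ballI linearI) (simp_all add: inner_add_left algebra_simps)
    show "smooth_on (ball 0 \<rho>) (\<lambda>x. M x v c)" for v c
      unfolding M_def
      by (intro smooth_on_sum smooth_on_scaleR smooth_on_const smooth_on_inner christoffelD(1)[OF \<Gamma>] open_ball)
    show "dir_deriv u (\<lambda>y. M y v c) x + M x v (M x u c) = dir_deriv v (\<lambda>y. M y u c) x + M x u (M x v c)"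
      if x: "x \<in> ball 0 \<rho>" for x u v c
    proof (rule euclidean_eqI)
      fix w :: 'b assume w: "w \<in> Basis"
      have "(dir_deriv u (\<lambda>y. M y v c) x + M x v (M x u c)) \<bullet> w
          = c \<bullet> (dir_deriv u (\<lambda>y. \<Gamma> y v w) x + \<Gamma> x u (\<Gamma> x v w))" for u v
        by (simp add: inner_add_left inner_add_right dM[OF x w] M[OF x])
      then show "(dir_deriv u (\<lambda>y. M y v c) x + M x v (M x u c)) \<bullet> w =
         (dir_deriv v (\<lambda>y. M y u c) x + M x u (M x v c)) \<bullet> w"
        using curv[OF x, where a = u and b = v and c = w] by simp
    qed
  qed (rule \<rho>)
  \<comment> \<open>The equation of parallel vector fields.\<close>
  interpret I2: integrable_system "\<lambda>x v c. - \<Gamma> x v c" \<rho>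
  proof (rule integrable_system.intro)
    show "linear (\<lambda>v. - \<Gamma> x v c)" if "x \<in> ball 0 \<rho>" for x c
      using linear_compose_neg[OF christoffelD(2)[OF \<Gamma> that]] .
    show "linear (\<lambda>c. - \<Gamma> x v c)" if "x \<in> ball 0 \<rho>" for x v
      using linear_compose_neg[OF christoffelD(3)[OF \<Gamma> that]] .
    show "smooth_on (ball 0 \<rho>) (\<lambda>x. - \<Gamma> x v c)" for v c
      by (rule smooth_on_linear_comp[OF bounded_linear_minus[OF bounded_linear_ident] open_ball christoffelD(1)[OF \<Gamma>]])
    show "dir_deriv u (\<lambda>y. - \<Gamma> y v c) x + - \<Gamma> x v (- \<Gamma> x u c) = dir_deriv v (\<lambda>y. - \<Gamma> y u c) x + - \<Gamma> x u (- \<Gamma> x v c)"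
      if x: "x \<in> ball 0 \<rho>" for x u v c
    proof -
      have "dir_deriv u (\<lambda>y. - \<Gamma> y v c) x = - dir_deriv u (\<lambda>y. \<Gamma> y v c) x" for u v
        by (rule dir_deriv_eq[OF has_derivative_minus[OF dG[OF x]]])
      then show ?thesis
        using curv[OF x, where a = u and b = v and c = c] by (simp add: linear_neg[OF christoffelD(3)[OF \<Gamma> x]] algebra_simps)
    qed
  qed (rule \<rho>)
  note hl = tensor2_component_linear[OF metric_tensor \<xi>(1) 0]
  obtain J J' :: "'b \<Rightarrow> 'b" where J: "linear J" "linear J'" "\<And>u. J (J' u) = u" "\<And>u. J' (J u) = u"
    "\<And>u v. h (\<xi> 0) (dvec \<xi> 0 (J u)) (dvec \<xi> 0 (J v)) = u \<bullet> v"
  proof (rule orthonormal_frame_exists[of "\<lambda>u v. h (\<xi> 0) (dvec \<xi> 0 u) (dvec \<xi> 0 v)"])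
    show "linear (\<lambda>v. h (\<xi> 0) (dvec \<xi> 0 u) (dvec \<xi> 0 v))" for u by (rule hl(2))
    note t = dvec_tangent[OF \<xi>(1) 0]
    show "h (\<xi> 0) (dvec \<xi> 0 u) (dvec \<xi> 0 v) = h (\<xi> 0) (dvec \<xi> 0 v) (dvec \<xi> 0 u)" for u v
      using metric t unfolding riemannian_metric_def by blast
    show "h (\<xi> 0) (dvec \<xi> 0 u) (dvec \<xi> 0 u) > 0" if "u \<noteq> 0" for u
    proof -
      have "dvec \<xi> 0 u \<noteq> (\<lambda>f. 0)" using that dvec_inj[OF \<xi>(1) 0, of u 0] dvec_zero[OF \<xi>(1) 0] by metis
      then show ?thesis using metric t unfolding riemannian_metric_def by blast
    qed
  qed blast
  obtain r1 where r1: "0 < r1" "r1 \<le> \<rho>"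
    "\<And>c. \<exists>\<theta>. smooth_on (ball 0 r1) \<theta> \<and> \<theta> 0 = c \<and> (\<forall>x\<in>ball 0 r1. (\<theta> has_derivative (\<lambda>v. M x v (\<theta> x))) (at x))"
    using I1.solution_exists by blast
  obtain r2 where r2: "0 < r2" "r2 \<le> \<rho>"
    "\<And>c. \<exists>X. smooth_on (ball 0 r2) X \<and> X 0 = c \<and> (\<forall>x\<in>ball 0 r2. (X has_derivative (\<lambda>v. - \<Gamma> x v (X x))) (at x))"
    using I2.solution_exists by blast
  define r where "r = min r1 r2"
  have r: "0 < r" "r \<le> r1" "r \<le> r2" "r \<le> \<rho>" using r1 r2 by (auto simp: r_def)
  have in\<rho>: "x \<in> ball 0 \<rho>" if "x \<in> ball 0 r" for x :: 'b using that r by auto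
  obtain \<theta> where \<theta>: "\<And>c. smooth_on (ball 0 r1) (\<theta> c)" "\<And>c. \<theta> c 0 = adjoint J' c"
    "\<And>c x. x \<in> ball 0 r1 \<Longrightarrow> (\<theta> c has_derivative (\<lambda>v. M x v (\<theta> c x))) (at x)"
    using r1(3)[of "adjoint J' _"] by metis
  obtain X where X: "\<And>c. smooth_on (ball 0 r2) (X c)" "\<And>c. X c 0 = J c"
    "\<And>c x. x \<in> ball 0 r2 \<Longrightarrow> (X c has_derivative (\<lambda>v. - \<Gamma> x v (X c x))) (at x)"
    using r2(3)[of "J _"] by metis
  have d\<theta>: "(\<theta> c has_derivative (\<lambda>v. M x v (\<theta> c x))) (at x)" if "x \<in> ball 0 r" for c x
    by (rule \<theta>(3)) (use that r in auto)
  have dX: "(X c has_derivative (\<lambda>v. - \<Gamma> x v (X c x))) (at x)" if "x \<in> ball 0 r" for c x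
    by (rule X(3)) (use that r in auto)
  have sm\<theta>: "smooth_on (ball 0 r) (\<theta> c)" for c by (rule smooth_on_subset[OF \<theta>(1)]) (use r in auto)
  have smX: "smooth_on (ball 0 r) (X c)" for c by (rule smooth_on_subset[OF X(1)]) (use r in auto)
  have "\<exists>f. smooth_on (ball 0 r) f \<and> f 0 = 0 \<and> (\<forall>x\<in>ball 0 r. (f has_derivative (\<lambda>v. \<theta> c x \<bullet> v)) (at x))" for c
  proof -
    have "dir_deriv u (\<theta> c) x \<bullet> v = dir_deriv v (\<theta> c) x \<bullet> u" if "x \<in> ball 0 r" for x u v
      unfolding dir_deriv_eq[OF d\<theta>[OF that]] M[OF in\<rho>[OF that]] using sym[OF in\<rho>[OF that], of u v] by simp
    from poincare_lemma[OF sm\<theta> this] show ?thesis by metis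
  qed
  then obtain y :: "'b \<Rightarrow> 'b \<Rightarrow> real" where y: "\<And>c. smooth_on (ball 0 r) (y c)" "\<And>c. y c 0 = 0"
    "\<And>c x. x \<in> ball 0 r \<Longrightarrow> (y c has_derivative (\<lambda>v. \<theta> c x \<bullet> v)) (at x)" by metis
  define Y where "Y x = (\<Sum>c\<in>Basis. y c x *\<^sub>R c)" for x
  define dY where "dY x v = (\<Sum>c\<in>Basis. (\<theta> c x \<bullet> v) *\<^sub>R c)" for x v
  \<comment> \<open>\<open>Z x\<close> will be the inverse of the derivative \<open>dY x\<close> of \<open>Y\<close>, because \<open>\<theta>\<close> and \<open>X\<close> are dual.\<close>
  define Z where "Z x a = (\<Sum>b\<in>Basis. (a \<bullet> b) *\<^sub>R X b x)" for x a
  have Yc: "Y x \<bullet> c = y c x" if "c \<in> Basis" for x c using that by (simp add: Y_def)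
  have derY: "(Y has_derivative dY x) (at x)" if "x \<in> ball 0 r" for x
    unfolding Y_def dY_def by (intro has_derivative_sum has_derivative_scaleR_left y(3) that)
  have smY: "smooth_on (ball 0 r) Y"
    unfolding Y_def by (intro smooth_on_sum smooth_on_scaleR smooth_on_const y(1) open_ball)
  have dual: "\<theta> c x \<bullet> X b x = b \<bullet> c" if x: "x \<in> ball 0 r" for b c x
  proof -
    have "((\<lambda>x. \<theta> c x \<bullet> X b x) has_derivative (\<lambda>v. 0)) (at z within ball 0 r)" if z: "z \<in> ball 0 r" for z
    proof -
      have "((\<lambda>x. \<theta> c x \<bullet> X b x) has_derivative (\<lambda>v. \<theta> c z \<bullet> (- \<Gamma> z v (X b z)) + M z v (\<theta> c z) \<bullet> X b z)) (at z)"
        by (rule has_derivative_inner[OF d\<theta>[OF z] dX[OF z]])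
      then show ?thesis by (simp add: M[OF in\<rho>[OF z]] has_derivative_at_withinI)
    qed
    then obtain k where k: "\<And>z. z \<in> ball 0 r \<Longrightarrow> \<theta> c z \<bullet> X b z = k"
      using has_derivative_zero_constant[OF convex_ball, of 0 r "\<lambda>x. \<theta> c x \<bullet> X b x"] by blast
    have "\<theta> c 0 \<bullet> X b 0 = b \<bullet> c"
      unfolding \<theta>(2) X(2) using adjoint_works[OF J(2), of "J b" c] J(4) by (simp add: inner_commute)
    then show ?thesis using k[OF x] k[of 0] r by simp
  qed
  have dYZ: "dY x (Z x a) = a" if "x \<in> ball 0 r" for x a
  proof -
    have "\<theta> c x \<bullet> Z x a = a \<bullet> c" if c: "c \<in> Basis" for c
    proof -
      have "\<theta> c x \<bullet> Z x a = (\<Sum>b\<in>Basis. (a \<bullet> b) * (b \<bullet> c))"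
        unfolding Z_def by (simp add: inner_sum_right dual[OF \<open>x \<in> ball 0 r\<close>])
      also have "\<dots> = a \<bullet> c" by (simp add: euclidean_inner[of a c] inner_commute)
      finally show ?thesis .
    qed
    then show ?thesis unfolding dY_def by (simp add: euclidean_representation)
  qed
  have bl: "bounded_linear (dY x)" if "x \<in> ball 0 r" for x
    by (rule has_derivative_bounded_linear[OF derY[OF that]])
  define Y' where "Y' x = Blinfun (dY x)" for x
  have Y': "blinfun_apply (Y' x) = dY x" if "x \<in> ball 0 r" for x
    unfolding Y'_def by (rule bounded_linear_Blinfun_apply[OF bl[OF that]])
  have contY': "continuous_on (ball 0 r) Y'"
  proof (rule continuous_on_blinfun_componentwise)
    fix i :: 'b
    have "continuous_on (ball 0 r) (\<lambda>x. dY x i)"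
      unfolding dY_def by (intro continuous_on_sum continuous_on_scaleR continuous_on_inner continuous_on_const smooth_on_continuous_on[OF sm\<theta>])
    then show "continuous_on (ball 0 r) (\<lambda>x. blinfun_apply (Y' x) i)"
      by (rule continuous_on_eq) (simp add: Y')
  qed
  have "bounded_linear J" using J(1) linear_conv_bounded_linear by blast
  have dY0: "dY 0 v = J' v" for v
  proof -
    have "\<theta> c 0 \<bullet> v = J' v \<bullet> c" for c unfolding \<theta>(2) using adjoint_works[OF J(2), of v c] by (simp add: inner_commute)
    then show ?thesis unfolding dY_def by (simp add: euclidean_representation)
  qed
  have inv0: "Blinfun J o\<^sub>L Y' 0 = id_blinfun"
    by (rule blinfun_eqI) (use Y'[of 0] r in \<open>simp add: bounded_linear_Blinfun_apply[OF \<open>bounded_linear J\<close>] dY0 J(3)\<close>)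
  have derY': "(Y has_derivative blinfun_apply (Y' x)) (at x)" if "x \<in> ball 0 r" for x
    using derY[OF that] Y'[OF that] by simp
  have r0: "0 \<in> ball (0::'b) r" using r by simp
  obtain U' V g g' where U': "open U'" "U' \<subseteq> ball 0 r" "0 \<in> U'" and V: "open V" "Y 0 \<in> V" and hom: "homeomorphism U' V Y g"
    and dg: "\<And>y. y \<in> V \<Longrightarrow> (g has_derivative (g' y)) (at y)"
    and g': "\<And>y. y \<in> V \<Longrightarrow> g' y = inv (blinfun_apply (Y' (g y)))"
    and bij: "\<And>y. y \<in> V \<Longrightarrow> bij (blinfun_apply (Y' (g y)))"
    by (rule inverse_function_theorem[OF open_ball derY' contY' r0 inv0], assumption, blast)
  have Y0: "Y 0 = 0" by (simp add: Y_def y(2))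
  obtain \<rho>' where \<rho>': "\<rho>' > 0" "ball 0 \<rho>' \<subseteq> V" using V Y0 by (metis openE)
  have gU: "g y \<in> U'" "Y (g y) = y" if "y \<in> V" for y
    using hom that by (auto simp: homeomorphism_def)
  have gr: "g y \<in> ball 0 r" if "y \<in> V" for y using gU that U' by blast
  have dgZ: "(g has_derivative Z (g y)) (at y)" if y: "y \<in> V" for y
  proof -
    have "g' y a = Z (g y) a" for a
      unfolding g'[OF y] Y'[OF gr[OF y]] using bij[OF y] dYZ[OF gr[OF y]] Y'[OF gr[OF y]]
      by (metis bij_inv_eq_iff)
    then have "g' y = Z (g y)" by blast
    then show ?thesis using dg[OF y] by simp
  qed
  have smg: "smooth_on V g"
  proof (rule smooth_on_bootstrap[OF V(1) _ dgZ])
    show "continuous_on V g" using hom by (simp add: homeomorphism_def)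
    show "Ck_on k (\<lambda>y. Z (g y) v) V" if "Ck_on k g V" for k v
      unfolding Z_def
    proof (intro Ck_on_sum V(1) Ck_on_linear_comp[OF bounded_linear_scaleR_right] Ck_on_compose[OF V(1) open_ball that])
      show "Ck_on k (X b) (ball 0 r)" for b using smX by (simp add: smooth_on_def)
    qed (use gr in auto)
  qed
  have smg': "smooth_on (ball 0 \<rho>') g" by (rule smooth_on_subset[OF smg \<rho>'(2)])
  have og: "open (g ` S)" if "open S" "S \<subseteq> V" for S
    by (rule homeomorphism_image_open[OF homeomorphism_symD[OF hom] U'(1) that])
  define e where "e y = \<xi> (g y)" for y
  have e: "local_param A \<rho>' e"
    unfolding e_def
  proof (rule local_param_compose[OF \<xi>(1) \<rho>'(1) smg' og[OF open_ball \<rho>'(2)]])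
    show "g ` ball 0 \<rho>' \<subseteq> ball 0 \<rho>" using gr \<rho>'(2) in\<rho> by blast
    show "smooth_on (g ` ball 0 \<rho>') Y" by (rule smooth_on_subset[OF smY]) (use gr \<rho>'(2) in blast)
    show "Y (g y) = y" if "y \<in> ball 0 \<rho>'" for y using gU(2) that \<rho>'(2) by blast
  qed
  have dvec_e: "dvec e z a = dvec \<xi> (g z) (Z (g z) a)" if z: "z \<in> V" for z a
  proof
    fix f
    show "dvec e z a f = dvec \<xi> (g z) (Z (g z) a) f"
    proof (cases "smooth_fun A f")
      case True
      have "((\<lambda>z. f (e z)) has_derivative (\<lambda>a. dir_deriv (Z (g z) a) (\<lambda>x. f (\<xi> x)) (g z))) (at z)"
        unfolding e_def
        using has_derivative_compose[OF dgZ[OF z] smooth_on_has_derivative[OF local_paramD(5)[OF \<xi>(1) True] in\<rho>[OF gr[OF z]]]] .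
      from dir_deriv_eq[OF this] show ?thesis using True by (simp add: dvec_def)
    qed (simp add: dvec_def)
  qed
  have "christoffel \<rho>' e (\<lambda>x a b. 0)"
    unfolding christoffel_def
  proof (intro conjI ballI allI)
    fix F G and z :: 'b assume F: "F \<in> vector_fields A" and G: "G \<in> vector_fields A" and z: "z \<in> ball 0 \<rho>'"
    have zV: "z \<in> V" using z \<rho>'(2) by blast
    let ?x = "g z"
    note x = in\<rho>[OF gr[OF zV]]
    let ?F = "rep \<xi> F ?x" and ?G = "rep \<xi> G ?x"
    note P = connD(1)[OF F G]
    have "rep e (D F G) z = dir_deriv (rep e F z) (rep e G) z"
    proof (rule euclidean_eqI)
      fix c :: 'b assume c: "c \<in> Basis"
      obtain k s where k: "smooth_fun A k" "norm z < s" "s < \<rho>'" "\<And>w. w \<in> cball 0 s \<Longrightarrow> k (e w) = w \<bullet> c"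
        using coordinate_function[OF e z] by metis
      have zs: "z \<in> ball 0 s" using k by simp
      have sV: "ball 0 s \<subseteq> V" using \<rho>'(2) k(3) by auto
      define S where "S = g ` ball 0 s"
      have S: "open S" "?x \<in> S" unfolding S_def using og[OF open_ball sV] zs by auto
      have Sr: "w \<in> ball 0 r" if "w \<in> S" for w using that gr sV by (auto simp: S_def)
      have k\<xi>: "k (\<xi> w) = y c w" if "w \<in> S" for w
      proof -
        obtain u where u: "u \<in> ball 0 s" "w = g u" using \<open>w \<in> S\<close> by (auto simp: S_def)
        have "k (\<xi> w) = u \<bullet> c" using k(4)[of u] u by (auto simp: e_def)
        also have "\<dots> = Y w \<bullet> c" using gU(2)[of u] u sV by auto
        finally show ?thesis by (simp add: Yc[OF c])
      qed
      have dk: "dvec \<xi> w u k = \<theta> c w \<bullet> u" if w: "w \<in> S" for w u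
      proof -
        have "((\<lambda>w. k (\<xi> w)) has_derivative (\<lambda>u. \<theta> c w \<bullet> u)) (at w)"
          by (rule has_derivative_transform_within_open[OF y(3)[OF Sr[OF w]] S(1) w]) (simp add: k\<xi>)
        from dir_deriv_eq[OF this] show ?thesis using k(1) by (simp add: dvec_def)
      qed
      note smGk = vector_fieldD(2)[OF G k(1)]
      have "rep e (D F G) z \<bullet> c = D F G (e z) k"
        using field_eq_dvec[OF e P z] dvec_coordinate[OF e z k(1) open_ball zs, of c] k(4) by simp
      also have "\<dots> = \<theta> c ?x \<bullet> (dir_deriv ?F (rep \<xi> G) ?x + \<Gamma> ?x ?F ?G)"
        unfolding e_def christoffelD(4)[OF \<Gamma> F G x] dk[OF S(2)] ..
      also have "\<dots> = F (\<xi> ?x) (\<lambda>q. G q k)"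
      proof -
        have "((\<lambda>w. \<theta> c w \<bullet> rep \<xi> G w) has_derivative
            (\<lambda>u. \<theta> c ?x \<bullet> dir_deriv u (rep \<xi> G) ?x + M ?x u (\<theta> c ?x) \<bullet> ?G)) (at ?x)"
          by (rule has_derivative_inner[OF d\<theta>[OF gr[OF zV]] smooth_on_has_derivative[OF rep_smooth[OF \<xi>(1) G] x]])
        then have "((\<lambda>w. G (\<xi> w) k) has_derivative
            (\<lambda>u. \<theta> c ?x \<bullet> dir_deriv u (rep \<xi> G) ?x + M ?x u (\<theta> c ?x) \<bullet> ?G)) (at ?x)"
          by (rule has_derivative_transform_within_open[OF _ S])
            (use field_eq_dvec[OF \<xi>(1) G in\<rho>[OF Sr]] dk in auto)
        from dir_deriv_eq[OF this]
        have "F (\<xi> ?x) (\<lambda>q. G q k) = \<theta> c ?x \<bullet> dir_deriv ?F (rep \<xi> G) ?x + M ?x ?F (\<theta> c ?x) \<bullet> ?G"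
          using field_apply[OF \<xi>(1) F x smGk] by simp
        then show ?thesis by (simp add: M[OF x] inner_add_right)
      qed
      also have "\<dots> = dir_deriv (rep e F z) (\<lambda>w. G (e w) k) z"
        using field_apply[OF e F z smGk] by (simp add: e_def)
      also have "\<dots> = dir_deriv (rep e F z) (rep e G) z \<bullet> c"
      proof (rule dir_deriv_eq)
        have "((\<lambda>w. rep e G w \<bullet> c) has_derivative (\<lambda>u. dir_deriv u (rep e G) z \<bullet> c)) (at z)"
          by (rule has_derivative_inner_left[OF smooth_on_has_derivative[OF rep_smooth[OF e G] z]])
        then show "((\<lambda>w. G (e w) k) has_derivative (\<lambda>u. dir_deriv u (rep e G) z \<bullet> c)) (at z)"
        proof (rule has_derivative_transform_within_open[OF _ open_ball zs])
          fix w :: 'b assume w: "w \<in> ball 0 s"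
          then have w': "w \<in> ball 0 \<rho>'" using k by auto
          show "rep e G w \<bullet> c = G (e w) k"
            using field_eq_dvec[OF e G w'] dvec_coordinate[OF e w' k(1) open_ball w, of c] k(4) by simp
        qed
      qed
      finally show "rep e (D F G) z \<bullet> c = dir_deriv (rep e F z) (rep e G) z \<bullet> c" .
    qed
    then show "D F G (e z) = dvec e z (dir_deriv (rep e F z) (rep e G) z + 0)"
      using field_eq_dvec[OF e P z] by simp
  qed (auto intro: smooth_on_const linear_zero)
  moreover have "h (e x) (dvec e x a) (dvec e x b) = a \<bullet> b" if x: "x \<in> ball 0 \<rho>'" for x a b
  proof -
    have 0: "0 \<in> V" using V(2) Y0 by simp
    have g0: "g 0 = 0" using hom U'(3) Y0 by (metis homeomorphism_apply1)
    have "Z 0 a = J a" for a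
      unfolding Z_def X(2) using linear_basis_expansion[OF J(1), of a] by simp
    then show ?thesis
      using flat_metric_constant[OF e \<open>christoffel \<rho>' e _\<close> x] dvec_e[OF 0] g0 J(5) by (simp add: e_def)
  qed
  moreover have "e 0 = p"
    using hom U'(3) Y0 \<xi>(2) by (metis e_def homeomorphism_apply1)
  ultimately show thesis by (intro that[of \<rho>' e]) (auto simp: flat_param_def e)
qed

end

section \<open>Transitions between flat coordinates\<close>

context flat_riemannian
begin

lemma flat_paramD:
  assumes "flat_param \<rho> e"
  shows "local_param A \<rho> e" "christoffel \<rho> e (\<lambda>x a b. 0)"
    "x \<in> ball 0 \<rho> \<Longrightarrow> h (e x) (dvec e x a) (dvec e x b) = a \<bullet> b"
    "X \<in> vector_fields A \<Longrightarrow> Y \<in> vector_fields A \<Longrightarrow> x \<in> ball 0 \<rho> \<Longrightarrow>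
      D X Y (e x) = dvec e x (dir_deriv (rep e X x) (rep e Y) x)"
  using assms christoffelD(4)[of \<rho> e "\<lambda>x a b. 0" X Y x] by (auto simp: flat_param_def)

lemma rep_recentre:
  assumes e: "local_param A \<rho> e" and X: "X \<in> vector_fields A" and x: "norm x + \<epsilon> \<le> \<rho>" and z: "z \<in> ball 0 \<epsilon>"
  shows "rep (\<lambda>z. e (x + z)) X z = rep e X (x + z)"
    "dir_deriv v (rep (\<lambda>z. e (x + z)) X) z = dir_deriv v (rep e X) (x + z)"
proof -
  have \<epsilon>: "\<epsilon> > 0" using z by (metis dist_0_norm le_less_trans mem_ball norm_ge_zero)
  have inb: "x + z \<in> ball 0 \<rho>" if "z \<in> ball 0 \<epsilon>" for z
    using that x norm_triangle_ineq[of x z] by simp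
  have 1: "rep (\<lambda>z. e (x + z)) X z = rep e X (x + z)" if "z \<in> ball 0 \<epsilon>" for z
    by (rule rep_eqI[OF local_param_recentre[OF e x \<epsilon>] that])
      (use field_eq_dvec[OF e X inb[OF that]] dvec_recentre[OF e inb[OF that]] in simp)
  show "rep (\<lambda>z. e (x + z)) X z = rep e X (x + z)" by (rule 1[OF z])
  have "((+) x has_derivative (\<lambda>v. v)) (at z)" by (auto intro!: derivative_eq_intros)
  from has_derivative_compose[OF this smooth_on_has_derivative[OF rep_smooth[OF e X] inb[OF z]]]
  have "(rep (\<lambda>z. e (x + z)) X has_derivative (\<lambda>v. dir_deriv v (rep e X) (x + z))) (at z)"
    by (rule has_derivative_transform_within_open[OF _ open_ball z]) (simp add: 1)
  from dir_deriv_eq[OF this]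
  show "dir_deriv v (rep (\<lambda>z. e (x + z)) X) z = dir_deriv v (rep e X) (x + z)" .
qed

lemma flat_param_recentre:
  assumes e: "flat_param \<rho> e" and x: "norm x + \<epsilon> \<le> \<rho>" and \<epsilon>: "\<epsilon> > 0"
  shows "flat_param \<epsilon> (\<lambda>z. e (x + z))"
proof -
  note L = flat_paramD[OF e]
  have inb: "x + z \<in> ball 0 \<rho>" if "z \<in> ball 0 \<epsilon>" for z
    using that x norm_triangle_ineq[of x z] by simp
  show ?thesis
    unfolding flat_param_def christoffel_def
  proof (intro conjI ballI allI local_param_recentre[OF L(1) x \<epsilon>])
    fix X Y and z :: 'b assume X: "X \<in> vector_fields A" and Y: "Y \<in> vector_fields A" and z: "z \<in> ball 0 \<epsilon>"
    show "D X Y (e (x + z)) = dvec (\<lambda>z. e (x + z)) z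
        (dir_deriv (rep (\<lambda>z. e (x + z)) X z) (rep (\<lambda>z. e (x + z)) Y) z + 0)"
      using L(4)[OF X Y inb[OF z]] dvec_recentre[OF L(1) inb[OF z]]
        rep_recentre[OF L(1) X x z] rep_recentre[OF L(1) Y x z] by simp
  next
    fix z a b :: 'b assume z: "z \<in> ball 0 \<epsilon>"
    show "h (e (x + z)) (dvec (\<lambda>z. e (x + z)) z a) (dvec (\<lambda>z. e (x + z)) z b) = a \<bullet> b"
      using L(3)[OF inb[OF z]] dvec_recentre[OF L(1) inb[OF z]] by simp
  qed (auto intro: smooth_on_const linear_zero)
qed

lemma flat_param_shrink: "flat_param \<rho> e \<Longrightarrow> 0 < r \<Longrightarrow> r \<le> \<rho> \<Longrightarrow> flat_param r e"
  using flat_param_recentre[of \<rho> e 0 r] by simp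

text \<open>The Christoffel symbols vanish, so only the second partial derivatives of
  \<open>f\<close> remain of its Hessian.\<close>

lemma hessian_in_flat_param:
  assumes e: "flat_param \<rho> e" and X: "X \<in> vector_fields A" and Y: "Y \<in> vector_fields A"
    and f: "smooth_fun A f" and x: "x \<in> ball 0 \<rho>"
  shows "X (e x) (\<lambda>q. Y q f) - D X Y (e x) f
      = dir_deriv (rep e X x) (dir_deriv (rep e Y x) (\<lambda>z. f (e z))) x"
proof -
  note L = flat_paramD[OF e]
  let ?f = "\<lambda>z. f (e z)" and ?X = "rep e X x"
  have smf: "smooth_on (ball 0 \<rho>) ?f" by (rule local_paramD(5)[OF L(1) f])
  have lin: "dir_deriv u ?f z = (\<Sum>b\<in>Basis. (u \<bullet> b) * dir_deriv b ?f z)" if "z \<in> ball 0 \<rho>" for u z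
    using linear_basis_expansion[OF smooth_on_linear_dir_deriv[OF smf that], of u] by simp
  note dY = smooth_on_has_derivative[OF rep_smooth[OF L(1) Y] x]
  note d2 = smooth_on_has_derivative[OF smooth_on_dir_deriv[OF smf] x]
  have "((\<lambda>z. \<Sum>b\<in>Basis. (rep e Y z \<bullet> b) * dir_deriv b ?f z) has_derivative
     (\<lambda>u. \<Sum>b\<in>Basis. (rep e Y x \<bullet> b) * dir_deriv u (dir_deriv b ?f) x
        + (dir_deriv u (rep e Y) x \<bullet> b) * dir_deriv b ?f x)) (at x)"
    by (intro has_derivative_sum has_derivative_mult has_derivative_inner_left dY d2)
  then have "((\<lambda>z. Y (e z) f) has_derivative
     (\<lambda>u. \<Sum>b\<in>Basis. (rep e Y x \<bullet> b) * dir_deriv u (dir_deriv b ?f) x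
        + (dir_deriv u (rep e Y) x \<bullet> b) * dir_deriv b ?f x)) (at x)"
    by (rule has_derivative_transform_within_open[OF _ open_ball x])
      (simp add: field_apply[OF L(1) Y _ f] flip: lin)
  from dir_deriv_eq[OF this]
  have 1: "X (e x) (\<lambda>q. Y q f) = (\<Sum>b\<in>Basis. (rep e Y x \<bullet> b) * dir_deriv ?X (dir_deriv b ?f) x)
      + dir_deriv (dir_deriv ?X (rep e Y) x) ?f x"
    using field_apply[OF L(1) X x vector_fieldD(2)[OF Y f]] by (simp add: sum.distrib flip: lin[OF x])
  have "((\<lambda>z. \<Sum>b\<in>Basis. (rep e Y x \<bullet> b) * dir_deriv b ?f z) has_derivative
     (\<lambda>u. \<Sum>b\<in>Basis. (rep e Y x \<bullet> b) * dir_deriv u (dir_deriv b ?f) x)) (at x)"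
    by (intro has_derivative_sum has_derivative_mult_right d2)
  then have "(dir_deriv (rep e Y x) ?f has_derivative
     (\<lambda>u. \<Sum>b\<in>Basis. (rep e Y x \<bullet> b) * dir_deriv u (dir_deriv b ?f) x)) (at x)"
    by (rule has_derivative_transform_within_open[OF _ open_ball x]) (simp flip: lin)
  from dir_deriv_eq[OF this] 1 show ?thesis
    using L(4)[OF X Y x] f by (simp add: dvec_def)
qed

lemma second_derivative_zero_imp_linear:
  fixes f :: "'b \<Rightarrow> real"
  assumes sm: "smooth_on (ball 0 \<delta>) f" and z: "\<And>u v x. x \<in> ball 0 \<delta> \<Longrightarrow> dir_deriv u (dir_deriv v f) x = 0"
    and x: "x \<in> ball 0 \<delta>"
  shows "f x = f 0 + dir_deriv x f 0"
proof -
  have 0: "0 \<in> ball (0::'b) \<delta>" using x by (metis dist_0_norm le_less_trans mem_ball norm_ge_zero dist_self)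
  have const: "dir_deriv v f y = dir_deriv v f 0" if y: "y \<in> ball 0 \<delta>" for v y
  proof -
    have "\<exists>c. \<forall>w\<in>ball 0 \<delta>. dir_deriv v f w = c"
    proof (rule has_derivative_zero_constant[OF convex_ball])
      fix w :: 'b assume w: "w \<in> ball 0 \<delta>"
      show "(dir_deriv v f has_derivative (\<lambda>h. 0)) (at w within ball 0 \<delta>)"
        using smooth_on_has_derivative[OF smooth_on_dir_deriv[OF sm] w] z[OF w] by (simp add: has_derivative_at_withinI)
    qed
    then show ?thesis using y 0 by metis
  qed
  have "ray_mean (dir_deriv b f) x = dir_deriv b f 0" for b
  proof -
    have "((\<lambda>s. dir_deriv b f (s *\<^sub>R x)) has_integral dir_deriv b f 0) (cbox 0 (1::real))"
      by (rule has_integral_eq[of _ "\<lambda>_. dir_deriv b f 0"])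
        (use const[OF scaleR_in_ball_0[OF x]] has_integral_const[of "dir_deriv b f 0" 0 "1::real"] in auto)
    then show ?thesis by (simp add: ray_mean_def integral_unique)
  qed
  then show ?thesis
    using hadamard_lemma[OF sm x] linear_basis_expansion[OF smooth_on_linear_dir_deriv[OF sm 0], of x] by simp
qed

text \<open>Coordinates of one flat parametrisation are affine in another one because their Hessian
  vanishes; they are isometric because both frames are orthonormal.\<close>

lemma flat_transition_local:
  assumes e1: "flat_param \<rho>1 e1" and e2: "flat_param \<rho>2 e2" and eq: "e1 0 = e2 0"
  obtains T \<delta> where "orthogonal_transformation T" "\<delta> > 0" "\<delta> \<le> \<rho>1" "\<delta> \<le> \<rho>2" "\<And>z. z \<in> ball 0 \<delta> \<Longrightarrow> e1 z = e2 (T z)"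
proof -
  note L1 = flat_paramD[OF e1] and L2 = flat_paramD[OF e2]
  have \<rho>: "\<rho>1 > 0" "\<rho>2 > 0" using local_paramD(1) L1(1) L2(1) by blast+
  define r where "r = \<rho>2 / 2"
  have r: "0 < r" "r < \<rho>2" using \<rho> by (auto simp: r_def)
  have "\<exists>k. smooth_fun A k \<and> (\<forall>z\<in>cball 0 r. k (e2 z) = z \<bullet> c)" for c
    by (rule extend_function[OF L2(1) r smooth_on_linear[OF bounded_linear_inner_left[of c] open_ball]]) auto
  then obtain k where k: "\<And>c. smooth_fun A (k c)" "\<And>c z. z \<in> cball 0 r \<Longrightarrow> k c (e2 z) = z \<bullet> c" by metis
  have o2: "open (e2 ` ball 0 r)" by (rule local_paramD(4)[OF L2(1) open_ball]) (use r in auto)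
  have "open (ball 0 \<rho>1 \<inter> e1 -` (e2 ` ball 0 r))"
    by (rule continuous_open_preimage[OF local_paramD(3)[OF L1(1)] open_ball o2])
  moreover have "0 \<in> ball 0 \<rho>1 \<inter> e1 -` (e2 ` ball 0 r)" using \<rho> r eq by auto
  ultimately obtain \<delta>0 where \<delta>0: "\<delta>0 > 0" "ball 0 \<delta>0 \<subseteq> ball 0 \<rho>1 \<inter> e1 -` (e2 ` ball 0 r)" by (metis openE)
  define \<delta> where "\<delta> = min \<delta>0 (min \<rho>1 \<rho>2)"
  have \<delta>: "\<delta> > 0" "\<delta> \<le> \<rho>1" "\<delta> \<le> \<rho>2" "ball 0 \<delta> \<subseteq> e1 -` (e2 ` ball 0 r)"
    using \<delta>0 \<rho> by (auto simp: \<delta>_def)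
  have in1: "x \<in> ball 0 \<rho>1" if "x \<in> ball 0 \<delta>" for x :: 'b using that \<delta> by auto
  have smk: "smooth_on (ball 0 \<delta>) (\<lambda>z. k c (e1 z))" for c
    by (rule smooth_on_subset[OF local_paramD(5)[OF L1(1) k(1)]]) (use \<delta> in auto)
  have hess: "dir_deriv u (dir_deriv v (\<lambda>z. k c (e1 z))) x = 0" if x: "x \<in> ball 0 \<delta>" for u v c x
  proof -
    obtain w where w: "w \<in> ball 0 r" "e1 x = e2 w" using x \<delta>(4) by blast
    have w2: "w \<in> ball 0 \<rho>2" using w r by auto
    define s where "s = (norm x + \<rho>1) / 2"
    have s: "0 < s" "s < \<rho>1" "x \<in> ball 0 s"
      using in1[OF x] \<rho> by (auto simp: s_def intro: add_nonneg_pos)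
    obtain U where U: "U \<in> vector_fields A" "\<And>z. z \<in> ball 0 s \<Longrightarrow> rep e1 U z = u"
      by (rule constant_field[OF L1(1) s(1,2), of u]) (rule that, auto)
    obtain V where V: "V \<in> vector_fields A" "\<And>z. z \<in> ball 0 s \<Longrightarrow> rep e1 V z = v"
      by (rule constant_field[OF L1(1) s(1,2), of v]) (rule that, auto)
    have "dir_deriv b (\<lambda>z. k c (e2 z)) z = b \<bullet> c" if z: "z \<in> ball 0 r" for b z
      by (rule dir_deriv_eq, rule has_derivative_transform_within_open[OF _ open_ball z, of "\<lambda>z. z \<bullet> c"])
        (auto intro!: derivative_eq_intros simp: k(2))
    then have "dir_deriv a (dir_deriv b (\<lambda>z. k c (e2 z))) w = 0" for a b
      by (intro dir_deriv_eq, intro has_derivative_transform_within_open[OF has_derivative_const[of "b \<bullet> c"] open_ball w(1)]) simp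
    then show ?thesis
      using hessian_in_flat_param[OF e1 U(1) V(1) k(1)[of c] in1[OF x]] hessian_in_flat_param[OF e2 U(1) V(1) k(1)[of c] w2]
        w(2) U(2)[OF s(3)] V(2)[OF s(3)] by simp
  qed
  define T where "T v = (\<Sum>c\<in>Basis. dir_deriv v (\<lambda>z. k c (e1 z)) 0 *\<^sub>R c)" for v
  have 0: "0 \<in> ball (0::'b) \<delta>" using \<delta> by simp
  have linT: "linear T"
    unfolding T_def using smooth_on_linear_dir_deriv[OF smk 0]
    by (intro linear_compose_sum ballI linearI)
      (simp_all add: linear_add[OF smooth_on_linear_dir_deriv[OF smk 0]] linear_scale[OF smooth_on_linear_dir_deriv[OF smk 0]] algebra_simps)
  have trans: "e1 z = e2 (T z)" "T z \<in> ball 0 r" if z: "z \<in> ball 0 \<delta>" for z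
  proof -
    obtain w where w: "w \<in> ball 0 r" "e1 z = e2 w" using z \<delta>(4) by blast
    have "w \<bullet> c = dir_deriv z (\<lambda>z. k c (e1 z)) 0" for c
    proof -
      have "k c (e1 0) = 0" using k(2)[of 0 c] r eq by simp
      then show ?thesis
        using second_derivative_zero_imp_linear[OF smk hess z, of c] k(2)[of w c] w by simp
    qed
    then have "T z = w" unfolding T_def by (metis (mono_tags, lifting) euclidean_representation sum.cong)
    with w show "e1 z = e2 (T z)" "T z \<in> ball 0 r" by auto
  qed
  have dv: "dvec e1 0 v = dvec e2 0 (T v)" for v
  proof
    fix f
    show "dvec e1 0 v f = dvec e2 0 (T v) f"
    proof (cases "smooth_fun A f")
      case True
      have T0: "T 0 = 0" by (rule linear_0[OF linT])
      have "(T has_derivative T) (at 0)"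
        using linT by (simp add: bounded_linear_imp_has_derivative linear_conv_bounded_linear)
      moreover have "((\<lambda>z. f (e2 z)) has_derivative (\<lambda>u. dir_deriv u (\<lambda>z. f (e2 z)) 0)) (at (T 0))"
        unfolding T0 by (rule smooth_on_has_derivative[OF local_paramD(5)[OF L2(1) True]]) (use \<rho> in simp)
      ultimately have "((\<lambda>z. f (e2 (T z))) has_derivative (\<lambda>v. dir_deriv (T v) (\<lambda>z. f (e2 z)) 0)) (at 0)"
        by (rule has_derivative_compose)
      then have "((\<lambda>z. f (e1 z)) has_derivative (\<lambda>v. dir_deriv (T v) (\<lambda>z. f (e2 z)) 0)) (at 0)"
        by (rule has_derivative_transform_within_open[OF _ open_ball 0]) (simp add: trans)
      from dir_deriv_eq[OF this] show ?thesis using True by (simp add: dvec_def)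
    qed (simp add: dvec_def)
  qed
  have "T u \<bullet> T v = u \<bullet> v" for u v
    using L1(3)[of 0 u v] L2(3)[of 0 "T u" "T v"] \<rho> eq dv by simp
  then have "orthogonal_transformation T" using linT by (simp add: orthogonal_transformation_def)
  then show thesis using that \<delta>(1-3) trans(1) by blast
qed

text \<open>Continuation: around a limit point of the interior of the set where both sides agree
  they again differ by an affine isometry, which is the identity on an open set. The interior is
  thus open and closed in the ball.\<close>

lemma flat_transition:
  assumes e1: "flat_param R e1" and e2: "flat_param R e2" and eq: "e1 0 = e2 0"
  obtains T where "orthogonal_transformation T" "\<And>z. z \<in> ball 0 R \<Longrightarrow> e1 z = e2 (T z)"
proof -
  note L1 = flat_paramD[OF e1] and L2 = flat_paramD[OF e2]
  obtain T \<delta> where T: "orthogonal_transformation T" and \<delta>: "\<delta> > 0" "\<delta> \<le> R" "\<And>z. z \<in> ball 0 \<delta> \<Longrightarrow> e1 z = e2 (T z)"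
    using flat_transition_local[OF e1 e2 eq] by metis
  have nT: "norm (T z) = norm z" for z using T by (rule orthogonal_transformation_norm)
  have lT: "linear T" using T by (rule orthogonal_transformation_linear)
  define E where "E = {z \<in> ball 0 R. e1 z = e2 (T z)}"
  define G where "G = interior E"
  have cont: "continuous_on (ball 0 R) e1" "continuous_on (ball 0 R) (\<lambda>z. e2 (T z))"
    using local_paramD(3)[OF L1(1)] nT
    by (auto intro!: continuous_on_compose2[OF local_paramD(3)[OF L2(1)] linear_continuous_on] simp: linear_conv_bounded_linear[symmetric] lT)
  have closed: "z \<in> G" if z: "z \<in> ball 0 R" "z \<in> closure G" for z
  proof -
    have eqz: "e1 z = e2 (T z)"
    proof (rule ccontr)
      assume "e1 z \<noteq> e2 (T z)"
      then obtain B C where BC: "open B" "open C" "e1 z \<in> B" "e2 (T z) \<in> C" "B \<inter> C = {}" using hausdorff by metis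
      define N where "N = (ball 0 R \<inter> e1 -` B) \<inter> (ball 0 R \<inter> (\<lambda>z. e2 (T z)) -` C)"
      have "open N" unfolding N_def
        by (intro open_Int continuous_open_preimage[OF cont(1) open_ball BC(1)] continuous_open_preimage[OF cont(2) open_ball BC(2)])
      moreover have "z \<in> N" using z BC by (simp add: N_def)
      ultimately obtain y where "y \<in> N" "y \<in> G" using z(2) by (metis IntE disjoint_iff open_Int_closure_eq_empty)
      then have "y \<in> E" using interior_subset[of E] by (auto simp: G_def)
      then show False using BC(5) \<open>y \<in> N\<close> by (auto simp: N_def E_def)
    qed
    define \<epsilon> where "\<epsilon> = R - norm z"
    have \<epsilon>: "\<epsilon> > 0" "norm z + \<epsilon> \<le> R" "norm (T z) + \<epsilon> \<le> R" using z nT by (auto simp: \<epsilon>_def)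
    obtain S \<eta> where S: "orthogonal_transformation S" and \<eta>: "\<eta> > 0" "\<eta> \<le> \<epsilon>"
      "\<And>w. w \<in> ball 0 \<eta> \<Longrightarrow> e1 (z + w) = e2 (T z + S w)"
      using flat_transition_local[OF flat_param_recentre[OF e1 \<epsilon>(2,1)] flat_param_recentre[OF e2 \<epsilon>(3,1)]] eqz
      by (metis (no_types, lifting) add.right_neutral)
    have lS: "linear S" using S by (rule orthogonal_transformation_linear)
    have agree: "T (y - z) = S (y - z)" if y: "y \<in> E" "y \<in> ball z \<eta>" for y
    proof -
      have w: "y - z \<in> ball 0 \<eta>" using y(2) by (simp add: dist_norm norm_minus_commute)
      have "e2 (T y) = e2 (T z + S (y - z))" using \<eta>(3)[OF w] y(1) by (simp add: E_def)
      moreover have "norm (T z + S (y - z)) < R"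
        using norm_triangle_ineq[of "T z" "S (y - z)"] orthogonal_transformation_norm[OF S, of "y - z"] w \<eta>(2) \<epsilon>(3) by simp
      moreover have "norm (T y) < R" using y(1) nT by (simp add: E_def)
      ultimately have "T y = T z + S (y - z)"
        using inj_onD[OF local_paramD(2)[OF L2(1)]] by simp
      then show ?thesis by (simp add: linear_diff[OF lT])
    qed
    obtain y where y: "y \<in> G" "y \<in> ball z \<eta>"
      using z(2) \<eta>(1) by (metis Int_emptyI centre_in_ball disjoint_iff open_Int_closure_eq_empty open_ball)
    have "open (G \<inter> ball z \<eta>)" by (simp add: G_def open_Int)
    then obtain \<gamma> where \<gamma>: "\<gamma> > 0" "ball y \<gamma> \<subseteq> G \<inter> ball z \<eta>" using y by (meson IntI openE)
    have TS: "T v = S v" for v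
    proof -
      define t where "t = \<gamma> / (2 * (norm v + 1))"
      have t: "t > 0" using \<gamma> by (simp add: t_def add_nonneg_pos)
      have "t * norm v < \<gamma>"
      proof -
        have "t * norm v \<le> t * (norm v + 1)" using t by (intro mult_left_mono) auto
        also have "\<dots> = \<gamma> / 2" using add_nonneg_pos[of "norm v" 1] by (simp add: t_def field_simps)
        finally show ?thesis using \<gamma> by simp
      qed
      then have "y + t *\<^sub>R v \<in> ball y \<gamma>" using t by (simp add: dist_norm)
      then have "y + t *\<^sub>R v \<in> E \<inter> ball z \<eta>" "y \<in> E \<inter> ball z \<eta>"
        using \<gamma> y interior_subset[of E] by (auto simp: G_def)
      then have "T (y + t *\<^sub>R v - z) = S (y + t *\<^sub>R v - z)" "T (y - z) = S (y - z)" using agree by blast+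
      then have "t *\<^sub>R T v = t *\<^sub>R S v"
        using linear_add[OF lT, of "y - z" "t *\<^sub>R v"] linear_add[OF lS, of "y - z" "t *\<^sub>R v"]
        by (simp add: linear_scale[OF lT] linear_scale[OF lS] algebra_simps)
      then show ?thesis using t by simp
    qed
    have "ball z \<eta> \<subseteq> E"
    proof
      fix w assume w: "w \<in> ball z \<eta>"
      have "norm w < R" using w \<eta>(2) norm_triangle_ineq2[of w z] by (simp add: \<epsilon>_def dist_norm norm_minus_commute)
      moreover have "e1 w = e2 (T w)"
        using \<eta>(3)[of "w - z"] w TS[of "w - z", symmetric] by (simp add: dist_norm norm_minus_commute linear_diff[OF lT])
      ultimately show "w \<in> E" by (simp add: E_def)
    qed
    then show ?thesis using \<eta>(1) by (metis G_def centre_in_ball interior_maximal open_ball subsetD)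
  qed
  have "openin (top_of_set (ball 0 R)) G"
    by (rule open_openin_trans) (use interior_subset[of E] in \<open>auto simp: G_def E_def\<close>)
  moreover have "closedin (top_of_set (ball 0 R)) G"
  proof -
    have "G = ball 0 R \<inter> closure G" using closed closure_subset[of G] interior_subset[of E] by (auto simp: G_def E_def)
    then show ?thesis by (metis closed_closure closedin_closed)
  qed
  moreover have "0 \<in> G"
  proof -
    have "ball 0 \<delta> \<subseteq> E" using \<delta> by (auto simp: E_def)
    then show ?thesis using \<delta>(1) by (metis G_def centre_in_ball interior_maximal open_ball subsetD)
  qed
  ultimately have "G = ball 0 R" using connected_clopen[of "ball (0::'b) R"] connected_ball by blast
  then have "ball 0 R \<subseteq> E" using interior_subset[of E] by (simp add: G_def)
  then show thesis by (intro that[OF T]) (auto simp: E_def)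
qed

text \<open>By compactness finitely many parameter balls of half radius cover the manifold.
  Recentring at a point of a half ball costs at most the other half of the radius.\<close>

lemma uniform_flat_param:
  assumes "compact (UNIV :: 'a set)"
  obtains R where "R > 0" "\<And>p. \<exists>e. flat_param R e \<and> e 0 = p"
proof -
  have "\<exists>\<rho> e. flat_param \<rho> e \<and> e 0 = p" for p using flat_param_exists by metis
  then obtain \<rho> e where e: "\<And>p. flat_param (\<rho> p) (e p)" "\<And>p. e p 0 = p" by metis
  have \<rho>: "\<rho> p > 0" for p using local_paramD(1) flat_paramD(1) e(1) by blast
  define V where "V p = e p ` ball 0 (\<rho> p / 2)" for p
  have oV: "open (V p)" for p
    unfolding V_def by (rule local_paramD(4)[OF flat_paramD(1)[OF e(1)] open_ball]) (use \<rho>[of p] in auto)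
  have pV: "p \<in> V p" for p using e(2)[of p] \<rho>[of p] unfolding V_def by (metis centre_in_ball half_gt_zero image_eqI)
  obtain P where P: "finite P" "UNIV \<subseteq> (\<Union>p\<in>P. V p)"
  proof (rule compactE_image[OF assms, of UNIV V])
    show "open (V p)" for p by (rule oV)
    show "UNIV \<subseteq> (\<Union>p. V p)" using pV by blast
  qed (rule that)
  have "P \<noteq> {}" using P(2) by auto
  define R where "R = Min ((\<lambda>p. \<rho> p / 2) ` P)"
  have R: "R > 0" "R \<le> \<rho> p / 2" if "p \<in> P" for p
    unfolding R_def using P(1) \<open>P \<noteq> {}\<close> \<rho> that by (simp, intro Min_le) auto
  have "R > 0" using \<open>P \<noteq> {}\<close> R(1) by blast
  have "\<exists>e. flat_param R e \<and> e 0 = q" for q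
  proof -
    have "q \<in> (\<Union>p\<in>P. V p)" using P(2) by blast
    then obtain p x where px: "p \<in> P" "x \<in> ball 0 (\<rho> p / 2)" "q = e p x" by (auto simp: V_def)
    have "flat_param R (\<lambda>z. e p (x + z))"
      by (rule flat_param_recentre[OF e(1)]) (use px R(2)[OF px(1)] \<open>R > 0\<close> in auto)
    then show ?thesis using px(3) by (intro exI[of _ "\<lambda>z. e p (x + z)"]) simp
  qed
  with \<open>R > 0\<close> show thesis by (rule that)
qed

lemma flat_transition_recentred:
  assumes e: "flat_param R e" and x: "norm x \<le> R / 2" and e': "flat_param R e'" and eq: "e' 0 = e x"
  obtains T where "orthogonal_transformation T" "\<And>z. z \<in> ball 0 (R / 2) \<Longrightarrow> e' z = e (x + T z)"
proof -
  have R: "R > 0" using local_paramD(1) flat_paramD(1) e by blast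
  show thesis
    using flat_transition[OF flat_param_shrink[OF e', of "R/2"] flat_param_recentre[OF e, of x "R/2"]] that x eq R
    by auto
qed

end

section \<open>Invariance of Lebesgue measure under orthogonal maps\<close>

lemma nn_integral_lborel_shift:
  fixes f :: "'b::euclidean_space \<Rightarrow> ennreal"
  assumes "f \<in> borel_measurable borel"
  shows "(\<integral>\<^sup>+x. f (c + x) \<partial>lborel) = (\<integral>\<^sup>+x. f x \<partial>lborel)"
proof -
  have "(\<integral>\<^sup>+x. f x \<partial>distr lborel borel ((+) c)) = (\<integral>\<^sup>+x. f (c + x) \<partial>lborel)"
    by (rule nn_integral_distr) (use assms in auto)
  then show ?thesis by (simp add: lborel_distr_plus)
qed

text \<open>The image measure is translation invariant; comparing it with Lebesgue measure by Tonelli's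
  theorem, as in the uniqueness of Haar measure, leaves a factor, which is one because balls
  centred at the origin are preserved.\<close>

lemma nn_integral_lborel_orthogonal:
  fixes f :: "'b::euclidean_space \<Rightarrow> ennreal" and T :: "'b \<Rightarrow> 'b"
  assumes T: "orthogonal_transformation T" and f[measurable]: "f \<in> borel_measurable borel"
  shows "(\<integral>\<^sup>+x. f (T x) \<partial>lborel) = (\<integral>\<^sup>+x. f x \<partial>lborel)"
proof -
  have lT: "linear T" using T by (rule orthogonal_transformation_linear)
  have [measurable]: "T \<in> borel_measurable borel"
    using lT by (intro borel_measurable_continuous_onI linear_continuous_on) (simp add: linear_conv_bounded_linear)
  define k :: "'b \<Rightarrow> ennreal" where "k = indicator (ball 0 1)"
  have [measurable]: "k \<in> borel_measurable borel" unfolding k_def by (intro borel_measurable_indicator) simp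
  have kn: "k x = k y" if "norm x = norm y" for x y using that by (simp add: k_def indicator_def)
  define v where "v = emeasure lborel (ball (0::'b) 1)"
  have vk: "(\<integral>\<^sup>+x. k x \<partial>lborel) = v" by (simp add: k_def v_def)
  have v: "v \<noteq> 0" "v \<noteq> top"
  proof -
    show "v \<noteq> top" unfolding v_def using emeasure_lborel_ball_finite[of "0::'b" 1] by simp
    have "measure lborel (ball (0::'b) 1) > 0" using content_ball_pos[of 1 "0::'b"] by simp
    then show "v \<noteq> 0" unfolding v_def by (metis enn2real_0 less_irrefl measure_def)
  qed
  obtain T' where T': "\<And>y. T (T' y) = y" using orthogonal_transformation_surj[OF T] by (metis surj_f_inv_f)
  have "(\<integral>\<^sup>+x. f (T x) \<partial>lborel) * v = (\<integral>\<^sup>+x. (\<integral>\<^sup>+y. f (T x) * k y \<partial>lborel) \<partial>lborel)"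
    by (simp add: nn_integral_cmult nn_integral_multc vk)
  also have "\<dots> = (\<integral>\<^sup>+x. (\<integral>\<^sup>+y. f (T x) * k (- T x + y) \<partial>lborel) \<partial>lborel)"
  proof (rule nn_integral_cong)
    fix x
    show "(\<integral>\<^sup>+y. f (T x) * k y \<partial>lborel) = (\<integral>\<^sup>+y. f (T x) * k (- T x + y) \<partial>lborel)"
      by (rule nn_integral_lborel_shift[of "\<lambda>y. f (T x) * k y", symmetric]) measurable
  qed
  also have "\<dots> = (\<integral>\<^sup>+y. (\<integral>\<^sup>+x. f (T x) * k (- T x + y) \<partial>lborel) \<partial>lborel)"
    by (rule lborel_pair.Fubini'[symmetric]) measurable
  also have "\<dots> = (\<integral>\<^sup>+y. (\<integral>\<^sup>+x. f (T x + y) * k x \<partial>lborel) \<partial>lborel)"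
  proof (rule nn_integral_cong)
    fix y :: 'b
    have "(\<integral>\<^sup>+x. f (T x) * k (- T x + y) \<partial>lborel) = (\<integral>\<^sup>+x. f (T (T' y + x)) * k (- T (T' y + x) + y) \<partial>lborel)"
      by (rule nn_integral_lborel_shift[symmetric]) measurable
    also have "\<dots> = (\<integral>\<^sup>+x. f (T x + y) * k x \<partial>lborel)"
    proof (rule nn_integral_cong)
      fix x
      have "k (- T (T' y + x) + y) = k x"
        by (rule kn) (simp add: linear_add[OF lT] T' orthogonal_transformation_norm[OF T])
      then show "f (T (T' y + x)) * k (- T (T' y + x) + y) = f (T x + y) * k x"
        by (simp add: linear_add[OF lT] T' add.commute)
    qed
    finally show "(\<integral>\<^sup>+x. f (T x) * k (- T x + y) \<partial>lborel) = (\<integral>\<^sup>+x. f (T x + y) * k x \<partial>lborel)" .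
  qed
  also have "\<dots> = (\<integral>\<^sup>+x. (\<integral>\<^sup>+y. f (T x + y) * k x \<partial>lborel) \<partial>lborel)"
    by (rule lborel_pair.Fubini') measurable
  also have "\<dots> = (\<integral>\<^sup>+x. (\<integral>\<^sup>+y. f y \<partial>lborel) * k x \<partial>lborel)"
    by (intro nn_integral_cong) (simp add: nn_integral_multc nn_integral_lborel_shift)
  also have "\<dots> = (\<integral>\<^sup>+y. f y \<partial>lborel) * v"
    by (simp add: nn_integral_cmult vk)
  finally show ?thesis using v ennreal_mult_cancel_left[of v] by (simp add: mult.commute)
qed

lemma distr_orthogonal_lborel:
  fixes T :: "'b::euclidean_space \<Rightarrow> 'b"
  assumes T: "orthogonal_transformation T"
  shows "distr lborel borel T = (lborel :: 'b::euclidean_space measure)"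
proof (rule measure_eqI)
  have "linear T" using T by (rule orthogonal_transformation_linear)
  then have Tm[measurable]: "T \<in> borel_measurable borel"
    by (intro borel_measurable_continuous_onI linear_continuous_on) (simp add: linear_conv_bounded_linear)
  fix S assume "S \<in> sets (distr lborel borel T)"
  then have S[measurable]: "S \<in> sets borel" by simp
  have "emeasure (distr lborel borel T) S = (\<integral>\<^sup>+x. indicator S x \<partial>distr lborel borel T)" by simp
  also have "\<dots> = (\<integral>\<^sup>+x. indicator S (T x) \<partial>lborel)" by (rule nn_integral_distr) auto
  also have "\<dots> = (\<integral>\<^sup>+x. indicator S x \<partial>lborel)" by (rule nn_integral_lborel_orthogonal[OF T]) auto
  finally show "emeasure (distr lborel borel T) S = emeasure lborel S" by simp
qed simp

lemma integral_lborel_orthogonal: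
  fixes f :: "'b::euclidean_space \<Rightarrow> real" and T :: "'b \<Rightarrow> 'b"
  assumes T: "orthogonal_transformation T" and f: "f \<in> borel_measurable borel"
  shows "(\<integral>x. f (T x) \<partial>lborel) = (\<integral>x. f x \<partial>lborel)"
proof -
  have "linear T" using T by (rule orthogonal_transformation_linear)
  then have "T \<in> borel_measurable borel"
    by (intro borel_measurable_continuous_onI linear_continuous_on) (simp add: linear_conv_bounded_linear)
  then have "(\<integral>x. f x \<partial>distr lborel borel T) = (\<integral>x. f (T x) \<partial>lborel)"
    by (intro integral_distr f) simp
  then show ?thesis by (simp add: distr_orthogonal_lborel[OF T])
qed

lemma integral_lborel_shift:
  fixes f :: "'b::euclidean_space \<Rightarrow> real"
  assumes f: "f \<in> borel_measurable borel"
  shows "(\<integral>x. f (c + x) \<partial>lborel) = (\<integral>x. f x \<partial>lborel)"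
proof -
  have "(\<integral>x. f x \<partial>distr lborel borel ((+) c)) = (\<integral>x. f (c + x) \<partial>lborel)"
    by (intro integral_distr f) simp
  then show ?thesis by (simp add: lborel_distr_plus)
qed

text \<open>Averages are integrals over the whole space, but their continuity and smoothness are
  results about integrals over boxes; the cube encloses the ball on which a kernel lives.\<close>

definition cube :: "real \<Rightarrow> 'b::euclidean_space set" where
  "cube s = cbox (- s *\<^sub>R One) (s *\<^sub>R One)"

lemma ball_subset_cube: "ball 0 s \<subseteq> (cube s :: 'b::euclidean_space set)"
proof
  fix x :: 'b assume x: "x \<in> ball 0 s"
  have "- s \<le> x \<bullet> i \<and> x \<bullet> i \<le> s" if "i \<in> Basis" for i
    using Basis_le_norm[OF that, of x] x by auto
  then show "x \<in> cube s" by (auto simp: cube_def mem_box)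
qed

lemma cube_subset_ball: "x \<in> (cube s :: 'b::euclidean_space set) \<Longrightarrow> norm x \<le> s * DIM('b)"
proof -
  assume "x \<in> (cube s :: 'b set)"
  then have "\<bar>x \<bullet> i\<bar> \<le> s" if "i \<in> Basis" for i
    using that by (auto simp: cube_def mem_box abs_le_iff)
  then have "(\<Sum>i\<in>Basis. \<bar>x \<bullet> i\<bar>) \<le> (\<Sum>i\<in>(Basis::'b set). s)" by (rule sum_mono)
  then show ?thesis using norm_le_l1[of x] by (simp add: mult.commute)
qed

lemma compact_support_integral:
  fixes f :: "'b::euclidean_space \<Rightarrow> real"
  assumes f: "continuous_on UNIV f" and z: "\<And>x. norm x \<ge> s \<Longrightarrow> f x = 0"
  shows "integrable lborel f" "(\<integral>x. f x \<partial>lborel) = integral (cube s) f"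
proof -
  have e: "(\<lambda>x. indicator (cube s) x *\<^sub>R f x) = f"
  proof
    fix x :: 'b
    show "indicator (cube s) x *\<^sub>R f x = f x"
      using z[of x] ball_subset_cube[of s] by (cases "x \<in> ball 0 s") (auto simp: indicator_def)
  qed
  have c: "continuous_on (cube s) f" by (rule continuous_on_subset[OF f]) simp
  have "integrable lborel (\<lambda>x. indicator (cube s) x *\<^sub>R f x)"
    by (rule borel_integrable_compact[OF _ c]) (simp add: cube_def)
  then show i: "integrable lborel f" unfolding e .
  have "set_integrable lborel (cube s) f" using i unfolding set_integrable_def e .
  from set_borel_integral_eq_integral(2)[OF this]
  show "(\<integral>x. f x \<partial>lborel) = integral (cube s) f" unfolding set_lebesgue_integral_def e .
qed

lemma continuous_on_kernel_mult:
  fixes k v :: "'b::euclidean_space \<Rightarrow> real"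
  assumes k: "continuous_on UNIV k" "\<forall>z. norm z \<ge> s \<longrightarrow> k z = 0" and v: "continuous_on (ball 0 r) v" and s: "s < r"
  shows "continuous_on UNIV (\<lambda>z. k z * v z)"
proof -
  have "continuous_on (ball 0 r \<union> - cball 0 s) (\<lambda>z. k z * v z)"
  proof (rule continuous_on_open_Un)
    show "continuous_on (ball 0 r) (\<lambda>z. k z * v z)"
      by (intro continuous_on_mult v continuous_on_subset[OF k(1)]) simp
    show "continuous_on (- cball 0 s) (\<lambda>z. k z * v z)"
      by (rule continuous_on_eq[of _ "\<lambda>_. 0"]) (auto simp: k(2))
  qed auto
  moreover have "ball 0 r \<union> - cball 0 s = (UNIV :: 'b set)" using s by auto
  ultimately show ?thesis by simp
qed

section \<open>Averaging over small balls\<close>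

text \<open>The averaging operator only uses that every point is the centre of a parametrisation of
  fixed radius and that the parametrisations differ by isometries.\<close>

locale isometric_frames =
  fixes R :: real and \<E> :: "('b::euclidean_space \<Rightarrow> 'a::t2_space) set"
  assumes R: "R > 0" and frame: "\<exists>e\<in>\<E>. e 0 = p"
    and frame_continuous: "e \<in> \<E> \<Longrightarrow> continuous_on (ball 0 R) e"
    and frame_open: "e \<in> \<E> \<Longrightarrow> open S \<Longrightarrow> S \<subseteq> ball 0 R \<Longrightarrow> open (e ` S)"
    and frame_transition: "e \<in> \<E> \<Longrightarrow> norm x \<le> R / 2 \<Longrightarrow> e' \<in> \<E> \<Longrightarrow> e' 0 = e x \<Longrightarrow>
      \<exists>T. orthogonal_transformation T \<and> (\<forall>z\<in>ball 0 (R / 2). e' z = e (x + T z))"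
    and compact_space: "compact (UNIV :: 'a set)"
begin

definition frame_at :: "'a \<Rightarrow> 'b \<Rightarrow> 'a" where
  "frame_at p = (SOME e. e \<in> \<E> \<and> e 0 = p)"

lemma frame_at: "frame_at p \<in> \<E>" "frame_at p 0 = p"
  using someI_ex[of "\<lambda>e. e \<in> \<E> \<and> e 0 = p"] frame[of p] by (auto simp: frame_at_def Bex_def)

text \<open>The radius of the kernel is small enough for the enclosing cube to stay in the
  parameter balls.\<close>

definition s :: real where "s = R / (8 * DIM('b))"

lemma s: "s > 0" "8 * s \<le> R"
proof -
  have "real DIM('b) \<ge> 1" using DIM_positive[where 'a = 'b] by linarith
  then show "s > 0" "8 * s \<le> R" using R mult_left_mono[of 1 "real DIM('b)" R] by (auto simp: s_def field_simps)
qed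

lemma cube_norm: "x \<in> (cube s :: 'b set) \<Longrightarrow> norm x \<le> R / 8"
  using cube_subset_ball[of x s] by (simp add: s_def)

definition mass :: real where "mass = (\<integral>z. radial_bump s (z::'b) \<partial>lborel)"

definition K :: "'b \<Rightarrow> real" where "K z = radial_bump s z / mass"

lemma radial_bump_continuous: "continuous_on UNIV (radial_bump r :: 'b \<Rightarrow> real)"
  by (rule smooth_on_continuous_on[OF radial_bump_smooth_on])

lemma radial_bump_zero: "r > 0 \<Longrightarrow> norm (z::'b) \<ge> r \<Longrightarrow> radial_bump r z = 0"
  using radial_bump_eq_0_iff by blast

lemma radial_bump_integral_pos:
  assumes "r > 0"
  shows "(\<integral>z. radial_bump r (z::'b) \<partial>lborel) > 0"
proof -
  note i = compact_support_integral[OF radial_bump_continuous radial_bump_zero[OF assms]]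
  have "integral (cube r) (radial_bump r :: 'b \<Rightarrow> real) > 0"
  proof -
    have "0 \<in> ball (0::'b) r" using assms by simp
    then have ne: "(cube r :: 'b set) \<noteq> {}" "box (- r *\<^sub>R One) (r *\<^sub>R One) \<noteq> ({} :: 'b set)"
      using ball_subset_cube[of r] \<open>0 \<in> ball (0::'b) r\<close> assms by (blast, simp add: box_ne_empty inner_sum_left_Basis)
    have nn: "integral (cube r) (radial_bump r :: 'b \<Rightarrow> real) \<ge> 0"
      by (rule integral_nonneg) (auto simp: radial_bump_nonneg cube_def intro!: integrable_continuous continuous_on_subset[OF radial_bump_continuous])
    moreover have "integral (cube r) (radial_bump r :: 'b \<Rightarrow> real) \<noteq> 0"
    proof
      assume "integral (cube r) (radial_bump r :: 'b \<Rightarrow> real) = 0"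
      then have "\<forall>x\<in>cbox (- r *\<^sub>R One) (r *\<^sub>R One :: 'b). radial_bump r x = 0"
        using integral_cbox_eq_0_iff[OF continuous_on_subset[OF radial_bump_continuous subset_UNIV] ne(2) radial_bump_nonneg, of r]
        unfolding cube_def by simp
      moreover have "(0::'b) \<in> cbox (- r *\<^sub>R One) (r *\<^sub>R One)"
        using ball_subset_cube[of r] \<open>0 \<in> ball (0::'b) r\<close> by (auto simp: cube_def)
      ultimately show False using radial_bump_pos_iff[OF assms, of "0::'b"] assms by force
    qed
    ultimately show ?thesis by linarith
  qed
  then show ?thesis using i(2) by simp
qed

lemma mass: "mass > 0" unfolding mass_def by (rule radial_bump_integral_pos[OF s(1)])

lemma K_continuous: "continuous_on UNIV K"
  unfolding K_def by (intro continuous_on_divide radial_bump_continuous continuous_on_const) (use mass in auto)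

lemma K_zero: "norm z \<ge> s \<Longrightarrow> K z = 0"
  using radial_bump_zero[OF s(1)] by (simp add: K_def)

lemma K_nonneg: "K z \<ge> 0" using radial_bump_nonneg[of s z] mass by (simp add: K_def)

lemma K_pos: "norm z < s \<Longrightarrow> K z > 0"
  using radial_bump_pos_iff[OF s(1), of z] mass by (simp add: K_def)

lemma K_smooth: "smooth_on UNIV K"
proof -
  have "K = (\<lambda>z. radial_bump s z * (1 / mass))" by (auto simp: K_def)
  then show ?thesis
    using smooth_on_linear_comp[OF bounded_linear_mult_left[of "1 / mass"] open_UNIV radial_bump_smooth_on[of s]] by simp
qed

lemma K_radial: "norm y = norm z \<Longrightarrow> K y = K z"
  by (metis K_def dot_square_norm radial_bump_def)

lemma K_integral: "(\<integral>z. K z \<partial>lborel) = 1"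
  using mass by (simp add: K_def mass_def[symmetric])

text \<open>Kernels that a rotation does not change: averages formed with them do not depend on
  the choice of the parametrisation.\<close>

definition radial_kernel :: "('b \<Rightarrow> real) \<Rightarrow> bool" where
  "radial_kernel k \<longleftrightarrow> continuous_on UNIV k \<and> (\<forall>z. norm z \<ge> s \<longrightarrow> k z = 0) \<and> (\<forall>z. k z \<ge> 0) \<and>
     (\<forall>y z. norm y = norm z \<longrightarrow> k y = k z)"

lemma radial_kernelD:
  assumes "radial_kernel k"
  shows "continuous_on UNIV k" "\<forall>z. norm z \<ge> s \<longrightarrow> k z = 0" "\<And>z. k z \<ge> 0" "norm y = norm z \<Longrightarrow> k y = k z"
  using assms unfolding radial_kernel_def by blast+

lemma K_kernel: "radial_kernel K"
  unfolding radial_kernel_def using K_continuous K_zero K_nonneg K_radial by blast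

lemma bump_kernel:
  assumes "0 < r" "r \<le> s"
  shows "radial_kernel (radial_bump r)"
proof -
  have "radial_bump r y = radial_bump r z" if "norm y = norm z" for y z :: 'b
    using that by (metis dot_square_norm radial_bump_def)
  then show ?thesis
    unfolding radial_kernel_def using radial_bump_continuous radial_bump_zero[OF assms(1)] radial_bump_nonneg assms(2) by (meson order_trans)
qed

lemma kernel_integral:
  assumes k: "radial_kernel k" and v: "continuous_on (ball 0 (R/4)) v"
  shows "integrable lborel (\<lambda>z. k z * v z)" "(\<integral>z. k z * v z \<partial>lborel) = integral (cube s) (\<lambda>z. k z * v z)"
    "(\<lambda>z. k z * v z) \<in> borel_measurable borel"
proof -
  have c: "continuous_on UNIV (\<lambda>z. k z * v z)"
    by (rule continuous_on_kernel_mult[OF radial_kernelD(1,2)[OF k] v]) (use s in auto)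
  have z: "k z * v z = 0" if "s \<le> norm z" for z using radial_kernelD(2)[OF k] that by simp
  show "integrable lborel (\<lambda>z. k z * v z)" "(\<integral>z. k z * v z \<partial>lborel) = integral (cube s) (\<lambda>z. k z * v z)"
    using compact_support_integral[OF c z] by auto
  show "(\<lambda>z. k z * v z) \<in> borel_measurable borel" by (rule borel_measurable_continuous_onI[OF c])
qed

lemma kernel_integral_rotate:
  assumes k: "radial_kernel k" and v: "continuous_on (ball 0 (R/4)) v" and T: "orthogonal_transformation T"
  shows "(\<integral>z. k z * v (T z) \<partial>lborel) = (\<integral>z. k z * v z \<partial>lborel)"
proof -
  have "k (T z) = k z" for z by (rule radial_kernelD(4)[OF k orthogonal_transformation_norm[OF T]])
  then show ?thesis using integral_lborel_orthogonal[OF T kernel_integral(3)[OF k v]] by simp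
qed

lemma kernel_integral_mono:
  assumes k: "radial_kernel k"
    and v: "continuous_on (ball 0 (R/4)) v" "continuous_on (ball 0 (R/4)) w"
    and le: "\<And>z. norm z < s \<Longrightarrow> v z \<le> w z"
  shows "(\<integral>z. k z * v z \<partial>lborel) \<le> (\<integral>z. k z * w z \<partial>lborel)"
proof (rule integral_mono[OF kernel_integral(1)[OF k v(1)] kernel_integral(1)[OF k v(2)]])
  show "k z * v z \<le> k z * w z" for z
    using le[of z] radial_kernelD(2,3)[OF k] by (cases "norm z < s") (auto intro: mult_left_mono)
qed

definition avg :: "('a \<Rightarrow> real) \<Rightarrow> 'a \<Rightarrow> real" where
  "avg u p = (\<integral>z. K z * u (frame_at p z) \<partial>lborel)"

lemma frame_comp_continuous:
  assumes u: "continuous_on UNIV u" and e: "e \<in> \<E>" and x: "norm x + r \<le> R"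
  shows "continuous_on (ball 0 r) (\<lambda>z. u (e (x + z)))"
proof (rule continuous_on_compose2[OF u])
  show "continuous_on (ball 0 r) (\<lambda>z. e (x + z))"
  proof (rule continuous_on_compose2[OF frame_continuous[OF e]])
    show "(+) x ` ball 0 r \<subseteq> ball 0 R"
    proof
      fix y assume "y \<in> (+) x ` ball 0 r"
      then have "norm (y - x) < r" by (auto simp: dist_norm norm_minus_commute)
      then show "y \<in> ball 0 R" using norm_triangle_ineq[of x "y - x"] x by simp
    qed
  qed (auto intro!: continuous_intros)
qed auto

text \<open>The transition between the two parametrisations is a rotation followed by a
  translation, and the kernel is radial. So the means near a point can all be computed in one
  parametrisation.\<close>

lemma kernel_integral_frame:
  assumes k: "radial_kernel k"
    and u: "continuous_on UNIV u" and e: "e \<in> \<E>" and x: "norm x \<le> R / 2" and e': "e' \<in> \<E>" "e' 0 = e x"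
  shows "(\<integral>z. k z * u (e' z) \<partial>lborel) = (\<integral>z. k z * u (e (x + z)) \<partial>lborel)"
proof -
  obtain T where T: "orthogonal_transformation T" "\<forall>z\<in>ball 0 (R / 2). e' z = e (x + T z)"
    using frame_transition[OF e x e'] by blast
  have "(\<integral>z. k z * u (e' z) \<partial>lborel) = (\<integral>z. k z * u (e (x + T z)) \<partial>lborel)"
  proof (rule Bochner_Integration.integral_cong[OF refl])
    fix z show "k z * u (e' z) = k z * u (e (x + T z))"
      using T(2) radial_kernelD(2)[OF k] s by (cases "norm z < s") auto
  qed
  also have "\<dots> = (\<integral>z. k z * u (e (x + z)) \<partial>lborel)"
    by (rule kernel_integral_rotate[OF k _ T(1)], rule frame_comp_continuous[OF u e]) (use x R in auto)
  finally show ?thesis .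
qed

lemma avg_eq:
  assumes "continuous_on UNIV u" "e \<in> \<E>" "norm x \<le> R / 2"
  shows "avg u (e x) = (\<integral>z. K z * u (e (x + z)) \<partial>lborel)"
  unfolding avg_def
  by (rule kernel_integral_frame[OF K_kernel assms frame_at])

lemma continuous_on_frames:
  assumes "\<And>e. e \<in> \<E> \<Longrightarrow> continuous_on (ball 0 (R/2)) (\<lambda>x. f (e x))"
  shows "continuous_on UNIV f"
  unfolding continuous_on_eq_continuous_at[OF open_UNIV]
proof
  fix p
  show "continuous (at p) f"
    unfolding continuous_at_open
  proof (intro allI impI)
    fix B assume B: "open B \<and> f p \<in> B"
    define e where "e = frame_at p"
    have o: "open (ball 0 (R/2) \<inter> (\<lambda>x. f (e x)) -` B)"
      using continuous_open_preimage[OF assms open_ball] B frame_at(1) by (auto simp: e_def)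
    have "open (e ` (ball 0 (R/2) \<inter> (\<lambda>x. f (e x)) -` B))"
      by (rule frame_open[OF _ o]) (use frame_at(1) R in \<open>auto simp: e_def\<close>)
    moreover have "p \<in> e ` (ball 0 (R/2) \<inter> (\<lambda>x. f (e x)) -` B)"
      using B R frame_at(2)[of p] by (intro image_eqI[of _ _ 0]) (auto simp: e_def)
    ultimately show "\<exists>S. open S \<and> p \<in> S \<and> (\<forall>x'\<in>S. f x' \<in> B)" by (intro exI[of _ "e ` _"]) auto
  qed
qed

lemma avg_continuous:
  assumes u: "continuous_on UNIV u"
  shows "continuous_on UNIV (avg u)"
proof (rule continuous_on_frames)
  fix e assume e: "e \<in> \<E>"
  have "continuous_on (ball 0 (R/2)) (\<lambda>x. integral (cube s) (\<lambda>z. K z * u (e (x + z))))"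
    unfolding cube_def
  proof (rule integral_continuous_on_param, unfold split_beta)
    have in1: "fst w + snd w \<in> ball 0 R" if "w \<in> ball 0 (R/2) \<times> cbox (- s *\<^sub>R One) (s *\<^sub>R One)" for w :: "'b \<times> 'b"
    proof -
      have "norm (snd w) \<le> R / 8" using that by (intro cube_norm) (auto simp: cube_def)
      then show ?thesis using that norm_triangle_ineq[of "fst w" "snd w"] R by auto
    qed
    have "continuous_on (ball 0 (R/2) \<times> cbox (- s *\<^sub>R One) (s *\<^sub>R One)) (\<lambda>w. e (fst w + snd w))"
      by (rule continuous_on_compose2[OF frame_continuous[OF e]]) (use in1 in \<open>auto intro!: continuous_intros\<close>)
    then have "continuous_on (ball 0 (R/2) \<times> cbox (- s *\<^sub>R One) (s *\<^sub>R One)) (\<lambda>w. u (e (fst w + snd w)))"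
      by (rule continuous_on_compose2[OF u]) auto
    moreover have "continuous_on (ball (0::'b) (R/2) \<times> cbox (- s *\<^sub>R One) (s *\<^sub>R One)) (\<lambda>w. K (snd w))"
      by (rule continuous_on_compose2[OF K_continuous]) (auto intro!: continuous_intros)
    ultimately show "continuous_on (ball 0 (R/2) \<times> cbox (- s *\<^sub>R One) (s *\<^sub>R One)) (\<lambda>w. K (snd w) * u (e (fst w + snd w)))"
      by (intro continuous_on_mult)
  qed
  then show "continuous_on (ball 0 (R/2)) (\<lambda>x. avg u (e x))"
  proof (rule continuous_on_eq)
    fix x :: 'b assume x: "x \<in> ball 0 (R/2)"
    have "continuous_on (ball 0 (R/4)) (\<lambda>z. u (e (x + z)))"
      by (rule frame_comp_continuous[OF u e]) (use x R in auto)
    then show "integral (cube s) (\<lambda>z. K z * u (e (x + z))) = avg u (e x)"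
      using avg_eq[OF u e, of x] kernel_integral(2)[OF K_kernel] x by simp
  qed
qed

text \<open>Steps of a quarter of the kernel radius are short enough for the average at one
  point to control the averages at the other.\<close>

definition near :: "'a \<Rightarrow> 'a \<Rightarrow> bool" where
  "near p q \<longleftrightarrow> (\<exists>e\<in>\<E>. e 0 = p \<and> (\<exists>x. norm x < s / 4 \<and> q = e x))"

lemma nearI: "e \<in> \<E> \<Longrightarrow> norm x \<le> R / 2 \<Longrightarrow> norm (y - x) < s / 4 \<Longrightarrow> near (e x) (e y)"
proof -
  assume e: "e \<in> \<E>" and x: "norm x \<le> R / 2" and y: "norm (y - x) < s / 4"
  obtain T where T: "orthogonal_transformation T" "\<forall>z\<in>ball 0 (R / 2). frame_at (e x) z = e (x + T z)"
    using frame_transition[OF e x frame_at] by blast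
  obtain z where z: "T z = y - x" using orthogonal_transformation_surj[OF T(1)] by (metis surjD)
  have n: "norm z = norm (y - x)" using orthogonal_transformation_norm[OF T(1), of z] z by simp
  then have "e y = frame_at (e x) z" using T(2) z y s by auto
  then show "near (e x) (e y)" unfolding near_def using frame_at n y by metis
qed

lemma near_refl: "near p p"
  using nearI[OF frame_at(1), of 0 0 p] frame_at(2)[of p] s R by simp

lemma near_sym: "near p q \<Longrightarrow> near q p"
proof -
  assume "near p q"
  then obtain e x where e: "e \<in> \<E>" "e 0 = p" "norm x < s / 4" "q = e x" by (auto simp: near_def)
  then show "near q p" using nearI[OF e(1), of x 0] s R by auto
qed

text \<open>The classes of points joined by chains of short steps. They are open and closed,
  hence compact, and take the place of the connected components.\<close>

definition linked :: "'a \<Rightarrow> 'a set" where "linked p = {q. near\<^sup>*\<^sup>* p q}"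

text \<open>The segment from the centre to \<open>x\<close> is divided into steps of length at
  most \<open>s / 8\<close>.\<close>

lemma linked_frame:
  assumes p: "e 0 \<in> linked p0" and e: "e \<in> \<E>" and x: "norm x < R / 2"
  shows "e x \<in> linked p0"
proof -
  have "near\<^sup>*\<^sup>* (e 0) (e x)" if "norm x < R / 2" "norm x \<le> real n * (s / 8)" for n x
    using that
  proof (induction n arbitrary: x)
    case 0
    then show ?case by simp
  next
    case (Suc n)
    define t where "t = 1 / real (Suc n)"
    have t: "0 \<le> t" "t \<le> 1" "(1 - t) * real (Suc n) = real n" "t * real (Suc n) = 1" by (auto simp: t_def field_simps)
    define y where "y = (1 - t) *\<^sub>R x"
    have ny: "norm y = (1 - t) * norm x" using t by (simp add: y_def)
    also have "\<dots> \<le> (1 - t) * (real (Suc n) * (s / 8))"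
      using Suc.prems(2) t by (intro mult_left_mono) auto
    also have "\<dots> = ((1 - t) * real (Suc n)) * (s / 8)" by (simp only: mult.assoc)
    finally have y1: "norm y \<le> real n * (s / 8)" unfolding t(3) .
    have "norm y \<le> 1 * norm x" unfolding ny using t by (intro mult_right_mono) auto
    then have y2: "norm y < R / 2" using Suc.prems(1) by simp
    have "x - y = t *\<^sub>R x" by (simp add: y_def algebra_simps)
    then have "norm (x - y) = t * norm x" using t by simp
    also have "\<dots> \<le> t * (real (Suc n) * (s / 8))" using Suc.prems(2) t by (intro mult_left_mono) auto
    also have "\<dots> = (t * real (Suc n)) * (s / 8)" by (simp only: mult.assoc)
    also have "\<dots> = s / 8" unfolding t(4) by simp
    finally have "near (e y) (e x)" using nearI[OF e, of y x] y2 s by simp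
    then show ?case using Suc.IH[OF y2 y1] by simp
  qed
  moreover obtain n where "norm x \<le> real n * (s / 8)"
    using reals_Archimedean3[of "s / 8"] s(1) by (metis divide_pos_pos less_imp_le zero_less_numeral)
  ultimately have "near\<^sup>*\<^sup>* (e 0) (e x)" using x by blast
  then show ?thesis using p unfolding linked_def by (simp add: rtranclp_trans)
qed

lemma linked_open: "open (linked p0)"
proof (subst open_subopen, intro ballI)
  fix q assume q: "q \<in> linked p0"
  have "open (frame_at q ` ball 0 (R/2))" by (rule frame_open[OF frame_at(1)]) (use R in auto)
  moreover have "q \<in> frame_at q ` ball 0 (R/2)" using R frame_at(2)[of q] by (metis centre_in_ball half_gt_zero image_eqI)
  moreover have "frame_at q ` ball 0 (R/2) \<subseteq> linked p0"
    using linked_frame[OF _ frame_at(1), of q p0] frame_at(2) q by auto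
  ultimately show "\<exists>S. open S \<and> q \<in> S \<and> S \<subseteq> linked p0" by blast
qed

lemma linked_eq: "q \<in> linked p \<Longrightarrow> linked q = linked p"
proof -
  have sym: "near\<^sup>*\<^sup>* a b \<Longrightarrow> near\<^sup>*\<^sup>* b a" for a b
    by (induction rule: rtranclp_induct) (auto intro: near_sym converse_rtranclp_into_rtranclp)
  assume "q \<in> linked p"
  then show ?thesis using sym by (fastforce simp: linked_def intro: rtranclp_trans)
qed

lemma linked_self: "p \<in> linked p" by (simp add: linked_def)

lemma linked_compact: "compact (linked p)"
proof -
  have "r \<notin> linked p" if "q \<notin> linked p" "r \<in> linked q" for q r
    using linked_eq[OF that(2)] linked_eq[of r p] linked_self[of q] that(1) by auto
  then have "- linked p = (\<Union>q\<in>- linked p. linked q)" using linked_self by auto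
  then have "open (- linked p)" using linked_open by (metis open_UN)
  then have "closed (linked p)" by (simp add: open_closed)
  then show ?thesis using compact_Int_closed[OF compact_space] by simp
qed

end

context isometric_frames
begin

lemma frame_at_linked: "norm z < R / 2 \<Longrightarrow> frame_at p z \<in> linked p"
  using linked_frame[OF _ frame_at(1)] frame_at(2) linked_self by metis

lemma frame_at_continuous: "continuous_on UNIV u \<Longrightarrow> continuous_on (ball 0 (R/4)) (\<lambda>z. u (frame_at p z))"
  using frame_comp_continuous[OF _ frame_at(1), of u 0 "R/4" p] R by simp

lemma avg_cong:
  assumes "\<And>q. q \<in> linked p \<Longrightarrow> v q = w q"
  shows "avg v p = avg w p"
  unfolding avg_def
proof (rule Bochner_Integration.integral_cong[OF refl])
  fix z show "K z * v (frame_at p z) = K z * w (frame_at p z)"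
    using assms[OF frame_at_linked[of z p]] K_zero[of z] s by (cases "norm z < s") auto
qed

lemma avg_mono:
  assumes "continuous_on UNIV v" "continuous_on UNIV w" "\<And>q. q \<in> linked p \<Longrightarrow> v q \<le> w q"
  shows "avg v p \<le> avg w p"
  unfolding avg_def
  by (rule kernel_integral_mono[OF K_kernel]) (use assms frame_at_continuous frame_at_linked s in auto)

lemma avg_const: "avg (\<lambda>_. c) p = c"
  by (simp add: avg_def K_integral)

lemma avg_diff:
  assumes "continuous_on UNIV v" "continuous_on UNIV w"
  shows "avg (\<lambda>p. v p - w p) p = avg v p - avg w p"
  unfolding avg_def right_diff_distrib
  by (rule Bochner_Integration.integral_diff; rule kernel_integral(1)[OF K_kernel]; rule frame_at_continuous; rule assms)

lemma avg_sum:
  assumes "\<And>k::nat. continuous_on UNIV (v k)"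
  shows "avg (\<lambda>p. \<Sum>k<n. v k p) p = (\<Sum>k<n. avg (v k) p)"
  unfolding avg_def sum_distrib_left
  by (rule Bochner_Integration.integral_sum, rule kernel_integral(1)[OF K_kernel], rule frame_at_continuous, rule assms)

definition iter :: "nat \<Rightarrow> ('a \<Rightarrow> real) \<Rightarrow> 'a \<Rightarrow> real" where
  "iter n u = (avg ^^ n) u"

lemma iter_simps: "iter 0 u = u" "iter (Suc n) u = avg (iter n u)"
  by (simp_all add: iter_def)

lemma iter_add: "iter (m + n) u = iter m (iter n u)"
  by (simp add: iter_def funpow_add)

lemma iter_continuous: "continuous_on UNIV u \<Longrightarrow> continuous_on UNIV (iter n u)"
  by (induction n) (auto simp: iter_simps intro: avg_continuous)

lemma iter_bounds:
  assumes u: "continuous_on UNIV u" and b: "\<And>q. q \<in> linked p \<Longrightarrow> a \<le> u q \<and> u q \<le> b"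
  shows "q \<in> linked p \<Longrightarrow> a \<le> iter n u q \<and> iter n u q \<le> b"
proof (induction n arbitrary: q)
  case 0
  then show ?case using b by (simp add: iter_simps)
next
  case (Suc n)
  have eq: "linked q = linked p" by (rule linked_eq[OF Suc.prems])
  have "avg (\<lambda>_. a) q \<le> avg (iter n u) q" "avg (iter n u) q \<le> avg (\<lambda>_. b) q"
    by (rule avg_mono; use iter_continuous[OF u] Suc.IH eq in auto)+
  then show ?case by (simp add: iter_simps avg_const)
qed

lemma iter_diff_const:
  assumes "continuous_on UNIV u"
  shows "iter n (\<lambda>q. u q - a) p = iter n u p - a" "iter n (\<lambda>q. a - u q) p = a - iter n u p"
proof (induction n arbitrary: p)
  case (Suc n)
  note c = iter_continuous[OF assms, of n] continuous_on_const
  { case 1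
    have "iter n (\<lambda>q. u q - a) = (\<lambda>q. iter n u q - a)" using Suc(1) by blast
    then show ?case using avg_diff[OF c] by (simp add: iter_simps avg_const) }
  { case 2
    have "iter n (\<lambda>q. a - u q) = (\<lambda>q. a - iter n u q)" using Suc(2) by blast
    then show ?case using avg_diff[OF c(2,1)] by (simp add: iter_simps avg_const) }
qed (simp_all add: iter_simps)

text \<open>A reference functional: the unnormalised mean over a ball of a quarter of the kernel
  radius. On nonnegative functions a multiple of it is dominated by the average at every nearby
  point.\<close>

definition core :: "'a \<Rightarrow> ('a \<Rightarrow> real) \<Rightarrow> real" where
  "core p u = (\<integral>z. radial_bump (s/4) z * u (frame_at p z) \<partial>lborel)"

definition core_mass :: real where "core_mass = (\<integral>z. radial_bump (s/4) (z::'b) \<partial>lborel)"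

lemma core_kernel: "radial_kernel (radial_bump (s/4))"
  by (rule bump_kernel) (use s in auto)

lemma core_mass: "core_mass > 0"
  unfolding core_mass_def by (rule radial_bump_integral_pos) (use s in auto)

text \<open>The kernel at distance \<open>3 s / 4\<close>, the sum of the distance \<open>s / 2\<close> of a nearby point and the radius \<open>s / 4\<close> of the reference
  functional.\<close>

definition \<kappa> :: real where "\<kappa> = flat_exp 0 (s\<^sup>2 - (3 * s / 4)\<^sup>2) / mass"

lemma \<kappa>: "\<kappa> > 0"
proof -
  have "(3 * s / 4)\<^sup>2 < s\<^sup>2" using s by (intro power_strict_mono) auto
  then show ?thesis using mass by (simp add: \<kappa>_def flat_exp_def)
qed

lemma K_ge_\<kappa>:
  assumes "norm z \<le> 3 * s / 4"
  shows "\<kappa> \<le> K z"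
proof -
  have "(norm z)\<^sup>2 \<le> (3 * s / 4)\<^sup>2" using assms by (intro power_mono) auto
  moreover have "(3 * s / 4)\<^sup>2 < s\<^sup>2" using s by (intro power_strict_mono) auto
  ultimately have "flat_exp 0 (s\<^sup>2 - (3 * s / 4)\<^sup>2) \<le> flat_exp 0 (s\<^sup>2 - z \<bullet> z)"
    by (auto simp: flat_exp_def dot_square_norm intro!: le_imp_inverse_le)
  then show ?thesis using mass by (simp add: \<kappa>_def K_def radial_bump_def divide_right_mono)
qed

lemma radial_bump_le_1: "radial_bump r z \<le> 1"
  by (simp add: radial_bump_def flat_exp_def)

lemma avg_ge_core:
  assumes u: "continuous_on UNIV u" and e: "e \<in> \<E>" and x: "norm x \<le> s / 2"
    and nn: "\<And>q. q \<in> linked (e 0) \<Longrightarrow> u q \<ge> 0"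
  shows "\<kappa> * core (e 0) u \<le> avg u (e x)"
proof -
  have xR: "norm x \<le> R / 2" using x s by auto
  define F where "F z = K z * u (e (x + z))" for z
  have c: "continuous_on (ball 0 (R/4)) (\<lambda>z. u (e (x + z)))" "continuous_on (ball 0 (R/4)) (\<lambda>z. u (e (0 + z)))"
    by (rule frame_comp_continuous[OF u e]; use x s R in auto)+
  have "avg u (e x) = (\<integral>z. F z \<partial>lborel)" unfolding F_def by (rule avg_eq[OF u e xR])
  also have "\<dots> = (\<integral>y. F (- x + y) \<partial>lborel)"
    by (rule integral_lborel_shift[symmetric]) (unfold F_def, rule kernel_integral(3)[OF K_kernel c(1)])
  finally have 1: "avg u (e x) = (\<integral>y. F (- x + y) \<partial>lborel)" .
  have "core (e 0) u = (\<integral>z. radial_bump (s/4) z * u (e (0 + z)) \<partial>lborel)"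
    unfolding core_def by (rule kernel_integral_frame[OF core_kernel u e]) (use R frame_at in auto)
  then have 2: "\<kappa> * core (e 0) u = (\<integral>z. \<kappa> * (radial_bump (s/4) z * u (e z)) \<partial>lborel)" by simp
  have "(\<integral>z. \<kappa> * (radial_bump (s/4) z * u (e z)) \<partial>lborel) \<le> (\<integral>y. F (- x + y) \<partial>lborel)"
  proof (rule integral_mono)
    show "integrable lborel (\<lambda>z. \<kappa> * (radial_bump (s/4) z * u (e z)))"
      using kernel_integral(1)[OF core_kernel c(2)] by simp
    have cF: "continuous_on UNIV F"
      unfolding F_def by (rule continuous_on_kernel_mult[OF radial_kernelD(1,2)[OF K_kernel] c(1)]) (use s in auto)
    show "integrable lborel (\<lambda>y. F (- x + y))"
    proof (rule compact_support_integral(1))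
      show "continuous_on UNIV (\<lambda>y. F (- x + y))"
        by (rule continuous_on_compose2[OF cF]) (auto intro!: continuous_intros)
      show "F (- x + y) = 0" if "2 * s \<le> norm y" for y
      proof -
        have "norm (- x + y) \<ge> s" using that x norm_triangle_ineq2[of y x] s by (simp add: add.commute[of "- x"])
        then show ?thesis by (simp add: F_def K_zero)
      qed
    qed
    fix y :: 'b
    have inl: "u (e y) \<ge> 0" if "norm y < 2 * s"
      by (rule nn, rule linked_frame[OF linked_self e]) (use that s R in auto)
    show "\<kappa> * (radial_bump (s/4) y * u (e y)) \<le> F (- x + y)"
    proof (cases "norm y < s / 4")
      case True
      have "norm (- x + y) \<le> 3 * s / 4" using norm_triangle_ineq[of "- x" y] True x by simp
      then have "\<kappa> \<le> K (- x + y)" by (rule K_ge_\<kappa>)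
      moreover have "radial_bump (s/4) y * u (e y) \<le> 1 * u (e y)"
        using inl True s by (intro mult_right_mono radial_bump_le_1) auto
      ultimately have "\<kappa> * (radial_bump (s/4) y * u (e y)) \<le> K (- x + y) * u (e y)"
        using inl True s \<kappa> radial_bump_nonneg[of "s/4" y] by (intro mult_mono) auto
      then show ?thesis by (simp add: F_def)
    next
      case False
      then have "radial_bump (s/4) y = 0" using radial_bump_zero[of "s/4" y] s by simp
      moreover have "F (- x + y) \<ge> 0"
      proof (cases "norm (- x + y) < s")
        case True
        have "norm y \<le> norm (- x + y) + norm x" using norm_triangle_ineq[of "- x + y" x] by simp
        then show ?thesis using True x inl K_nonneg s by (simp add: F_def)
      qed (simp add: F_def K_zero)
      ultimately show ?thesis by simp
    qed
  qed
  then show ?thesis unfolding 1 2 .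
qed

lemma core_step:
  assumes u: "continuous_on UNIV u" and n: "near p q" and nn: "\<And>r. r \<in> linked p \<Longrightarrow> u r \<ge> 0"
  shows "(\<kappa> * core_mass) * core p u \<le> core q (avg u)"
proof -
  obtain e x where e: "e \<in> \<E>" "e 0 = p" and x: "norm x < s / 4" "q = e x" using n by (auto simp: near_def)
  have c: "continuous_on (ball 0 (R/4)) (\<lambda>z. avg u (e (x + z)))"
    by (rule frame_comp_continuous[OF avg_continuous[OF u] e(1)]) (use x s R in auto)
  have "core q (avg u) = (\<integral>z. radial_bump (s/4) z * avg u (e (x + z)) \<partial>lborel)"
    unfolding core_def by (rule kernel_integral_frame[OF core_kernel avg_continuous[OF u] e(1)]) (use x s frame_at in auto)
  moreover have "(\<integral>z. radial_bump (s/4) (z::'b) * (\<kappa> * core p u) \<partial>lborel) \<le> (\<integral>z. radial_bump (s/4) z * avg u (e (x + z)) \<partial>lborel)"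
  proof (rule integral_mono)
    show "integrable lborel (\<lambda>z. radial_bump (s/4) (z::'b) * (\<kappa> * core p u))"
      by (rule kernel_integral(1)[OF core_kernel continuous_on_const])
    show "integrable lborel (\<lambda>z. radial_bump (s/4) z * avg u (e (x + z)))"
      by (rule kernel_integral(1)[OF core_kernel c])
    fix z :: 'b
    show "radial_bump (s/4) z * (\<kappa> * core p u) \<le> radial_bump (s/4) z * avg u (e (x + z))"
    proof (cases "norm z < s / 4")
      case True
      have "norm (x + z) \<le> s / 2" using norm_triangle_ineq[of x z] True x by simp
      then have "\<kappa> * core p u \<le> avg u (e (x + z))" using avg_ge_core[OF u e(1)] nn e(2) by simp
      then show ?thesis by (intro mult_left_mono radial_bump_nonneg)
    next
      case False
      then show ?thesis using radial_bump_zero[of "s/4" z] s by simp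
    qed
  qed
  ultimately show ?thesis by (simp add: core_mass_def mult_ac)
qed

lemma bounded_on_linked:
  fixes u :: "'a \<Rightarrow> real"
  assumes "continuous_on UNIV u"
  obtains B where "\<And>w. w \<in> linked p \<Longrightarrow> \<bar>u w\<bar> \<le> B"
proof -
  have "bounded (u ` linked p)"
    by (intro compact_imp_bounded compact_continuous_image[OF continuous_on_subset[OF assms] linked_compact]) simp
  then obtain B where "\<forall>y\<in>u ` linked p. norm y \<le> B" using bounded_iff by blast
  then show thesis using that by auto
qed

text \<open>Each further average carries the reference functional at one point over to the
  nearby points, at the price of a constant factor. Since a point is near itself, the bound
  persists for all later iterates.\<close>

lemma core_spread:
  assumes "q \<in> linked p"
  shows "\<exists>n. \<forall>m\<ge>n. \<exists>\<delta>>0. \<forall>u. continuous_on UNIV u \<longrightarrow> (\<forall>r\<in>linked p. u r \<ge> 0) \<longrightarrow> \<delta> * core p u \<le> core q (iter m u)"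
proof -
  define P where "P q n \<longleftrightarrow> (\<exists>\<delta>>0. \<forall>u. continuous_on UNIV u \<longrightarrow> (\<forall>r\<in>linked p. u r \<ge> 0) \<longrightarrow> \<delta> * core p u \<le> core q (iter n u))"
    for q n
  have step: "P q' (Suc n)" if P: "P q n" and q: "q \<in> linked p" "near q q'" for q q' n
  proof -
    obtain \<delta> where \<delta>: "\<delta> > 0" "\<And>u. continuous_on UNIV u \<Longrightarrow> (\<forall>r\<in>linked p. u r \<ge> 0) \<Longrightarrow> \<delta> * core p u \<le> core q (iter n u)"
      using P by (auto simp: P_def)
    have "(\<kappa> * core_mass * \<delta>) * core p u \<le> core q' (iter (Suc n) u)"
      if u: "continuous_on UNIV u" "\<forall>r\<in>linked p. u r \<ge> 0" for u
    proof -
      have nn: "iter n u r \<ge> 0" if "r \<in> linked q" for r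
      proof -
        have r: "r \<in> linked p" using that linked_eq[OF q(1)] by simp
        obtain B where "\<And>w. w \<in> linked p \<Longrightarrow> \<bar>u w\<bar> \<le> B" using bounded_on_linked[OF u(1)] by metis
        then have "\<And>w. w \<in> linked p \<Longrightarrow> u w \<le> B" by (meson abs_le_D1)
        then show ?thesis using iter_bounds[OF u(1), of p 0 B r n] u(2) r by auto
      qed
      have "(\<kappa> * core_mass) * (\<delta> * core p u) \<le> (\<kappa> * core_mass) * core q (iter n u)"
        using \<delta>(2)[OF u] \<kappa> core_mass by (intro mult_left_mono) auto
      also have "\<dots> \<le> core q' (iter (Suc n) u)"
        unfolding iter_simps by (rule core_step[OF iter_continuous[OF u(1)] q(2) nn])
      finally show ?thesis by (simp add: mult_ac)
    qed
    then show ?thesis unfolding P_def using \<delta>(1) \<kappa> core_mass by (intro exI[of _ "\<kappa> * core_mass * \<delta>"]) auto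
  qed
  have "\<exists>n. P q n"
    using assms unfolding linked_def mem_Collect_eq
  proof (induction rule: rtranclp_induct)
    case base
    have "P p 0" unfolding P_def by (rule exI[of _ 1]) (simp add: iter_simps)
    then show ?case ..
  next
    case (step y z)
    then obtain n where "P y n" by blast
    moreover have "y \<in> linked p" using step by (simp add: linked_def)
    ultimately show ?case using \<open>\<And>q q' n. P q n \<Longrightarrow> q \<in> linked p \<Longrightarrow> near q q' \<Longrightarrow> P q' (Suc n)\<close> step by blast
  qed
  then obtain n where n: "P q n" by blast
  have "P q m" if "m \<ge> n" for m
    using that by (induction m rule: dec_induct) (auto intro: n step assms near_refl)
  then show ?thesis unfolding P_def by blast
qed

text \<open>Doeblin's condition. Finitely many small balls cover the class, and the bound for
  each of their centres holds from some number of steps on; a common number of steps serves all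
  of them.\<close>

lemma doeblin:
  obtains N \<eta> where "N > 0" "\<eta> > 0"
    "\<And>u x. continuous_on UNIV u \<Longrightarrow> (\<forall>r\<in>linked p. u r \<ge> 0) \<Longrightarrow> x \<in> linked p \<Longrightarrow> \<eta> * core p u \<le> iter N u x"
proof -
  obtain n where n: "\<And>q m. q \<in> linked p \<Longrightarrow> m \<ge> n q \<Longrightarrow> \<exists>\<delta>>0. \<forall>u. continuous_on UNIV u \<longrightarrow>
      (\<forall>r\<in>linked p. u r \<ge> 0) \<longrightarrow> \<delta> * core p u \<le> core q (iter m u)"
    using core_spread[of _ p] by metis
  define V where "V q = frame_at q ` ball 0 (s/4)" for q
  obtain Q where Q: "Q \<subseteq> linked p" "finite Q" "linked p \<subseteq> (\<Union>q\<in>Q. V q)"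
  proof (rule compactE_image[OF linked_compact, of "linked p" V])
    show "open (V q)" for q
      unfolding V_def by (rule frame_open[OF frame_at(1)]) (use s in auto)
    show "linked p \<subseteq> (\<Union>q\<in>linked p. V q)"
    proof
      fix q assume q: "q \<in> linked p"
      have "q \<in> V q" unfolding V_def using frame_at(2)[of q] s by (intro image_eqI[of _ _ 0]) auto
      then show "q \<in> (\<Union>q\<in>linked p. V q)" using q by blast
    qed
  qed (rule that)
  have "Q \<noteq> {}" using Q(3) linked_self[of p] by auto
  define m where "m = Max (n ` Q)"
  have "n q \<le> m" if "q \<in> Q" for q unfolding m_def using Q(2) that by (intro Max_ge) auto
  then have "\<forall>q\<in>Q. \<exists>\<delta>>0. \<forall>u. continuous_on UNIV u \<longrightarrow> (\<forall>r\<in>linked p. u r \<ge> 0) \<longrightarrow> \<delta> * core p u \<le> core q (iter m u)"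
    using n Q(1) by blast
  then obtain \<delta> where \<delta>: "\<And>q. q \<in> Q \<Longrightarrow> \<delta> q > 0"
    "\<And>q u. q \<in> Q \<Longrightarrow> continuous_on UNIV u \<Longrightarrow> (\<forall>r\<in>linked p. u r \<ge> 0) \<Longrightarrow> \<delta> q * core p u \<le> core q (iter m u)"
    by metis
  define \<eta> where "\<eta> = \<kappa> * Min (\<delta> ` Q)"
  have \<eta>: "\<eta> > 0" using \<kappa> Q(2) \<open>Q \<noteq> {}\<close> \<delta>(1) by (simp add: \<eta>_def)
  have "\<eta> * core p u \<le> iter (Suc m) u x"
    if u: "continuous_on UNIV u" "\<forall>r\<in>linked p. u r \<ge> 0" and x: "x \<in> linked p" for u x
  proof -
    have "x \<in> (\<Union>q\<in>Q. V q)" using Q(3) x by blast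
    then obtain q y where q: "q \<in> Q" and y: "norm y < s / 4" "x = frame_at q y" by (auto simp: V_def)
    have ql: "q \<in> linked p" using Q(1) q by blast
    obtain B where "\<And>w. w \<in> linked p \<Longrightarrow> \<bar>u w\<bar> \<le> B" using bounded_on_linked[OF u(1)] by metis
    then have B: "\<And>w. w \<in> linked p \<Longrightarrow> u w \<le> B" by (meson abs_le_D1)
    have nn: "iter m u r \<ge> 0" if "r \<in> linked (frame_at q 0)" for r
      using iter_bounds[OF u(1), of p 0 B r m] u(2) B that linked_eq[OF ql] frame_at(2)[of q] by auto
    have 1: "\<kappa> * core q (iter m u) \<le> iter (Suc m) u x"
      using avg_ge_core[OF iter_continuous[OF u(1)] frame_at(1)[of q], of y m] y nn s
      unfolding iter_simps frame_at(2) by simp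
    have "core p u \<ge> 0"
    proof -
      have "(\<integral>z. radial_bump (s/4) (z::'b) * 0 \<partial>lborel) \<le> core p u"
        unfolding core_def
        by (rule kernel_integral_mono[OF core_kernel continuous_on_const frame_at_continuous[OF u(1)]])
          (use u(2) frame_at_linked s in auto)
      then show ?thesis by simp
    qed
    then have "\<eta> * core p u \<le> \<kappa> * \<delta> q * core p u"
      unfolding \<eta>_def using Q(2) q \<kappa> by (intro mult_right_mono mult_left_mono Min_le) auto
    also have "\<dots> \<le> \<kappa> * core q (iter m u)"
      using \<delta>(2)[OF q u] \<kappa> by (simp add: mult.assoc)
    finally show ?thesis using 1 by linarith
  qed
  then show thesis by (intro that[of "Suc m" \<eta>] \<eta>) auto
qed

text \<open>If \<open>a \<le> u \<le> b\<close>, Doeblin's condition applied to \<open>u - a\<close> and to \<open>b - u\<close> raises the lower bound and reduces the upper one by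
  multiples of the reference functional that add up to a fixed fraction of \<open>b - a\<close>.\<close>

lemma contraction:
  obtains N \<theta> where "N > 0" "0 \<le> \<theta>" "\<theta> < 1"
    "\<And>u a b. continuous_on UNIV u \<Longrightarrow> (\<forall>q\<in>linked p. a \<le> u q \<and> u q \<le> b) \<Longrightarrow>
       \<exists>a' b'. b' - a' = \<theta> * (b - a) \<and> (\<forall>q\<in>linked p. a' \<le> iter N u q \<and> iter N u q \<le> b')"
proof -
  obtain N \<eta> where N: "N > 0" and \<eta>: "\<eta> > 0" and low:
    "\<And>u x. continuous_on UNIV u \<Longrightarrow> (\<forall>r\<in>linked p. u r \<ge> 0) \<Longrightarrow> x \<in> linked p \<Longrightarrow> \<eta> * core p u \<le> iter N u x"
    using doeblin by metis
  have core_diff: "core p (\<lambda>q. u q - a) = core p u - core_mass * a" "core p (\<lambda>q. a - u q) = core_mass * a - core p u"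
    if u: "continuous_on UNIV u" for u a
    unfolding core_def core_mass_def right_diff_distrib
    using kernel_integral(1)[OF core_kernel frame_at_continuous[OF u]] kernel_integral(1)[OF core_kernel continuous_on_const]
    by simp_all
  define \<theta> where "\<theta> = 1 - \<eta> * core_mass"
  have core0: "core p (\<lambda>_. 1) = core_mass" by (simp add: core_def core_mass_def)
  have "\<eta> * core p (\<lambda>_. 1) \<le> iter N (\<lambda>_. 1) p"
    by (rule low) (auto intro: linked_self)
  moreover have "iter N (\<lambda>_. 1) p \<le> 1"
    using iter_bounds[of "\<lambda>_. 1" p 1 1 p N] linked_self by simp
  ultimately have "\<theta> \<ge> 0" by (simp add: core0 \<theta>_def)
  moreover have "\<theta> < 1" using \<eta> core_mass by (simp add: \<theta>_def)
  moreover have "\<exists>a' b'. b' - a' = \<theta> * (b - a) \<and> (\<forall>q\<in>linked p. a' \<le> iter N u q \<and> iter N u q \<le> b')"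
    if u: "continuous_on UNIV u" and ab: "\<forall>q\<in>linked p. a \<le> u q \<and> u q \<le> b" for u a b
  proof (intro exI conjI ballI)
    let ?a = "a + \<eta> * (core p u - core_mass * a)" and ?b = "b - \<eta> * (core_mass * b - core p u)"
    show "?b - ?a = \<theta> * (b - a)" by (simp add: \<theta>_def algebra_simps)
    fix q assume q: "q \<in> linked p"
    have cd: "continuous_on UNIV (\<lambda>q. u q - a)" "continuous_on UNIV (\<lambda>q. b - u q)"
      by (intro continuous_on_diff u continuous_on_const)+
    show "?a \<le> iter N u q"
      using low[OF cd(1) _ q] ab by (simp add: iter_diff_const[OF u] core_diff[OF u])
    show "iter N u q \<le> ?b"
      using low[OF cd(2) _ q] ab by (simp add: iter_diff_const[OF u] core_diff[OF u])
  qed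
  ultimately show thesis using that N by blast
qed

text \<open>An average stays within the bounds of its argument, so the intervals obtained by
  contraction are bounds for all later iterates. Their lengths decrease geometrically and the
  iterates converge to a constant.\<close>

lemma decay:
  assumes u: "continuous_on UNIV u"
  obtains c B q where "0 \<le> q" "q < 1" "\<And>n x. x \<in> linked p \<Longrightarrow> \<bar>iter n u x - c\<bar> \<le> B * q ^ n"
proof -
  obtain N \<theta> where N: "N > 0" and \<theta>: "0 \<le> \<theta>" "\<theta> < 1" and con:
    "\<And>u a b. continuous_on UNIV u \<Longrightarrow> (\<forall>q\<in>linked p. a \<le> u q \<and> u q \<le> b) \<Longrightarrow>
       \<exists>a' b'. b' - a' = \<theta> * (b - a) \<and> (\<forall>q\<in>linked p. a' \<le> iter N u q \<and> iter N u q \<le> b')"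
    using contraction by metis
  obtain L where L: "\<And>w. w \<in> linked p \<Longrightarrow> \<bar>u w\<bar> \<le> L" using bounded_on_linked[OF u] by metis
  have L0: "L \<ge> 0" using L[OF linked_self] by linarith
  have "\<exists>a b. b - a = \<theta> ^ m * (2 * L) \<and> (\<forall>q\<in>linked p. a \<le> iter (m * N) u q \<and> iter (m * N) u q \<le> b)" for m
  proof (induction m)
    case 0
    have "\<forall>q\<in>linked p. - L \<le> u q \<and> u q \<le> L" using L by (auto simp: abs_le_iff) (metis minus_le_iff)
    then show ?case by (intro exI[of _ "- L"] exI[of _ L]) (simp add: iter_simps)
  next
    case (Suc m)
    then obtain a b where ab: "b - a = \<theta> ^ m * (2 * L)" "\<forall>q\<in>linked p. a \<le> iter (m * N) u q \<and> iter (m * N) u q \<le> b" by blast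
    show ?case using con[OF iter_continuous[OF u] ab(2)] ab(1) by (simp add: iter_add mult.assoc)
  qed
  then obtain a b where ab: "\<And>m. b m - a m = \<theta> ^ m * (2 * L)"
     "\<And>m q. q \<in> linked p \<Longrightarrow> a m \<le> iter (m * N) u q \<and> iter (m * N) u q \<le> b m" by metis
  have later: "a m \<le> iter n u q \<and> iter n u q \<le> b m" if "m * N \<le> n" "q \<in> linked p" for m n q
  proof -
    have "iter n u = iter (n - m * N) (iter (m * N) u)" using that(1) by (simp flip: iter_add)
    then show ?thesis using iter_bounds[OF iter_continuous[OF u] ab(2) that(2)] by simp
  qed
  \<comment> \<open>A positive rate is needed in order to divide by it; its \<open>N\<close>-th root is the rate per single step.\<close>
  define \<theta>' where "\<theta>' = max \<theta> (1/2)"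
  have \<theta>': "\<theta> \<le> \<theta>'" "0 < \<theta>'" "\<theta>' < 1" using \<theta> by (auto simp: \<theta>'_def)
  define q where "q = root N \<theta>'"
  have q: "0 < q" "q < 1" "q ^ N = \<theta>'"
    using \<theta>' N real_root_lt_1_iff[of N \<theta>'] by (auto simp: q_def)
  have rate: "\<theta> ^ (n div N) * (2 * L) \<le> (2 * L / \<theta>') * q ^ n" for n
  proof -
    have "n \<le> N * (n div N) + N"
      using N mult_div_mod_eq[of N n] mod_less_divisor[of N n] by linarith
    then have "q ^ (N * (n div N) + N) \<le> q ^ n" using q by (intro power_decreasing) auto
    then have "\<theta>' ^ (n div N) * \<theta>' \<le> q ^ n" by (simp add: power_add power_mult q(3))
    then have "\<theta>' ^ (n div N) \<le> q ^ n / \<theta>'" using \<theta>' by (simp add: field_simps)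
    moreover have "\<theta> ^ (n div N) \<le> \<theta>' ^ (n div N)" using \<theta> \<theta>' by (intro power_mono) auto
    ultimately have "\<theta> ^ (n div N) * (2 * L) \<le> q ^ n / \<theta>' * (2 * L)" using L0 by (intro mult_right_mono) auto
    then show ?thesis by (simp add: mult_ac)
  qed
  have close: "\<bar>iter n u x - iter n' u y\<bar> \<le> (2 * L / \<theta>') * q ^ n"
    if "n \<le> n'" "x \<in> linked p" "y \<in> linked p" for n n' x y
  proof -
    have le: "n div N * N \<le> n" "n div N * N \<le> n'" using that(1) div_times_less_eq_dividend[of n N] by linarith+
    have "\<bar>iter n u x - iter n' u y\<bar> \<le> b (n div N) - a (n div N)"
      using later[OF le(1) that(2)] later[OF le(2) that(3)] by linarith
    then show ?thesis using rate[of n] ab(1)[of "n div N"] by linarith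
  qed
  have q0: "(\<lambda>n. (2 * L / \<theta>') * q ^ n) \<longlonglongrightarrow> 0"
    by (rule tendsto_mult_right_zero[OF LIMSEQ_power_zero]) (use q in simp)
  have "Cauchy (\<lambda>n. iter n u p)"
  proof (rule metric_CauchyI)
    fix e :: real assume "e > 0"
    then obtain M where M: "\<And>n. n \<ge> M \<Longrightarrow> \<bar>(2 * L / \<theta>') * q ^ n\<bar> < e"
      using LIMSEQ_D[OF q0] by (metis real_norm_def diff_zero)
    have lt: "(2 * L / \<theta>') * q ^ m < e" if "m \<ge> M" for m
      using M[OF that] abs_ge_self[of "(2 * L / \<theta>') * q ^ m"] by linarith
    have "dist (iter m u p) (iter n u p) < e" if "m \<ge> M" "n \<ge> M" for m n
    proof (cases "m \<le> n")
      case True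
      show ?thesis unfolding dist_real_def
        using close[OF True linked_self linked_self] lt[OF that(1)] by linarith
    next
      case False
      then have "n \<le> m" by simp
      show ?thesis unfolding dist_real_def
        using close[OF \<open>n \<le> m\<close> linked_self linked_self] lt[OF that(2)] by linarith
    qed
    then show "\<exists>M. \<forall>m\<ge>M. \<forall>n\<ge>M. dist (iter m u p) (iter n u p) < e" by blast
  qed
  then obtain c where c: "(\<lambda>n. iter n u p) \<longlonglongrightarrow> c" using Cauchy_convergent_iff convergent_def by blast
  have "\<bar>iter n u x - c\<bar> \<le> (2 * L / \<theta>') * q ^ n" if "x \<in> linked p" for n x
  proof (rule LIMSEQ_le_const2)
    show "(\<lambda>n'. \<bar>iter n u x - iter n' u p\<bar>) \<longlonglongrightarrow> \<bar>iter n u x - c\<bar>"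
      by (intro tendsto_rabs tendsto_diff tendsto_const c)
    show "\<exists>M. \<forall>n'\<ge>M. \<bar>iter n u x - iter n' u p\<bar> \<le> (2 * L / \<theta>') * q ^ n"
      using close[OF _ that linked_self] by blast
  qed
  then show thesis using that[of q c "2 * L / \<theta>'"] q by auto
qed

text \<open>The analogue of Poisson's equation, with the averaging operator in place of the heat
  operator. The constant \<open>c\<close> on each class is the limit of the iterated averages of
  \<open>u\<close>, and \<open>w\<close> is the Neumann series \<open>\<Sum>n. avg\<^sup>n u - c\<close>, which converges by the geometric decay.\<close>

theorem poisson:
  assumes u: "continuous_on UNIV u"
  obtains w c where "continuous_on UNIV w" "\<And>p. w p = u p - c p + avg w p" "\<And>p q. q \<in> linked p \<Longrightarrow> c q = c p"
proof -
  define c where "c p = lim (\<lambda>n. iter n u p)" for p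
  have "\<exists>B q. 0 \<le> q \<and> q < 1 \<and> (\<forall>n. \<forall>x\<in>linked p. \<bar>iter n u x - c p\<bar> \<le> B * q ^ n) \<and> (\<forall>x\<in>linked p. c x = c p)" for p
  proof -
    obtain d B q where d: "0 \<le> q" "q < 1" "\<And>n x. x \<in> linked p \<Longrightarrow> \<bar>iter n u x - d\<bar> \<le> B * q ^ n"
      using decay[OF u] by metis
    have "c x = d" if "x \<in> linked p" for x
    proof -
      have "(\<lambda>n. B * q ^ n) \<longlonglongrightarrow> 0" using tendsto_mult_right_zero[OF LIMSEQ_power_zero[of q]] d by simp
      then have "(\<lambda>n. iter n u x - d) \<longlonglongrightarrow> 0"
        by (rule Lim_null_comparison[rotated]) (use d(3)[OF that] in simp)
      then show ?thesis unfolding c_def using LIM_zero_iff limI by blast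
    qed
    then show ?thesis using d linked_self[of p] by (intro exI[of _ B] exI[of _ q]) auto
  qed
  then obtain B q where q: "\<And>p. 0 \<le> q p" "\<And>p. q p < 1"
    and b: "\<And>p n x. x \<in> linked p \<Longrightarrow> \<bar>iter n u x - c p\<bar> \<le> B p * q p ^ n" and cc: "\<And>p x. x \<in> linked p \<Longrightarrow> c x = c p" by metis
  define f where "f n p = iter n u p - c p" for n p
  have contc: "continuous_on UNIV c"
    unfolding continuous_on_eq_continuous_at[OF open_UNIV]
  proof
    fix p
    have "continuous_on (linked p) c" by (rule continuous_on_eq[of _ "\<lambda>_. c p"]) (auto simp: cc)
    then show "continuous (at p) c" using linked_open linked_self continuous_on_eq_continuous_at by blast
  qed
  have contf: "continuous_on UNIV (f n)" for n
    unfolding f_def by (intro continuous_on_diff iter_continuous u contc)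
  define w where "w p = (\<Sum>n. f n p)" for p
  have lim: "uniform_limit (linked p) (\<lambda>n x. \<Sum>k<n. f k x) w sequentially" for p
    unfolding w_def
  proof (rule Weierstrass_m_test)
    show "norm (f n x) \<le> B p * q p ^ n" if "x \<in> linked p" for n x
      using b[OF that, of n] cc[OF that] by (simp add: f_def)
    show "summable (\<lambda>n. B p * q p ^ n)" using q[of p] by (intro summable_mult summable_geometric) auto
  qed
  have contS: "continuous_on UNIV (\<lambda>x. \<Sum>k<n. f k x)" for n by (intro continuous_on_sum contf)
  have contw: "continuous_on UNIV w"
    unfolding continuous_on_eq_continuous_at[OF open_UNIV]
  proof
    fix p
    have "continuous_on (linked p) w"
      by (rule uniform_limit_theorem[OF _ lim]) (auto intro!: always_eventually continuous_on_subset[OF contS])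
    then show "continuous (at p) w" using linked_open linked_self continuous_on_eq_continuous_at by blast
  qed
  have "w p = u p - c p + avg w p" for p
  proof -
    have "avg c p = c p" using avg_cong[of p c "\<lambda>_. c p"] cc avg_const by simp
    then have af: "avg (f k) p = f (Suc k) p" for k
      unfolding f_def using avg_diff[OF iter_continuous[OF u] contc] by (simp add: iter_simps)
    have aS: "avg (\<lambda>x. \<Sum>k<n. f k x) p = (\<Sum>k<Suc n. f k p) - f 0 p" for n
      unfolding avg_sum[OF contf] af by (subst sum.lessThan_Suc_shift) simp
    have "(\<lambda>n. avg (\<lambda>x. \<Sum>k<n. f k x) p) \<longlonglongrightarrow> avg w p"
    proof (rule tendstoI)
      fix e :: real assume e: "e > 0"
      have "\<forall>\<^sub>F n in sequentially. \<forall>x\<in>linked p. dist (\<Sum>k<n. f k x) (w x) < e / 2"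
        using lim[of p] half_gt_zero[OF e] unfolding uniform_limit_iff by blast
      then show "\<forall>\<^sub>F n in sequentially. dist (avg (\<lambda>x. \<Sum>k<n. f k x) p) (avg w p) < e"
      proof eventually_elim
        case (elim n)
        let ?S = "\<lambda>x. \<Sum>k<n. f k x"
        have cd: "continuous_on UNIV (\<lambda>x. ?S x - w x)" by (intro continuous_on_diff contS contw)
        have sw: "?S x - w x \<le> e/2" "- (e/2) \<le> ?S x - w x" if "x \<in> linked p" for x
          using bspec[OF elim that] unfolding dist_real_def by linarith+
        have "avg (\<lambda>x. ?S x - w x) p \<le> avg (\<lambda>_. e/2) p" "avg (\<lambda>_. - (e/2)) p \<le> avg (\<lambda>x. ?S x - w x) p"
          by (rule avg_mono[OF cd continuous_on_const sw(1)], assumption,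
            rule avg_mono[OF continuous_on_const cd sw(2)], assumption)
        then have "\<bar>avg ?S p - avg w p\<bar> \<le> e/2" using avg_diff[OF contS[of n] contw, of p] unfolding avg_const by linarith
        then show ?case using e by (simp add: dist_real_def)
      qed
    qed
    moreover have "(\<lambda>n. (\<Sum>k<Suc n. f k p) - f 0 p) \<longlonglongrightarrow> w p - f 0 p"
      by (intro tendsto_diff tendsto_const LIMSEQ_Suc[OF tendsto_uniform_limitI[OF lim linked_self]])
    ultimately have "avg w p = w p - f 0 p" unfolding aS by (rule LIMSEQ_unique)
    then show ?thesis by (simp add: f_def iter_simps)
  qed
  then show thesis using that[OF contw] cc by blast
qed

end

section \<open>Local potentials of a Hessian metric\<close>

context flat_riemannian
begin

text \<open>The symmetry of \<open>D g\<close> says that the one-forms \<open>g(\<cdot>, b)\<close> are closed. They are the differentials of the components of a map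
  \<open>\<Theta>\<close>, whose derivative \<open>g\<close> is symmetric, so that
  \<open>\<Theta>\<close> is in turn a gradient.\<close>

lemma hessian_potential:
  assumes g: "hessian_metric A D g" and e: "flat_param \<rho> e"
  obtains \<phi> where "smooth_on (ball 0 \<rho>) \<phi>"
    "\<And>x u v. x \<in> ball 0 \<rho> \<Longrightarrow> dir_deriv u (dir_deriv v \<phi>) x = g (e x) (dvec e x u) (dvec e x v)"
proof -
  note L = flat_paramD[OF e]
  have T: "tensor2 A g" and gsym: "\<And>p v w. v \<in> tangent_space A p \<Longrightarrow> w \<in> tangent_space A p \<Longrightarrow> g p v w = g p w v"
    using g by (auto simp: hessian_metric_def riemannian_metric_def)
  define G where "G x a b = g (e x) (dvec e x a) (dvec e x b)" for x a b
  have smG: "smooth_on (ball 0 \<rho>) (\<lambda>x. G x a b)" for a b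
    unfolding G_def by (rule tensor2_component_smooth[OF T L(1)])
  have Gsym: "G x a b = G x b a" if "x \<in> ball 0 \<rho>" for x a b
    unfolding G_def by (rule gsym; rule dvec_tangent[OF L(1) that])
  have closed: "dir_deriv u (\<lambda>x. G x v b) x = dir_deriv v (\<lambda>x. G x u b) x" if x: "x \<in> ball 0 \<rho>" for u v b x
  proof -
    obtain E where E: "\<And>a. E a \<in> vector_fields A"
      "\<And>v a b. cov_deriv2 D g (E v) (E a) (E b) (e x) = dir_deriv v (\<lambda>z. g (e z) (dvec e z a) (dvec e z b)) x"
      by (rule flat_cov_deriv2[OF T L(1,2) x]) (rule that, auto)
    have "cov_deriv2 D g (E u) (E v) (E b) (e x) = cov_deriv2 D g (E v) (E u) (E b) (e x)"
      using g E(1) unfolding hessian_metric_def by blast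
    then show ?thesis unfolding E(2) G_def .
  qed
  define \<theta> where "\<theta> b x = (\<Sum>a\<in>Basis. G x a b *\<^sub>R a)" for b x
  have \<theta>: "\<theta> b x \<bullet> v = G x v b" if x: "x \<in> ball 0 \<rho>" for b x v
    using linear_basis_expansion[OF tensor2_component_linear(1)[OF T L(1) x, of b], of v]
    by (simp add: \<theta>_def G_def inner_sum_left) (simp add: inner_commute mult.commute)
  have sm\<theta>: "smooth_on (ball 0 \<rho>) (\<theta> b)" for b
    unfolding \<theta>_def by (intro smooth_on_sum smooth_on_scaleR smooth_on_const smG open_ball)
  have d_inner: "dir_deriv u F x \<bullet> v = dir_deriv u f x"
    if F: "smooth_on (ball 0 \<rho>) F" and eq: "\<And>x. x \<in> ball 0 \<rho> \<Longrightarrow> F x \<bullet> v = f x" and x: "x \<in> ball 0 \<rho>" for F :: "'b \<Rightarrow> 'b" and f u v x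
  proof -
    have "((\<lambda>x. F x \<bullet> v) has_derivative (\<lambda>u. dir_deriv u F x \<bullet> v)) (at x)"
      by (rule has_derivative_inner_left[OF smooth_on_has_derivative[OF F x]])
    then have "(f has_derivative (\<lambda>u. dir_deriv u F x \<bullet> v)) (at x)"
      by (rule has_derivative_transform_within_open[OF _ open_ball x]) (rule eq)
    from dir_deriv_eq[OF this] show ?thesis by simp
  qed
  have "\<exists>f. smooth_on (ball 0 \<rho>) f \<and> (\<forall>x\<in>ball 0 \<rho>. (f has_derivative (\<lambda>v. \<theta> b x \<bullet> v)) (at x))" for b
  proof -
    have "dir_deriv u (\<theta> b) x \<bullet> v = dir_deriv v (\<theta> b) x \<bullet> u" if x: "x \<in> ball 0 \<rho>" for x u v
      using d_inner[OF sm\<theta> \<theta> x, of b u v] d_inner[OF sm\<theta> \<theta> x, of b v u] closed[OF x, where u = u and v = v and b = b] by simp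
    from poincare_lemma[OF sm\<theta> this] show ?thesis by metis
  qed
  then obtain f :: "'b \<Rightarrow> 'b \<Rightarrow> real" where f: "\<And>b. smooth_on (ball 0 \<rho>) (f b)"
    "\<And>b x. x \<in> ball 0 \<rho> \<Longrightarrow> (f b has_derivative (\<lambda>v. \<theta> b x \<bullet> v)) (at x)" by metis
  define \<Theta> where "\<Theta> x = (\<Sum>b\<in>Basis. f b x *\<^sub>R b)" for x
  have sm\<Theta>: "smooth_on (ball 0 \<rho>) \<Theta>"
    unfolding \<Theta>_def by (intro smooth_on_sum smooth_on_scaleR smooth_on_const f(1) open_ball)
  have d\<Theta>: "dir_deriv u \<Theta> x \<bullet> v = G x u v" if x: "x \<in> ball 0 \<rho>" for u v x
  proof -
    have "(\<Theta> has_derivative (\<lambda>u. \<Sum>b\<in>Basis. (\<theta> b x \<bullet> u) *\<^sub>R b)) (at x)"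
      unfolding \<Theta>_def by (intro has_derivative_sum has_derivative_scaleR_left f(2) x)
    from dir_deriv_eq[OF this] have "dir_deriv u \<Theta> x \<bullet> v = (\<Sum>b\<in>Basis. (v \<bullet> b) * G x u b)"
      by (simp add: \<theta>[OF x] inner_sum_left) (simp add: inner_commute mult.commute)
    also have "\<dots> = G x u v"
      using linear_basis_expansion[OF tensor2_component_linear(2)[OF T L(1) x, of u], of v] by (simp add: G_def)
    finally show ?thesis .
  qed
  obtain \<phi> :: "'b \<Rightarrow> real" where \<phi>: "smooth_on (ball 0 \<rho>) \<phi>"
    "\<And>x. x \<in> ball 0 \<rho> \<Longrightarrow> (\<phi> has_derivative (\<lambda>v. \<Theta> x \<bullet> v)) (at x)"
  proof (rule poincare_lemma[OF sm\<Theta>])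
    show "dir_deriv u \<Theta> x \<bullet> v = dir_deriv v \<Theta> x \<bullet> u" if "x \<in> ball 0 \<rho>" for x u v
      unfolding d\<Theta>[OF that] by (rule Gsym[OF that])
  qed (rule that)
  have "dir_deriv u (dir_deriv v \<phi>) x = g (e x) (dvec e x u) (dvec e x v)" if x: "x \<in> ball 0 \<rho>" for x u v
  proof -
    have "\<Theta> y \<bullet> v = dir_deriv v \<phi> y" if "y \<in> ball 0 \<rho>" for y
      using dir_deriv_eq[OF \<phi>(2)[OF that], of v] by simp
    from d_inner[OF sm\<Theta> this x] d\<Theta>[OF x, of u v] show ?thesis by (simp add: G_def)
  qed
  with \<phi>(1) show thesis by (rule that)
qed

end

section \<open>The maximum principle\<close>

text \<open>The rotation is removed from the two arguments separately; in each of them it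
  preserves the norm of a linear form.\<close>

lemma frobenius_orthogonal_invariant:
  fixes B :: "'b::euclidean_space \<Rightarrow> 'b \<Rightarrow> real" and T :: "'b \<Rightarrow> 'b"
  assumes B: "\<And>u. linear (B u)" "\<And>v. linear (\<lambda>u. B u v)" and T: "orthogonal_transformation T"
  shows "(\<Sum>a\<in>Basis. \<Sum>b\<in>Basis. (B (T a) (T b))\<^sup>2) = (\<Sum>a\<in>Basis. \<Sum>b\<in>Basis. (B a b)\<^sup>2)"
proof -
  have lT: "linear T" using T by (rule orthogonal_transformation_linear)
  have one: "(\<Sum>b\<in>Basis. (F (T b))\<^sup>2) = (\<Sum>b\<in>Basis. (F b)\<^sup>2)" if F: "linear F" for F :: "'b \<Rightarrow> real"
  proof -
    define y where "y = adjoint F 1"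
    have F': "F x = x \<bullet> y" for x using adjoint_works[OF F, of x 1] by (simp add: y_def)
    have "\<exists>z. T z = y" using orthogonal_transformation_surj[OF T] by (metis surjD)
    then obtain z where z: "T z = y" by blast
    have "(\<Sum>b\<in>Basis. (F (T b))\<^sup>2) = (\<Sum>b\<in>Basis. (z \<bullet> b)\<^sup>2)"
      using T z by (auto simp: F' orthogonal_transformation_def inner_commute intro!: sum.cong)
    also have "\<dots> = (norm z)\<^sup>2" by (simp add: norm_eq_sqrt_inner euclidean_inner[of z z] power2_eq_square sum_nonneg)
    also have "\<dots> = (norm y)\<^sup>2" using orthogonal_transformation_norm[OF T, of z] z by simp
    also have "\<dots> = (\<Sum>b\<in>Basis. (F b)\<^sup>2)" by (simp add: F' norm_eq_sqrt_inner euclidean_inner[of y y] power2_eq_square sum_nonneg inner_commute)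
    finally show ?thesis .
  qed
  have "(\<Sum>a\<in>Basis. \<Sum>b\<in>Basis. (B (T a) (T b))\<^sup>2) = (\<Sum>a\<in>Basis. \<Sum>b\<in>Basis. (B (T a) b)\<^sup>2)"
    by (intro sum.cong refl one B(1))
  also have "\<dots> = (\<Sum>b\<in>Basis. \<Sum>a\<in>Basis. (B (T a) b)\<^sup>2)" by (rule sum.swap)
  also have "\<dots> = (\<Sum>b\<in>Basis. \<Sum>a\<in>Basis. (B a b)\<^sup>2)" by (intro sum.cong refl one B(2))
  also have "\<dots> = (\<Sum>a\<in>Basis. \<Sum>b\<in>Basis. (B a b)\<^sup>2)" by (rule sum.swap)
  finally show ?thesis .
qed

text \<open>The symmetric second difference is nonnegative at a minimum, and it is a second
  derivative at a nearby point.\<close>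

lemma second_derivative_at_minimum:
  fixes f :: "'b::euclidean_space \<Rightarrow> real"
  assumes sm: "smooth_on (ball 0 r) f" and r: "r > 0" and min: "\<And>x. x \<in> ball 0 r \<Longrightarrow> f 0 \<le> f x"
  shows "dir_deriv u (dir_deriv u f) 0 \<ge> 0"
proof (rule ccontr)
  let ?g = "dir_deriv u (dir_deriv u f)"
  assume "\<not> ?thesis"
  then have neg: "?g 0 < 0" by simp
  have "continuous (at 0) ?g"
    using smooth_on_continuous_on[OF smooth_on_dir_deriv[OF smooth_on_dir_deriv[OF sm]]] r
    by (simp add: continuous_on_eq_continuous_at)
  then obtain d where d: "d > 0" "\<And>y. dist y 0 < d \<Longrightarrow> dist (?g y) (?g 0) < - ?g 0"
    unfolding continuous_at_eps_delta using neg by (metis neg_0_less_iff_less)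
  define m where "m = min r d"
  have m: "m > 0" using r d by (simp add: m_def)
  define t where "t = m / (8 * (norm u + 1))"
  have pos: "norm u + 1 > 0" by (simp add: add_nonneg_pos)
  have t: "t > 0" using m pos by (simp add: t_def)
  have tu: "t * norm u < m / 8"
  proof -
    have "t * norm u < t * (norm u + 1)" using t by simp
    also have "\<dots> = m / 8" using pos by (simp add: t_def field_simps)
    finally show ?thesis .
  qed
  have nt: "norm (t *\<^sub>R u) < m / 8" using tu t by simp
  have sub: "ball (- t *\<^sub>R u) (m / 2) \<subseteq> ball 0 r"
  proof
    fix y assume "y \<in> ball (- t *\<^sub>R u) (m / 2)"
    then have "norm (y + t *\<^sub>R u) < m / 2" by (simp add: dist_norm norm_minus_commute add.commute)
    then show "y \<in> ball 0 r" using norm_triangle_ineq4[of "y + t *\<^sub>R u" "t *\<^sub>R u"] nt m by (simp add: m_def)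
  qed
  obtain y where y: "norm (y - (- t *\<^sub>R u)) \<le> t * (norm u + norm u)"
    "f (- t *\<^sub>R u + t *\<^sub>R u + t *\<^sub>R u) - f (- t *\<^sub>R u + t *\<^sub>R u) - f (- t *\<^sub>R u + t *\<^sub>R u) + f (- t *\<^sub>R u) = t * t * ?g y"
    by (rule second_difference_mean_value[OF smooth_on_subset[OF sm sub] t, of u u]) (use tu m in \<open>auto simp: algebra_simps\<close>)
  have "norm y < m"
    using y(1) tu nt m norm_triangle_ineq4[of "y - (- t *\<^sub>R u)" "t *\<^sub>R u"] by (simp add: algebra_simps)
  then have "?g y < 0" using d(2)[of y] by (simp add: m_def dist_real_def abs_if split: if_splits)
  then have "t * t * ?g y < 0" using t by (simp add: mult_pos_neg)
  moreover have "f (t *\<^sub>R u) \<ge> f 0" "f (- t *\<^sub>R u) \<ge> f 0"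
    using nt m by (auto intro!: min simp: m_def)
  ultimately show False using y(2) by simp
qed

section \<open>The decomposition\<close>

locale compact_hessian = flat_riemannian A D h
  for A :: "('a::{t2_space,second_countable_topology}, 'b::euclidean_space) atlas" and D :: "'a conn" and h :: "'a form2" +
  fixes g :: "'a form2"
  assumes compact_manifold: "compact (UNIV :: 'a set)" and hessian: "hessian_metric A D g"
begin

definition flat_radius :: real where
  "flat_radius = (SOME R. R > 0 \<and> (\<forall>p. \<exists>e. flat_param R e \<and> e 0 = p))"

lemma flat_radius: "flat_radius > 0" "\<exists>e. flat_param flat_radius e \<and> e 0 = p"
proof -
  have "\<exists>R. R > 0 \<and> (\<forall>p. \<exists>e. flat_param R e \<and> e 0 = p)"
    using uniform_flat_param[OF compact_manifold] by metis
  from someI_ex[OF this] show "flat_radius > 0" "\<exists>e. flat_param flat_radius e \<and> e 0 = p"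
    by (auto simp: flat_radius_def)
qed

sublocale frames: isometric_frames flat_radius "Collect (flat_param flat_radius)"
proof (unfold_locales, unfold mem_Collect_eq)
  show "flat_radius > 0" by (rule flat_radius(1))
  show "\<exists>e\<in>Collect (flat_param flat_radius). e 0 = p" for p using flat_radius(2)[of p] by blast
  show "compact (UNIV :: 'a set)" by (rule compact_manifold)
  fix e assume e: "flat_param flat_radius e"
  show "continuous_on (ball 0 flat_radius) e" by (rule local_paramD(3)[OF flat_paramD(1)[OF e]])
  show "open (e ` S)" if "open S" "S \<subseteq> ball 0 flat_radius" for S
    by (rule local_paramD(4)[OF flat_paramD(1)[OF e] that])
  fix x e' assume "norm x \<le> flat_radius / 2" "flat_param flat_radius e'" "e' 0 = e x"
  from flat_transition_recentred[OF e this]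
  show "\<exists>T. orthogonal_transformation T \<and> (\<forall>z\<in>ball 0 (flat_radius / 2). e' z = e (x + T z))" by metis
qed

abbreviation "R \<equiv> flat_radius"
abbreviation "s \<equiv> frames.s"
abbreviation "K \<equiv> frames.K"

lemma frame_flat: "flat_param R (frames.frame_at p)" "frames.frame_at p 0 = p"
  using frames.frame_at[of p] by auto

text \<open>A Hessian potential in the given parameters. It is determined up to an affine
  function.\<close>

definition potential :: "('b \<Rightarrow> 'a) \<Rightarrow> 'b \<Rightarrow> real" where
  "potential e = (SOME \<phi>. smooth_on (ball 0 R) \<phi> \<and>
     (\<forall>x\<in>ball 0 R. \<forall>u v. dir_deriv u (dir_deriv v \<phi>) x = g (e x) (dvec e x u) (dvec e x v)))"

lemma potential:
  assumes "flat_param R e"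
  shows "smooth_on (ball 0 R) (potential e)"
    "x \<in> ball 0 R \<Longrightarrow> dir_deriv u (dir_deriv v (potential e)) x = g (e x) (dvec e x u) (dvec e x v)"
proof -
  have "\<exists>\<phi>. smooth_on (ball 0 R) \<phi> \<and>
     (\<forall>x\<in>ball 0 R. \<forall>u v. dir_deriv u (dir_deriv v \<phi>) x = g (e x) (dvec e x u) (dvec e x v))"
    using hessian_potential[OF hessian assms] by metis
  from someI_ex[OF this]
  show "smooth_on (ball 0 R) (potential e)"
    "x \<in> ball 0 R \<Longrightarrow> dir_deriv u (dir_deriv v (potential e)) x = g (e x) (dvec e x u) (dvec e x v)"
    by (auto simp: potential_def)
qed

definition local_mean :: "('b \<Rightarrow> real) \<Rightarrow> 'b \<Rightarrow> real" where
  "local_mean f x = (\<integral>z. K z * f (x + z) \<partial>lborel)"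

lemma half_ball: "x \<in> ball 0 (R/2) \<Longrightarrow> norm z \<le> R / 4 \<Longrightarrow> x + z \<in> ball 0 R" for x z :: 'b
  using norm_triangle_ineq[of x z] flat_radius(1) by auto

lemma shifted_continuous:
  fixes f :: "'b \<Rightarrow> real"
  assumes "continuous_on (ball 0 R) f" "x \<in> ball 0 (R/2)"
  shows "continuous_on (ball 0 (R/4)) (\<lambda>z. f (x + z))"
proof (rule continuous_on_compose2[OF assms(1)])
  show "(+) x ` ball 0 (R/4) \<subseteq> ball 0 R" using half_ball[OF assms(2)] by (auto simp del: image_add_ball)
qed (auto intro!: continuous_intros)

lemma local_mean_integral:
  assumes "continuous_on (ball 0 R) f" "x \<in> ball 0 (R/2)"
  shows "local_mean f x = integral (cube s) (\<lambda>z. K z *\<^sub>R f (1 *\<^sub>R x + z))"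
  using frames.kernel_integral(2)[OF frames.K_kernel shifted_continuous[OF assms]] by (simp add: local_mean_def)

lemma cube_in_ball: "x \<in> ball 0 (R/2) \<Longrightarrow> z \<in> cube s \<Longrightarrow> 1 *\<^sub>R x + z \<in> ball 0 R" for x z :: 'b
  using half_ball[of x z] frames.cube_norm[of z] flat_radius(1) by auto

lemma K_cube_continuous: "continuous_on (cube s) K"
  by (rule continuous_on_subset[OF frames.K_continuous]) simp

lemma local_mean_smooth:
  assumes f: "smooth_on (ball 0 R) f"
  shows "smooth_on (ball 0 (R/2)) (local_mean f)"
proof (rule smooth_on_cong[OF open_ball])
  show "smooth_on (ball 0 (R/2)) (\<lambda>x. integral (cube s) (\<lambda>z. K z *\<^sub>R f (1 *\<^sub>R x + z)))"
    unfolding cube_def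
    by (rule affine_integral_smooth_on[OF _ _ _ open_ball convex_ball _ open_ball f])
      (use cube_in_ball K_cube_continuous in \<open>auto simp: cube_def intro: continuous_on_id\<close>)
  show "integral (cube s) (\<lambda>z. K z *\<^sub>R f (1 *\<^sub>R x + z)) = local_mean f x" if "x \<in> ball 0 (R/2)" for x
    using local_mean_integral[OF smooth_on_continuous_on[OF f] that] by simp
qed

lemma local_mean_dir_deriv:
  assumes f: "smooth_on (ball 0 R) f" and x: "x \<in> ball 0 (R/2)"
  shows "dir_deriv v (local_mean f) x = local_mean (dir_deriv v f) x"
proof -
  have f1: "Ck_on (Suc 0) f (ball 0 R)" using f by (simp only: smooth_on_def)
  have "((\<lambda>x. integral (cube s) (\<lambda>z. K z *\<^sub>R f (1 *\<^sub>R x + z))) has_derivative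
     (\<lambda>v. integral (cube s) (\<lambda>z. (K z * 1) *\<^sub>R dir_deriv v f (1 *\<^sub>R x + z)))) (at x)"
    unfolding cube_def
    by (rule affine_integral_has_derivative[OF _ _ _ open_ball convex_ball _ open_ball f1 x])
      (use cube_in_ball K_cube_continuous in \<open>auto simp: cube_def intro: continuous_on_id\<close>)
  then have "(local_mean f has_derivative
     (\<lambda>v. integral (cube s) (\<lambda>z. (K z * 1) *\<^sub>R dir_deriv v f (1 *\<^sub>R x + z)))) (at x)"
    by (rule has_derivative_transform_within_open[OF _ open_ball x])
      (simp add: local_mean_integral[OF smooth_on_continuous_on[OF f]])
  from dir_deriv_eq[OF this] show ?thesis
    using local_mean_integral[OF smooth_on_continuous_on[OF smooth_on_dir_deriv[OF f]] x] by simp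
qed

text \<open>A radial kernel is even, so linear functions have mean zero.\<close>

lemma mean_of_affine:
  fixes f :: "'b \<Rightarrow> real"
  assumes f: "linear f"
  shows "(\<integral>z. K z * (c + f z) \<partial>lborel) = c"
proof -
  have cf: "continuous_on (ball 0 (R/4)) f"
    using f by (simp add: linear_continuous_on linear_conv_bounded_linear)
  note i = frames.kernel_integral(1)[OF frames.K_kernel cf] frames.kernel_integral(1)[OF frames.K_kernel continuous_on_const]
  have "orthogonal_transformation (\<lambda>z::'b. - z)"
    by (simp add: orthogonal_transformation_def linear_uminus)
  from frames.kernel_integral_rotate[OF frames.K_kernel cf this]
  have "(\<integral>z. K z * f z \<partial>lborel) = 0" by (simp add: linear_neg[OF f])
  then show ?thesis using i by (simp add: distrib_left frames.K_integral)
qed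

text \<open>Affine functions equal their means, so the difference between the mean of a local
  potential and the potential does not depend on the potential. Its Hessian is the averaged
  metric minus \<open>g\<close>.\<close>

definition source :: "'a \<Rightarrow> real" where
  "source p = local_mean (potential (frames.frame_at p)) 0 - potential (frames.frame_at p) 0"

lemma dvec_transition:
  assumes e: "flat_param R e" and x: "x \<in> ball 0 (R/2)" and e': "flat_param R e'"
    and T: "orthogonal_transformation T" "\<forall>z\<in>ball 0 (R/2). e' z = e (x + T z)" and z: "z \<in> ball 0 (R/2)"
  shows "dvec e' z u = dvec e (x + T z) (T u)"
proof
  fix f
  show "dvec e' z u f = dvec e (x + T z) (T u) f"
  proof (cases "smooth_fun A f")
    case True
    have lT: "linear T" using T(1) by (rule orthogonal_transformation_linear)
    have inb: "x + T z \<in> ball 0 R"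
      using norm_triangle_ineq[of x "T z"] x z orthogonal_transformation_norm[OF T(1), of z] by simp
    have "((\<lambda>z. x + T z) has_derivative (\<lambda>u. 0 + T u)) (at z)"
      using lT by (intro has_derivative_add has_derivative_const bounded_linear_imp_has_derivative) (simp add: linear_conv_bounded_linear)
    from has_derivative_compose[OF this smooth_on_has_derivative[OF local_paramD(5)[OF flat_paramD(1)[OF e] True] inb]]
    have "((\<lambda>z. f (e (x + T z))) has_derivative (\<lambda>u. dir_deriv (T u) (\<lambda>z. f (e z)) (x + T z))) (at z)" by simp
    then have "((\<lambda>z. f (e' z)) has_derivative (\<lambda>u. dir_deriv (T u) (\<lambda>z. f (e z)) (x + T z))) (at z)"
      by (rule has_derivative_transform_within_open[OF _ open_ball z]) (use T(2) in simp)
    from dir_deriv_eq[OF this] show ?thesis using True by (simp add: dvec_def)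
  qed (simp add: dvec_def)
qed

text \<open>The potentials in two parametrisations have the same Hessian and hence differ by an
  affine function, which contributes nothing.\<close>

lemma source_eq:
  assumes e: "flat_param R e" and x: "x \<in> ball 0 (R/2)"
  shows "source (e x) = local_mean (potential e) x - potential e x"
proof -
  define e' where "e' = frames.frame_at (e x)"
  have e': "flat_param R e'" "e' 0 = e x" using frame_flat by (auto simp: e'_def)
  have xle: "norm x \<le> R/2" using x by simp
  obtain T where T: "orthogonal_transformation T" "\<And>z. z \<in> ball 0 (R/2) \<Longrightarrow> e' z = e (x + T z)"
    by (rule flat_transition_recentred[OF e xle e']) (rule that)
  have T': "\<forall>z\<in>ball 0 (R/2). e' z = e (x + T z)" using T(2) by blast
  have lT: "linear T" using T(1) by (rule orthogonal_transformation_linear)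
  have inb: "x + T z \<in> ball 0 R" if "z \<in> ball 0 (R/2)" for z
    using norm_triangle_ineq[of x "T z"] x that orthogonal_transformation_norm[OF T(1), of z] by simp
  note P = potential[OF e] and P' = potential[OF e'(1)]
  have R0: "R > 0" by (rule flat_radius(1))
  have smT: "smooth_on (ball 0 (R/2)) (\<lambda>z. f (x + T z))"
    if f: "smooth_on (ball 0 R) f" for f :: "'b \<Rightarrow> real"
    by (rule smooth_on_compose[OF open_ball open_ball _ f])
      (use inb lT in \<open>auto intro!: smooth_on_add[OF _ smooth_on_const smooth_on_linear] simp: linear_conv_bounded_linear\<close>)
  have dT: "dir_deriv u (\<lambda>z. f (x + T z)) z = dir_deriv (T u) f (x + T z)"
    if f: "smooth_on (ball 0 R) f" and z: "z \<in> ball 0 (R/2)" for f :: "'b \<Rightarrow> real" and u z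
  proof -
    have "((\<lambda>z. x + T z) has_derivative (\<lambda>u. 0 + T u)) (at z)"
      using lT by (intro has_derivative_add has_derivative_const bounded_linear_imp_has_derivative) (simp add: linear_conv_bounded_linear)
    from has_derivative_compose[OF this smooth_on_has_derivative[OF f inb[OF z]]] show ?thesis
      using dir_deriv_eq by fastforce
  qed
  define \<psi> where "\<psi> z = potential e (x + T z) - potential e' z" for z
  have sP': "smooth_on (ball 0 (R/2)) (potential e')" by (rule smooth_on_subset[OF P'(1)]) (use R0 in auto)
  have sm\<psi>: "smooth_on (ball 0 (R/2)) \<psi>"
    unfolding \<psi>_def by (intro smooth_on_diff smT P(1) sP' open_ball)
  have dd: "dir_deriv u (\<lambda>z. f z - f' z) z = dir_deriv u f z - dir_deriv u f' z"
    if "smooth_on (ball 0 (R/2)) f" "smooth_on (ball 0 (R/2)) f'" "z \<in> ball 0 (R/2)" for f f' :: "'b \<Rightarrow> real" and u z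
    by (rule dir_deriv_eq) (intro has_derivative_diff smooth_on_has_derivative[OF that(1,3)] smooth_on_has_derivative[OF that(2,3)])
  have hess0: "dir_deriv u (dir_deriv v \<psi>) z = 0" if z: "z \<in> ball 0 (R/2)" for u v z
  proof -
    have zR: "z \<in> ball 0 R" using z R0 by auto
    have first: "dir_deriv v \<psi> y = dir_deriv (T v) (potential e) (x + T y) - dir_deriv v (potential e') y" if "y \<in> ball 0 (R/2)" for y
      unfolding \<psi>_def using dd[OF smT[OF P(1)] sP' that] dT[OF P(1) that] by simp
    have sm2: "smooth_on (ball 0 (R/2)) (dir_deriv v \<psi>)" by (rule smooth_on_dir_deriv[OF sm\<psi>])
    have "dir_deriv u (dir_deriv v \<psi>) z =
       dir_deriv u (\<lambda>y. dir_deriv (T v) (potential e) (x + T y) - dir_deriv v (potential e') y) z"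
      by (rule dir_deriv_cong_open[OF open_ball z first])
        (use smooth_on_has_derivative[OF sm2 z] in \<open>auto simp: differentiable_def\<close>)
    also have "\<dots> = dir_deriv (T u) (dir_deriv (T v) (potential e)) (x + T z) - dir_deriv u (dir_deriv v (potential e')) z"
      using dd[OF smT[OF smooth_on_dir_deriv[OF P(1)]] smooth_on_dir_deriv[OF sP'] z] dT[OF smooth_on_dir_deriv[OF P(1)] z] by simp
    also have "\<dots> = 0"
      unfolding P(2)[OF inb[OF z]] P'(2)[OF zR] dvec_transition[OF e x e'(1) T(1) T' z] using T(2)[OF z] by simp
    finally show ?thesis .
  qed
  have affine: "\<psi> z = \<psi> 0 + dir_deriv z \<psi> 0" if "z \<in> ball 0 (R/2)" for z
    by (rule second_derivative_zero_imp_linear[OF sm\<psi> hess0 that])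
  have cT: "continuous_on (ball 0 (R/4)) (\<lambda>z. potential e (x + T z))"
    by (rule continuous_on_subset[OF smooth_on_continuous_on[OF smT[OF P(1)]]]) (use R0 in auto)
  have cP': "continuous_on (ball 0 (R/4)) (potential e')"
    by (rule continuous_on_subset[OF smooth_on_continuous_on[OF sP']]) (use R0 in auto)
  note ki = frames.kernel_integral(1)[OF frames.K_kernel]
  have "(\<integral>z. K z * potential e (x + T z) \<partial>lborel) - (\<integral>z. K z * potential e' z \<partial>lborel) = (\<integral>z. K z * \<psi> z \<partial>lborel)"
    unfolding \<psi>_def right_diff_distrib by (rule Bochner_Integration.integral_diff[OF ki[OF cT] ki[OF cP'], symmetric])
  also have "\<dots> = (\<integral>z. K z * (\<psi> 0 + dir_deriv z \<psi> 0) \<partial>lborel)"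
  proof (rule Bochner_Integration.integral_cong[OF refl])
    fix z show "K z * \<psi> z = K z * (\<psi> 0 + dir_deriv z \<psi> 0)"
      using affine[of z] frames.K_zero[of z] frames.s by (cases "norm z < s") auto
  qed
  also have "\<dots> = \<psi> 0"
    by (rule mean_of_affine, rule smooth_on_linear_dir_deriv[OF sm\<psi>]) (use R0 in simp)
  finally have "(\<integral>z. K z * potential e (x + T z) \<partial>lborel) - (\<integral>z. K z * potential e' z \<partial>lborel) = potential e x - potential e' 0"
    by (simp add: \<psi>_def linear_0[OF lT])
  moreover have "(\<integral>z. K z * potential e (x + T z) \<partial>lborel) = local_mean (potential e) x"
    unfolding local_mean_def
    by (rule frames.kernel_integral_rotate[OF frames.K_kernel shifted_continuous[OF smooth_on_continuous_on[OF P(1)] x] T(1)])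
  ultimately show ?thesis by (simp add: source_def local_mean_def e'_def)
qed

lemma source_continuous: "continuous_on UNIV source"
proof (rule frames.continuous_on_frames)
  fix e assume "e \<in> Collect (flat_param R)"
  then have e: "flat_param R e" by simp
  have "continuous_on (ball 0 (R/2)) (\<lambda>x. local_mean (potential e) x - potential e x)"
    by (intro continuous_on_diff smooth_on_continuous_on[OF local_mean_smooth] potential[OF e]
        continuous_on_subset[OF smooth_on_continuous_on[OF potential(1)[OF e]]]) (use flat_radius(1) in auto)
  then show "continuous_on (ball 0 (R/2)) (\<lambda>x. source (e x))"
    by (rule continuous_on_eq) (simp add: source_eq[OF e])
qed

end

text \<open>By the equation for \<open>w\<close> the sum of a local potential of
  \<open>g\<close> and \<open>w\<close> agrees with its mean up to a local constant, and every second derivative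
  of the sum agrees with its mean exactly.\<close>

locale hessian_solution = compact_hessian A D h g
  for A :: "('a::{t2_space,second_countable_topology}, 'b::euclidean_space) atlas" and D :: "'a conn"
    and h g :: "'a form2" +
  fixes w c :: "'a \<Rightarrow> real"
  assumes w_continuous: "continuous_on UNIV w" and w_eq: "w p = source p - c p + frames.avg w p"
    and c_const: "q \<in> frames.linked p \<Longrightarrow> c q = c p"
begin

lemma R_pos: "R > 0" by (rule flat_radius(1))

lemma s_pos: "s > 0" and s_le: "8 * s \<le> R" using frames.s by auto

lemma frame_linked: "flat_param R e \<Longrightarrow> norm x < R/2 \<Longrightarrow> e x \<in> frames.linked (e 0)"
  using frames.linked_frame[OF frames.linked_self, of e x] by simp

lemma w_frame_continuous: "flat_param R e \<Longrightarrow> continuous_on (ball 0 R) (\<lambda>x. w (e x))"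
  using frames.frame_comp_continuous[OF w_continuous, of e 0 R] by simp

lemma avg_w: "flat_param R e \<Longrightarrow> x \<in> ball 0 (R/2) \<Longrightarrow> frames.avg w (e x) = local_mean (\<lambda>z. w (e z)) x"
  using frames.avg_eq[OF w_continuous, of e x] by (simp add: local_mean_def)

lemma w_local:
  assumes e: "flat_param R e" and x: "x \<in> ball 0 (R/2)"
  shows "w (e x) = local_mean (potential e) x - potential e x - c (e 0) + local_mean (\<lambda>z. w (e z)) x"
  using w_eq[of "e x"] source_eq[OF e x] avg_w[OF e x] c_const[OF frame_linked[OF e, of x]] x by simp

text \<open>The mean of the merely continuous \<open>w\<close> is a convolution with a smooth kernel, so the equation
  for \<open>w\<close> shows its smoothness.\<close>

lemma w_smooth_near:
  assumes e: "flat_param R e"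
  shows "smooth_on (ball 0 s) (\<lambda>x. w (e x))"
proof (rule smooth_on_cong[OF open_ball])
  note cw = w_frame_continuous[OF e]
  have sub: "ball 0 s \<subseteq> ball (0::'b) (R/2)" using s_pos s_le by auto
  have cub: "y \<in> ball 0 R" if "y \<in> (cube (2 * s) :: 'b set)" for y
  proof -
    have "norm y \<le> 2 * s * DIM('b)" by (rule cube_subset_ball[OF that])
    also have "\<dots> = R / 4" using DIM_positive[where 'a = 'b] by (simp add: frames.s_def)
    finally show ?thesis using R_pos by simp
  qed
  have conv: "local_mean (\<lambda>z. w (e z)) x = integral (cube (2 * s)) (\<lambda>y. w (e y) *\<^sub>R K ((- 1) *\<^sub>R x + y))"
    if x: "x \<in> ball 0 s" for x
  proof -
    have x2: "x \<in> ball 0 (R/2)" using x sub by blast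
    define F where "F z = K z * w (e (x + z))" for z
    note ck = shifted_continuous[OF cw x2]
    have cF: "continuous_on UNIV F"
      unfolding F_def by (rule continuous_on_kernel_mult[OF frames.radial_kernelD(1,2)[OF frames.K_kernel] ck]) (use s_pos s_le in auto)
    have "local_mean (\<lambda>z. w (e z)) x = (\<integral>z. F z \<partial>lborel)" by (simp add: local_mean_def F_def)
    also have "\<dots> = (\<integral>y. F (- x + y) \<partial>lborel)"
      by (rule integral_lborel_shift[symmetric]) (rule borel_measurable_continuous_onI[OF cF])
    also have "\<dots> = integral (cube (2 * s)) (\<lambda>y. F (- x + y))"
    proof (rule compact_support_integral(2))
      show "continuous_on UNIV (\<lambda>y. F (- x + y))"
        by (rule continuous_on_compose2[OF cF]) (auto intro!: continuous_intros)
      show "F (- x + y) = 0" if "2 * s \<le> norm y" for y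
      proof -
        have "norm (- x + y) \<ge> s" using that x norm_triangle_ineq2[of y x] by (simp add: add.commute[of "- x"])
        then show ?thesis by (simp add: F_def frames.K_zero)
      qed
    qed
    finally show ?thesis by (simp add: F_def mult.commute)
  qed
  have "smooth_on (ball 0 s) (\<lambda>x. integral (cube (2 * s)) (\<lambda>y. w (e y) *\<^sub>R K ((- 1) *\<^sub>R x + y)))"
    unfolding cube_def
  proof (rule affine_integral_smooth_on[OF _ continuous_on_const continuous_on_id open_ball convex_ball _ open_UNIV frames.K_smooth])
    show "continuous_on (cbox (- (2 * s) *\<^sub>R One) ((2 * s) *\<^sub>R One)) (\<lambda>y. w (e y))"
      by (rule continuous_on_subset[OF cw]) (use cub in \<open>auto simp: cube_def\<close>)
  qed auto
  then have 1: "smooth_on (ball 0 s) (local_mean (\<lambda>z. w (e z)))"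
    by (rule smooth_on_cong[OF open_ball]) (simp add: conv)
  have 2: "smooth_on (ball 0 s) (local_mean (potential e))" "smooth_on (ball 0 s) (potential e)"
    by (rule smooth_on_subset[OF local_mean_smooth[OF potential(1)[OF e]] sub],
      rule smooth_on_subset[OF potential(1)[OF e]], use s_pos s_le in auto)
  show "smooth_on (ball 0 s) (\<lambda>x. local_mean (potential e) x - potential e x - c (e 0) + local_mean (\<lambda>z. w (e z)) x)"
    by (intro smooth_on_add smooth_on_diff smooth_on_const 1 2 open_ball)
  show "local_mean (potential e) x - potential e x - c (e 0) + local_mean (\<lambda>z. w (e z)) x = w (e x)"
    if "x \<in> ball 0 s" for x using w_local[OF e] that sub by auto
qed

lemma w_smooth: "smooth_fun A w"
proof (rule smooth_fun_local)
  fix p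
  define e where "e = frames.frame_at p"
  have e: "flat_param R e" "e 0 = p" using frame_flat by (auto simp: e_def)
  have ls: "local_param A s e" by (rule local_param_shrink[OF flat_paramD(1)[OF e(1)]]) (use s_pos s_le in auto)
  obtain f where f: "smooth_fun A f" "\<And>x. x \<in> cball 0 (s/2) \<Longrightarrow> f (e x) = w (e x)"
    by (rule extend_function[OF ls _ _ w_smooth_near[OF e(1)], of "s/2"]) (use s_pos that in auto)
  show "\<exists>W f. open W \<and> p \<in> W \<and> smooth_fun A f \<and> (\<forall>q\<in>W. w q = f q)"
  proof (intro exI conjI)
    show "open (e ` ball 0 (s/2))" by (rule local_paramD(4)[OF ls open_ball]) (use s_pos in auto)
    show "p \<in> e ` ball 0 (s/2)" using e(2) s_pos by (intro image_eqI[of _ _ 0]) auto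
    show "\<forall>q\<in>e ` ball 0 (s/2). w q = f q" using f(2) by auto
  qed (rule f(1))
qed

definition \<psi> :: "('b \<Rightarrow> 'a) \<Rightarrow> 'b \<Rightarrow> real" where
  "\<psi> e x = potential e x + w (e x)"

text \<open>The components of the tensor \<open>g + D dw\<close>.\<close>

definition T :: "('b \<Rightarrow> 'a) \<Rightarrow> 'b \<Rightarrow> 'b \<Rightarrow> 'b \<Rightarrow> real" where
  "T e x u v = dir_deriv u (dir_deriv v (\<psi> e)) x"

lemma w_frame_smooth: "flat_param R e \<Longrightarrow> smooth_on (ball 0 R) (\<lambda>x. w (e x))"
  by (rule local_paramD(5)[OF flat_paramD(1) w_smooth])

lemma \<psi>_smooth: "flat_param R e \<Longrightarrow> smooth_on (ball 0 R) (\<psi> e)"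
  unfolding \<psi>_def by (intro smooth_on_add potential(1) w_frame_smooth open_ball)

lemma T_smooth: "flat_param R e \<Longrightarrow> smooth_on (ball 0 R) (\<lambda>x. T e x u v)"
  unfolding T_def by (intro smooth_on_dir_deriv \<psi>_smooth)

lemma T_sym: "flat_param R e \<Longrightarrow> x \<in> ball 0 R \<Longrightarrow> T e x u v = T e x v u"
  unfolding T_def by (rule dir_deriv_commute[OF open_ball \<psi>_smooth])

lemma T_linear:
  assumes e: "flat_param R e" and x: "x \<in> ball 0 R"
  shows "linear (\<lambda>u. T e x u v)" "linear (T e x u)"
proof -
  show 1: "linear (\<lambda>u. T e x u v)" for v
    unfolding T_def by (rule smooth_on_linear_dir_deriv[OF smooth_on_dir_deriv[OF \<psi>_smooth[OF e]] x])
  have "T e x u = (\<lambda>v. T e x v u)" using T_sym[OF e x] by blast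
  then show "linear (T e x u)" using 1 by simp
qed

lemma \<psi>_mean:
  assumes e: "flat_param R e" and x: "x \<in> ball 0 (R/2)"
  shows "local_mean (\<psi> e) x = \<psi> e x + c (e 0)"
proof -
  note ki = frames.kernel_integral(1)[OF frames.K_kernel]
  have "local_mean (\<psi> e) x = local_mean (potential e) x + local_mean (\<lambda>z. w (e z)) x"
    unfolding local_mean_def \<psi>_def distrib_left
    by (rule Bochner_Integration.integral_add; rule ki; rule shifted_continuous[OF _ x])
      (use smooth_on_continuous_on potential(1)[OF e] w_frame_continuous[OF e] in auto)
  then show ?thesis using w_local[OF e x] by (simp add: \<psi>_def)
qed

lemma mean_value_derivative:
  fixes f :: "'b \<Rightarrow> real"
  assumes f: "smooth_on (ball 0 R) f" and m: "\<And>x. x \<in> ball 0 (R/2) \<Longrightarrow> local_mean f x = f x + k" and x: "x \<in> ball 0 (R/2)"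
  shows "local_mean (dir_deriv v f) x = dir_deriv v f x"
proof -
  have x': "x \<in> ball 0 R" using x R_pos by auto
  have "((\<lambda>x. f x + k) has_derivative (\<lambda>v. dir_deriv v f x)) (at x)"
    using has_derivative_add_const[OF smooth_on_has_derivative[OF f x'], of k] .
  then have "(local_mean f has_derivative (\<lambda>v. dir_deriv v f x)) (at x)"
    by (rule has_derivative_transform_within_open[OF _ open_ball x]) (simp add: m)
  from dir_deriv_eq[OF this] show ?thesis using local_mean_dir_deriv[OF f x] by simp
qed

text \<open>Averaging commutes with derivatives in flat coordinates, and the derivatives remove
  the constant.\<close>

lemma T_mean:
  assumes e: "flat_param R e"
  shows "(\<integral>z. K z * T e z u v \<partial>lborel) = T e 0 u v"
proof -
  have 1: "local_mean (dir_deriv v (\<psi> e)) x = dir_deriv v (\<psi> e) x + 0" if "x \<in> ball 0 (R/2)" for x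
    using mean_value_derivative[OF \<psi>_smooth[OF e] \<psi>_mean[OF e] that] by simp
  have "local_mean (dir_deriv u (dir_deriv v (\<psi> e))) 0 = dir_deriv u (dir_deriv v (\<psi> e)) 0"
    by (rule mean_value_derivative[OF smooth_on_dir_deriv[OF \<psi>_smooth[OF e]] 1]) (use R_pos in auto)
  then show ?thesis by (simp add: local_mean_def T_def)
qed

lemma T_decompose:
  assumes e: "flat_param R e" and x: "x \<in> ball 0 R"
  shows "T e x u v = g (e x) (dvec e x u) (dvec e x v) + dir_deriv u (dir_deriv v (\<lambda>z. w (e z))) x"
proof -
  note P = potential(1)[OF e] and W = w_frame_smooth[OF e]
  have add: "dir_deriv u (\<lambda>z. f z + f' z) y = dir_deriv u f y + dir_deriv u f' y"
    if "smooth_on (ball 0 R) f" "smooth_on (ball 0 R) f'" "y \<in> ball 0 R" for f f' :: "'b \<Rightarrow> real" and u y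
    by (rule dir_deriv_eq) (intro has_derivative_add smooth_on_has_derivative[OF that(1,3)] smooth_on_has_derivative[OF that(2,3)])
  have "T e x u v = dir_deriv u (\<lambda>y. dir_deriv v (potential e) y + dir_deriv v (\<lambda>z. w (e z)) y) x"
    unfolding T_def
  proof (rule dir_deriv_cong_open[OF open_ball x])
    show "dir_deriv v (\<psi> e) y = dir_deriv v (potential e) y + dir_deriv v (\<lambda>z. w (e z)) y" if "y \<in> ball 0 R" for y
      unfolding \<psi>_def by (rule add[OF P W that])
    show "dir_deriv v (\<psi> e) differentiable at x"
      using smooth_on_has_derivative[OF smooth_on_dir_deriv[OF \<psi>_smooth[OF e]] x] by (auto simp: differentiable_def)
  qed
  also have "\<dots> = dir_deriv u (dir_deriv v (potential e)) x + dir_deriv u (dir_deriv v (\<lambda>z. w (e z))) x"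
    by (rule add[OF smooth_on_dir_deriv[OF P] smooth_on_dir_deriv[OF W] x])
  finally show ?thesis using potential(2)[OF e x] by simp
qed

lemma T_fields:
  assumes e: "flat_param R e" and x: "x \<in> ball 0 R" and X: "X \<in> vector_fields A" and Y: "Y \<in> vector_fields A"
  shows "T e x (rep e X x) (rep e Y x) = g (e x) (X (e x)) (Y (e x)) + (X (e x) (\<lambda>q. Y q w) - D X Y (e x) w)"
  using T_decompose[OF e x] hessian_in_flat_param[OF e X Y w_smooth x]
    field_eq_dvec[OF flat_paramD(1)[OF e] X x] field_eq_dvec[OF flat_paramD(1)[OF e] Y x] by simp

text \<open>Both frames are orthonormal for the parallel metric at the common point, so the
  components in the two differ by a rotation.\<close>

lemma T_change:
  assumes e: "flat_param R e" and x: "x \<in> ball 0 R" and e': "flat_param R e'" and x': "x' \<in> ball 0 R" and eq: "e x = e' x'"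
  obtains S where "orthogonal_transformation S" "\<And>a. dvec e x (S a) = dvec e' x' a"
    "\<And>a b. T e' x' a b = T e x (S a) (S b)"
proof -
  note L = flat_paramD[OF e] and L' = flat_paramD[OF e']
  define S where "S a = vec e x (dvec e' x' a)" for a
  have dS: "dvec e x (S a) = dvec e' x' a" for a
    unfolding S_def by (rule dvec_vec[OF L(1) x]) (use dvec_tangent[OF L'(1) x'] eq in simp)
  have "linear S"
  proof (rule linearI)
    show "S (a + b) = S a + S b" for a b
      by (rule dvec_inj[OF L(1) x])
        (use dvec_linear[OF L(1) x, of 1 "S a" 1 "S b"] dvec_linear[OF L'(1) x', of 1 a 1 b] dS in simp)
    show "S (r *\<^sub>R a) = r *\<^sub>R S a" for r a
      by (rule dvec_inj[OF L(1) x])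
        (use dvec_linear[OF L(1) x, of r "S a" 0 0] dvec_linear[OF L'(1) x', of r a 0 0] dS dvec_zero[OF L(1) x] dvec_zero[OF L'(1) x'] in simp)
  qed
  moreover have "S a \<bullet> S b = a \<bullet> b" for a b
    using L(3)[OF x, of "S a" "S b"] L'(3)[OF x', of a b] eq dS by simp
  ultimately have S: "orthogonal_transformation S" by (simp add: orthogonal_transformation_def)
  have "T e' x' a b = T e x (S a) (S b)" for a b
  proof -
    obtain X where X: "X \<in> vector_fields A" "X (e' x') = dvec e' x' a" by (rule extend_tangent[OF dvec_tangent[OF L'(1) x']])
    obtain Y where Y: "Y \<in> vector_fields A" "Y (e' x') = dvec e' x' b" by (rule extend_tangent[OF dvec_tangent[OF L'(1) x']])
    have "rep e' X x' = a" "rep e' Y x' = b" by (rule rep_eqI[OF L'(1) x']; use X Y in simp)+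
    moreover have "rep e X x = S a" "rep e Y x = S b" by (rule rep_eqI[OF L(1) x]; use X Y dS eq in simp)+
    ultimately show ?thesis using T_fields[OF e x X(1) Y(1)] T_fields[OF e' x' X(1) Y(1)] eq by simp
  qed
  with S dS show thesis by (rule that)
qed

text \<open>The squared norm of the tensor for the parallel metric; it does not depend on the
  frame.\<close>

definition T_norm_in :: "('b \<Rightarrow> 'a) \<Rightarrow> 'b \<Rightarrow> real" where
  "T_norm_in e x = (\<Sum>a\<in>Basis. \<Sum>b\<in>Basis. (T e x a b)\<^sup>2)"

definition T_norm :: "'a \<Rightarrow> real" where "T_norm p = T_norm_in (frames.frame_at p) 0"

lemma T_norm_eq: "flat_param R e \<Longrightarrow> x \<in> ball 0 R \<Longrightarrow> T_norm (e x) = T_norm_in e x"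
proof -
  assume e: "flat_param R e" and x: "x \<in> ball 0 R"
  have 0: "0 \<in> ball (0::'b) R" using R_pos by simp
  obtain S where S: "orthogonal_transformation S" "\<And>a b. T (frames.frame_at (e x)) 0 a b = T e x (S a) (S b)"
    using T_change[OF e x frame_flat(1) 0, of "e x"] frame_flat(2)[of "e x"] by metis
  show ?thesis
    unfolding T_norm_def T_norm_in_def S(2) by (rule frobenius_orthogonal_invariant[OF T_linear(2,1)[OF e x] S(1)])
qed

lemma T_norm_in_smooth: "flat_param R e \<Longrightarrow> smooth_on (ball 0 R) (T_norm_in e)"
  unfolding T_norm_in_def power2_eq_square by (intro smooth_on_sum smooth_on_mult T_smooth open_ball)

lemma T_norm_continuous: "continuous_on UNIV T_norm"
proof (rule frames.continuous_on_frames)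
  fix e assume "e \<in> Collect (flat_param R)"
  then have e: "flat_param R e" by simp
  have "continuous_on (ball 0 (R/2)) (T_norm_in e)"
    by (rule continuous_on_subset[OF smooth_on_continuous_on[OF T_norm_in_smooth[OF e]]]) (use R_pos in auto)
  then show "continuous_on (ball 0 (R/2)) (\<lambda>x. T_norm (e x))"
    by (rule continuous_on_eq) (use T_norm_eq[OF e] R_pos in auto)
qed

text \<open>At a maximum of the norm, the strict convexity of the square forces the components, which
  equal their means, to be constant.\<close>

lemma T_constant_at_max:
  assumes e: "flat_param R e" and max: "\<And>r. r \<in> frames.linked (e 0) \<Longrightarrow> T_norm r \<le> T_norm (e 0)"
    and z: "norm z < s" and ab: "a \<in> Basis" "b \<in> Basis"
  shows "T e z a b = T e 0 a b"
proof -
  define H where "H z = (\<Sum>a\<in>Basis. \<Sum>b\<in>Basis. (T e z a b - T e 0 a b)\<^sup>2)" for z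
  have R4: "ball 0 (R/4) \<subseteq> ball (0::'b) R" using R_pos by auto
  have cT: "continuous_on (ball 0 (R/4)) (\<lambda>z. T e z a b)" for a b
    by (rule continuous_on_subset[OF smooth_on_continuous_on[OF T_smooth[OF e]] R4])
  have cN: "continuous_on (ball 0 (R/4)) (T_norm_in e)"
    by (rule continuous_on_subset[OF smooth_on_continuous_on[OF T_norm_in_smooth[OF e]] R4])
  note ki = frames.kernel_integral(1)[OF frames.K_kernel]
  have sq: "(\<integral>z. K z * (T e z a b - T e 0 a b)\<^sup>2 \<partial>lborel) = (\<integral>z. K z * (T e z a b)\<^sup>2 \<partial>lborel) - (T e 0 a b)\<^sup>2" for a b
  proof -
    let ?t = "T e 0 a b"
    have i: "integrable lborel (\<lambda>z. K z * (T e z a b)\<^sup>2)" "integrable lborel (\<lambda>z. K z * T e z a b)" "integrable lborel (\<lambda>z. K z * 1)"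
      by (intro ki continuous_on_power cT, intro ki cT, intro ki continuous_on_const)
    have "(\<integral>z. K z * (T e z a b - ?t)\<^sup>2 \<partial>lborel) =
        (\<integral>z. K z * (T e z a b)\<^sup>2 - 2 * ?t * (K z * T e z a b) + ?t\<^sup>2 * (K z * 1) \<partial>lborel)"
      by (rule Bochner_Integration.integral_cong[OF refl]) (simp add: power2_eq_square algebra_simps)
    also have "\<dots> = (\<integral>z. K z * (T e z a b)\<^sup>2 \<partial>lborel) - 2 * ?t * (\<integral>z. K z * T e z a b \<partial>lborel) + ?t\<^sup>2 * (\<integral>z. K z * 1 \<partial>lborel)"
      using i by simp
    finally show ?thesis using T_mean[OF e] frames.K_integral by (simp add: power2_eq_square)
  qed
  have cH: "continuous_on (ball 0 (R/4)) H"
    unfolding H_def by (intro continuous_on_sum continuous_on_power continuous_on_diff cT continuous_on_const)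
  have iab: "integrable lborel (\<lambda>z. K z * (T e z a b - T e 0 a b)\<^sup>2)" "integrable lborel (\<lambda>z. K z * (T e z a b)\<^sup>2)" for a b
    by (intro ki continuous_on_power continuous_on_diff cT continuous_on_const)+
  have "(\<integral>z. K z * H z \<partial>lborel) = (\<Sum>a\<in>Basis. \<Sum>b\<in>Basis. \<integral>z. K z * (T e z a b - T e 0 a b)\<^sup>2 \<partial>lborel)"
    unfolding H_def sum_distrib_left using iab by (simp add: Bochner_Integration.integral_sum)
  also have "\<dots> = (\<Sum>a\<in>Basis. \<Sum>b\<in>Basis. \<integral>z. K z * (T e z a b)\<^sup>2 \<partial>lborel) - T_norm_in e 0"
    by (simp add: sq sum_subtractf T_norm_in_def)
  finally have e1: "(\<integral>z. K z * H z \<partial>lborel) = (\<Sum>a\<in>Basis. \<Sum>b\<in>Basis. \<integral>z. K z * (T e z a b)\<^sup>2 \<partial>lborel) - T_norm_in e 0" .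
  have e2: "(\<Sum>a\<in>Basis. \<Sum>b\<in>Basis. \<integral>z. K z * (T e z a b)\<^sup>2 \<partial>lborel) = (\<integral>z. K z * T_norm_in e z \<partial>lborel)"
    unfolding T_norm_in_def sum_distrib_left using iab by (simp add: Bochner_Integration.integral_sum)
  have e3: "(\<integral>z. K z * T_norm_in e z \<partial>lborel) \<le> (\<integral>z. K z * T_norm_in e 0 \<partial>lborel)"
  proof (rule frames.kernel_integral_mono[OF frames.K_kernel cN continuous_on_const])
    fix z :: 'b assume "norm z < s"
    then have zR: "z \<in> ball 0 R" "norm z < R/2" using s_pos s_le by auto
    show "T_norm_in e z \<le> T_norm_in e 0"
      using max[OF frame_linked[OF e zR(2)]] T_norm_eq[OF e zR(1)] T_norm_eq[OF e, of 0] R_pos by simp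
  qed
  have le: "(\<integral>z. K z * H z \<partial>lborel) \<le> 0"
    using e1 e2 e3 frames.K_integral by simp
  have H0: "H z \<ge> 0" for z unfolding H_def by (intro sum_nonneg) auto
  have KH: "continuous_on UNIV (\<lambda>z. K z * H z)"
    by (rule continuous_on_kernel_mult[OF frames.radial_kernelD(1,2)[OF frames.K_kernel] cH]) (use s_pos s_le in auto)
  have cc: "continuous_on (cbox (- s *\<^sub>R One) (s *\<^sub>R One)) (\<lambda>z. K z * H z)" by (rule continuous_on_subset[OF KH]) simp
  have nonneg: "0 \<le> K z * H z" for z using frames.K_nonneg H0 by simp
  have "integral (cbox (- s *\<^sub>R One) (s *\<^sub>R One)) (\<lambda>z. K z * H z) \<ge> 0"
    by (rule integral_nonneg[OF integrable_continuous[OF cc] nonneg])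
  then have "integral (cbox (- s *\<^sub>R One) (s *\<^sub>R One)) (\<lambda>z. K z * H z) = 0"
    using le frames.kernel_integral(2)[OF frames.K_kernel cH] by (simp add: cube_def)
  moreover have "box (- s *\<^sub>R One) (s *\<^sub>R One) \<noteq> ({} :: 'b set)" using s_pos by (simp add: box_ne_empty inner_sum_left_Basis)
  ultimately have "\<forall>z\<in>cbox (- s *\<^sub>R One) (s *\<^sub>R One). K z * H z = 0"
    using integral_cbox_eq_0_iff[OF cc _ nonneg] by simp
  moreover have "z \<in> cbox (- s *\<^sub>R One) (s *\<^sub>R One)" using ball_subset_cube[of s] z by (auto simp: cube_def)
  ultimately have "H z = 0" using frames.K_pos[OF z] by force
  then show ?thesis
    using ab unfolding H_def by (simp add: sum_nonneg_eq_0_iff sum_nonneg)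
qed

text \<open>A maximum of the norm propagates along chains of short steps.\<close>

lemma T_norm_constant:
  assumes "r \<in> frames.linked p"
  shows "T_norm r = T_norm p"
proof -
  obtain q where q: "q \<in> frames.linked p" "\<And>r. r \<in> frames.linked p \<Longrightarrow> T_norm r \<le> T_norm q"
    using continuous_attains_sup[OF frames.linked_compact, of p T_norm] frames.linked_self[of p]
      continuous_on_subset[OF T_norm_continuous] by (metis empty_iff subset_UNIV)
  have lq: "frames.linked q = frames.linked p" by (rule frames.linked_eq[OF q(1)])
  have "T_norm r = T_norm q" if "r \<in> frames.linked q" for r
    using that unfolding frames.linked_def mem_Collect_eq
  proof (induction rule: rtranclp_induct)
    case (step y z)
    obtain e x where e: "flat_param R e" "e 0 = y" and x: "norm x < s / 4" "z = e x" using step(2) by (auto simp: frames.near_def)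
    have "y \<in> frames.linked q" using step(1) by (simp add: frames.linked_def)
    then have ly: "frames.linked (e 0) = frames.linked p" using frames.linked_eq lq e(2) by metis
    have "T e x a b = T e 0 a b" if "a \<in> Basis" "b \<in> Basis" for a b
      by (rule T_constant_at_max[OF e(1) _ _ that]) (use ly q(2) step(3) e(2) x s_pos in auto)
    then have "T_norm_in e x = T_norm_in e 0" by (simp add: T_norm_in_def)
    moreover have "x \<in> ball 0 R" using x s_pos s_le by auto
    ultimately show ?case using T_norm_eq[OF e(1), of x] T_norm_eq[OF e(1), of 0] R_pos e(2) x(2) step(3) by simp
  qed simp
  then show ?thesis using assms frames.linked_self[of p] lq by metis
qed

theorem T_constant:
  assumes e: "flat_param R e" and z: "norm z < s"
  shows "T e z u v = T e 0 u v"
proof -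
  have zR: "z \<in> ball 0 R" "0 \<in> ball (0::'b) R" using z s_le R_pos by auto
  have b: "T e z a b = T e 0 a b" if "a \<in> Basis" "b \<in> Basis" for a b
    by (rule T_constant_at_max[OF e _ z that]) (simp add: T_norm_constant)
  have "T e z u b = T e 0 u b" if "b \<in> Basis" for b
    using linear_eq_stdbasis[OF T_linear(1)[OF e zR(1)] T_linear(1)[OF e zR(2)] b[OF _ that]] by metis
  then show ?thesis
    using linear_eq_stdbasis[OF T_linear(2)[OF e zR(1)] T_linear(2)[OF e zR(2)], of u u] by metis
qed

text \<open>Where \<open>w\<close> attains its minimum, the parallel tensor dominates \<open>g\<close>; being parallel, it is
  then positive on the whole class.\<close>

lemma T_positive:
  assumes e: "flat_param R e" and u: "u \<noteq> 0"
  shows "T e 0 u u > 0"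
proof -
  have 0: "0 \<in> ball (0::'b) R" using R_pos by simp
  obtain q where q: "q \<in> frames.linked (e 0)" "\<And>r. r \<in> frames.linked (e 0) \<Longrightarrow> w q \<le> w r"
    using continuous_attains_inf[OF frames.linked_compact, of "e 0" w] frames.linked_self[of "e 0"]
      continuous_on_subset[OF w_continuous] by (metis empty_iff subset_UNIV)
  have lq: "frames.linked q = frames.linked (e 0)" by (rule frames.linked_eq[OF q(1)])
  define P where "P r \<longleftrightarrow> (\<forall>e. flat_param R e \<longrightarrow> e 0 = r \<longrightarrow> (\<forall>u. u \<noteq> 0 \<longrightarrow> T e 0 u u > 0))" for r
  have Pq: "P q"
    unfolding P_def
  proof (intro allI impI)
    fix f and u :: 'b assume f: "flat_param R f" "f 0 = q" and u: "u \<noteq> 0"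
    note L = flat_paramD[OF f(1)]
    have "dir_deriv u (dir_deriv u (\<lambda>z. w (f z))) 0 \<ge> 0"
    proof (rule second_derivative_at_minimum)
      show "smooth_on (ball 0 (R/2)) (\<lambda>z. w (f z))"
        by (rule smooth_on_subset[OF w_frame_smooth[OF f(1)]]) (use R_pos in auto)
      show "w (f 0) \<le> w (f x)" if "x \<in> ball 0 (R/2)" for x
        using q(2) frame_linked[OF f(1), of x] that lq f(2) by simp
    qed (use R_pos in simp)
    moreover have "g (f 0) (dvec f 0 u) (dvec f 0 u) > 0"
    proof -
      have "dvec f 0 u \<noteq> (\<lambda>f. 0)" using u dvec_inj[OF L(1) 0, of u 0] dvec_zero[OF L(1) 0] by metis
      then show ?thesis using hessian dvec_tangent[OF L(1) 0]
        unfolding hessian_metric_def riemannian_metric_def by blast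
    qed
    ultimately show "T f 0 u u > 0" using T_decompose[OF f(1) 0, of u u] by simp
  qed
  have "P r" if "r \<in> frames.linked q" for r
    using that unfolding frames.linked_def mem_Collect_eq
  proof (induction rule: rtranclp_induct)
    case base
    show ?case by (rule Pq)
  next
    case (step y z)
    obtain f x where f: "flat_param R f" "f 0 = y" and x: "norm x < s / 4" "z = f x" using step(2) by (auto simp: frames.near_def)
    have xs: "norm x < s" "x \<in> ball 0 R" using x s_pos s_le by auto
    show ?case
      unfolding P_def
    proof (intro allI impI)
      fix f' and u :: 'b assume f': "flat_param R f'" "f' 0 = z" and u: "u \<noteq> 0"
      obtain S where S: "orthogonal_transformation S" "\<And>a b. T f' 0 a b = T f x (S a) (S b)"
        using T_change[OF f(1) xs(2) f'(1) 0] f'(2) x(2) by metis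
      have "S u \<noteq> 0" using orthogonal_transformation_norm[OF S(1), of u] u by auto
      then show "T f' 0 u u > 0"
        using step(3) f unfolding S(2) T_constant[OF f(1) xs(1)] P_def by blast
    qed
  qed
  then have "P (e 0)" using lq frames.linked_self[of "e 0"] by simp
  then show ?thesis using e u by (simp add: P_def)
qed

text \<open>The tensor \<open>g + D dw\<close>, evaluated in the flat coordinates chosen at each
  point.\<close>

definition g_flat :: "'a form2" where
  "g_flat p u v = T (frames.frame_at p) 0 (vec (frames.frame_at p) 0 u) (vec (frames.frame_at p) 0 v)"

definition \<alpha> :: "'a form1" where "\<alpha> p v = - v w"

lemma g_flat_fields:
  assumes X: "X \<in> vector_fields A" and Y: "Y \<in> vector_fields A"
  shows "g_flat p (X p) (Y p) = g p (X p) (Y p) + (X p (\<lambda>q. Y q w) - D X Y p w)"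
  using T_fields[OF frame_flat(1)[of p] _ X Y, of 0] R_pos frame_flat(2)[of p] by (simp add: g_flat_def rep_def)

lemma g_flat_frame:
  assumes e: "flat_param R e" and x: "x \<in> ball 0 R" and X: "X \<in> vector_fields A" and Y: "Y \<in> vector_fields A"
  shows "g_flat (e x) (X (e x)) (Y (e x)) = T e x (rep e X x) (rep e Y x)"
  using T_fields[OF e x X Y] g_flat_fields[OF X Y, of "e x"] by simp

lemma vec_linear:
  assumes \<xi>: "local_param A \<rho> \<xi>" and x: "x \<in> ball 0 \<rho>"
    and u: "u \<in> tangent_space A (\<xi> x)" and v: "v \<in> tangent_space A (\<xi> x)"
  shows "vec \<xi> x (tv_comb a u b v) = a *\<^sub>R vec \<xi> x u + b *\<^sub>R vec \<xi> x v"
  using dvec_linear[OF \<xi> x, of a "vec \<xi> x u" b "vec \<xi> x v"] dvec_vec[OF \<xi> x u] dvec_vec[OF \<xi> x v]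
    vec_dvec[OF \<xi> x, of "a *\<^sub>R vec \<xi> x u + b *\<^sub>R vec \<xi> x v"] by simp

lemma g_flat_metric: "riemannian_metric A g_flat"
proof -
  have L: "local_param A R (frames.frame_at p)" "frames.frame_at p 0 = p" for p
    using flat_paramD(1)[OF frame_flat(1)] frame_flat(2) by auto
  have 0: "0 \<in> ball (0::'b) R" using R_pos by simp
  note lin = T_linear[OF frame_flat(1) 0]
  have gs: "smooth_fun A (\<lambda>p. g p (X p) (Y p))" if "X \<in> vector_fields A" "Y \<in> vector_fields A" for X Y
    using hessian that by (simp add: hessian_metric_def riemannian_metric_def tensor2_def)
  show ?thesis
    unfolding riemannian_metric_def tensor2_def
  proof (intro conjI allI ballI impI)
    fix p u v z and a b :: real
    assume t: "u \<in> tangent_space A p" "v \<in> tangent_space A p" "z \<in> tangent_space A p"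
    have vl: "vec (frames.frame_at p) 0 (tv_comb a u b v) = a *\<^sub>R vec (frames.frame_at p) 0 u + b *\<^sub>R vec (frames.frame_at p) 0 v"
      by (rule vec_linear[OF L(1) 0]) (use t L(2) in auto)
    show "g_flat p (tv_comb a u b v) z = a * g_flat p u z + b * g_flat p v z"
      unfolding g_flat_def vl by (simp add: linear_add[OF lin(1)] linear_scale[OF lin(1)])
    show "g_flat p z (tv_comb a u b v) = a * g_flat p z u + b * g_flat p z v"
      unfolding g_flat_def vl by (simp add: linear_add[OF lin(2)] linear_scale[OF lin(2)])
  next
    fix X Y assume X: "X \<in> vector_fields A" and Y: "Y \<in> vector_fields A"
    show "smooth_fun A (\<lambda>p. g_flat p (X p) (Y p))"
      unfolding g_flat_fields[OF X Y]
      by (intro smooth_fun_add smooth_fun_diff gs X Y vector_fieldD(2)[OF X vector_fieldD(2)[OF Y w_smooth]]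
          vector_fieldD(2)[OF connD(1)[OF X Y] w_smooth])
  next
    fix p u v
    show "g_flat p u v = g_flat p v u" unfolding g_flat_def by (rule T_sym[OF frame_flat(1) 0])
  next
    fix p u assume t: "u \<in> tangent_space A p" and u: "u \<noteq> (\<lambda>f. 0)"
    have "vec (frames.frame_at p) 0 u \<noteq> 0"
      using dvec_vec[OF L(1) 0, of u p] dvec_zero[OF L(1) 0, of p] t u L(2)[of p] by auto
    then show "0 < g_flat p u u" unfolding g_flat_def by (rule T_positive[OF frame_flat(1)])
  qed
qed

text \<open>In flat coordinates the components are constant near the centre, so the product rule
  cancels the terms of the covariant derivative.\<close>

lemma g_flat_parallel: "D_flat A D g_flat"
  unfolding D_flat_def
proof (intro ballI allI)
  fix X Y Z p assume X: "X \<in> vector_fields A" and Y: "Y \<in> vector_fields A" and Z: "Z \<in> vector_fields A"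
  define e where "e = frames.frame_at p"
  have e: "flat_param R e" "e 0 = p" using frame_flat by (auto simp: e_def)
  note L = flat_paramD[OF e(1)]
  have 0: "0 \<in> ball (0::'b) R" "0 \<in> ball (0::'b) s" using R_pos s_pos by auto
  let ?X = "rep e X 0" and ?B = "T e 0"
  note lin = T_linear[OF e(1) 0(1)]
  have conv: "bounded_bilinear ?B"
    using lin by (simp add: bilinear_conv_bounded_bilinear[symmetric] bilinear_def)
  note dY = smooth_on_has_derivative[OF rep_smooth[OF L(1) Y] 0(1)] and dZ = smooth_on_has_derivative[OF rep_smooth[OF L(1) Z] 0(1)]
  have "((\<lambda>z. ?B (rep e Y z) (rep e Z z)) has_derivative
     (\<lambda>v. ?B (rep e Y 0) (dir_deriv v (rep e Z) 0) + ?B (dir_deriv v (rep e Y) 0) (rep e Z 0))) (at 0)"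
    by (rule bounded_bilinear.FDERIV[OF conv dY dZ])
  then have "((\<lambda>z. g_flat (e z) (Y (e z)) (Z (e z))) has_derivative
     (\<lambda>v. ?B (rep e Y 0) (dir_deriv v (rep e Z) 0) + ?B (dir_deriv v (rep e Y) 0) (rep e Z 0))) (at 0)"
  proof (rule has_derivative_transform_within_open[OF _ open_ball 0(2)])
    fix z :: 'b assume z: "z \<in> ball 0 s"
    then have "z \<in> ball 0 R" using s_pos s_le by auto
    then show "?B (rep e Y z) (rep e Z z) = g_flat (e z) (Y (e z)) (Z (e z))"
      using g_flat_frame[OF e(1) _ Y Z] T_constant[OF e(1)] z by simp
  qed
  from dir_deriv_eq[OF this]
  have 1: "dir_deriv ?X (\<lambda>z. g_flat (e z) (Y (e z)) (Z (e z))) 0 =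
     ?B (rep e Y 0) (dir_deriv ?X (rep e Z) 0) + ?B (dir_deriv ?X (rep e Y) 0) (rep e Z 0)" .
  have sm: "smooth_fun A (\<lambda>q. g_flat q (Y q) (Z q))"
    using g_flat_metric Y Z by (simp add: riemannian_metric_def tensor2_def)
  have repD: "rep e (D X V) 0 = dir_deriv ?X (rep e V) 0" if V: "V \<in> vector_fields A" for V
    by (rule rep_eqI[OF L(1) 0(1)]) (rule L(4)[OF X V 0(1)])
  show "cov_deriv2 D g_flat X Y Z p = 0"
    unfolding cov_deriv2_def
    using field_apply[OF L(1) X 0(1) sm] 1 g_flat_frame[OF e(1) 0(1) connD(1)[OF X Y] Z]
      g_flat_frame[OF e(1) 0(1) Y connD(1)[OF X Z]] repD[OF Y] repD[OF Z] e(2) by simp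
qed

lemma \<alpha>_closed: "closed_one_form A \<alpha>"
proof -
  have neg: "X p (\<lambda>q. - f q) = - X p f" if "X \<in> vector_fields A" "smooth_fun A f" for X p f
    using tangentD(1)[OF vector_fieldD(1)[OF that(1)] that(2) that(2), of p "-1" 0] by simp
  have neg2: "X p (\<lambda>q. - Y q w) = - X p (\<lambda>q. Y q w)" if "X \<in> vector_fields A" "Y \<in> vector_fields A" for X Y p
    by (rule neg[OF that(1) vector_fieldD(2)[OF that(2) w_smooth]])
  have sneg: "smooth_fun A (\<lambda>p. - f p)" if "smooth_fun A f" for f
    using smooth_fun_diff[OF smooth_fun_const[of 0] that] by simp
  show ?thesis
    unfolding closed_one_form_def one_form_def \<alpha>_def
    using w_smooth by (auto simp: tv_comb_def lie_bracket_def neg neg2 vector_fieldD(2) intro!: sneg)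
qed

lemma decomposition:
  assumes X: "X \<in> vector_fields A" and Y: "Y \<in> vector_fields A"
  shows "g p (X p) (Y p) = g_flat p (X p) (Y p) + cov_deriv1 D \<alpha> X Y p"
proof -
  have "X p (\<lambda>q. - Y q w) = - X p (\<lambda>q. Y q w)"
    using tangentD(1)[OF vector_fieldD(1)[OF X] vector_fieldD(2)[OF Y w_smooth] vector_fieldD(2)[OF Y w_smooth], of p "-1" 0] by simp
  then show ?thesis using g_flat_fields[OF X Y, of p] by (simp add: cov_deriv1_def \<alpha>_def)
qed

end

theorem theorem1p5:
  fixes A :: "('a::{t2_space,second_countable_topology}, 'b::euclidean_space) atlas"
    and D :: "'a conn"
    and g :: "'a form2"
  assumes "flat_affine_manifold A D"
    and "compact (UNIV :: 'a set)"
    and "\<exists>h. riemannian_metric A h \<and> D_flat A D h"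
    and "hessian_metric A D g"
  shows "\<exists>g_flat \<alpha>.
           riemannian_metric A g_flat \<and> D_flat A D g_flat \<and>
           closed_one_form A \<alpha> \<and>
           (\<forall>X\<in>vector_fields A. \<forall>Y\<in>vector_fields A. \<forall>p.
              g p (X p) (Y p) = g_flat p (X p) (Y p) + cov_deriv1 D \<alpha> X Y p)"
proof -
  obtain h where h: "riemannian_metric A h" "D_flat A D h" using assms(3) by blast
  interpret compact_hessian A D h g
    by unfold_locales (use assms h in \<open>auto simp: flat_affine_manifold_def\<close>)
  obtain w c where w: "continuous_on UNIV w" "\<And>p. w p = source p - c p + frames.avg w p"
    "\<And>p q. q \<in> frames.linked p \<Longrightarrow> c q = c p"
    using frames.poisson[OF source_continuous] by metis
  interpret hessian_solution A D h g w c
    by unfold_locales (use w in auto)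
  show ?thesis
    using g_flat_metric g_flat_parallel \<alpha>_closed decomposition by blast
qed

end
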